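(* Let $\mathbf X=(X,\mathsf d,\mathfrak m)$ be a bounded PI space (i.e. a PI space with $\operatorname{diam}(X)<+\infty$). Then for every $\alpha\in(1,+\infty)$ with $\alpha\ge\log_2(C_D(\mathbf X))$, the Banach space $\mathbb W_\alpha(\mathbf X)/\overline{\mathbb V}_\alpha(\mathbf X)$ is a predual of $\mathrm{BV}(\mathbf X)$, i.e. $\mathrm{BV}(\mathbf X)$ is isomorphic as a Banach space (via a linear homeomorphism) to $(\mathbb W_\alpha(\mathbf X)/\overline{\mathbb V}_\alpha(\mathbf X))^*$.
   Context: **Metric measure spaces.** A metric measure space $\mathbf X=(X,\mathsf d,\mathfrak m)$ is a metric space $(X,\mathsf d)$ with a finite non-negative Radon measure $\mathfrak m$. $\tau$ denotes the topology induced by $\mathsf d$; $\mathrm{LIP}_b(X)$ is the set of bounded real-valued $\mathsf d$-Lipschitz functions, $\mathrm{Lip}(f)$ the least Lipschitz constant, and $\mathrm{lip}_a(f)(x):=\inf\{\mathrm{Lip}(f|_U): x\in U,\ U\text{ open}\}$. **PI spaces.** A complete metric measure space $\mathbf X$ is a PI space if: (i) there is a constant $C_D(\mathbf X)>0$ with $0<\mathfrak m(B_{2r}(x))\le C_D(\mathbf X)\,\mathfrak m(B_r(x))<+\infty$ for all $x\in X$, $r>0$; (ii) there are constants $C_P(\mathbf X)>0$, $\lambda(\mathbf X)\ge1$ such that for every Lipschitz $f\colon X\to\mathbb R$, all $x\in X$ and $r>0$, writing $f_B:=\mathfrak m(B)^{-1}\int_B f\,d\mathfrak m$ and $B=B_r(x)$,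 $\lambda B=B_{\lambda(\mathbf X)r}(x)$, $$\frac1{\mathfrak m(B)}\int_B|f-f_B|\,d\mathfrak m\le C_P(\mathbf X)\,r\,\frac1{\mathfrak m(\lambda B)}\int_{\lambda B}\mathrm{lip}_a(f)\,d\mathfrak m.$$ (A bounded PI space is compact.) **Derivations.** A derivation on $\mathbf X$ is a linear operator $b\colon\mathrm{LIP}_b(X)\to L^\infty(\mathfrak m)$ with $b(fg)=f\,b(g)+g\,b(f)$ for all $f,g$, and for which there is $G\in L^\infty(\mathfrak m)$, $G\ge0$, with $|b(f)|\le G\,\mathrm{lip}_a(f)$ $\mathfrak m$-a.e. for all $f$. The $\mathfrak m$-a.e. minimal such $G$ is denoted $|b|$. The space $\mathrm{Der}^\infty(\mathbf X)$ of derivations is a Banach space with norm $\|b\|_{\mathrm{Der}^\infty(\mathbf X)}:=\||b|\|_{L^\infty(\mathfrak m)}$, and an $L^\infty(\mathfrak m)$-module via $(hb)(f):=h\,b(f)$. $\mathrm{Der}^\infty_\infty(\mathbf X)$ is the subspace of those $b$ having divergence: there is a (unique) $\mathrm{div}(b)\in L^\infty(\mathfrak m)$ with $\int b(f)\,d\mathfrak m=-\int f\,\mathrm{div}(b)\,d\mathfrak m$ for all $f\in\mathrm{LIP}_b(X)$. $\overline{\mathrm{Der}}^\infty_\infty(\mathbf X)$ is the closure of $\mathrm{Der}^\infty_\infty(\mathbf X)$ in $\mathrm{Der}^\infty(\mathbf X)$. **BV functions.** $\mathcal M(X)$ is the Banach space of finite signed Radon measures with the total variation norm. $\mathrm{BV}(\mathbf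 X)$ is the space of $f\in L^1(\mathfrak m)$ for which there is a bounded linear operator $\mathbf L_f\colon(\mathrm{Der}^\infty_\infty(\mathbf X),\|\cdot\|_{\mathrm{Der}^\infty(\mathbf X)})\to\mathcal M(X)$ with $\mathbf L_f(b)(X)=-\int f\,\mathrm{div}(b)\,d\mathfrak m$ and $\mathbf L_f(hb)=h\,\mathbf L_f(b)$ for all $b\in\mathrm{Der}^\infty_\infty(\mathbf X)$, $h\in\mathrm{LIP}_b(X)$. Such $\mathbf L_f$ is unique; $\mathrm V(f)$ is its operator norm. $\mathrm{BV}(\mathbf X)$ is a Banach space with norm $\|f\|_{\mathrm{BV}(\mathbf X)}:=\|f\|_{L^1(\mathfrak m)}+\mathrm V(f)$. **The spaces $\mathbb W_\alpha$, $\mathbb V_\alpha$.** $C_0(X)$ is the sup-norm closure of the compactly supported continuous functions (here all of $C(X)$, as $X$ is compact), $\hat\otimes_\pi$ is the (completed) projective tensor product of Banach spaces, $\times_\infty$ is the product with norm $\max\{\|v\|,\|w\|\}$, and $$\mathbb W_\alpha(\mathbf X):=L^\alpha(\mathfrak m)\times_\infty\big(\overline{\mathrm{Der}}^\infty_\infty(\mathbf X)\hat\otimes_\pi C_0(X)\big),$$ $$\mathbb V_\alpha(\mathbf X):=\Big\{\Big(g,\sum_{i=1}^n b_i\otimes h_i\Big)\in L^\infty(\mathfrak m)\times(\mathrm{Der}^\infty_\infty(\mathbf X)\otimes\mathrm{LIP}_b(X))\;:\;g=\mathrm{div}\Big(\sum_{i=1}^n h_ib_i\Big)\Big\},$$ where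 $\otimes$ is the algebraic tensor product; $\overline{\mathbb V}_\alpha(\mathbf X)$ is the closure of $\mathbb V_\alpha(\mathbf X)$ in $\mathbb W_\alpha(\mathbf X)$. *)

theory Defs
  imports "HOL-Analysis.Analysis"
begin

section \<open>Normed spaces with explicit carrier\<close>

text \<open>
  The Banach spaces below depend on a measure and on exponents, so they are values of a record
  type rather than types. Equality of vectors is equality in HOL: maps are extensional, and
  a.e. equivalence classes and cosets are sets.
\<close>

record 'v nvs =
  vcarrier :: "'v set"
  vzero :: 'v
  vadd :: "'v \<Rightarrow> 'v \<Rightarrow> 'v"
  vscale :: "real \<Rightarrow> 'v \<Rightarrow> 'v"
  vnorm :: "'v \<Rightarrow> real"

definition vdiff :: "'v nvs \<Rightarrow> 'v \<Rightarrow> 'v \<Rightarrow> 'v" where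
  "vdiff E x y = vadd E x (vscale E (-1) y)"

definition vlist_sum :: "'v nvs \<Rightarrow> 'v list \<Rightarrow> 'v" where
  "vlist_sum E xs = foldr (vadd E) xs (vzero E)"

locale normed_space_on =
  fixes E :: "'v nvs"
  assumes zero_closed: "vzero E \<in> vcarrier E"
    and add_closed: "\<lbrakk>x \<in> vcarrier E; y \<in> vcarrier E\<rbrakk> \<Longrightarrow> vadd E x y \<in> vcarrier E"
    and scale_closed: "x \<in> vcarrier E \<Longrightarrow> vscale E c x \<in> vcarrier E"
    and add_assoc: "\<lbrakk>x \<in> vcarrier E; y \<in> vcarrier E; z \<in> vcarrier E\<rbrakk> \<Longrightarrow>
      vadd E (vadd E x y) z = vadd E x (vadd E y z)"
    and add_commute: "\<lbrakk>x \<in> vcarrier E; y \<in> vcarrier E\<rbrakk> \<Longrightarrow> vadd E x y = vadd E y x"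
    and add_zero: "x \<in> vcarrier E \<Longrightarrow> vadd E x (vzero E) = x"
    and add_inverse: "x \<in> vcarrier E \<Longrightarrow> vadd E x (vscale E (-1) x) = vzero E"
    and scale_add_right: "\<lbrakk>x \<in> vcarrier E; y \<in> vcarrier E\<rbrakk> \<Longrightarrow>
      vscale E c (vadd E x y) = vadd E (vscale E c x) (vscale E c y)"
    and scale_add_left: "x \<in> vcarrier E \<Longrightarrow>
      vscale E (c + d) x = vadd E (vscale E c x) (vscale E d x)"
    and scale_scale: "x \<in> vcarrier E \<Longrightarrow> vscale E c (vscale E d x) = vscale E (c * d) x"
    and scale_one: "x \<in> vcarrier E \<Longrightarrow> vscale E 1 x = x"
    and norm_nonneg: "x \<in> vcarrier E \<Longrightarrow> 0 \<le> vnorm E x"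
    and norm_eq_zero: "x \<in> vcarrier E \<Longrightarrow> vnorm E x = 0 \<longleftrightarrow> x = vzero E"
    and norm_scale: "x \<in> vcarrier E \<Longrightarrow> vnorm E (vscale E c x) = \<bar>c\<bar> * vnorm E x"
    and norm_triangle: "\<lbrakk>x \<in> vcarrier E; y \<in> vcarrier E\<rbrakk> \<Longrightarrow>
      vnorm E (vadd E x y) \<le> vnorm E x + vnorm E y"

definition vCauchy :: "'v nvs \<Rightarrow> (nat \<Rightarrow> 'v) \<Rightarrow> bool" where
  "vCauchy E s \<longleftrightarrow> (\<forall>n. s n \<in> vcarrier E) \<and>
     (\<forall>e>0. \<exists>N. \<forall>i\<ge>N. \<forall>j\<ge>N. vnorm E (vdiff E (s i) (s j)) < e)"

locale banach_space_on = normed_space_on E for E :: "'v nvs" +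
  assumes complete: "vCauchy E s \<Longrightarrow>
    \<exists>l\<in>vcarrier E. (\<lambda>n. vnorm E (vdiff E (s n) l)) \<longlonglongrightarrow> 0"

definition vsubspace :: "'v nvs \<Rightarrow> 'v set \<Rightarrow> bool" where
  "vsubspace E N \<longleftrightarrow> N \<subseteq> vcarrier E \<and> vzero E \<in> N \<and>
     (\<forall>x\<in>N. \<forall>y\<in>N. vadd E x y \<in> N) \<and> (\<forall>c. \<forall>x\<in>N. vscale E c x \<in> N)"

definition vspan :: "'v nvs \<Rightarrow> 'v set \<Rightarrow> 'v set" where
  "vspan E S = \<Inter>{N. vsubspace E N \<and> S \<subseteq> N}"

definition vclosure :: "'v nvs \<Rightarrow> 'v set \<Rightarrow> 'v set" where
  "vclosure E S = {x \<in> vcarrier E. \<forall>e>0. \<exists>y\<in>S. vnorm E (vdiff E x y) < e}"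

definition vcoset :: "'v nvs \<Rightarrow> 'v set \<Rightarrow> 'v \<Rightarrow> 'v set" where
  "vcoset E N x = {vadd E x n | n. n \<in> N}"

text \<open>
  The quotient by a subspace \<open>N\<close> with the quotient norm. Adding \<open>N\<close> in the scalar multiplication
  makes \<open>0 \<cdot> A\<close> the coset \<open>N\<close> and not just a single vector.
\<close>

definition vquotient :: "'v nvs \<Rightarrow> 'v set \<Rightarrow> 'v set nvs" where
  "vquotient E N = \<lparr>
     vcarrier = vcoset E N ` vcarrier E,
     vzero = N,
     vadd = (\<lambda>A B. {vadd E a b | a b. a \<in> A \<and> b \<in> B}),
     vscale = (\<lambda>c A. {vadd E (vscale E c a) n | a n. a \<in> A \<and> n \<in> N}),
     vnorm = (\<lambda>A. Inf (vnorm E ` A))\<rparr>"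

text \<open>
  \<open>vmaps A E F N\<close>: the space \<open>F\<close> of maps from the set \<open>A\<close> to \<open>E\<close>, extensional outside \<open>A\<close>, with
  pointwise operations and norm \<open>N\<close>.
\<close>

definition vmaps :: "'u set \<Rightarrow> 'v nvs \<Rightarrow> ('u \<Rightarrow> 'v) set \<Rightarrow> (('u \<Rightarrow> 'v) \<Rightarrow> real) \<Rightarrow> ('u \<Rightarrow> 'v) nvs" where
  "vmaps A E F N = \<lparr>
     vcarrier = F,
     vzero = restrict (\<lambda>x. vzero E) A,
     vadd = (\<lambda>f g. restrict (\<lambda>x. vadd E (f x) (g x)) A),
     vscale = (\<lambda>c f. restrict (\<lambda>x. vscale E c (f x)) A),
     vnorm = N\<rparr>"

definition real_nvs :: "real nvs" where
  "real_nvs = \<lparr>vcarrier = UNIV, vzero = 0, vadd = (+), vscale = (*), vnorm = abs\<rparr>"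

definition vprod_max :: "'u nvs \<Rightarrow> 'v nvs \<Rightarrow> ('u \<times> 'v) nvs" where
  "vprod_max E F = \<lparr>
     vcarrier = vcarrier E \<times> vcarrier F,
     vzero = (vzero E, vzero F),
     vadd = (\<lambda>(x, y) (x', y'). (vadd E x x', vadd F y y')),
     vscale = (\<lambda>c (x, y). (vscale E c x, vscale F c y)),
     vnorm = (\<lambda>(x, y). max (vnorm E x) (vnorm F y))\<rparr>"

definition vcauchy_seqs :: "'v nvs \<Rightarrow> (nat \<Rightarrow> 'v) nvs" where
  "vcauchy_seqs E = vmaps UNIV E {s. vCauchy E s} (\<lambda>s. lim (\<lambda>n. vnorm E (s n)))"

definition vnull_seqs :: "'v nvs \<Rightarrow> (nat \<Rightarrow> 'v) set" where
  "vnull_seqs E = {s. (\<forall>n. s n \<in> vcarrier E) \<and> (\<lambda>n. vnorm E (s n)) \<longlonglongrightarrow> 0}"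

definition vcompletion :: "'v nvs \<Rightarrow> (nat \<Rightarrow> 'v) set nvs" where
  "vcompletion E = vquotient (vcauchy_seqs E) (vnull_seqs E)"

definition vembed :: "'v nvs \<Rightarrow> 'v \<Rightarrow> (nat \<Rightarrow> 'v) set" where
  "vembed E x = vcoset (vcauchy_seqs E) (vnull_seqs E) (\<lambda>n. x)"


subsection \<open>Bounded operators, duals, preduals\<close>

definition vlinear :: "'u nvs \<Rightarrow> 'v nvs \<Rightarrow> ('u \<Rightarrow> 'v) \<Rightarrow> bool" where
  "vlinear E F T \<longleftrightarrow> T \<in> vcarrier E \<rightarrow>\<^sub>E vcarrier F \<and>
     (\<forall>x\<in>vcarrier E. \<forall>y\<in>vcarrier E. T (vadd E x y) = vadd F (T x) (T y)) \<and>
     (\<forall>c. \<forall>x\<in>vcarrier E. T (vscale E c x) = vscale F c (T x))"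

definition vbounded_linear :: "'u nvs \<Rightarrow> 'v nvs \<Rightarrow> ('u \<Rightarrow> 'v) \<Rightarrow> bool" where
  "vbounded_linear E F T \<longleftrightarrow> vlinear E F T \<and>
     (\<exists>C. \<forall>x\<in>vcarrier E. vnorm F (T x) \<le> C * vnorm E x)"

definition vopnorm :: "'u nvs \<Rightarrow> 'v nvs \<Rightarrow> ('u \<Rightarrow> 'v) \<Rightarrow> real" where
  "vopnorm E F T = Inf {C. 0 \<le> C \<and> (\<forall>x\<in>vcarrier E. vnorm F (T x) \<le> C * vnorm E x)}"

definition vdual :: "'v nvs \<Rightarrow> ('v \<Rightarrow> real) nvs" where
  "vdual E = vmaps (vcarrier E) real_nvs {T. vbounded_linear E real_nvs T} (vopnorm E real_nvs)"

definition visomorphic :: "'u nvs \<Rightarrow> 'v nvs \<Rightarrow> bool" where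
  "visomorphic E F \<longleftrightarrow> (\<exists>T S. vbounded_linear E F T \<and> vbounded_linear F E S \<and>
     (\<forall>x\<in>vcarrier E. S (T x) = x) \<and> (\<forall>y\<in>vcarrier F. T (S y) = y))"

definition is_predual :: "'u nvs \<Rightarrow> 'v nvs \<Rightarrow> bool" where
  "is_predual P B \<longleftrightarrow> banach_space_on P \<and> banach_space_on B \<and> visomorphic B (vdual P)"


subsection \<open>Projective tensor product\<close>

text \<open>
  The norm chosen on the free vector space plays no role: on the algebraic tensor product it is
  replaced by the projective norm.
\<close>

definition vdelta :: "'p \<Rightarrow> 'p \<Rightarrow> real" where
  "vdelta p = (\<lambda>q. if q = p then 1 else 0)"

definition free_vs :: "'p set \<Rightarrow> ('p \<Rightarrow> real) nvs" where
  "free_vs A = vmaps UNIV real_nvs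
     {c. finite {p. c p \<noteq> 0} \<and> {p. c p \<noteq> 0} \<subseteq> A} (\<lambda>c. \<Sum>p | c p \<noteq> 0. \<bar>c p\<bar>)"

definition bilinear_relations :: "'u nvs \<Rightarrow> 'v nvs \<Rightarrow> ('u \<times> 'v \<Rightarrow> real) set" where
  "bilinear_relations E F =
     {\<lambda>q. vdelta (vadd E x x', y) q - vdelta (x, y) q - vdelta (x', y) q | x x' y.
        x \<in> vcarrier E \<and> x' \<in> vcarrier E \<and> y \<in> vcarrier F} \<union>
     {\<lambda>q. vdelta (x, vadd F y y') q - vdelta (x, y) q - vdelta (x, y') q | x y y'.
        x \<in> vcarrier E \<and> y \<in> vcarrier F \<and> y' \<in> vcarrier F} \<union>
     {\<lambda>q. vdelta (vscale E c x, y) q - c * vdelta (x, y) q | c x y.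
        x \<in> vcarrier E \<and> y \<in> vcarrier F} \<union>
     {\<lambda>q. vdelta (x, vscale F c y) q - c * vdelta (x, y) q | c x y.
        x \<in> vcarrier E \<and> y \<in> vcarrier F}"

definition alg_tensor :: "'u nvs \<Rightarrow> 'v nvs \<Rightarrow> ('u \<times> 'v \<Rightarrow> real) set nvs" where
  "alg_tensor E F = (let P = free_vs (vcarrier E \<times> vcarrier F)
     in vquotient P (vspan P (bilinear_relations E F)))"

definition tensor :: "'u nvs \<Rightarrow> 'v nvs \<Rightarrow> 'u \<Rightarrow> 'v \<Rightarrow> ('u \<times> 'v \<Rightarrow> real) set" where
  "tensor E F x y = (let P = free_vs (vcarrier E \<times> vcarrier F)
     in vcoset P (vspan P (bilinear_relations E F)) (vdelta (x, y)))"

definition tensor_sum :: "'u nvs \<Rightarrow> 'v nvs \<Rightarrow> ('u \<times> 'v) list \<Rightarrow> ('u \<times> 'v \<Rightarrow> real) set" where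
  "tensor_sum E F ps = vlist_sum (alg_tensor E F) (map (\<lambda>(x, y). tensor E F x y) ps)"

definition projective_norm :: "'u nvs \<Rightarrow> 'v nvs \<Rightarrow> ('u \<times> 'v \<Rightarrow> real) set \<Rightarrow> real" where
  "projective_norm E F u = Inf {\<Sum>(x, y)\<leftarrow>ps. vnorm E x * vnorm F y | ps.
     set ps \<subseteq> vcarrier E \<times> vcarrier F \<and> tensor_sum E F ps = u}"

definition proj_tensor_alg :: "'u nvs \<Rightarrow> 'v nvs \<Rightarrow> ('u \<times> 'v \<Rightarrow> real) set nvs" where
  "proj_tensor_alg E F = (alg_tensor E F)\<lparr>vnorm := projective_norm E F\<rparr>"

definition proj_tensor ::
    "'u nvs \<Rightarrow> 'v nvs \<Rightarrow> (nat \<Rightarrow> ('u \<times> 'v \<Rightarrow> real) set) set nvs" where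
  "proj_tensor E F = vcompletion (proj_tensor_alg E F)"


section \<open>Metric measure spaces\<close>

definition radon_measure :: "'a::metric_space measure \<Rightarrow> bool" where
  "radon_measure m \<longleftrightarrow> sets m = sets borel \<and>
     (\<forall>K. compact K \<longrightarrow> emeasure m K < \<infinity>) \<and>
     (\<forall>B\<in>sets borel. emeasure m B = (SUP K\<in>{K. compact K \<and> K \<subseteq> B}. emeasure m K))"

definition metric_measure_space :: "'a::metric_space measure \<Rightarrow> bool" where
  "metric_measure_space m \<longleftrightarrow> radon_measure m \<and> finite_measure m"

definition Lip_funs :: "('a::metric_space \<Rightarrow> real) set" where
  "Lip_funs = {f. \<exists>L. L-lipschitz_on UNIV f}"

definition LIPb :: "('a::metric_space \<Rightarrow> real) set" where
  "LIPb = {f \<in> Lip_funs. bounded (range f)}"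

definition Lip_const :: "('a::metric_space \<Rightarrow> real) \<Rightarrow> 'a set \<Rightarrow> real" where
  "Lip_const f U = Inf {L. L-lipschitz_on U f}"

definition lip_a :: "('a::metric_space \<Rightarrow> real) \<Rightarrow> 'a \<Rightarrow> real" where
  "lip_a f x = Inf {Lip_const f U | U. open U \<and> x \<in> U}"

definition doubling :: "'a::metric_space measure \<Rightarrow> real \<Rightarrow> bool" where
  "doubling m C \<longleftrightarrow> C > 0 \<and> (\<forall>x. \<forall>r>0. 0 < emeasure m (ball x (2 * r)) \<and>
     emeasure m (ball x (2 * r)) \<le> ennreal C * emeasure m (ball x r) \<and>
     ennreal C * emeasure m (ball x r) < \<infinity>)"

definition avg :: "'a measure \<Rightarrow> 'a set \<Rightarrow> ('a \<Rightarrow> real) \<Rightarrow> real" where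
  "avg m B f = (LINT x:B|m. f x) / measure m B"

definition poincare :: "'a::metric_space measure \<Rightarrow> real \<Rightarrow> real \<Rightarrow> bool" where
  "poincare m C lam \<longleftrightarrow> C > 0 \<and> lam \<ge> 1 \<and> (\<forall>f\<in>Lip_funs. \<forall>x. \<forall>r>0.
     avg m (ball x r) (\<lambda>y. \<bar>f y - avg m (ball x r) f\<bar>)
       \<le> C * r * avg m (ball x (lam * r)) (lip_a f))"

definition PI_space :: "'a::metric_space measure \<Rightarrow> real \<Rightarrow> bool" where
  "PI_space m CD \<longleftrightarrow> metric_measure_space m \<and> complete (UNIV :: 'a set) \<and>
     doubling m CD \<and> (\<exists>CP lam. poincare m CP lam)"


subsection \<open>Function spaces\<close>

definition null_funs :: "'a measure \<Rightarrow> ('a \<Rightarrow> real) set" where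
  "null_funs m = {f \<in> borel_measurable m. AE x in m. f x = 0}"

text \<open>
  Elements of \<open>L\<^sup>p\<close> and \<open>L\<^sup>\<infinity>\<close> are a.e. equivalence classes, i.e. cosets of the null functions.
  The seminorms are constant on these cosets, so the quotient norm is the usual one.
\<close>

definition Lp :: "'a measure \<Rightarrow> real \<Rightarrow> ('a \<Rightarrow> real) set nvs" where
  "Lp m p = vquotient
     (vmaps UNIV real_nvs {f \<in> borel_measurable m. integrable m (\<lambda>x. \<bar>f x\<bar> powr p)}
        (\<lambda>f. (LINT x|m. \<bar>f x\<bar> powr p) powr (1 / p)))
     (null_funs m)"

definition Linf_funs :: "'a measure \<Rightarrow> ('a \<Rightarrow> real) set" where
  "Linf_funs m = {f \<in> borel_measurable m. \<exists>C. AE x in m. \<bar>f x\<bar> \<le> C}"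

definition Linf :: "'a measure \<Rightarrow> ('a \<Rightarrow> real) set nvs" where
  "Linf m = vquotient
     (vmaps UNIV real_nvs (Linf_funs m) (\<lambda>f. Inf {C. 0 \<le> C \<and> (AE x in m. \<bar>f x\<bar> \<le> C)}))
     (null_funs m)"

text \<open>Adding null functions makes the product a full a.e. class even where \<open>h\<close> vanishes.\<close>

definition fmult :: "'a measure \<Rightarrow> ('a \<Rightarrow> real) \<Rightarrow> ('a \<Rightarrow> real) set \<Rightarrow> ('a \<Rightarrow> real) set" where
  "fmult m h A = {\<lambda>x. h x * u x + n x | u n. u \<in> A \<and> n \<in> null_funs m}"

definition sup_norm :: "('a \<Rightarrow> real) \<Rightarrow> real" where
  "sup_norm f = (SUP x. \<bar>f x\<bar>)"

definition LIPb_space :: "('a::metric_space \<Rightarrow> real) nvs" where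
  "LIPb_space = vmaps UNIV real_nvs LIPb sup_norm"

definition C0 :: "('a::metric_space \<Rightarrow> real) nvs" where
  "C0 = vmaps UNIV real_nvs
     {h. \<forall>e>0. \<exists>k. continuous_on UNIV k \<and> compact (closure {x. k x \<noteq> 0}) \<and> (\<forall>x. \<bar>h x - k x\<bar> < e)}
     sup_norm"


subsection \<open>Signed Radon measures\<close>

text \<open>
  A finite signed measure is a real-valued set function on the Borel sets. Its positive and
  negative parts come from the Hahn--Jordan decomposition,
  \<open>\<mu>\<^sup>+(B) = sup {\<mu>(A) | A \<subseteq> B}\<close>; truncation by \<open>ennreal\<close> is harmless because \<open>\<mu>({}) = 0\<close>.
\<close>

definition signed_measure :: "('a::metric_space set \<Rightarrow> real) \<Rightarrow> bool" where
  "signed_measure \<mu> \<longleftrightarrow> \<mu> \<in> extensional (sets borel) \<and> \<mu> {} = 0 \<and>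
     (\<forall>A :: nat \<Rightarrow> 'a set. range A \<subseteq> sets borel \<longrightarrow> disjoint_family A \<longrightarrow>
        (\<lambda>i. \<mu> (A i)) sums \<mu> (\<Union>i. A i))"

definition pos_part :: "('a::metric_space set \<Rightarrow> real) \<Rightarrow> 'a measure" where
  "pos_part \<mu> = measure_of UNIV (sets borel) (\<lambda>B. SUP A\<in>{A \<in> sets borel. A \<subseteq> B}. ennreal (\<mu> A))"

definition neg_part :: "('a::metric_space set \<Rightarrow> real) \<Rightarrow> 'a measure" where
  "neg_part \<mu> = pos_part (\<lambda>A. - \<mu> A)"

definition variation :: "('a::metric_space set \<Rightarrow> real) \<Rightarrow> 'a measure" where
  "variation \<mu> = measure_of UNIV (sets borel)
     (\<lambda>B. emeasure (pos_part \<mu>) B + emeasure (neg_part \<mu>) B)"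

definition Meas :: "('a::metric_space set \<Rightarrow> real) nvs" where
  "Meas = vmaps (sets borel) real_nvs
     {\<mu>. signed_measure \<mu> \<and> radon_measure (variation \<mu>)} (\<lambda>\<mu>. measure (variation \<mu>) UNIV)"

definition signed_integral :: "('a::metric_space set \<Rightarrow> real) \<Rightarrow> ('a \<Rightarrow> real) \<Rightarrow> real" where
  "signed_integral \<mu> h = (LINT x|pos_part \<mu>. h x) - (LINT x|neg_part \<mu>. h x)"

definition density_signed ::
    "('a::metric_space \<Rightarrow> real) \<Rightarrow> ('a set \<Rightarrow> real) \<Rightarrow> 'a set \<Rightarrow> real" where
  "density_signed h \<mu> =
     restrict (\<lambda>B. signed_integral \<mu> (\<lambda>x. indicator B x * h x)) (sets borel)"


section \<open>Derivations\<close>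

definition der_bound :: "'a::metric_space measure \<Rightarrow>
    (('a \<Rightarrow> real) \<Rightarrow> ('a \<Rightarrow> real) set) \<Rightarrow> ('a \<Rightarrow> real) \<Rightarrow> bool" where
  "der_bound m b G \<longleftrightarrow> G \<in> Linf_funs m \<and> (AE x in m. 0 \<le> G x) \<and>
     (\<forall>f\<in>LIPb. \<forall>u\<in>b f. AE x in m. \<bar>u x\<bar> \<le> G x * lip_a f x)"

text \<open>\<open>|b|\<close> as an a.e. equivalence class: the set of all a.e. minimal bounds.\<close>

definition der_modulus :: "'a::metric_space measure \<Rightarrow>
    (('a \<Rightarrow> real) \<Rightarrow> ('a \<Rightarrow> real) set) \<Rightarrow> ('a \<Rightarrow> real) set" where
  "der_modulus m b = {G. der_bound m b G \<and> (\<forall>H. der_bound m b H \<longrightarrow> (AE x in m. G x \<le> H x))}"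

definition derivation :: "'a::metric_space measure \<Rightarrow>
    (('a \<Rightarrow> real) \<Rightarrow> ('a \<Rightarrow> real) set) \<Rightarrow> bool" where
  "derivation m b \<longleftrightarrow> vlinear LIPb_space (Linf m) b \<and>
     (\<forall>f\<in>LIPb. \<forall>g\<in>LIPb. b (\<lambda>x. f x * g x) = vadd (Linf m) (fmult m f (b g)) (fmult m g (b f))) \<and>
     (\<exists>G. der_bound m b G)"

definition Der :: "'a::metric_space measure \<Rightarrow> (('a \<Rightarrow> real) \<Rightarrow> ('a \<Rightarrow> real) set) nvs" where
  "Der m = vmaps LIPb (Linf m) {b. derivation m b} (\<lambda>b. vnorm (Linf m) (der_modulus m b))"

definition der_mult :: "'a::metric_space measure \<Rightarrow> ('a \<Rightarrow> real) \<Rightarrow>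
    (('a \<Rightarrow> real) \<Rightarrow> ('a \<Rightarrow> real) set) \<Rightarrow> ('a \<Rightarrow> real) \<Rightarrow> ('a \<Rightarrow> real) set" where
  "der_mult m h b = restrict (\<lambda>f. fmult m h (b f)) LIPb"

text \<open>
  \<open>div(b)\<close> as an a.e. equivalence class: the set of all its representatives, which is empty iff
  \<open>b\<close> has no divergence.
\<close>

definition divergence :: "'a::metric_space measure \<Rightarrow>
    (('a \<Rightarrow> real) \<Rightarrow> ('a \<Rightarrow> real) set) \<Rightarrow> ('a \<Rightarrow> real) set" where
  "divergence m b = {d \<in> Linf_funs m.
     \<forall>f\<in>LIPb. \<forall>u\<in>b f. (LINT x|m. u x) = - (LINT x|m. f x * d x)}"

definition DerDiv :: "'a::metric_space measure \<Rightarrow> (('a \<Rightarrow> real) \<Rightarrow> ('a \<Rightarrow> real) set) nvs" where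
  "DerDiv m = (Der m)\<lparr>vcarrier := {b \<in> vcarrier (Der m). divergence m b \<noteq> {}}\<rparr>"

definition DerDiv_closure :: "'a::metric_space measure \<Rightarrow> (('a \<Rightarrow> real) \<Rightarrow> ('a \<Rightarrow> real) set) nvs" where
  "DerDiv_closure m = (Der m)\<lparr>vcarrier := vclosure (Der m) (vcarrier (DerDiv m))\<rparr>"


section \<open>Functions of bounded variation\<close>

definition BV_operator :: "'a::metric_space measure \<Rightarrow> ('a \<Rightarrow> real) set \<Rightarrow>
    ((('a \<Rightarrow> real) \<Rightarrow> ('a \<Rightarrow> real) set) \<Rightarrow> 'a set \<Rightarrow> real) \<Rightarrow> bool" where
  "BV_operator m A L \<longleftrightarrow> vbounded_linear (DerDiv m) Meas L \<and>
     (\<forall>b\<in>vcarrier (DerDiv m). \<forall>f\<in>A. \<forall>d\<in>divergence m b. L b UNIV = - (LINT x|m. f x * d x)) \<and>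
     (\<forall>b\<in>vcarrier (DerDiv m). \<forall>h\<in>LIPb. L (der_mult m h b) = density_signed h (L b))"

definition BV_op :: "'a::metric_space measure \<Rightarrow> ('a \<Rightarrow> real) set \<Rightarrow>
    (('a \<Rightarrow> real) \<Rightarrow> ('a \<Rightarrow> real) set) \<Rightarrow> 'a set \<Rightarrow> real" where
  "BV_op m A = (THE L. BV_operator m A L)"

definition BV_variation :: "'a::metric_space measure \<Rightarrow> ('a \<Rightarrow> real) set \<Rightarrow> real" where
  "BV_variation m A = vopnorm (DerDiv m) Meas (BV_op m A)"

definition BV :: "'a::metric_space measure \<Rightarrow> ('a \<Rightarrow> real) set nvs" where
  "BV m = (Lp m 1)\<lparr>
     vcarrier := {A \<in> vcarrier (Lp m 1). \<exists>L. BV_operator m A L},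
     vnorm := (\<lambda>A. vnorm (Lp m 1) A + BV_variation m A)\<rparr>"


section \<open>The predual\<close>

definition W_space :: "'a::metric_space measure \<Rightarrow> real \<Rightarrow>
    (('a \<Rightarrow> real) set \<times>
     (nat \<Rightarrow> ((('a \<Rightarrow> real) \<Rightarrow> ('a \<Rightarrow> real) set) \<times> ('a \<Rightarrow> real) \<Rightarrow> real) set) set) nvs" where
  "W_space m \<alpha> = vprod_max (Lp m \<alpha>) (proj_tensor (DerDiv_closure m) C0)"

text \<open>
  A list represents \<open>b\<^sub>1 \<otimes> h\<^sub>1 + \<dots> + b\<^sub>n \<otimes> h\<^sub>n\<close>. On a compact space bounded Lipschitz
  functions lie in \<open>C0\<close>, and as \<open>m\<close> is finite the \<open>L\<^sup>\<infinity>\<close>-class of the divergence is also an element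
  of \<open>L\<^sup>\<alpha>\<close>.
\<close>

definition V_set :: "'a::metric_space measure \<Rightarrow>
    (('a \<Rightarrow> real) set \<times>
     (nat \<Rightarrow> ((('a \<Rightarrow> real) \<Rightarrow> ('a \<Rightarrow> real) set) \<times> ('a \<Rightarrow> real) \<Rightarrow> real) set) set) set" where
  "V_set m = {(g, vembed (proj_tensor_alg (DerDiv_closure m) C0)
                    (tensor_sum (DerDiv_closure m) C0 bhs)) | g bhs.
     g \<in> vcarrier (Linf m) \<and> set bhs \<subseteq> vcarrier (DerDiv m) \<times> LIPb \<and>
     g = divergence m (vlist_sum (Der m) (map (\<lambda>(b, h). der_mult m h b) bhs))}"

end

theory Submission
  imports Defs
begin

text \<open>
 A function \<open>f\<close> of bounded variation acts on \<open>W_space m s\<close> by \<open>(g, b \<otimes> h) \<mapsto> \<integral> f g + \<integral> h dL(b)\<close>,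
 where \<open>L\<close> is the operator in the definition of BV; this vanishes on \<open>V_set m\<close> because
 \<open>L(hb)(X) = - \<integral> f div(hb)\<close>. The first summand needs \<open>f\<close> in \<open>L\<^sup>p\<close> for the conjugate exponent \<open>p\<close>.
 This follows from the Sobolev inequality, which the Poincare inequality and \<open>s \<ge> log 2 CD\<close>
 give by chaining and truncation: by Hahn--Banach it lets one solve \<open>div b = g\<close> for \<open>g\<close> of mean zero with
 \<open>b\<close> bounded by the \<open>L\<^sup>s\<close> norm of \<open>g\<close>, and testing \<open>L(b)\<close> bounds \<open>\<integral> f g\<close>. Conversely, a functional on
 the quotient restricts to a functional on \<open>L\<^sup>s\<close>, represented by some \<open>f\<close> in \<open>L\<^sup>p\<close>, and for every \<open>b\<close> to
 a functional of \<open>h\<close>, represented by a measure \<open>L(b)\<close>; vanishing on \<open>V_set m\<close> says that \<open>L\<close> is the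
 operator of \<open>f\<close>.
\<close>

text \<open>On a bounded space, iterated doubling gives a lower bound of order
  \<open>r powr s\<close> for the mass of balls at dyadic radii as soon as
  \<open>CD <= 2 powr s\<close>; so \<open>s\<close> acts as a dimension, and the Sobolev exponent
  for energies in L^1 is \<open>s / (s - 1)\<close>. For such energies the maximal function argument
  yields only a weak-type bound, and truncation recovers the strong one. In solving
  \<open>div b = g\<close>, Hahn--Banach must yield a derivation with an essential bound, not merely
  a functional. The functional is therefore extended to fields of Lipschitz functions, where the
  seminorm sees each field only infinitesimally near the base point; this forces linearity and the
  Leibniz rule almost everywhere. Testing with the constant 1 shows that a divergence has integral
  zero, so only mean-zero \<open>g\<close> are reached and the mean is controlled separately by the
  L^1 norm of \<open>f\<close>. The isomorphism obtained is not claimed to be isometric: one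
  direction costs the Sobolev constant, the other a factor 3 from the Riesz construction. It is
  built from a relation between BV classes and functionals, whose linearity is checked by testing on
  indicators of Borel sets.\<close>

abbreviation "carr \<equiv> vcarrier"

abbreviation "cDer \<equiv> DerDiv_closure"

abbreviation "DD m \<equiv> vcarrier (DerDiv m)"

abbreviation "sint \<equiv> signed_integral"

abbreviation "vdist E x y \<equiv> vnorm E (vdiff E x y)"

abbreviation tends_to (infixr "---->" 60) where "X ----> L \<equiv> filterlim X (nhds L) sequentially"

section \<open>Seminormed spaces on explicit carriers\<close>

text \<open>The algebraic axioms of \<open>normed_space_on\<close>, split off because free vector
  spaces and quotients are computed with before a norm on them is considered.\<close>

locale vspace_on =
 fixes E :: "'v nvs"
 assumes zero_closed [simp]: "vzero E : carr E" and add_closed [simp]: "[|x : carr E; y : carr E|] ==> vadd E x y : carr E"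
  and scale_closed [simp]: "x : carr E ==> vscale E c x : carr E"
  and add_assoc: "[|x : carr E; y : carr E; z : carr E|] ==>
   vadd E (vadd E x y) z = vadd E x (vadd E y z)" and add_commute: "[|x : carr E; y : carr E|] ==> vadd E x y = vadd E y x"
  and add_zero [simp]: "x : carr E ==> vadd E x (vzero E) = x"
  and add_inverse: "x : carr E ==> vadd E x (vscale E (-1) x) = vzero E" and scale_add_right: "[|x : carr E; y : carr E|] ==>
   vscale E c (vadd E x y) = vadd E (vscale E c x) (vscale E c y)" and scale_add_left: "x : carr E ==>
   vscale E (c + d) x = vadd E (vscale E c x) (vscale E d x)"
  and scale_scale [simp]: "x : carr E ==> vscale E c (vscale E d x) = vscale E (c * d) x"
  and scale_one [simp]: "x : carr E ==> vscale E 1 x = x"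
begin

lemma zero_add [simp]: "x : carr E ==> vadd E (vzero E) x = x" using add_commute[of "vzero E" x] by simp

lemma add_left_commute: "[|x : carr E; y : carr E; z : carr E|] ==>
  vadd E x (vadd E y z) = vadd E y (vadd E x z)" by (metis add_assoc add_commute)

lemmas add_ac = add_assoc add_commute add_left_commute

lemma scale_zero_left [simp]: "x : carr E ==> vscale E 0 x = vzero E" using scale_add_left[of x 1 "-1"] add_inverse[of x] by simp

lemma scale_zero_right [simp]: "vscale E c (vzero E) = vzero E" using scale_scale[of "vzero E" c 0] by simp

lemma diff_closed [simp]: "[|x : carr E; y : carr E|] ==> vdiff E x y : carr E" by (simp add: vdiff_def)

lemma diff_self [simp]: "x : carr E ==> vdiff E x x = vzero E" by (simp add: vdiff_def add_inverse)

lemma diff_zero [simp]: "x : carr E ==> vdiff E x (vzero E) = x" by (simp add: vdiff_def)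

lemma diff_add_cancel [simp]: "[|x : carr E; y : carr E|] ==> vadd E (vdiff E x y) y = x"
 using add_inverse[of y] add_commute[of y "vscale E (-1) y"] by (simp add: vdiff_def add_assoc)

lemma add_diff_cancel [simp]: "[|x : carr E; y : carr E|] ==> vdiff E (vadd E x y) y = x"
 using add_inverse[of y] by (simp add: vdiff_def add_assoc)

lemma add_diff_cancel_left [simp]:
 "[|x : carr E; y : carr E|] ==> vdiff E (vadd E x y) x = y" by (metis add_commute add_diff_cancel)

lemma diff_eq_zero_iff: "[|x : carr E; y : carr E|] ==> vdiff E x y = vzero E \<longleftrightarrow> x = y"
 by (metis diff_add_cancel diff_self zero_add)

lemma diff_split: "[|x : carr E; y : carr E; z : carr E|] ==>
  vdiff E x z = vadd E (vdiff E x y) (vdiff E y z)"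
proof -
 assume c: "x : carr E" "y : carr E" "z : carr E"
 have "vadd E (vdiff E x y) (vdiff E y z) = vadd E (vadd E (vdiff E x y) y) (vscale E (-1) z)"
  unfolding vdiff_def[of _ y z] using c by (subst add_assoc) auto
 thus ?thesis using c by (simp add: vdiff_def[of _ x z])
qed

lemma diff_add_add: "[|x : carr E; y : carr E; x' : carr E; y' : carr E|] ==>
  vdiff E (vadd E x y) (vadd E x' y') = vadd E (vdiff E x x') (vdiff E y y')" by (simp add: vdiff_def scale_add_right add_ac)

lemma scale_diff: "[|x : carr E; y : carr E|] ==>
  vscale E c (vdiff E x y) = vdiff E (vscale E c x) (vscale E c y)" by (simp add: vdiff_def scale_add_right)

lemma diff_swap: "[|x : carr E; y : carr E|] ==>
  vdiff E y x = vscale E (-1) (vdiff E x y)" by (simp add: vdiff_def scale_add_right add_ac)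

section \<open>Subspaces, spans, cosets and quotients\<close>

lemma subspaceD:
 assumes "vsubspace E N" shows "N <= carr E" "x : N ==> x : carr E" "vzero E : N"
  "[|x : N; y : N|] ==> vadd E x y : N" "x : N ==> vscale E c x : N"
  "[|x : N; y : N|] ==> vdiff E x y : N" using assms by (auto simp: vsubspace_def vdiff_def)

lemma vsubspace_carrier: "vsubspace E (carr E)" by (simp add: vsubspace_def)

lemma vsubspace_vspan:
 assumes "S <= carr E" shows "vsubspace E (vspan E S)"
proof -
 have "vspan E S <= carr E" using vsubspace_carrier assms by (auto simp: vspan_def)
 thus ?thesis by (auto simp: vsubspace_def vspan_def)
qed

lemma vspan_superset: "S <= vspan E S" by (auto simp: vspan_def)

lemma vspan_least: "[|vsubspace E N; S <= N|] ==> vspan E S <= N" by (auto simp: vspan_def)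

text \<open>The difference form of coset membership, in which most computations with quotients are
  carried out.\<close>

lemma mem_vcoset_iff:
 assumes N: "vsubspace E N" and x: "x : carr E" shows "y : vcoset E N x \<longleftrightarrow> y : carr E & vdiff E y x : N"
proof
 assume "y : vcoset E N x"
 then obtain n where "n : N" "y = vadd E x n" by (auto simp: vcoset_def)
 thus "y : carr E & vdiff E y x : N" using x subspaceD[OF N] by simp
next
 assume "y : carr E & vdiff E y x : N"
 thus "y : vcoset E N x" unfolding vcoset_def using x by (metis (mono_tags, lifting) add_commute diff_add_cancel diff_closed mem_Collect_eq)
qed

lemma self_mem_vcoset: "vsubspace E N ==> x : carr E ==> x : vcoset E N x" by (simp add: mem_vcoset_iff subspaceD)

lemma vcoset_eq_iff:
 assumes N: "vsubspace E N" and x: "x : carr E" and y: "y : carr E"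
 shows "vcoset E N x = vcoset E N y \<longleftrightarrow> vdiff E x y : N"
proof
 assume "vcoset E N x = vcoset E N y"
 thus "vdiff E x y : N" using self_mem_vcoset[OF N x] mem_vcoset_iff[OF N y] by simp
next
 assume d: "vdiff E x y : N"
 have d': "vdiff E y x : N" using subspaceD(5)[OF N d, of "-1"] x y by (simp add: diff_swap[of x y])
 have "vdiff E z y : N" if "z : carr E" "vdiff E z x : N" for z using diff_split[of z x y] that x y subspaceD(4)[OF N that(2) d] by simp
 moreover have "vdiff E z x : N" if "z : carr E" "vdiff E z y : N" for z
  using diff_split[of z y x] that x y subspaceD(4)[OF N that(2) d'] by simp
 ultimately show "vcoset E N x = vcoset E N y" by (auto simp: mem_vcoset_iff[OF N x] mem_vcoset_iff[OF N y])
qed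

lemma vcoset_subspace: "vsubspace E N ==> vcoset E N (vzero E) = N" using subspaceD(1,2)[of N] by (auto simp: mem_vcoset_iff)

lemma vcoset_add:
 assumes N: "vsubspace E N" and x: "x : carr E" and y: "y : carr E"
 shows "{vadd E a b | a b. a : vcoset E N x & b : vcoset E N y} = vcoset E N (vadd E x y)"
proof (intro set_eqI iffI)
 fix z assume "z : {vadd E a b | a b. a : vcoset E N x & b : vcoset E N y}"
 thus "z : vcoset E N (vadd E x y)" using x y subspaceD(4)[OF N] by (auto simp: mem_vcoset_iff[OF N] diff_add_add)
next
 fix z assume "z : vcoset E N (vadd E x y)"
 then obtain n where n: "n : N" "z = vadd E (vadd E x y) n" by (auto simp: vcoset_def)
 have "z = vadd E x (vadd E y n)" using n x y subspaceD(2)[OF N] by (simp add: add_assoc)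
 moreover have "vadd E y n : vcoset E N y" using n by (auto simp: vcoset_def)
 ultimately show "z : {vadd E a b | a b. a : vcoset E N x & b : vcoset E N y}" using self_mem_vcoset[OF N x] by blast
qed

lemma vcoset_scale:
 assumes N: "vsubspace E N" and x: "x : carr E"
 shows "{vadd E (vscale E c a) n | a n. a : vcoset E N x & n : N} = vcoset E N (vscale E c x)"
proof (intro set_eqI iffI)
 fix z assume "z : {vadd E (vscale E c a) n | a n. a : vcoset E N x & n : N}"
 then obtain a n where z: "z = vadd E (vscale E c a) n" "a : vcoset E N x" "n : N" by blast
 have a: "a : carr E" "vdiff E a x : N" and n: "n : carr E" using z x subspaceD(2)[OF N] by (auto simp: mem_vcoset_iff[OF N])
 have "vdiff E z (vscale E c x) = vadd E (vdiff E (vscale E c a) (vscale E c x)) n"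
  using a n x z(1) diff_add_add[of "vscale E c a" n "vscale E c x" "vzero E"] by simp
 also have "... = vadd E (vscale E c (vdiff E a x)) n" using a x by (simp add: scale_diff)
 finally show "z : vcoset E N (vscale E c x)" using a n x z subspaceD(4,5)[OF N] by (simp add: mem_vcoset_iff[OF N])
next
 fix z assume "z : vcoset E N (vscale E c x)"
 thus "z : {vadd E (vscale E c a) n | a n. a : vcoset E N x & n : N}" using self_mem_vcoset[OF N x] by (auto simp: vcoset_def)
qed

lemma vquotient_simps:
 assumes N: "vsubspace E N" shows "carr (vquotient E N) = vcoset E N ` carr E"
  "vzero (vquotient E N) = vcoset E N (vzero E)"
  "[|x : carr E; y : carr E|] ==>
   vadd (vquotient E N) (vcoset E N x) (vcoset E N y) = vcoset E N (vadd E x y)"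
  "x : carr E ==> vscale (vquotient E N) c (vcoset E N x) = vcoset E N (vscale E c x)"
  "vnorm (vquotient E N) A = Inf (vnorm E ` A)" using vcoset_add[OF N] vcoset_scale[OF N] vcoset_subspace[OF N]
 by (simp_all add: vquotient_def)

lemma vquotient_diff:
 assumes "vsubspace E N" "x : carr E" "y : carr E"
 shows "vdiff (vquotient E N) (vcoset E N x) (vcoset E N y) = vcoset E N (vdiff E x y)" using assms by (simp add: vdiff_def vquotient_simps)

lemma vspace_vquotient:
 assumes N: "vsubspace E N" shows "vspace_on (vquotient E N)"
proof -
 note [simp] = vquotient_simps(1-4)[OF N]
 show ?thesis
 proof (unfold_locales, goal_cases)
  case (5 A B)
  then obtain x y where "x : carr E" "A = vcoset E N x" "y : carr E" "B = vcoset E N y" by auto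
  thus ?case using add_commute[of x y] by simp
 qed (auto simp: add_assoc scale_add_right scale_add_left add_inverse)
qed

end

lemma (in vspace_on) vspace_cong:
 assumes "carr F = carr E" "vzero F = vzero E" "vadd F = vadd E" "vscale F = vscale E" shows "vspace_on F" by (unfold_locales)
  (simp_all add: assms add_assoc scale_add_right scale_add_left add_inverse,
   simp add: add_commute)

lemma (in vspace_on) vspace_subspace:
 assumes "vsubspace E N" shows "vspace_on (E\<lparr>vcarrier := N\<rparr>)" using assms subspaceD(2)[OF assms] by (unfold_locales)
   (auto simp: vsubspace_def add_assoc scale_add_right scale_add_left add_inverse intro: add_commute)

text \<open>The operations are pointwise, so closure of \<open>F\<close> is the only real condition.
  That members of \<open>F\<close> are extensional enters for the axioms that return
  \<open>x\<close> itself: neutrality of zero and scaling by one.\<close>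

lemma vspace_vmaps:
 assumes E: "vspace_on E" and F: "F <= A \<rightarrow>\<^sub>E carr E" and zero: "restrict (%x. vzero E) A : F"
  and add: "!!f g. f : F ==> g : F ==> restrict (%x. vadd E (f x) (g x)) A : F"
  and scale: "!!c f. f : F ==> restrict (%x. vscale E c (f x)) A : F" shows "vspace_on (vmaps A E F N)"
proof -
 interpret vspace_on E by fact
 have m: "f x : carr E" if "f : F" "x : A" for f x using that F by auto
 have r: "restrict f A = f" if "f : F" for f using that F by (meson PiE_restrict subsetD)
 show ?thesis
 proof (unfold_locales, goal_cases)
  case (5 x y) thus ?case
   by (auto simp: vmaps_def m intro!: restrict_ext add_commute)
 next
  case (6 x)
  hence "restrict (%t. vadd E (x t) (vzero E)) A = restrict x A" by (intro restrict_ext) (simp add: vmaps_def m)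
  with 6 show ?case by (simp add: vmaps_def r cong: restrict_cong)
 next
  case (11 x)
  hence "restrict (%t. vscale E 1 (x t)) A = restrict x A" by (intro restrict_ext) (simp add: vmaps_def m)
  with 11 show ?case by (simp add: vmaps_def r)
 qed (simp add: vmaps_def zero add scale; (intro restrict_ext; simp add: m add_assoc scale_add_right scale_add_left add_inverse)?)+
qed

text \<open>Function spaces before passing to classes, and spaces of Cauchy sequences, carry only
  seminorms. Definiteness is added at the end by \<open>normed_space_onI\<close>.\<close>

locale seminormed = vspace_on E for E :: "'v nvs" +
 assumes norm_nonneg [simp]: "x : carr E ==> 0 <= vnorm E x"
  and norm_scale: "x : carr E ==> vnorm E (vscale E c x) = abs c * vnorm E x" and norm_triangle: "[|x : carr E; y : carr E|] ==>
   vnorm E (vadd E x y) <= vnorm E x + vnorm E y"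
begin

lemma norm_zero [simp]: "vnorm E (vzero E) = 0" using norm_scale[of "vzero E" 0] by simp

lemma norm_diff_commute:
 "[|x : carr E; y : carr E|] ==> vdist E x y = vdist E y x" by (simp add: diff_swap[of y x] norm_scale)

lemma norm_diff_triangle: "[|x : carr E; y : carr E; z : carr E|] ==>
  vdist E x z <= vdist E x y + vdist E y z"
 using norm_triangle[of "vdiff E x y" "vdiff E y z"] by (simp add: diff_split[of x y z])

lemma norm_le_diff: "[|x : carr E; y : carr E|] ==> vnorm E x <= vdist E x y + vnorm E y"
 using norm_triangle[of "vdiff E x y" y] by simp

lemma norm_abs_diff: "[|x : carr E; y : carr E|] ==>
  \<bar>vnorm E x - vnorm E y\<bar> <= vdist E x y"
 using norm_le_diff[of x y] norm_le_diff[of y x] norm_diff_commute[of x y] by linarith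

lemma vclosure_subset: "vclosure E S <= carr E" by (auto simp: vclosure_def)

lemma subset_vclosure: "S <= carr E ==> S <= vclosure E S" unfolding vclosure_def by (auto intro!: bexI)

lemma vclosureD: "x : vclosure E S ==> e > 0 ==> EX y:S. vdist E x y < e" by (auto simp: vclosure_def)

lemma vsubspace_vclosure:
 assumes N: "vsubspace E N" shows "vsubspace E (vclosure E N)" unfolding vsubspace_def
proof (intro conjI ballI allI)
 show "vclosure E N <= carr E" by (rule vclosure_subset)
 show "vzero E : vclosure E N" using subset_vclosure[OF subspaceD(1)[OF N]] subspaceD(3)[OF N] by blast
next
 fix x y assume x: "x : vclosure E N" and y: "y : vclosure E N"
 show "vadd E x y : vclosure E N" unfolding vclosure_def
 proof (intro CollectI conjI allI impI)
  show "vadd E x y : carr E" using x y by (simp add: vclosure_def)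
  fix e :: real assume "e > 0"
  then obtain x' y' where x': "x' : N" "vdist E x x' < e / 2" and y': "y' : N" "vdist E y y' < e / 2"
   using vclosureD[OF x, of "e / 2"] vclosureD[OF y, of "e / 2"] by auto
  have "vdist E (vadd E x y) (vadd E x' y') < e"
   using norm_triangle[of "vdiff E x x'" "vdiff E y y'"] x' y' x y subspaceD(2)[OF N] by (simp add: diff_add_add vclosure_def)
  thus "EX z:N. vdist E (vadd E x y) z < e" using x' y' subspaceD(4)[OF N] by blast
 qed
next
 fix c x assume x: "x : vclosure E N"
 show "vscale E c x : vclosure E N" unfolding vclosure_def
 proof (intro CollectI conjI allI impI)
  show "vscale E c x : carr E" using x by (simp add: vclosure_def)
  fix e :: real assume "e > 0"
  hence "e / (abs c + 1) > 0" by simp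
  then obtain x' where x': "x' : N" "vdist E x x' < e / (abs c + 1)" using vclosureD[OF x] by blast
  have c: "x : carr E" "x' : carr E" using x x' subspaceD(2)[OF N] by (auto simp: vclosure_def)
  have "vdist E (vscale E c x) (vscale E c x') = abs c * vdist E x x'"
   using c by (simp add: scale_diff[symmetric] norm_scale)
  also have "... <= abs c * (e / (abs c + 1))" using x' by (intro mult_left_mono) auto
  also have "... < e" using \<open>e > 0\<close> by (simp add: field_simps)
  finally show "EX z:N. vdist E (vscale E c x) z < e" using x' subspaceD(5)[OF N] by blast
 qed
qed

lemma vclosure_idem:
 assumes "S <= carr E" shows "vclosure E (vclosure E S) <= vclosure E S"
proof
 fix x assume x: "x : vclosure E (vclosure E S)"
 show "x : vclosure E S" unfolding vclosure_def
 proof (intro CollectI conjI allI impI)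
  show "x : carr E" using x by (simp add: vclosure_def)
  fix e :: real assume "e > 0"
  then obtain y where y: "y : vclosure E S" "vdist E x y < e / 2" using vclosureD[OF x, of "e / 2"] by auto
  then obtain z where z: "z : S" "vdist E y z < e / 2" using \<open>e > 0\<close> vclosureD[OF y(1), of "e / 2"] by auto
  have "vdist E x z < e" using norm_diff_triangle[of x y z] x y z assms by (auto simp: vclosure_def)
  thus "EX z:S. vdist E x z < e" using z by blast
 qed
qed

lemma bdd_below_norm: "A <= carr E ==> bdd_below (vnorm E ` A)" by (rule bdd_belowI[of _ 0]) auto

lemma vcoset_subset: "vsubspace E N ==> x : carr E ==> vcoset E N x <= carr E" by (auto simp: mem_vcoset_iff)

lemma vquotient_norm_le:
 assumes "vsubspace E N" "x : carr E" "y : vcoset E N x" shows "vnorm (vquotient E N) (vcoset E N x) <= vnorm E y"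
 using assms by (simp add: vquotient_simps bdd_below_norm vcoset_subset cINF_lower)

lemma vquotient_norm_approx:
 assumes N: "vsubspace E N" and x: "x : carr E" and r: "vnorm (vquotient E N) (vcoset E N x) < r"
 obtains y where "y : vcoset E N x" "y : carr E" "vnorm E y < r" "vcoset E N y = vcoset E N x"
proof -
 have "EX y:vcoset E N x. vnorm E y < r" using r self_mem_vcoset[OF N x] cInf_lessD[of "vnorm E ` vcoset E N x" r]
  by (auto simp: vquotient_simps[OF N])
 then obtain y where y: "y : vcoset E N x" "vnorm E y < r" by blast
 thus thesis using that x N by (auto simp: mem_vcoset_iff vcoset_eq_iff)
qed

text \<open>Dividing out null vectors leaves the norm unchanged. This identifies the quotient norm
  on \<open>Lp\<close>, and makes the embedding into a completion isometric.\<close>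

lemma vquotient_norm_const:
 assumes N: "vsubspace E N" and x: "x : carr E" and 0: "!!n. n : N ==> vnorm E n = 0"
 shows "vnorm (vquotient E N) (vcoset E N x) = vnorm E x"
proof -
 have "vnorm E y = vnorm E x" if "y : vcoset E N x" for y
  using that x norm_abs_diff[of y x] 0[of "vdiff E y x"] by (simp add: mem_vcoset_iff[OF N])
 hence "vnorm E ` vcoset E N x = (%y. vnorm E x) ` vcoset E N x" by (rule image_cong[OF refl])
 also have "... = {vnorm E x}" using self_mem_vcoset[OF N x] by blast
 finally have "vnorm E ` vcoset E N x = {vnorm E x}" .
 thus ?thesis by (simp add: vquotient_simps[OF N])
qed

end

text \<open>One inequality for scaling is enough: applied to \<open>vscale E c x\<close> with factor
  \<open>1 / c\<close> it gives the reverse one.\<close>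

lemma seminormedI:
 assumes "vspace_on E" and nn: "!!x. x : carr E ==> 0 <= vnorm E x"
  and scale: "!!c x. x : carr E ==> vnorm E (vscale E c x) <= abs c * vnorm E x"
  and tri: "!!x y. x : carr E ==> y : carr E ==> vnorm E (vadd E x y) <= vnorm E x + vnorm E y" shows "seminormed E"
proof -
 interpret vspace_on E by fact
 have "abs c * vnorm E x <= vnorm E (vscale E c x)" if x: "x : carr E" for c x
 proof (cases "c = 0")
  case True
  thus ?thesis using nn[of "vzero E"] x by simp
 next
  case False
  hence "vnorm E x <= abs (1 / c) * vnorm E (vscale E c x)" using scale[of "vscale E c x" "1 / c"] x by simp
  thus ?thesis using False by (simp add: field_simps)
 qed
 thus ?thesis using nn tri scale by unfold_locales (auto intro: order_antisym)
qed

text \<open>The standard way here to bound something by \<open>K\<close> times an infimum: every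
  \<open>t\<close> above the infimum comes with a representative of cost below
  \<open>t\<close>.\<close>

lemma le_mult_limit:
 fixes x y K :: real
 assumes K: "0 <= K" and le: "!!t. x < t ==> y <= K * t" shows "y <= K * x"
proof (rule field_le_epsilon)
 fix e :: real assume e: "e > 0"
 have "y <= K * (x + e / (K + 1))" using e K by (intro le) simp
 also have "... <= K * x + e" using e K by (simp add: field_simps)
 finally show "y <= K * x + e" .
qed

text \<open>The quotient norm and the projective norm are infima of a cost over representatives.\<close>

lemma seminormed_infimum:
 assumes E: "vspace_on E" and le: "!!r. r : R ==> 0 <= cost r & vnorm E (\<pi> r) <= cost r"
  and approx: "!!u t. u : carr E ==> vnorm E u < t ==> EX r:R. \<pi> r = u & cost r < t"
  and scale: "!!c r. r : R ==> EX q:R. \<pi> q = vscale E c (\<pi> r) & cost q <= abs c * cost r"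
  and add: "!!r r'. r : R ==> r' : R ==> EX q:R. \<pi> q = vadd E (\<pi> r) (\<pi> r') & cost q <= cost r + cost r'"
 shows "seminormed E"
proof (rule seminormedI[OF E])
 fix u c assume u: "u : carr E"
 show "0 <= vnorm E u" using approx[OF u, of 0] le by fastforce
 show "vnorm E (vscale E c u) <= abs c * vnorm E u"
 proof (rule le_mult_limit)
  fix t assume "vnorm E u < t"
  then obtain r where r: "r : R" "\<pi> r = u" "cost r < t" using approx[OF u] by blast
  obtain q where q: "q : R" "\<pi> q = vscale E c u" "cost q <= abs c * cost r" using scale[OF r(1), of c] r(2) by auto
  show "vnorm E (vscale E c u) <= abs c * t" using le[OF q(1)] q(2,3) mult_left_mono[of "cost r" t "abs c"] r(3) by simp
 qed simp
 fix v assume v: "v : carr E"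
 \<comment> \<open>The inequality is first shown for upper bounds \<open>t\<close>,
   \<open>t'\<close> of the two norms; \<open>le_mult_limit\<close> then lowers them to the norms
   one at a time.\<close>
 have 1: "vnorm E (vadd E u v) <= t + t'" if t: "vnorm E u < t" "vnorm E v < t'" for t t'
 proof -
  obtain r where r: "r : R" "\<pi> r = u" "cost r < t" using approx[OF u t(1)] by blast
  obtain r' where r': "r' : R" "\<pi> r' = v" "cost r' < t'" using approx[OF v t(2)] by blast
  obtain q where "q : R" "\<pi> q = vadd E u v" "cost q <= cost r + cost r'" using add[OF r(1) r'(1)] r(2) r'(2) by auto
  thus ?thesis using le[of q] r(3) r'(3) by (metis add_mono less_imp_le order_trans)
 qed
 have 2: "vnorm E (vadd E u v) - t <= 1 * vnorm E v" if t: "vnorm E u < t" for t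
 proof (rule le_mult_limit)
  show "vnorm E (vadd E u v) - t <= 1 * t'" if "vnorm E v < t'" for t' using 1[OF t that] by simp
 qed simp
 have "vnorm E (vadd E u v) - vnorm E v <= 1 * vnorm E u"
 proof (rule le_mult_limit)
  show "vnorm E (vadd E u v) - vnorm E v <= 1 * t" if "vnorm E u < t" for t using 2[OF that] by simp
 qed simp
 thus "vnorm E (vadd E u v) <= vnorm E u + vnorm E v" by simp
qed

lemma (in seminormed) seminormed_vquotient:
 assumes N: "vsubspace E N" shows "seminormed (vquotient E N)"
proof (rule seminormed_infimum[OF vspace_vquotient[OF N], of "carr E" "vnorm E" "vcoset E N"])
 note q = vquotient_simps[OF N]
 show "0 <= vnorm E x & vnorm (vquotient E N) (vcoset E N x) <= vnorm E x" if "x : carr E" for x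
  using vquotient_norm_le[OF N that self_mem_vcoset[OF N that]] that by simp
 show "EX y:carr E. vcoset E N y = u & vnorm E y < t" if "u : carr (vquotient E N)" "vnorm (vquotient E N) u < t" for u t
  using that vquotient_norm_approx[OF N] unfolding q(1) by blast
 show "EX y:carr E. vcoset E N y = vscale (vquotient E N) c (vcoset E N x) & vnorm E y <= abs c * vnorm E x"
  if "x : carr E" for c x using that by (intro bexI[of _ "vscale E c x"]) (simp_all add: q(4) norm_scale)
 show "EX z:carr E. vcoset E N z = vadd (vquotient E N) (vcoset E N x) (vcoset E N y) & vnorm E z <= vnorm E x + vnorm E y"
  if "x : carr E" "y : carr E" for x y using that by (intro bexI[of _ "vadd E x y"]) (simp_all add: q(3) norm_triangle)
qed

lemma normed_space_onI:
 assumes "seminormed E" "!!x. x : carr E ==> vnorm E x = 0 ==> x = vzero E" shows "normed_space_on E"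
proof -
 interpret seminormed E by fact
 show ?thesis by (unfold_locales) (auto simp: add_assoc scale_add_right scale_add_left add_inverse norm_scale norm_triangle assms(2)
    intro: add_commute)
qed

text \<open>A coset of norm zero contains vectors \<open>y\<close> of arbitrarily small norm, so the
  elements \<open>x - y\<close> of \<open>N\<close> approximate \<open>x\<close>, and closedness
  puts \<open>x\<close> into \<open>N\<close>.\<close>

lemma (in seminormed) normed_vquotient:
 assumes N: "vsubspace E N" and closed: "vclosure E N <= N" shows "normed_space_on (vquotient E N)"
proof (rule normed_space_onI)
 let ?Q = "vquotient E N"
 show "seminormed ?Q" by (rule seminormed_vquotient[OF N])
 fix A assume A: "A : carr ?Q" "vnorm ?Q A = 0"
 then obtain x where x: "x : carr E" "A = vcoset E N x" by (auto simp: vquotient_simps[OF N])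
 have "x : vclosure E N" unfolding vclosure_def
 proof (intro CollectI conjI allI impI)
  fix e :: real assume "e > 0"
  then obtain y where y: "y : vcoset E N x" "vnorm E y < e" using vquotient_norm_approx[OF N x(1), of e] A x by auto
  hence yc: "y : carr E" "vdiff E y x : N" using x by (auto simp: mem_vcoset_iff[OF N])
  hence "vdiff E x y : N" using x subspaceD(5)[OF N, of "vdiff E y x" "-1"] by (simp add: diff_swap[of y x])
  moreover have "vdiff E x (vdiff E x y) = y" using x yc by (metis add_diff_cancel_left diff_add_cancel diff_closed)
  ultimately show "EX z:N. vdist E x z < e" using y by metis
 qed (use x in auto)
 hence "vdiff E x (vzero E) : N" using closed x by auto
 thus "A = vzero ?Q" using x by (simp add: vquotient_simps[OF N] vcoset_eq_iff[OF N])
qed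

lemma (in seminormed) seminormed_subspace:
 assumes "vsubspace E N" shows "seminormed (E\<lparr>vcarrier := N\<rparr>)"
proof -
 interpret F: vspace_on "E\<lparr>vcarrier := N\<rparr>" by (rule vspace_subspace[OF assms])
 show ?thesis using subspaceD(2)[OF assms] by unfold_locales (auto simp: norm_scale norm_triangle)
qed

lemma vdiff_carrier_update [simp]: "vdiff (E\<lparr>vcarrier := N\<rparr>) = vdiff E" by (intro ext) (simp add: vdiff_def)

text \<open>Kept apart from \<open>banach_space_on\<close> so that it applies to seminormed spaces
  as well.\<close>

definition vcomplete :: "'v nvs => bool" where
 "vcomplete E \<longleftrightarrow> (ALL s. vCauchy E s --> (EX l:carr E. (%n. vdist E (s n) l) ----> 0))"

lemma banach_space_onI: "normed_space_on E ==> vcomplete E ==> banach_space_on E"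
 by (simp add: banach_space_on_def banach_space_on_axioms_def vcomplete_def)

lemma normed_imp_seminormed: "normed_space_on E ==> seminormed E"
proof -
 assume "normed_space_on E"
 then interpret normed_space_on E .
 show ?thesis by unfold_locales (simp_all add: zero_closed add_closed scale_closed add_assoc add_zero add_inverse
    scale_add_right scale_add_left scale_scale scale_one norm_nonneg norm_scale norm_triangle,
    simp add: add_commute)
qed

lemma vCauchyD:
 "vCauchy E s ==> e > 0 ==> EX N. ALL i>=N. ALL j>=N. vdist E (s i) (s j) < e"
 "vCauchy E s ==> s n : carr E" by (auto simp: vCauchy_def)

context seminormed
begin

lemma convergent_imp_vCauchy:
 assumes "!!n. s n : carr E" "l : carr E" "(%n. vdist E (s n) l) ----> 0" shows "vCauchy E s" unfolding vCauchy_def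
proof (intro conjI allI impI)
 fix e :: real assume "e > 0"
 then obtain M where M: "!!n. n >= M ==> vdist E (s n) l < e / 2"
  using order_tendstoD(2)[OF assms(3), of "e/2"] by (auto simp: eventually_sequentially)
 have "vdist E (s i) (s j) < e" if "i >= M" "j >= M" for i j
  using norm_diff_triangle[of "s i" l "s j"] M[OF that(1)] M[OF that(2)] assms norm_diff_commute[of l "s j"] by simp
 thus "EX N. ALL i>=N. ALL j>=N. vdist E (s i) (s j) < e" by blast
qed (use assms in auto)

lemma vCauchy_norm_convergent:
 assumes "vCauchy E s" shows "convergent (%n. vnorm E (s n))"
proof (rule Cauchy_convergent, rule metric_CauchyI)
 fix e :: real assume "e > 0"
 then obtain M where "ALL i>=M. ALL j>=M. vdist E (s i) (s j) < e" using vCauchyD(1)[OF assms] by blast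
 thus "EX M. ALL m>=M. ALL n>=M. dist (vnorm E (s m)) (vnorm E (s n)) < e"
  using norm_abs_diff vCauchyD(2)[OF assms] by (metis (no_types, opaque_lifting) dist_real_def le_less_trans)
qed

text \<open>It suffices to test completeness on rapidly Cauchy sequences.\<close>

lemma vcompleteI_rapid:
 assumes "!!s. [|!!n. s n : carr E; !!n. vdist E (s (Suc n)) (s n) < (1/2) ^ n|] ==>
  EX l:carr E. (%n. vdist E (s n) l) ----> 0" shows "vcomplete E" unfolding vcomplete_def
proof (intro allI impI)
 fix s assume s: "vCauchy E s"
 note sc = vCauchyD(2)[OF s]
 have "ALL k. EX N. ALL i>=N. ALL j>=N. vdist E (s i) (s j) < (1/2) ^ k" using vCauchyD(1)[OF s] by simp
 then obtain N where N: "!!k i j. i >= N k ==> j >= N k ==> vdist E (s i) (s j) < (1/2) ^ k" by metis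
 \<comment> \<open>The partial sums make \<open>r\<close> increasing and above \<open>N\<close>, so
   consecutive distances along \<open>r\<close> are below \<open>(1/2) ^ k\<close>; the summand
   \<open>k\<close> makes \<open>r\<close> unbounded.\<close>
 define r where "r k = (\<Sum>j\<le>k. N j) + k" for k
 have rN: "r k >= N k" for k by (simp add: r_def trans_le_add1 member_le_sum)
 have rS: "r (Suc k) >= r k" for k by (simp add: r_def)
 obtain l where l: "l : carr E" "(%n. vdist E (s (r n)) l) ----> 0"
  using assms[of "%k. s (r k)"] sc N rN rS by (meson order_trans)
 have "(%n. vdist E (s n) l) ----> 0"
 proof (rule LIMSEQ_I)
  fix e :: real assume "e > 0"
  then obtain M where M: "ALL i>=M. ALL j>=M. vdist E (s i) (s j) < e / 2" using vCauchyD(1)[OF s, of "e/2"] by auto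
  obtain K where K: "!!n. n >= K ==> vdist E (s (r n)) l < e / 2"
   using order_tendstoD(2)[OF l(2), of "e/2"] \<open>e > 0\<close> by (auto simp: eventually_sequentially)
  define k where "k = max M K"
  have "r k >= k" by (simp add: r_def)
  hence "vdist E (s n) l < e" if "n >= M" for n using norm_diff_triangle[of "s n" "s (r k)" l] M K[of k] that sc l(1)
   by (smt (verit) field_sum_of_halves k_def max.bounded_iff max.cobounded2)
  thus "EX no. ALL n>=no. norm (vdist E (s n) l - 0) < e" using sc l(1) by auto
 qed
 thus "EX l:carr E. (%n. vdist E (s n) l) ----> 0" using l by blast
qed

lemma vCauchy_rapid:
 assumes s: "!!n. s n : carr E" and d: "!!n. vdist E (s (Suc n)) (s n) < (1/2) ^ n" shows "vCauchy E s"
proof -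
 \<comment> \<open>The exact geometric difference reproduces itself in the induction, which the
   bound \<open>2 * (1/2) ^ n\<close> alone would not.\<close>
 have le: "vdist E (s (n + k)) (s n) <= 2 * (1/2) ^ n - 2 * (1/2) ^ (n + k)" for n k
 proof (induction k)
  case (Suc k)
  show ?case using norm_diff_triangle[of "s (n + Suc k)" "s (n + k)" "s n"] s d[of "n + k"] Suc by simp
 qed (use s in auto)
 have le': "vdist E (s i) (s j) <= 4 * (1/2) ^ M" if "i >= M" "j >= M" for i j M
 proof -
  have "vdist E (s i) (s M) <= 2 * (1/2) ^ M" "vdist E (s j) (s M) <= 2 * (1/2) ^ M"
   using le[of M "i - M"] le[of M "j - M"] that by (smt (verit) le_add_diff_inverse zero_le_power zero_le_divide_1_iff)+
  thus ?thesis using norm_diff_triangle[of "s i" "s M" "s j"] s norm_diff_commute[of "s M" "s j"] by simp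
 qed
 show ?thesis unfolding vCauchy_def
 proof (intro conjI allI impI s)
  fix e :: real assume "e > 0"
  then obtain M where "(1/2) ^ M < e / 4" using real_arch_pow_inv[of "e/4" "1/2"] by auto
  hence "4 * (1/2) ^ M < e" by simp
  thus "EX N. ALL i>=N. ALL j>=N. vdist E (s i) (s j) < e" using le'[of M] by (intro exI[of _ M] allI impI) (rule le_less_trans)
 qed
qed

text \<open>A rapidly Cauchy sequence of cosets lifts step by step to a rapidly Cauchy sequence of
  representatives, because a difference of small quotient norm has a representative of small
  norm.\<close>

lemma vcomplete_vquotient:
 assumes N: "vsubspace E N" and E: "vcomplete E" shows "vcomplete (vquotient E N)"
proof -
 let ?Q = "vquotient E N"
 interpret Q: seminormed ?Q by (rule seminormed_vquotient[OF N])
 show ?thesis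
 proof (rule Q.vcompleteI_rapid)
  fix S assume S: "!!n. S n : carr ?Q" "!!n. vdist ?Q (S (Suc n)) (S n) < (1/2) ^ n"
  have "EX x'. x' : carr E & vcoset E N x' = S (Suc n) & vdist E x' x < (1/2) ^ n"
   if x: "x : carr E" "vcoset E N x = S n" for n x
  proof -
   obtain z where z: "z : carr E" "vcoset E N z = S (Suc n)" using S(1)[of "Suc n"] by (auto simp: vquotient_simps[OF N])
   have "vnorm ?Q (vcoset E N (vdiff E z x)) < (1/2) ^ n" using S(2)[of n] z x by (metis vquotient_diff[OF N])
   then obtain y where y: "y : carr E" "vnorm E y < (1/2) ^ n"
     "vcoset E N y = vcoset E N (vdiff E z x)" using vquotient_norm_approx[OF N] z x by (metis diff_closed)
   have "vcoset E N (vadd E y x) = vadd ?Q (vcoset E N (vdiff E z x)) (vcoset E N x)" using y x by (metis vquotient_simps(3)[OF N])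
   also have "... = vcoset E N z" using z x by (subst vquotient_simps(3)[OF N]) auto
   finally show ?thesis using y x z by (intro exI[of _ "vadd E y x"]) auto
  qed
  moreover have "EX x. x : carr E & vcoset E N x = S 0" using S(1)[of 0] by (auto simp: vquotient_simps[OF N])
  ultimately obtain x where x: "!!n. x n : carr E & vcoset E N (x n) = S n"
    "!!n. vdist E (x (Suc n)) (x n) < (1/2) ^ n" using dependent_nat_choice[of "%n x. x : carr E & vcoset E N x = S n"
     "%n x x'. vdist E x' x < (1/2) ^ n"] by (metis (no_types, lifting))
  obtain l where l: "l : carr E" "(%n. vdist E (x n) l) ----> 0"
   using E vCauchy_rapid[of x] x unfolding vcomplete_def by blast
  have "(%n. vdist ?Q (S n) (vcoset E N l)) ----> 0"
  proof (rule Lim_null_comparison[OF _ l(2)], rule always_eventually, rule allI)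
   fix n
   have "vdiff ?Q (S n) (vcoset E N l) = vcoset E N (vdiff E (x n) l)" using x l by (metis vquotient_diff[OF N])
   thus "norm (vdist ?Q (S n) (vcoset E N l)) <= vdist E (x n) l"
    using vquotient_norm_le[OF N, of "vdiff E (x n) l" "vdiff E (x n) l"]
     seminormed.norm_nonneg[OF seminormed_vquotient[OF N], of "vcoset E N (vdiff E (x n) l)"] self_mem_vcoset[OF N, of "vdiff E (x n) l"] x l
    by (simp add: vquotient_simps(1)[OF N])
  qed
  thus "EX l:carr ?Q. (%n. vdist ?Q (S n) l) ----> 0" using l by (auto simp: vquotient_simps[OF N])
 qed
qed

end

section \<open>Function spaces, functionals and duals\<close>

lemma real_nvs_simps [simp]:
 "carr real_nvs = UNIV" "vzero real_nvs = 0" "vadd real_nvs = (+)" "vscale real_nvs = (*)"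
 "vnorm real_nvs = abs" by (simp_all add: real_nvs_def)

lemma vdiff_real_nvs [simp]: "vdiff real_nvs x y = x - y" by (simp add: vdiff_def)

declare restrict_UNIV [simp]

lemma seminormed_real_nvs: "seminormed real_nvs" by unfold_locales (auto simp: algebra_simps abs_mult)

lemma vmaps_simps [simp]:
 "carr (vmaps A E F N) = F" "vnorm (vmaps A E F N) = N"
 "vzero (vmaps A E F N) = restrict (%x. vzero E) A"
 "vadd (vmaps A E F N) f g = restrict (%x. vadd E (f x) (g x)) A"
 "vscale (vmaps A E F N) c f = restrict (%x. vscale E c (f x)) A" by (simp_all add: vmaps_def)

lemma vdiff_vmaps [simp]: "vdiff (vmaps A E F N) f g = restrict (%x. vdiff E (f x) (g x)) A"
 by (auto simp: vdiff_def restrict_def fun_eq_iff)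

lemma vspace_fun:
 fixes F :: "('u => real) set"
 assumes "(%x. 0) : F" "!!f g. f : F ==> g : F ==> (%x. f x + g x) : F"
  "!!c f. f : F ==> (%x. c * f x) : F" shows "vspace_on (vmaps UNIV real_nvs F N)" using seminormed_real_nvs assms
 by (intro vspace_vmaps) (auto simp: seminormed_def)

lemma seminormed_fun:
 fixes F :: "('u => real) set"
 assumes "(%x. 0) : F" "!!f g. f : F ==> g : F ==> (%x. f x + g x) : F"
  "!!c f. f : F ==> (%x. c * f x) : F"
  "!!f. f : F ==> 0 <= N f" "!!c f. f : F ==> N (%x. c * f x) <= abs c * N f"
  "!!f g. f : F ==> g : F ==> N (%x. f x + g x) <= N f + N g" shows "seminormed (vmaps UNIV real_nvs F N)"
 by (rule seminormedI[OF vspace_fun[OF assms(1-3)]]) (simp_all add: assms(4-6))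

text \<open>A bounded functional without the extensionality demanded by \<open>vdual\<close>, so
  that lambda terms qualify directly, and with an explicit admissible constant
  \<open>C\<close>.\<close>

definition vfunc :: "'v nvs => ('v => real) => real => bool" where
 "vfunc E phi C \<longleftrightarrow> (ALL x:carr E. ALL y:carr E. phi (vadd E x y) = phi x + phi y) &
   (ALL c. ALL x:carr E. phi (vscale E c x) = c * phi x) & (ALL x:carr E. abs (phi x) <= C * vnorm E x)"

lemma vfuncD:
 assumes "vfunc E phi C" shows "[|x : carr E; y : carr E|] ==> phi (vadd E x y) = phi x + phi y"
  "x : carr E ==> phi (vscale E c x) = c * phi x"
  "x : carr E ==> abs (phi x) <= C * vnorm E x" using assms by (auto simp: vfunc_def)

lemma (in vspace_on) vfunc_simps:
 assumes "vfunc E phi C" shows "phi (vzero E) = 0"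
  "[|x : carr E; y : carr E|] ==> phi (vdiff E x y) = phi x - phi y"
proof -
 show "phi (vzero E) = 0" using vfuncD(2)[OF assms, of "vzero E" 0] by simp
 show "phi (vdiff E x y) = phi x - phi y" if "x : carr E" "y : carr E"
  using vfuncD(1)[OF assms, of x "vscale E (-1) y"] vfuncD(2)[OF assms, of y "-1"] that by (simp add: vdiff_def)
qed

lemma (in seminormed) vfunc_tendsto:
 assumes phi: "vfunc E phi C" and s: "!!n. s n : carr E" and l: "l : carr E"
  and lim: "(%n. vdist E (s n) l) ----> 0" shows "(%n. phi (s n)) ----> phi l"
proof (rule LIM_zero_cancel, rule Lim_null_comparison)
 show "(%n. C * vdist E (s n) l) ----> 0" using tendsto_mult_right_zero[OF lim] by simp
 show "\<forall>\<^sub>F n in sequentially. norm (phi (s n) - phi l) <= C * vdist E (s n) l"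
  using vfuncD(3)[OF phi] s l by (simp add: vfunc_simps(2)[OF phi, symmetric])
qed

lemma (in seminormed) vCauchy_map:
 assumes s: "vCauchy E s" and t: "!!n. t n : carr F" and le: "!!i j. vdist F (t i) (t j) <= C * vdist E (s i) (s j)"
 shows "vCauchy F t" unfolding vCauchy_def
proof (intro conjI allI impI t)
 fix e :: real assume e: "e > 0"
 then obtain M where M: "ALL i>=M. ALL j>=M. vdist E (s i) (s j) < e / (abs C + 1)"
  using vCauchyD(1)[OF s, of "e / (abs C + 1)"] by auto
 have "vdist F (t i) (t j) < e" if "i >= M" "j >= M" for i j
 proof -
  have "C * vdist E (s i) (s j) <= abs C * (e / (abs C + 1))"
   using M that vCauchyD(2)[OF s] by (intro mult_mono) (auto intro: less_imp_le)
  also have "... < e" using e by (simp add: field_simps)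
  finally show ?thesis using le[of i j] by linarith
 qed
 thus "EX N. ALL i>=N. ALL j>=N. vdist F (t i) (t j) < e" by blast
qed

lemma vCauchy_real_nvs: "vCauchy real_nvs a ==> convergent a"
 by (intro Cauchy_convergent metric_CauchyI) (simp add: vCauchy_def dist_real_def)

lemma (in seminormed) vfunc_convergent:
 assumes phi: "vfunc E phi C" and s: "vCauchy E s" shows "(%n. phi (s n)) ----> lim (%n. phi (s n))"
proof -
 have "vCauchy real_nvs (%n. phi (s n))" using vfuncD(3)[OF phi diff_closed] vCauchyD(2)[OF s]
  by (intro vCauchy_map[OF s, of _ _ C]) (simp_all add: vfunc_simps(2)[OF phi, symmetric])
 thus ?thesis using vCauchy_real_nvs convergent_LIMSEQ_iff by blast
qed

lemma vcomplete_transfer: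
 assumes E: "seminormed E" and F: "vcomplete F" and T: "!!x. x : carr E ==> T x : carr F"
   "!!x y. x : carr E ==> y : carr E ==> T (vdiff E x y) = vdiff F (T x) (T y)"
  and ub: "!!x. x : carr E ==> vnorm F (T x) <= C * vnorm E x" and lb: "!!x. x : carr E ==> vnorm E x <= D * vnorm F (T x)"
  and surj: "!!y. y : carr F ==> EX x:carr E. T x = y" shows "vcomplete E" unfolding vcomplete_def
proof (intro allI impI)
 interpret E: seminormed E by fact
 fix s assume s: "vCauchy E s"
 note sc = vCauchyD(2)[OF s]
 have "vCauchy F (%n. T (s n))" using ub[OF E.diff_closed[OF sc sc]] by (intro E.vCauchy_map[OF s]) (simp_all add: T sc)
 then obtain y where y: "y : carr F" "(%n. vdist F (T (s n)) y) ----> 0" using F unfolding vcomplete_def by blast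
 obtain x where x: "x : carr E" "T x = y" using surj y by blast
 have lim: "(%n. D * vdist F (T (s n)) y) ----> 0" using tendsto_mult_right_zero[OF y(2)] by simp
 have "(%n. vdist E (s n) x) ----> 0"
  using lb[OF E.diff_closed[OF sc x(1)]] sc x by (intro Lim_null_comparison[OF _ lim]) (simp add: T)
 thus "EX l:carr E. (%n. vdist E (s n) l) ----> 0" using x by blast
qed

lemma (in seminormed) vclosure_seq:
 assumes x: "x : vclosure E S" and S: "S <= carr E"
 obtains s where "!!n. s n : S" "(%n. vdist E (s n) x) ----> 0"
proof -
 have "ALL n. EX y:S. vdist E x y < inverse (real (Suc n))" using vclosureD[OF x] by simp
 then obtain s where s: "!!n. s n : S" "!!n. vdist E x (s n) < inverse (real (Suc n))" by metis
 have c: "s n : carr E" "x : carr E" for n using s S x vclosure_subset[of S] by auto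
 have "(%n. vdist E (s n) x) ----> 0"
 proof (rule Lim_null_comparison[OF _ LIMSEQ_inverse_real_of_nat], intro always_eventually allI)
  fix n show "norm (vdist E (s n) x) <= inverse (real (Suc n))" using s(2)[of n] c norm_diff_commute[of "s n" x] by simp
 qed
 thus thesis using that s by blast
qed

lemma (in seminormed) vfunc_eq_closure:
 assumes phi: "vfunc E phi C" and psi: "vfunc E psi D" and S: "S <= carr E"
  and eq: "!!x. x : S ==> phi x = psi x" and x: "x : vclosure E S" shows "phi x = psi x"
proof -
 obtain s where s: "!!n. s n : S" "(%n. vdist E (s n) x) ----> 0" using vclosure_seq[OF x S] by blast
 have "s n : carr E" "x : carr E" for n using s S x vclosure_subset[of S] by auto
 hence "(%n. phi (s n)) ----> phi x" "(%n. psi (s n)) ----> psi x" using vfunc_tendsto[OF phi] vfunc_tendsto[OF psi] s by blast+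
 thus ?thesis using eq[OF s(1)] LIMSEQ_unique by simp
qed

text \<open>\<open>Phi\<close> evaluates \<open>phi\<close> at a chosen representative of the coset;
  the choice is harmless because \<open>phi\<close> vanishes on \<open>N\<close>.\<close>

lemma (in vspace_on) quotient_linear:
 fixes phi :: "'v => real"
 assumes N: "vsubspace E N" and diff: "!!x y. x : carr E ==> y : carr E ==> phi (vdiff E x y) = phi x - phi y"
  and 0: "!!x. x : N ==> phi x = 0"
 obtains Phi where "!!x. x : carr E ==> Phi (vcoset E N x) = phi x"
proof (rule that)
 fix x assume x: "x : carr E"
 have "(SOME y. y : vcoset E N x) : vcoset E N x" using self_mem_vcoset[OF N x] by (rule someI)
 thus "phi (SOME y. y : vcoset E N x) = phi x" using diff[of "SOME y. y : vcoset E N x" x] x 0 by (auto simp: mem_vcoset_iff[OF N])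
qed

lemma (in seminormed) quotient_functional:
 assumes N: "vsubspace E N" and phi: "vfunc E phi C" and C: "0 <= C" and 0: "!!x. x : N ==> phi x = 0"
 obtains Phi where "vfunc (vquotient E N) Phi C"
  "!!x. x : carr E ==> Phi (vcoset E N x) = phi x"
proof -
 let ?Q = "vquotient E N"
 obtain Phi where eq: "!!x. x : carr E ==> Phi (vcoset E N x) = phi x"
  by (rule quotient_linear[OF N vfunc_simps(2)[OF phi] 0]) (assumption | rule that)+
 have bd: "abs (phi x) <= C * vnorm ?Q (vcoset E N x)" if x: "x : carr E" for x
 proof (rule le_mult_limit[OF C])
  fix t assume "vnorm ?Q (vcoset E N x) < t"
  then obtain y where y: "y : carr E" "vnorm E y < t" "vcoset E N y = vcoset E N x" using vquotient_norm_approx[OF N x] by blast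
  have "abs (phi x) = abs (phi y)" using eq[OF x] eq[OF y(1)] y(3) by simp
  also have "... <= C * t" using vfuncD(3)[OF phi y(1)] mult_left_mono[OF less_imp_le[OF y(2)] C] by linarith
  finally show "abs (phi x) <= C * t" .
 qed
 have "vfunc ?Q Phi C" using bd vfuncD(1,2)[OF phi] by (auto simp: vfunc_def vquotient_simps(1-4)[OF N] eq)
 thus thesis using that eq by blast
qed

text \<open>The infimum in \<open>vopnorm\<close> is itself an admissible bound: division by
  \<open>vnorm E x\<close> reduces this to a lower bound for all admissible constants. If
  \<open>vnorm E x = 0\<close>, any one admissible constant settles the matter.\<close>

lemma vopnorm_bound:
 assumes E: "seminormed E" and F: "seminormed F" and T: "vbounded_linear E F T"
 shows "0 <= vopnorm E F T" "x : carr E ==> vnorm F (T x) <= vopnorm E F T * vnorm E x"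
proof -
 interpret E: seminormed E by fact
 interpret F: seminormed F by fact
 let ?S = "{C. 0 <= C & (ALL x:carr E. vnorm F (T x) <= C * vnorm E x)}"
 obtain C where C: "!!x. x : carr E ==> vnorm F (T x) <= C * vnorm E x" using T by (auto simp: vbounded_linear_def)
 have ne: "max C 0 : ?S" using C E.norm_nonneg by (auto intro!: order_trans[OF C mult_right_mono])
 show "0 <= vopnorm E F T" unfolding vopnorm_def by (intro cInf_greatest) (use ne in blast, auto)
 show "vnorm F (T x) <= vopnorm E F T * vnorm E x" if x: "x : carr E"
 proof (cases "vnorm E x = 0")
  case True
  thus ?thesis using C[OF x] by simp
 next
  case False
  hence pos: "vnorm E x > 0" using E.norm_nonneg[OF x] by linarith
  have "vnorm F (T x) / vnorm E x <= vopnorm E F T" unfolding vopnorm_def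
   by (intro cInf_greatest) (use ne in blast, use x pos in \<open>auto simp: divide_le_eq\<close>)
  thus ?thesis using pos by (simp add: field_simps)
 qed
qed

lemma vopnorm_le:
 assumes "0 <= C" "!!x. x : carr E ==> vnorm F (T x) <= C * vnorm E x" shows "vopnorm E F T <= C"
 unfolding vopnorm_def using assms by (intro cInf_lower) (auto intro: bdd_belowI[of _ 0])

lemma vdual_carrier_iff:
 assumes E: "seminormed E"
 shows "T : carr (vdual E) \<longleftrightarrow> T : extensional (carr E) & (EX C. vfunc E T C)"
 by (auto simp: vdual_def vbounded_linear_def vlinear_def vfunc_def PiE_def)

lemma vdual_norm:
 assumes E: "seminormed E" and T: "T : carr (vdual E)" shows "vfunc E T (vnorm (vdual E) T)" "0 <= vnorm (vdual E) T"
 using vopnorm_bound[OF E seminormed_real_nvs, of T] T by (auto simp: vdual_def vfunc_def vbounded_linear_def vlinear_def)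

lemma vdual_norm_le: "vfunc E T C ==> 0 <= C ==> vnorm (vdual E) T <= C" by (auto simp: vdual_def vfunc_def intro: vopnorm_le)

lemma vfunc_restrict:
 assumes "seminormed E" "vfunc E phi C" shows "vfunc E (restrict phi (carr E)) C"
proof -
 interpret seminormed E by fact
 show ?thesis using assms by (auto simp: vfunc_def)
qed

lemma vfunc_mono:
 assumes "seminormed E" "vfunc E phi C" "C <= D" shows "vfunc E phi D"
proof -
 interpret seminormed E by fact
 show ?thesis using assms unfolding vfunc_def by (meson mult_right_mono norm_nonneg order_trans)
qed

lemma normed_vdual:
 assumes E: "seminormed E" shows "normed_space_on (vdual E)"
proof (rule normed_space_onI)
 interpret E: seminormed E by fact
 note mem = vdual_carrier_iff[OF E] and nrm = vdual_norm[OF E]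
 have zero: "restrict (%x. 0) (carr E) : carr (vdual E)" unfolding mem by (auto simp: vfunc_def intro!: exI[of _ 0])
 have add: "vfunc E (restrict (%x. S x + T x) (carr E)) (C + D)" if "vfunc E S C" "vfunc E T D" for S T C D
  using that unfolding vfunc_def by (auto simp: algebra_simps intro: order_trans[OF abs_triangle_ineq add_mono])
 have scale: "vfunc E (restrict (%x. c * T x) (carr E)) (abs c * C)" if "vfunc E T C" for T C c
 proof -
  have "abs (c * T x) <= abs c * C * vnorm E x" if "x : carr E" for x
   using mult_left_mono[of "abs (T x)" "C * vnorm E x" "abs c"] \<open>vfunc E T C\<close> that
   by (simp add: abs_mult mult.assoc vfunc_def)
  thus ?thesis using that by (auto simp: vfunc_def distrib_left)
 qed
 have add_mem: "restrict (%x. S x + T x) (carr E) : carr (vdual E)" if "S : carr (vdual E)" "T : carr (vdual E)" for S T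
  using that add restrict_extensional unfolding mem by blast
 have scale_mem: "restrict (%x. c * T x) (carr E) : carr (vdual E)" if "T : carr (vdual E)" for T c
  using that scale unfolding mem by (auto intro: restrict_extensional)
 define F where "F = carr (vdual E)"
 define N where "N = vnorm (vdual E)"
 have d: "vdual E = vmaps (carr E) real_nvs F N" by (simp add: F_def N_def vdual_def)
 show "seminormed (vdual E)" unfolding d
 proof (rule seminormedI; (simp only: vmaps_simps)?)
  show "vspace_on (vmaps (carr E) real_nvs F N)" using seminormed_real_nvs zero add_mem scale_mem
   by (intro vspace_vmaps) (auto simp: seminormed_def F_def mem PiE_def)
  show "0 <= N f" if "f : F" for f using that nrm(2) by (simp add: F_def N_def)
  show "N (restrict (%x. vadd real_nvs (f x) (g x)) (carr E)) <= N f + N g" if "f : F" "g : F" for f g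
   using that nrm[of f] nrm[of g] add unfolding F_def N_def by (auto intro!: vdual_norm_le)
  show "N (restrict (%x. vscale real_nvs c (f x)) (carr E)) <= abs c * N f" if "f : F" for c f
   using that nrm[of f] scale unfolding F_def N_def by (auto intro!: vdual_norm_le)
 qed
 fix T assume T: "T : carr (vdual E)" "vnorm (vdual E) T = 0"
 hence "T x = 0" if "x : carr E" for x using vfuncD(3)[OF nrm(1)[OF T(1)] that] by simp
 thus "T = vzero (vdual E)" using T(1) unfolding mem by (auto simp: vdual_def fun_eq_iff restrict_def extensional_def)
qed

lemma vdual_ops:
 "vadd (vdual E) S T = restrict (%x. S x + T x) (carr E)"
 "vscale (vdual E) c T = restrict (%x. c * T x) (carr E)"
 "vdiff (vdual E) S T = restrict (%x. S x - T x) (carr E)" by (simp_all add: vdual_def)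

lemma vcomplete_vdual:
 assumes E: "seminormed E" shows "vcomplete (vdual E)" unfolding vcomplete_def
proof (intro allI impI)
 fix T assume T: "vCauchy (vdual E) T"
 interpret E: seminormed E by fact
 interpret D: seminormed "vdual E" using normed_vdual[OF E] by (rule normed_imp_seminormed)
 note mem = vdual_carrier_iff[OF E] and nrm = vdual_norm[OF E]
 have Tc: "T n : carr (vdual E)" for n using vCauchyD(2)[OF T] .
 have bd: "abs (T i x - T j x) <= vdist (vdual E) (T i) (T j) * vnorm E x" if "x : carr E" for x i j
  using vfuncD(3)[OF nrm(1)[OF D.diff_closed[OF Tc Tc]] that, of i j] that by (simp add: vdual_ops)
 have "convergent (%n. T n x)" if x: "x : carr E" for x
  using bd[OF x] by (intro vCauchy_real_nvs D.vCauchy_map[OF T, of _ _ "vnorm E x"]) (simp_all add: mult.commute)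
 hence lim: "(%n. T n x) ----> lim (%n. T n x)" if "x : carr E" for x using that by (simp add: convergent_LIMSEQ_iff)
 define L where "L = restrict (%x. lim (%n. T n x)) (carr E)"
 have L: "(%n. T n x) ----> L x" if "x : carr E" for x using lim that by (simp add: L_def)
 have Tlin: "vfunc E (T n) (vnorm (vdual E) (T n))" for n using nrm(1)[OF Tc] .
 \<comment> \<open>Letting \<open>j\<close> tend to infinity in the Cauchy estimate keeps the rate
   and is uniform in \<open>x\<close>. It serves twice: for the boundedness of \<open>L\<close> and
   for convergence in norm.\<close>
 have close: "abs (T i x - L x) <= e * vnorm E x"
  if x: "x : carr E" and M: "ALL i>=M. ALL j>=M. vdist (vdual E) (T i) (T j) < e" and i: "i >= M" for x i M e
 proof (rule tendsto_upperbound)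
  show "(%j. abs (T i x - T j x)) ----> abs (T i x - L x)" using L[OF x] by (intro tendsto_intros)
  have "abs (T i x - T j x) <= e * vnorm E x" if "j >= M" for j using bd[OF x, of i j] M i that E.norm_nonneg[OF x]
   by (meson less_imp_le mult_right_mono order_trans)
  thus "\<forall>\<^sub>F j in sequentially. abs (T i x - T j x) <= e * vnorm E x" by (auto simp: eventually_sequentially)
 qed auto
 have Ladd: "L (vadd E x y) = L x + L y" if "x : carr E" "y : carr E" for x y
  using L[of "vadd E x y"] tendsto_add[OF L[OF that(1)] L[OF that(2)]] that vfuncD(1)[OF Tlin] by (auto intro: LIMSEQ_unique)
 have Lscale: "L (vscale E c x) = c * L x" if "x : carr E" for x c
  using L[of "vscale E c x"] tendsto_mult_left[OF L[OF that], of c] that vfuncD(2)[OF Tlin] by (auto intro: LIMSEQ_unique)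
 obtain M where M: "ALL i>=M. ALL j>=M. vdist (vdual E) (T i) (T j) < 1" using vCauchyD(1)[OF T, of 1] by auto
 have "abs (L x) <= (1 + vnorm (vdual E) (T M)) * vnorm E x" if x: "x : carr E" for x
  using close[OF x M order_refl] vfuncD(3)[OF Tlin x, of M] by (simp add: algebra_simps)
 hence "vfunc E L (1 + vnorm (vdual E) (T M))" by (simp add: vfunc_def Ladd Lscale)
 hence Lc: "L : carr (vdual E)" unfolding mem by (auto simp: L_def)
 have "(%n. vdist (vdual E) (T n) L) ----> 0"
 proof (rule LIMSEQ_I)
  fix e :: real assume "e > 0"
  then obtain M where M: "ALL i>=M. ALL j>=M. vdist (vdual E) (T i) (T j) < e / 2"
   using vCauchyD(1)[OF T, of "e/2"] by auto
  have "vdist (vdual E) (T n) L <= e / 2" if "n >= M" for n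
   using close[OF _ M that] nrm(1)[OF D.diff_closed[OF Tc Lc, of n]] \<open>e > 0\<close>
   by (intro vdual_norm_le) (auto simp: vfunc_def vdual_ops)
  thus "EX no. ALL n>=no. norm (vdist (vdual E) (T n) L - 0) < e"
   using \<open>e > 0\<close> D.norm_nonneg Tc Lc by (intro exI[of _ M]) force
 qed
 thus "EX l:carr (vdual E). (%n. vdist (vdual E) (T n) l) ----> 0" using Lc by blast
qed

text \<open>The lower bound and definiteness of the norm of \<open>E\<close> give injectivity; the
  inverse, defined by choosing preimages, inherits linearity from it. The second conclusion is what
  makes \<open>BV\<close> complete.\<close>

lemma visomorphicI:
 assumes E: "normed_space_on E" and F: "seminormed F" and T: "vlinear E F T"
  and ub: "!!x. x : carr E ==> vnorm F (T x) <= C * vnorm E x" and lb: "!!x. x : carr E ==> vnorm E x <= D * vnorm F (T x)"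
  and surj: "!!y. y : carr F ==> EX x:carr E. T x = y" shows "visomorphic E F" "vcomplete F ==> vcomplete E"
proof -
 interpret NE: normed_space_on E by fact
 interpret E: seminormed E using E by (rule normed_imp_seminormed)
 interpret F: seminormed F by fact
 have Tc: "T x : carr F" if "x : carr E" for x using T that by (auto simp: vlinear_def)
 have Tadd: "T (vadd E x y) = vadd F (T x) (T y)" if "x : carr E" "y : carr E" for x y using T that by (simp add: vlinear_def)
 have Tsc: "T (vscale E c x) = vscale F c (T x)" if "x : carr E" for x c using T that by (simp add: vlinear_def)
 have Tdiff: "T (vdiff E x y) = vdiff F (T x) (T y)" if "x : carr E" "y : carr E" for x y
  using that by (simp add: vdiff_def Tadd Tsc)
 have inj: "x = y" if "x : carr E" "y : carr E" "T x = T y" for x y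
 proof -
  have "vdist E x y <= 0" using lb[of "vdiff E x y"] that Tc by (simp add: Tdiff)
  hence "vdist E x y = 0" by (rule order_antisym) (simp add: that)
  hence "vdiff E x y = vzero E" using NE.norm_eq_zero[of "vdiff E x y"] that by simp
  thus ?thesis using E.diff_eq_zero_iff that by blast
 qed
 define S where "S = restrict (%y. SOME x. x : carr E & T x = y) (carr F)"
 have S: "S y : carr E" "T (S y) = y" if "y : carr F" for y
  using someI_ex[of "%x. x : carr E & T x = y"] surj[OF that] that by (auto simp: S_def)
 have "vbounded_linear F E S" unfolding vbounded_linear_def vlinear_def
 proof (intro conjI ballI allI)
  show "S : carr F \<rightarrow>\<^sub>E carr E" using S by (auto simp: S_def)
  show "S (vadd F x y) = vadd E (S x) (S y)" if "x : carr F" "y : carr F" for x y using that S by (intro inj) (auto simp: Tadd)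
  show "S (vscale F c x) = vscale E c (S x)" if "x : carr F" for x c using that S by (intro inj) (auto simp: Tsc)
  show "EX C. ALL x:carr F. vnorm E (S x) <= C * vnorm F x" using lb S by (intro exI[of _ D]) (metis (no_types))
 qed
 moreover have "vbounded_linear E F T" using T ub by (auto simp: vbounded_linear_def)
 moreover have "S (T x) = x" if "x : carr E" for x using that S Tc by (intro inj) auto
 ultimately show "visomorphic E F" unfolding visomorphic_def using S by blast
 show "vcomplete F ==> vcomplete E" by (rule vcomplete_transfer[OF E.seminormed_axioms _ Tc Tdiff ub lb surj])
qed

section \<open>Products and completions\<close>

lemma vprod_max_simps:
 "carr (vprod_max E F) = carr E \<times> carr F" "vzero (vprod_max E F) = (vzero E, vzero F)"
 "vadd (vprod_max E F) (x, y) (x', y') = (vadd E x x', vadd F y y')"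
 "vscale (vprod_max E F) c (x, y) = (vscale E c x, vscale F c y)"
 "vnorm (vprod_max E F) (x, y) = max (vnorm E x) (vnorm F y)"
 "vdiff (vprod_max E F) (x, y) (x', y') = (vdiff E x x', vdiff F y y')" by (simp_all add: vprod_max_def vdiff_def)

lemma seminormed_vprod_max:
 assumes E: "seminormed E" and F: "seminormed F" shows "seminormed (vprod_max E F)"
proof -
 interpret E: seminormed E by fact
 interpret F: seminormed F by fact
 show ?thesis
 proof (unfold_locales, goal_cases)
  case (5 x y) thus ?case
   by (cases x; cases y) (auto simp: vprod_max_simps E.add_commute F.add_commute)
 next
  case (12 x) thus ?case by (cases x) (auto simp: vprod_max_simps le_max_iff_disj)
 next
  case (13 x) thus ?case
   by (cases x) (auto simp: vprod_max_simps E.norm_scale F.norm_scale max_mult_distrib_left)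
 next
  case (14 x y) thus ?case
   using E.norm_triangle[of "fst x" "fst y"] F.norm_triangle[of "snd x" "snd y"] by (cases x; cases y) (auto simp: vprod_max_simps)
 qed (auto simp: vprod_max_simps E.add_assoc F.add_assoc E.add_inverse F.add_inverse
   E.scale_add_right F.scale_add_right E.scale_add_left F.scale_add_left)
qed

lemma vcomplete_vprod_max:
 assumes E: "seminormed E" and F: "seminormed F" and cE: "vcomplete E" and cF: "vcomplete F"
 shows "vcomplete (vprod_max E F)" unfolding vcomplete_def
proof (intro allI impI)
 let ?P = "vprod_max E F"
 interpret E: seminormed E by fact
 interpret F: seminormed F by fact
 fix s assume s: "vCauchy ?P s"
 define a b where "a n = fst (s n)" and "b n = snd (s n)" for n
 have sab: "s n = (a n, b n)" for n by (simp add: a_def b_def)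
 have c: "a n : carr E" "b n : carr F" for n using vCauchyD(2)[OF s, of n] by (auto simp: sab vprod_max_simps)
 have nrm: "vdist ?P (s i) (s j) = max (vdist E (a i) (a j)) (vdist F (b i) (b j))" for i j
  by (simp add: sab vprod_max_simps)
 have "vCauchy E a" "vCauchy F b" using vCauchyD(1)[OF s] c unfolding vCauchy_def nrm max_less_iff_conj by blast+
 then obtain x y where x: "x : carr E" "(%n. vdist E (a n) x) ----> 0"
  and y: "y : carr F" "(%n. vdist F (b n) y) ----> 0" using cE cF unfolding vcomplete_def by blast
 have "(%n. vdist ?P (s n) (x, y)) ----> 0" using tendsto_max[OF x(2) y(2)] by (simp add: sab vprod_max_simps)
 thus "EX l:carr ?P. (%n. vdist ?P (s n) l) ----> 0" using x y by (intro bexI[of _ "(x, y)"]) (auto simp: vprod_max_simps)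
qed

text \<open>Replacing the n-th term by an element of \<open>D\<close> at distance below
  \<open>1 / (n + 1)\<close> changes neither the Cauchy property nor the limit.\<close>

lemma (in seminormed) vcomplete_dense:
 assumes D: "D <= carr E" and dense: "carr E <= vclosure E D" and lim: "!!s. vCauchy E s ==> range s <= D ==>
   EX l:carr E. (%n. vdist E (s n) l) ----> 0" shows "vcomplete E" unfolding vcomplete_def
proof (intro allI impI)
 fix s assume s: "vCauchy E s"
 have sc: "s n : carr E" for n using vCauchyD(2)[OF s] .
 have "ALL n. EX y:D. vdist E (s n) y < inverse (real (Suc n))"
  using vclosureD sc dense by (metis inverse_positive_iff_positive of_nat_0_less_iff subsetD zero_less_Suc)
 then obtain d where d: "!!n. d n : D" "!!n. vdist E (s n) (d n) < inverse (real (Suc n))" by metis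
 have dc: "d n : carr E" for n using d D by blast
 have d0: "(%n. vdist E (s n) (d n)) ----> 0" using d(2) sc dc by (intro Lim_null_comparison[OF _ LIMSEQ_inverse_real_of_nat])
   (auto intro!: always_eventually less_imp_le)
 have "vCauchy E d" unfolding vCauchy_def
 proof (intro conjI allI impI dc)
  fix e :: real assume e: "e > 0"
  then obtain M where M: "ALL i>=M. ALL j>=M. vdist E (s i) (s j) < e / 3" using vCauchyD(1)[OF s, of "e/3"] by auto
  obtain K where K: "!!n. n >= K ==> vdist E (s n) (d n) < e / 3"
   using order_tendstoD(2)[OF d0, of "e/3"] e by (auto simp: eventually_sequentially)
  have "vdist E (d i) (d j) < e" if "i >= max M K" "j >= max M K" for i j
  proof -
   have "vdist E (s i) (s j) < e / 3" using M that by simp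
   moreover have "vdist E (s i) (d i) < e / 3" "vdist E (s j) (d j) < e / 3" using K that by auto
   ultimately show ?thesis using norm_diff_triangle[of "d i" "s i" "d j"] norm_diff_triangle[of "s i" "s j" "d j"]
     norm_diff_commute[of "d i" "s i"] sc dc by simp
  qed
  thus "EX N. ALL i>=N. ALL j>=N. vdist E (d i) (d j) < e" by blast
 qed
 then obtain l where l: "l : carr E" "(%n. vdist E (d n) l) ----> 0" using lim d(1) by blast
 have "(%n. vdist E (s n) l) ----> 0"
 proof (rule Lim_null_comparison)
  show "(%n. vdist E (s n) (d n) + vdist E (d n) l) ----> 0" using tendsto_add[OF d0 l(2)] by simp
  show "\<forall>\<^sub>F n in sequentially. norm (vdist E (s n) l)
    <= vdist E (s n) (d n) + vdist E (d n) l" using norm_diff_triangle sc dc l(1) by (intro always_eventually allI) simp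
 qed
 thus "EX l:carr E. (%n. vdist E (s n) l) ----> 0" using l by blast
qed

section \<open>Completion by Cauchy sequences modulo null sequences\<close>

context seminormed
begin

lemma vCauchy_const: "x : carr E ==> vCauchy E (%n. x)" by (simp add: vCauchy_def)

lemma vCauchy_add:
 assumes s: "vCauchy E s" and t: "vCauchy E t" shows "vCauchy E (%n. vadd E (s n) (t n))" unfolding vCauchy_def
proof (intro conjI allI impI)
 note c = vCauchyD(2)[OF s] vCauchyD(2)[OF t]
 show "vadd E (s n) (t n) : carr E" for n using c by simp
 fix e :: real assume e: "e > 0"
 then obtain M K where M: "ALL i>=M. ALL j>=M. vdist E (s i) (s j) < e / 2"
  and K: "ALL i>=K. ALL j>=K. vdist E (t i) (t j) < e / 2" using vCauchyD(1)[OF s, of "e/2"] vCauchyD(1)[OF t, of "e/2"] by auto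
 have "vdist E (vadd E (s i) (t i)) (vadd E (s j) (t j)) < e" if "i >= max M K" "j >= max M K" for i j
 proof -
  have "vdist E (s i) (s j) < e / 2" "vdist E (t i) (t j) < e / 2" using M K that by auto
  thus ?thesis using norm_triangle[of "vdiff E (s i) (s j)" "vdiff E (t i) (t j)"] c by (simp add: diff_add_add)
 qed
 thus "EX N. ALL i>=N. ALL j>=N. vdist E (vadd E (s i) (t i)) (vadd E (s j) (t j)) < e" by blast
qed

lemma vCauchy_scale:
 assumes s: "vCauchy E s" shows "vCauchy E (%n. vscale E c (s n))"
 using vCauchyD(2)[OF s] by (intro vCauchy_map[OF s, of _ _ "abs c"]) (simp_all add: scale_diff[symmetric] norm_scale)

lemma vcauchy_seqs_simps:
 "carr (vcauchy_seqs E) = {s. vCauchy E s}"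
 "vnorm (vcauchy_seqs E) s = lim (%n. vnorm E (s n))"
 "vzero (vcauchy_seqs E) = (%n. vzero E)"
 "vadd (vcauchy_seqs E) s t = (%n. vadd E (s n) (t n))"
 "vscale (vcauchy_seqs E) c s = (%n. vscale E c (s n))"
 "vdiff (vcauchy_seqs E) s t = (%n. vdiff E (s n) (t n))" by (auto simp: vcauchy_seqs_def)

lemma vcauchy_seqs_norm_lim:
 "vCauchy E s ==> (%n. vnorm E (s n)) ----> vnorm (vcauchy_seqs E) s"
 using vCauchy_norm_convergent by (simp add: vcauchy_seqs_simps convergent_LIMSEQ_iff)

lemma seminormed_vcauchy_seqs: "seminormed (vcauchy_seqs E)"
proof -
 note lim = vcauchy_seqs_norm_lim
 have "vspace_on (vcauchy_seqs E)" unfolding vcauchy_seqs_def by (rule vspace_vmaps)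
   (auto simp: vCauchy_add vCauchy_scale vCauchy_const vspace_on_axioms dest: vCauchyD(2))
 then interpret S: vspace_on "vcauchy_seqs E" .
 show ?thesis
 proof (unfold_locales, goal_cases)
  case (1 s) thus ?case
   using tendsto_lowerbound[OF lim[of s], of 0] by (auto simp: vcauchy_seqs_simps(1) vCauchyD(2))
 next
  case (2 s c)
  hence s: "vCauchy E s" by (simp add: vcauchy_seqs_simps)
  have "(%n. vnorm E (vscale E c (s n))) ----> abs c * vnorm (vcauchy_seqs E) s"
   using tendsto_mult_left[OF lim[OF s], of "abs c"] vCauchyD(2)[OF s] by (simp add: norm_scale)
  thus ?case using lim[OF vCauchy_scale[OF s, of c]] by (auto simp: vcauchy_seqs_simps(5) intro: LIMSEQ_unique)
 next
  case (3 s t)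
  hence s: "vCauchy E s" and t: "vCauchy E t" by (simp_all add: vcauchy_seqs_simps)
  show ?case unfolding vcauchy_seqs_simps(4) using lim[OF vCauchy_add[OF s t]] tendsto_add[OF lim[OF s] lim[OF t]]
   by (rule LIMSEQ_le) (auto intro!: norm_triangle vCauchyD(2) s t)
 qed
qed

text \<open>Null sequences are the kernel of the limit seminorm, so the general facts on kernels of
  seminorms show that they form a closed subspace.\<close>

lemma vnull_seqs_eq: "vnull_seqs E = {s. vCauchy E s & vnorm (vcauchy_seqs E) s = 0}"
proof -
 have "vCauchy E s" if "ALL n. s n : carr E" "(%n. vnorm E (s n)) ----> 0" for s
  using that convergent_imp_vCauchy[of s "vzero E"] by simp
 moreover have "(%n. vnorm E (s n)) ----> 0" if "vCauchy E s" "lim (%n. vnorm E (s n)) = 0" for s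
  using vcauchy_seqs_norm_lim[OF that(1)] that(2) by (simp add: vcauchy_seqs_simps(2))
 ultimately show ?thesis using vCauchyD(2)[of E] unfolding vnull_seqs_def by (auto simp: vcauchy_seqs_simps(2) limI)
qed

lemma vsubspace_norm_zero: "vsubspace E {x : carr E. vnorm E x = 0}" unfolding vsubspace_def using norm_triangle norm_nonneg
 by (auto simp: norm_scale) (metis add.left_neutral add_closed norm_nonneg order_antisym)

lemma vclosure_norm_zero: "vclosure E {x : carr E. vnorm E x = 0} <= {x : carr E. vnorm E x = 0}"
proof
 fix x assume x: "x : vclosure E {x : carr E. vnorm E x = 0}"
 hence xc: "x : carr E" by (simp add: vclosure_def)
 have "vnorm E x <= e" if "e > 0" for e using vclosureD[OF x that] norm_le_diff[OF xc] by fastforce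
 hence "vnorm E x <= 0" using field_le_epsilon[of "vnorm E x" 0] by simp
 thus "x : {x : carr E. vnorm E x = 0}" using xc norm_nonneg[OF xc] by simp
qed

lemma vsubspace_vnull_seqs: "vsubspace (vcauchy_seqs E) (vnull_seqs E)"
 "vclosure (vcauchy_seqs E) (vnull_seqs E) <= vnull_seqs E"
proof -
 interpret S: seminormed "vcauchy_seqs E" by (rule seminormed_vcauchy_seqs)
 have "vnull_seqs E = {s : carr (vcauchy_seqs E). vnorm (vcauchy_seqs E) s = 0}" by (auto simp: vnull_seqs_eq vcauchy_seqs_simps(1))
 thus "vsubspace (vcauchy_seqs E) (vnull_seqs E)"
  "vclosure (vcauchy_seqs E) (vnull_seqs E) <= vnull_seqs E" using S.vsubspace_norm_zero S.vclosure_norm_zero by auto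
qed

text \<open>The distance from \<open>s\<close> to its k-th term, taken as a constant sequence, is
  the limit over \<open>n\<close> of the distances between the terms \<open>k\<close> and
  \<open>n\<close>.\<close>

lemma vcauchy_seqs_tendsto:
 assumes s: "vCauchy E s" shows "(%k. vdist (vcauchy_seqs E) (%n. s k) s) ----> 0"
proof (rule LIMSEQ_I)
 interpret S: seminormed "vcauchy_seqs E" by (rule seminormed_vcauchy_seqs)
 note c = vCauchy_const[OF vCauchyD(2)[OF s]]
 have d: "vdiff (vcauchy_seqs E) (%n. s k) s : carr (vcauchy_seqs E)" for k
  using S.diff_closed[of "%n. s k" s] c s by (simp add: vcauchy_seqs_simps(1))
 fix e :: real assume e: "e > 0"
 then obtain M where M: "ALL i>=M. ALL j>=M. vdist E (s i) (s j) < e / 2" using vCauchyD(1)[OF s, of "e/2"] by auto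
 have "vdist (vcauchy_seqs E) (%n. s k) s <= e / 2" if k: "k >= M" for k
  by (rule tendsto_upperbound[OF vcauchy_seqs_norm_lim[OF d[of k, unfolded vcauchy_seqs_simps(1) mem_Collect_eq]]])
   (use M k in \<open>auto simp: vcauchy_seqs_simps(6) eventually_sequentially intro!: exI[of _ M] less_imp_le\<close>)
 thus "EX M. ALL k>=M. norm (vdist (vcauchy_seqs E) (%n. s k) s - 0) < e"
  using e S.norm_nonneg[OF d] by (intro exI[of _ M]) force
qed

lemma vcauchy_seqs_dense:
 assumes s: "vCauchy E s" shows "s : vclosure (vcauchy_seqs E) ((%x n. x) ` carr E)" unfolding vclosure_def
proof (intro CollectI conjI allI impI)
 interpret S: seminormed "vcauchy_seqs E" by (rule seminormed_vcauchy_seqs)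
 show sc: "s : carr (vcauchy_seqs E)" using s by (simp add: vcauchy_seqs_simps)
 fix e :: real assume "e > 0"
 then obtain k where "vdist (vcauchy_seqs E) (%n. s k) s < e"
  using order_tendstoD(2)[OF vcauchy_seqs_tendsto[OF s]] by (auto simp: eventually_sequentially)
 thus "EX t:(%x n. x) ` carr E. vdist (vcauchy_seqs E) s t < e"
  using vCauchyD(2)[OF s, of k] sc S.norm_diff_commute[OF sc, of "%n. s k"]
  by (intro bexI[of _ "%n. s k"]) (auto simp: vcauchy_seqs_simps(1) vCauchy_const)
qed

text \<open>By density only sequences of constant sequences matter. Such a sequence, if Cauchy, is a
  Cauchy sequence \<open>x\<close> of \<open>E\<close>, and \<open>x\<close> itself is its
  limit.\<close>

lemma vcomplete_vcauchy_seqs: "vcomplete (vcauchy_seqs E)"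
proof (rule seminormed.vcomplete_dense[OF seminormed_vcauchy_seqs])
 show "(%x n. x) ` carr E <= carr (vcauchy_seqs E)" by (auto simp: vcauchy_seqs_simps vCauchy_const)
 show "carr (vcauchy_seqs E) <= vclosure (vcauchy_seqs E) ((%x n. x) ` carr E)"
  using vcauchy_seqs_dense by (auto simp: vcauchy_seqs_simps(1))
 fix S assume S: "vCauchy (vcauchy_seqs E) S" "range S <= (%x n. x) ` carr E"
 hence "ALL k. EX x:carr E. S k = (%n. x)" by auto
 then obtain x where x: "!!k. x k : carr E" "!!k. S k = (%n. x k)" by metis
 have "vCauchy E x" unfolding vCauchy_def using x vCauchyD(1)[OF S(1)] by (simp add: vcauchy_seqs_simps(2,6))
 thus "EX l:carr (vcauchy_seqs E). (%n. vdist (vcauchy_seqs E) (S n) l) ----> 0"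
  unfolding x(2) using vcauchy_seqs_tendsto by (intro bexI[of _ x]) (auto simp: vcauchy_seqs_simps(1))
qed

lemma seminormed_vcompletion: "seminormed (vcompletion E)" unfolding vcompletion_def
 using seminormed.seminormed_vquotient[OF seminormed_vcauchy_seqs vsubspace_vnull_seqs(1)] .

lemma vcomplete_vcompletion: "vcomplete (vcompletion E)" unfolding vcompletion_def
 using seminormed.vcomplete_vquotient[OF seminormed_vcauchy_seqs vsubspace_vnull_seqs(1)
   vcomplete_vcauchy_seqs] .

lemma vembed_closed [simp]: "x : carr E ==> vembed E x : carr (vcompletion E)"
 using vspace_on.vquotient_simps(1)[OF seminormed.axioms(1)[OF seminormed_vcauchy_seqs]
   vsubspace_vnull_seqs(1)] by (auto simp: vembed_def vcompletion_def vcauchy_seqs_simps vCauchy_const)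

lemma vembed_simps:
 assumes "x : carr E" shows "y : carr E ==> vembed E (vadd E x y) = vadd (vcompletion E) (vembed E x) (vembed E y)"
  "vembed E (vscale E c x) = vscale (vcompletion E) c (vembed E x)"
  "vnorm (vcompletion E) (vembed E x) = vnorm E x"
proof -
 interpret S: seminormed "vcauchy_seqs E" by (rule seminormed_vcauchy_seqs)
 note N = vsubspace_vnull_seqs(1)
 have c: "(%n. x) : carr (vcauchy_seqs E)" if "x : carr E" for x using that by (simp add: vcauchy_seqs_simps vCauchy_const)
 show "vembed E (vadd E x y) = vadd (vcompletion E) (vembed E x) (vembed E y)" if "y : carr E"
  using S.vquotient_simps(3)[OF N c[OF assms] c[OF that]] by (simp add: vembed_def vcompletion_def vcauchy_seqs_simps)
 show "vembed E (vscale E c x) = vscale (vcompletion E) c (vembed E x)" using S.vquotient_simps(4)[OF N c[OF assms]]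
  by (simp add: vembed_def vcompletion_def vcauchy_seqs_simps)
 show "vnorm (vcompletion E) (vembed E x) = vnorm E x" using S.vquotient_norm_const[OF N c[OF assms]]
  by (simp add: vembed_def vcompletion_def vcauchy_seqs_simps vnull_seqs_eq)
qed

lemma vembed_dense: "carr (vcompletion E) <= vclosure (vcompletion E) (vembed E ` carr E)"
proof
 interpret S: seminormed "vcauchy_seqs E" by (rule seminormed_vcauchy_seqs)
 note N = vsubspace_vnull_seqs(1)
 fix A assume A: "A : carr (vcompletion E)"
 then obtain s where s: "s : carr (vcauchy_seqs E)" "A = vcoset (vcauchy_seqs E) (vnull_seqs E) s"
  by (auto simp: vcompletion_def S.vquotient_simps(1)[OF N])
 show "A : vclosure (vcompletion E) (vembed E ` carr E)" unfolding vclosure_def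
 proof (intro CollectI conjI allI impI A)
  fix e :: real assume "e > 0"
  then obtain x where x: "x : carr E"
   "vdist (vcauchy_seqs E) s (%n. x) < e"
   using S.vclosureD[OF vcauchy_seqs_dense[of s]] s by (auto simp: vcauchy_seqs_simps(1))
  have xc: "(%n. x) : carr (vcauchy_seqs E)" using x by (simp add: vcauchy_seqs_simps vCauchy_const)
  have "vdist (vcompletion E) A (vembed E x)
    <= vdist (vcauchy_seqs E) s (%n. x)" unfolding vcompletion_def vembed_def s(2) S.vquotient_diff[OF N s(1) xc]
   using s(1) xc by (intro S.vquotient_norm_le[OF N] S.self_mem_vcoset[OF N]) auto
  thus "EX y:vembed E ` carr E. vdist (vcompletion E) A y < e" using x by force
 qed
qed

text \<open>The functional is extended to Cauchy sequences by taking limits, keeps its bound, and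
  vanishes on null sequences.\<close>

lemma vcompletion_functional:
 assumes phi: "vfunc E phi C" and C: "0 <= C"
 obtains Phi where "vfunc (vcompletion E) Phi C"
  "!!x. x : carr E ==> Phi (vembed E x) = phi x"
proof -
 interpret S: seminormed "vcauchy_seqs E" by (rule seminormed_vcauchy_seqs)
 define psi where "psi s = lim (%n. phi (s n))" for s
 note lim = vfunc_convergent[OF phi, folded psi_def]
 have psi: "vfunc (vcauchy_seqs E) psi C" unfolding vfunc_def vcauchy_seqs_simps(1,4,5)
 proof (intro conjI ballI allI; clarsimp)
  fix s assume s: "vCauchy E s"
  note sc = vCauchyD(2)[OF s]
  show "psi (%n. vscale E c (s n)) = c * psi s" for c using lim[OF vCauchy_scale[OF s, of c]] tendsto_mult_left[OF lim[OF s], of c]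
   by (auto simp: vfuncD(2)[OF phi sc] intro: LIMSEQ_unique)
  show "abs (psi s) <= C * vnorm (vcauchy_seqs E) s"
   using tendsto_rabs[OF lim[OF s]] tendsto_mult_left[OF vcauchy_seqs_norm_lim[OF s], of C]
   by (rule LIMSEQ_le) (auto intro: vfuncD(3)[OF phi sc])
  fix t assume t: "vCauchy E t"
  show "psi (%n. vadd E (s n) (t n)) = psi s + psi t" using lim[OF vCauchy_add[OF s t]] tendsto_add[OF lim[OF s] lim[OF t]]
   by (auto simp: vfuncD(1)[OF phi sc vCauchyD(2)[OF t]] intro: LIMSEQ_unique)
 qed
 have 0: "psi s = 0" if "s : vnull_seqs E" for s using vfuncD(3)[OF psi, of s] that by (simp add: vnull_seqs_eq vcauchy_seqs_simps(1))
 obtain Phi where Phi: "vfunc (vcompletion E) Phi C"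
  "!!s. s : carr (vcauchy_seqs E) ==> Phi (vcoset (vcauchy_seqs E) (vnull_seqs E) s) = psi s"
  using S.quotient_functional[OF vsubspace_vnull_seqs(1) psi C 0] unfolding vcompletion_def by blast
 have "Phi (vembed E x) = phi x" if "x : carr E" for x
  using Phi(2)[of "%n. x"] that by (simp add: vembed_def vcauchy_seqs_simps(1) vCauchy_const psi_def)
 thus thesis using that Phi by blast
qed

end

section \<open>Projective tensor products\<close>

context vspace_on
begin

lemma vlist_sum_simps [simp]:
 "vlist_sum E [] = vzero E" "vlist_sum E (x # xs) = vadd E x (vlist_sum E xs)" by (simp_all add: vlist_sum_def)

lemma vlist_sum_closed [simp]: "set xs <= carr E ==> vlist_sum E xs : carr E" by (induction xs) auto

lemma vlist_sum_append:
 "set xs <= carr E ==> set ys <= carr E ==>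
  vlist_sum E (xs @ ys) = vadd E (vlist_sum E xs) (vlist_sum E ys)" by (induction xs) (auto simp: add_assoc)

lemma vscale_vlist_sum:
 "set xs <= carr E ==> vscale E c (vlist_sum E xs) = vlist_sum E (map (vscale E c) xs)" by (induction xs) (auto simp: scale_add_right)

lemma vlist_sum_additive:
 assumes "phi (vzero E) = 0" and "!!x y. x : carr E ==> y : carr E ==> phi (vadd E x y) = phi x + (phi y :: real)"
 shows "set xs <= carr E ==> phi (vlist_sum E xs) = (\<Sum>x\<leftarrow>xs. phi x)" by (induction xs) (auto simp: assms)

end

locale tensor_pair = E: seminormed E + F: seminormed F for E :: "'u nvs" and F :: "'v nvs"
begin

definition "FV = free_vs (carr E \<times> carr F)"
definition "BR = vspan FV (bilinear_relations E F)"

lemma FV_simps [simp]: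
 "carr FV = {c. finite {p. c p ~= 0} & {p. c p ~= 0} <= carr E \<times> carr F}"
 "vzero FV = (%p. 0)" "vadd FV c d = (%p. c p + d p)" "vscale FV r c = (%p. r * c p)"
 "vdiff FV c d = (%p. c p - d p)" by (simp_all add: FV_def free_vs_def)

sublocale FV: vspace_on FV
proof -
 have fin: "finite {p. c p + d p ~= 0} & {p. c p + d p ~= 0} <= A"
  if "finite {p. c p ~= 0} & {p. c p ~= 0} <= A" "finite {p. d p ~= 0} & {p. d p ~= 0} <= A" for c d :: "'u \<times> 'v => real" and A
 proof -
  have "{p. c p + d p ~= 0} <= {p. c p ~= 0} Un {p. d p ~= 0}" by auto
  thus ?thesis using that by (meson finite_UnI finite_subset le_sup_iff order_trans)
 qed
 show "vspace_on FV" unfolding FV_def free_vs_def by (rule vspace_fun) (use fin in \<open>auto intro: finite_subset[rotated]\<close>)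
qed

lemma vdelta_closed [simp]: "x : carr E ==> y : carr F ==> vdelta (x, y) : carr FV" by (auto simp: vdelta_def)

lemma bilinear_relations_closed: "bilinear_relations E F <= carr FV"
proof -
 have 1: "(%q. c q - d q - e q) : carr FV" if "c : carr FV" "d : carr FV" "e : carr FV" for c d e
  using FV.diff_closed[OF FV.diff_closed[OF that(1,2)] that(3)] by simp
 have 2: "(%q. c q - r * d q) : carr FV" if "c : carr FV" "d : carr FV" for c d r
  using FV.diff_closed[OF that(1) FV.scale_closed[OF that(2), of r]] by simp
 show ?thesis unfolding bilinear_relations_def by (auto simp del: FV_simps(1) intro!: 1 2)
qed

lemma BR: "vsubspace FV BR" unfolding BR_def by (rule FV.vsubspace_vspan[OF bilinear_relations_closed])

lemma BR_mem: "c : bilinear_relations E F ==> c : BR" using FV.vspan_superset unfolding BR_def by blast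

abbreviation "AT \<equiv> alg_tensor E F"
abbreviation "PT \<equiv> proj_tensor_alg E F"

lemma alg_tensor_eq: "AT = vquotient FV BR" by (simp add: alg_tensor_def FV_def BR_def Let_def)

lemma tensor_eq: "tensor E F x y = vcoset FV BR (vdelta (x, y))" by (simp add: tensor_def FV_def BR_def Let_def)

sublocale AT: vspace_on "alg_tensor E F" unfolding alg_tensor_eq by (rule FV.vspace_vquotient[OF BR])

lemma PT_simps [simp]:
 "carr PT = carr AT" "vzero PT = vzero AT" "vadd PT = vadd AT" "vscale PT = vscale AT"
 "vnorm PT = projective_norm E F" by (simp_all add: proj_tensor_alg_def)

lemma tensor_closed [simp]:
 "x : carr E ==> y : carr F ==> tensor E F x y : carr AT"
 unfolding alg_tensor_eq tensor_eq FV.vquotient_simps(1)[OF BR] by (intro imageI vdelta_closed)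

lemma tensor_add_left:
 assumes "x : carr E" "x' : carr E" "y : carr F" shows "tensor E F (vadd E x x') y = vadd AT (tensor E F x y) (tensor E F x' y)"
proof -
 have "(%q. vdelta (vadd E x x', y) q - vdelta (x, y) q - vdelta (x', y) q) : BR"
  by (rule BR_mem) (use assms in \<open>auto simp: bilinear_relations_def\<close>)
 hence "vdiff FV (vdelta (vadd E x x', y)) (vadd FV (vdelta (x, y)) (vdelta (x', y))) : BR" by (simp add: diff_diff_eq)
 hence "vcoset FV BR (vdelta (vadd E x x', y)) = vcoset FV BR (vadd FV (vdelta (x, y)) (vdelta (x', y)))"
  using assms by (subst FV.vcoset_eq_iff[OF BR] ) (auto simp del: FV_simps)
 thus ?thesis unfolding tensor_eq alg_tensor_eq using assms by (subst FV.vquotient_simps(3)[OF BR]) (auto simp del: FV_simps)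
qed

lemma tensor_add_right:
 assumes "x : carr E" "y : carr F" "y' : carr F" shows "tensor E F x (vadd F y y') = vadd AT (tensor E F x y) (tensor E F x y')"
proof -
 have "(%q. vdelta (x, vadd F y y') q - vdelta (x, y) q - vdelta (x, y') q) : BR"
  by (rule BR_mem) (use assms in \<open>auto simp: bilinear_relations_def\<close>)
 hence "vdiff FV (vdelta (x, vadd F y y')) (vadd FV (vdelta (x, y)) (vdelta (x, y'))) : BR" by (simp add: diff_diff_eq)
 hence "vcoset FV BR (vdelta (x, vadd F y y')) = vcoset FV BR (vadd FV (vdelta (x, y)) (vdelta (x, y')))"
  using assms by (subst FV.vcoset_eq_iff[OF BR] ) (auto simp del: FV_simps)
 thus ?thesis unfolding tensor_eq alg_tensor_eq using assms by (subst FV.vquotient_simps(3)[OF BR]) (auto simp del: FV_simps)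
qed

lemma tensor_scale_left:
 assumes "x : carr E" "y : carr F" shows "tensor E F (vscale E c x) y = vscale AT c (tensor E F x y)"
proof -
 have "(%q. vdelta (vscale E c x, y) q - c * vdelta (x, y) q) : BR"
  by (rule BR_mem) (use assms in \<open>auto simp: bilinear_relations_def\<close>)
 hence "vdiff FV (vdelta (vscale E c x, y)) (vscale FV c (vdelta (x, y))) : BR" by simp
 hence "vcoset FV BR (vdelta (vscale E c x, y)) = vcoset FV BR (vscale FV c (vdelta (x, y)))"
  using assms by (subst FV.vcoset_eq_iff[OF BR] ) (auto simp del: FV_simps)
 thus ?thesis unfolding tensor_eq alg_tensor_eq using assms by (subst FV.vquotient_simps(4)[OF BR]) (auto simp del: FV_simps)
qed

lemma tensor_scale_right:
 assumes "x : carr E" "y : carr F" shows "tensor E F x (vscale F c y) = vscale AT c (tensor E F x y)"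
proof -
 have "(%q. vdelta (x, vscale F c y) q - c * vdelta (x, y) q) : BR"
  by (rule BR_mem) (use assms in \<open>auto simp: bilinear_relations_def\<close>)
 hence "vdiff FV (vdelta (x, vscale F c y)) (vscale FV c (vdelta (x, y))) : BR" by simp
 hence "vcoset FV BR (vdelta (x, vscale F c y)) = vcoset FV BR (vscale FV c (vdelta (x, y)))"
  using assms by (subst FV.vcoset_eq_iff[OF BR] ) (auto simp del: FV_simps)
 thus ?thesis unfolding tensor_eq alg_tensor_eq using assms by (subst FV.vquotient_simps(4)[OF BR]) (auto simp del: FV_simps)
qed

lemma tensor_list_closed:
 "set ps <= carr E \<times> carr F ==> set (map (%(x, y). tensor E F x y) ps) <= carr AT" by auto

lemma tensor_sum_simps [simp]:
 "tensor_sum E F [] = vzero AT"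
 "tensor_sum E F ((x, y) # ps) = vadd AT (tensor E F x y) (tensor_sum E F ps)" by (simp_all add: tensor_sum_def)

lemma tensor_sum_closed [simp]:
 "set ps <= carr E \<times> carr F ==> tensor_sum E F ps : carr AT"
 unfolding tensor_sum_def by (rule AT.vlist_sum_closed[OF tensor_list_closed])

lemma tensor_sum_append:
 "set ps <= carr E \<times> carr F ==> set qs <= carr E \<times> carr F ==>
  tensor_sum E F (ps @ qs) = vadd AT (tensor_sum E F ps) (tensor_sum E F qs)" unfolding tensor_sum_def map_append
 by (rule AT.vlist_sum_append[OF tensor_list_closed tensor_list_closed])

lemma tensor_sum_scale:
 "set ps <= carr E \<times> carr F ==>
  tensor_sum E F (map (%(x, y). (vscale E c x, y)) ps) = vscale AT c (tensor_sum E F ps)"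
proof (induction ps)
 case (Cons p ps)
 thus ?case by (cases p) (auto simp: AT.scale_add_right tensor_scale_left)
qed simp

text \<open>Induction on the support: removing a point \<open>(x, y)\<close> splits off a multiple
  of an elementary tensor, and its coefficient is absorbed into the left factor.\<close>

lemma vcoset_FV_tensor_sum:
 assumes "c : carr FV" shows "EX ps. set ps <= carr E \<times> carr F & tensor_sum E F ps = vcoset FV BR c"
proof -
 have "finite {p. c p ~= 0}" using assms by simp
 thus ?thesis using assms
 proof (induction "{p. c p ~= 0}" arbitrary: c rule: finite_induct)
  case empty
  hence "c = vzero FV" by (auto simp: fun_eq_iff)
  thus ?case by (intro exI[of _ "[]"]) (simp add: alg_tensor_eq FV.vquotient_simps(2)[OF BR])
 next
  case (insert p S)
  define d where "d = c(p := 0)"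
  obtain x y where p: "p = (x, y)" by force
  have cp: "c p ~= 0" and xy: "x : carr E" "y : carr F" using insert p by auto
  have S: "S = {q. d q ~= 0}" using insert by (auto simp: d_def)
  have "{q. d q ~= 0} <= {q. c q ~= 0}" by (auto simp: d_def)
  hence d: "d : carr FV" using insert.prems by (auto intro: finite_subset)
  obtain ps where ps: "set ps <= carr E \<times> carr F" "tensor_sum E F ps = vcoset FV BR d" using insert(3)[OF S d] by blast
  have c: "c = vadd FV (vscale FV (c p) (vdelta (x, y))) d" by (auto simp: d_def p vdelta_def fun_eq_iff)
  have "vcoset FV BR c = vadd AT (vscale AT (c p) (tensor E F x y)) (vcoset FV BR d)" unfolding alg_tensor_eq tensor_eq
   by (subst c) (simp only: FV.vquotient_simps(3,4)[OF BR] vdelta_closed xy FV.scale_closed d)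
  also have "... = tensor_sum E F ((vscale E (c p) x, y) # ps)" using ps xy by (simp add: tensor_scale_left)
  finally show ?case using ps xy by (intro exI[of _ "(vscale E (c p) x, y) # ps"]) auto
 qed
qed

lemma tensor_sum_surj:
 assumes "u : carr AT"
 obtains ps where "set ps <= carr E \<times> carr F" "tensor_sum E F ps = u"
proof -
 obtain c where "c : carr FV" "u = vcoset FV BR c" using assms unfolding alg_tensor_eq FV.vquotient_simps(1)[OF BR] by blast
 thus thesis using vcoset_FV_tensor_sum that by blast
qed

definition "cost ps = (\<Sum>(x, y)\<leftarrow>ps. vnorm E x * vnorm F y)"

lemma cost_nonneg: "set ps <= carr E \<times> carr F ==> 0 <= cost ps" unfolding cost_def by (rule sum_list_nonneg) auto

lemma projective_norm_eq:
 "projective_norm E F u = Inf {cost ps | ps. set ps <= carr E \<times> carr F & tensor_sum E F ps = u}"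
 by (simp add: projective_norm_def cost_def)

lemma projective_norm_le:
 "set ps <= carr E \<times> carr F ==> projective_norm E F (tensor_sum E F ps) <= cost ps" unfolding projective_norm_eq
 by (rule cInf_lower) (auto intro!: bdd_belowI[of _ 0] cost_nonneg)

lemma projective_norm_approx:
 assumes "u : carr AT" "projective_norm E F u < r"
 obtains ps where "set ps <= carr E \<times> carr F" "tensor_sum E F ps = u" "cost ps < r"
proof -
 obtain ps where "set ps <= carr E \<times> carr F" "tensor_sum E F ps = u" using tensor_sum_surj[OF assms(1)] by blast
 hence "{cost ps | ps. set ps <= carr E \<times> carr F & tensor_sum E F ps = u} ~= {}" by blast
 from cInf_lessD[OF this assms(2)[unfolded projective_norm_eq]] show thesis using that by blast
qed

lemma projective_norm_tensor_le:
 "x : carr E ==> y : carr F ==> projective_norm E F (tensor E F x y) <= vnorm E x * vnorm F y"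
 using projective_norm_le[of "[(x, y)]"] by (simp add: cost_def)

lemma seminormed_proj_tensor_alg: "seminormed PT"
proof (rule seminormed_infimum[of PT "{ps. set ps <= carr E \<times> carr F}" cost "tensor_sum E F"]; (unfold mem_Collect_eq PT_simps)?)
 show "vspace_on PT" by (rule AT.vspace_cong) simp_all
 show "0 <= cost ps & projective_norm E F (tensor_sum E F ps) <= cost ps" if "set ps <= carr E \<times> carr F" for ps
  using cost_nonneg[OF that] projective_norm_le[OF that] ..
 show "EX ps:{ps. set ps <= carr E \<times> carr F}. tensor_sum E F ps = u & cost ps < t"
  if "u : carr AT" "projective_norm E F u < t" for u t by (rule projective_norm_approx[OF that]) auto
 fix ps assume ps: "set ps <= carr E \<times> carr F"
 have "cost (map (%(x, y). (vscale E c x, y)) ps) = abs c * cost ps" for c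
  using ps unfolding cost_def by (induction ps) (auto simp: E.norm_scale distrib_left mult.assoc)
 thus "EX qs:{ps. set ps <= carr E \<times> carr F}. tensor_sum E F qs = vscale AT c (tensor_sum E F ps) & cost qs <= abs c * cost ps" for c
  using ps tensor_sum_scale[OF ps, of c] by (intro bexI[of _ "map (%(x, y). (vscale E c x, y)) ps"]) auto
 show "EX rs:{ps. set ps <= carr E \<times> carr F}. tensor_sum E F rs = vadd AT (tensor_sum E F ps) (tensor_sum E F qs) & cost rs <= cost ps + cost qs"
  if "set qs <= carr E \<times> carr F" for qs
  using ps that by (intro bexI[of _ "ps @ qs"]) (simp_all add: tensor_sum_append cost_def)
qed

text \<open>The universal property with a bound. \<open>beta\<close> extends linearly to the free
  vector space, bilinearity makes the extension vanish on the relations and hence on their span, and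
  the bound is inherited from the cost of representations.\<close>

lemma tensor_functional:
 assumes bl: "!!x x' y. [|x : carr E; x' : carr E; y : carr F|] ==> beta (vadd E x x') y = beta x y + beta x' y"
  "!!x y y'. [|x : carr E; y : carr F; y' : carr F|] ==> beta x (vadd F y y') = beta x y + beta x y'"
  "!!c x y. [|x : carr E; y : carr F|] ==> beta (vscale E c x) y = c * beta x y"
  "!!c x y. [|x : carr E; y : carr F|] ==> beta x (vscale F c y) = c * beta x y"
  and bd: "!!x y. [|x : carr E; y : carr F|] ==> abs (beta x y) <= C * (vnorm E x * vnorm F y)" and C: "0 <= C"
 obtains phi where "vfunc PT phi C"
  "!!x y. [|x : carr E; y : carr F|] ==> phi (tensor E F x y) = beta x y"
proof -
 define f where "f c = (\<Sum>p | c p ~= 0. c p * beta (fst p) (snd p))" for c :: "'u \<times> 'v => real"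
 have f_eq: "f c = (\<Sum>p\<in>S. c p * beta (fst p) (snd p))" if "finite S" "{p. c p ~= 0} <= S" for c S
  unfolding f_def using that by (intro sum.mono_neutral_left) auto
 have fadd: "f (%p. c p + d p) = f c + f d" if "c : carr FV" "d : carr FV" for c d
 proof -
  let ?S = "{p. c p ~= 0} Un {p. d p ~= 0}"
  have S: "finite ?S" using that by simp
  have "{p. c p + d p ~= 0} <= ?S" by auto
  thus ?thesis using f_eq[OF S, of "%p. c p + d p"] f_eq[OF S, of c] f_eq[OF S, of d] by (auto simp: sum.distrib distrib_right)
 qed
 have fscale: "f (%p. r * c p) = r * f c" if "c : carr FV" for c r
 proof -
  have S: "finite {p. c p ~= 0}" using that by simp
  show ?thesis using f_eq[OF S, of "%p. r * c p"] f_eq[OF S, of c] by (auto simp: sum_distrib_left mult.assoc)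
 qed
 have fdiff: "f (%p. c p - d p) = f c - f d" if "c : carr FV" "d : carr FV" for c d
  using fadd[OF that(1) FV.scale_closed[OF that(2), of "-1"]] fscale[OF that(2), of "-1"] by simp
 have fdelta: "f (vdelta (x, y)) = beta x y" for x y using f_eq[of "{(x, y)}" "vdelta (x, y)"] by (auto simp: vdelta_def)
 have "BR <= {c : carr FV. f c = 0}" unfolding BR_def
 proof (rule FV.vspan_least)
  show "vsubspace FV {c : carr FV. f c = 0}" unfolding vsubspace_def using fadd fscale FV.add_closed FV.scale_closed FV.zero_closed
   by (auto simp del: FV_simps(1) simp: f_def)
  have d: "vdelta (x, y) : carr FV & f (vdelta (x, y)) = beta x y" if "x : carr E" "y : carr F" for x y
   using that fdelta vdelta_closed by blast
  have 1: "f (%q. c q - d q - e q) = f c - f d - f e" if "c : carr FV" "d : carr FV" "e : carr FV" for c d e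
   using fdiff[of "%q. c q - d q" e] fdiff[OF that(1,2)] FV.diff_closed[OF that(1,2)] that by (simp del: FV_simps(1))
  have 2: "f (%q. c q - r * d q) = f c - r * f d" if "c : carr FV" "d : carr FV" for c d r
   using fdiff[OF that(1) FV.scale_closed[OF that(2), of r]] fscale[OF that(2)] by simp
  have "f c = 0" if "c : bilinear_relations E F" for c using that unfolding bilinear_relations_def
   by (auto simp del: FV_simps(1) simp: 1 2 fdelta d bl)
  thus "bilinear_relations E F <= {c : carr FV. f c = 0}" using bilinear_relations_closed by blast
 qed
 hence BR0: "f n = 0" if "n : BR" for n using that by blast
 obtain phi where phi: "!!c. c : carr FV ==> phi (vcoset FV BR c) = f c"
  by (rule FV.quotient_linear[where phi=f, OF BR _ BR0]) (assumption | rule that | simp only: FV_simps(5) fdiff)+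
 have add: "phi (vadd AT u v) = phi u + phi v" if uv: "u : carr AT" "v : carr AT" for u v
 proof -
  obtain c d where c: "c : carr FV" "u = vcoset FV BR c" and d: "d : carr FV" "v = vcoset FV BR d"
   using uv unfolding alg_tensor_eq FV.vquotient_simps(1)[OF BR] by blast
  show ?thesis unfolding alg_tensor_eq c(2) d(2) FV.vquotient_simps(3)[OF BR c(1) d(1)] phi[OF c(1)] phi[OF d(1)]
    phi[OF FV.add_closed[OF c(1) d(1)]] using fadd[OF c(1) d(1)] by (simp only: FV_simps)
 qed
 have scale: "phi (vscale AT r u) = r * phi u" if u: "u : carr AT" for u r
 proof -
  obtain c where c: "c : carr FV" "u = vcoset FV BR c" using u unfolding alg_tensor_eq FV.vquotient_simps(1)[OF BR] by blast
  show ?thesis unfolding alg_tensor_eq c(2) FV.vquotient_simps(4)[OF BR c(1)] phi[OF c(1)]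
    phi[OF FV.scale_closed[OF c(1)]] using fscale[OF c(1)] by (simp only: FV_simps)
 qed
 have tens: "phi (tensor E F x y) = beta x y" if "x : carr E" "y : carr F" for x y
  unfolding tensor_eq using phi[OF vdelta_closed[OF that]] fdelta by simp
 have zero: "phi (vzero AT) = 0" using scale[OF AT.zero_closed, of 0] by simp
 \<comment> \<open>The estimate holds for every representation separately; the infimum over
   representations then gives the projective norm.\<close>
 have sum_le: "abs (phi (tensor_sum E F ps)) <= C * cost ps" if "set ps <= carr E \<times> carr F" for ps using that
 proof (induction ps)
  case Nil
  thus ?case by (simp add: zero cost_def)
 next
  case (Cons p ps)
  obtain x y where p: "p = (x, y)" by force
  show ?case using Cons bd[of x y] tens[of x y] add[of "tensor E F x y" "tensor_sum E F ps"] by (simp add: p cost_def distrib_left)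
 qed
 have "abs (phi u) <= C * projective_norm E F u" if u: "u : carr AT" for u
 proof (rule le_mult_limit[OF C])
  fix t assume "projective_norm E F u < t"
  then obtain ps where ps: "set ps <= carr E \<times> carr F" "tensor_sum E F ps = u" "cost ps < t"
   using projective_norm_approx[OF u] by blast
  thus "abs (phi u) <= C * t" using sum_le[OF ps(1)] mult_left_mono[OF less_imp_le[OF ps(3)] C] by simp
 qed
 hence "vfunc PT phi C" by (simp add: vfunc_def add scale)
 thus thesis using that tens by blast
qed

end

section \<open>Bounded Lipschitz functions\<close>

lemma LIPb_iff: "f : LIPb \<longleftrightarrow> (EX L. L-lipschitz_on UNIV f) & (EX B. ALL x. abs (f x) <= B)"
 by (auto simp: LIPb_def Lip_funs_def bounded_iff)

lemma LIPbE:
 assumes "f : LIPb" obtains L B where "L-lipschitz_on UNIV f" "!!x. abs (f x) <= B" "0 <= L" "0 <= B"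
 using assms by (force simp: LIPb_iff dest: lipschitz_on_nonneg intro: order_trans[OF abs_ge_zero])

lemma LIPb_const [simp]: "(%x. c) : LIPb" using lipschitz_on_constant[of UNIV c] by (auto simp: LIPb_iff)

lemma LIPb_add [simp]: assumes "f : LIPb" "g : LIPb" shows "(%x. f x + g x) : LIPb"
proof -
 obtain L A where f: "L-lipschitz_on UNIV f" "!!x. abs (f x) <= A" using LIPbE[OF assms(1)] by metis
 obtain M B where g: "M-lipschitz_on UNIV g" "!!x. abs (g x) <= B" using LIPbE[OF assms(2)] by metis
 have "abs (f x + g x) <= A + B" for x using f(2)[of x] g(2)[of x] by linarith
 thus ?thesis using lipschitz_on_add[OF f(1) g(1)] unfolding LIPb_iff by blast
qed

lemma LIPb_cmult [simp]: assumes "f : LIPb" shows "(%x. c * f x) : LIPb"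
proof -
 obtain L A where f: "L-lipschitz_on UNIV f" "!!x. abs (f x) <= A" using LIPbE[OF assms(1)] by metis
 have "abs (c * f x) <= abs c * A" for x using f(2)[of x] by (simp add: abs_mult mult_left_mono)
 thus ?thesis using lipschitz_on_cmult_real[OF f(1), of c] unfolding LIPb_iff by blast
qed

lemma LIPb_uminus [simp]: assumes "f : LIPb" shows "(%x. - f x) : LIPb" using LIPb_cmult[OF assms, of "-1"] by simp

lemma LIPb_diff [simp]: assumes "f : LIPb" "g : LIPb" shows "(%x. f x - g x) : LIPb"
 using LIPb_add[OF assms(1) LIPb_uminus[OF assms(2)]] by simp

text \<open>The sup bounds on \<open>U\<close> stay explicit because \<open>lip_a_leibniz\<close>
  applies this to factors that are small on a small ball.\<close>

lemma lipschitz_on_mult_real: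
 fixes f g :: "'a::metric_space => real"
 assumes f: "L-lipschitz_on U f" "!!x. x : U ==> abs (f x) <= A"
  and g: "M-lipschitz_on U g" "!!x. x : U ==> abs (g x) <= B" and "0 <= A" "0 <= B" shows "(A * M + B * L)-lipschitz_on U (%x. f x * g x)"
proof (rule lipschitz_onI)
 fix x y assume xy: "x : U" "y : U"
 have "f x * g x - f y * g y = f x * (g x - g y) + g y * (f x - f y)" by (simp add: algebra_simps)
 hence "abs (f x * g x - f y * g y) <= abs (f x) * abs (g x - g y) + abs (g y) * abs (f x - f y)" by (metis abs_mult abs_triangle_ineq)
 also have "... <= A * (M * dist x y) + B * (L * dist x y)"
  using lipschitz_onD[OF f(1) xy] lipschitz_onD[OF g(1) xy] f(2)[OF xy(1)] g(2)[OF xy(2)] assms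
  by (intro add_mono mult_mono) (auto simp: dist_real_def)
 finally show "dist (f x * g x) (f y * g y) <= (A * M + B * L) * dist x y" by (simp add: dist_real_def algebra_simps)
next
 show "0 <= A * M + B * L" using assms lipschitz_on_nonneg[OF f(1)] lipschitz_on_nonneg[OF g(1)] by simp
qed

lemma LIPb_mult [simp]: assumes "f : LIPb" "g : LIPb" shows "(%x. f x * g x) : LIPb"
proof -
 obtain L A where f: "L-lipschitz_on UNIV f" "!!x. abs (f x) <= A" "0 <= A" using LIPbE[OF assms(1)] by metis
 obtain M B where g: "M-lipschitz_on UNIV g" "!!x. abs (g x) <= B" "0 <= B" using LIPbE[OF assms(2)] by metis
 show ?thesis
 proof -
  have "abs (f x * g x) <= A * B" for x unfolding abs_mult using f g by (intro mult_mono) auto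
  thus ?thesis using lipschitz_on_mult_real[OF f(1) f(2) g(1) g(2) f(3) g(3)] unfolding LIPb_iff by blast
 qed
qed

lemma LIPb_continuous: "f : LIPb ==> continuous_on UNIV f" by (auto simp: LIPb_iff intro: lipschitz_on_continuous_on)

lemma LIPb_measurable: "f : LIPb ==> f : borel_measurable borel" by (intro borel_measurable_continuous_onI LIPb_continuous)

lemma LIPb_bounded: "f : LIPb ==> EX B. ALL x. abs (f x) <= B" by (simp add: LIPb_iff)

lemma lipschitz_on_min_real:
 fixes f :: "'a::metric_space => real"
 assumes "L-lipschitz_on U f" shows "L-lipschitz_on U (%x. min (f x) c)"
proof -
 have "dist (min a c) (min b c) <= dist a b" for a b :: real by (auto simp: dist_real_def min_def)
 thus ?thesis using assms unfolding lipschitz_on_def by (meson order_trans)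
qed

lemma open_approx_LIPb:
 fixes U :: "'a::metric_space set"
 assumes U: "open U"
 obtains phi :: "nat => 'a => real" where
  "!!k. phi k : LIPb" "!!k x. 0 <= phi k x" "!!k x. phi k x <= 1" "!!k x. phi k x <= phi (Suc k) x"
  "!!k x. x ~: U ==> phi k x = 0" "!!x. x : U ==> EX k. ALL j>=k. phi j x = 1"
  "!!x. (%k. phi k x) ----> indicator U x"
proof -
 \<comment> \<open>\<open>infdist\<close> to the empty set is 0 by convention, so the whole space
   gets the constant 1 instead of a distance to its complement.\<close>
 define d where "d x = (if U = UNIV then 1 else infdist x (- U))" for x
 define phi where "phi k x = min (real k * d x) 1" for k :: nat and x
 have d0: "0 <= d x" for x by (simp add: d_def infdist_nonneg)
 have "1-lipschitz_on UNIV d" by (auto intro!: lipschitz_onI simp: d_def dist_real_def infdist_triangle_abs)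
 hence "phi k : LIPb" for k unfolding LIPb_iff phi_def using d0
  by (intro conjI exI[of _ 1] allI exI[of _ "real k * 1"] lipschitz_on_min_real
    lipschitz_on_cmult_real_nonneg) auto
 moreover have dU: "d x = 0" if "x ~: U" for x using that by (auto simp: d_def)
 moreover have ev: "EX k. ALL j>=k. phi j x = 1" if "x : U" for x
 proof -
  have "d x > 0" using that U in_closed_iff_infdist_zero[of "- U" x] infdist_nonneg[of x "- U"] by (auto simp: d_def less_le)
  then obtain k where k: "1 < real k * d x" using reals_Archimedean3 by blast
  have "phi j x = 1" if "j >= k" for j
  proof -
   have "real k * d x <= real j * d x" using that d0 by (intro mult_right_mono) auto
   thus ?thesis using k by (simp add: phi_def)
  qed
  thus ?thesis by blast
 qed
 moreover have "(%k. phi k x) ----> indicator U x" for x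
 proof (cases "x : U")
  case True
  then obtain k where "ALL j>=k. phi j x = 1" using ev by blast
  thus ?thesis using True by (intro tendsto_eventually) (auto simp: eventually_sequentially)
 qed (simp add: phi_def dU)
 moreover have "phi k x <= phi (Suc k) x" for k x
 proof -
  have "real k * d x <= real (Suc k) * d x" using d0 by (intro mult_right_mono) auto
  thus ?thesis unfolding phi_def by (rule min.mono) simp
 qed
 ultimately show thesis using that[of phi] d0 by (simp add: phi_def)
qed

section \<open>Finite Borel measures on metric spaces\<close>

definition bdd_borel :: "('a::topological_space => real) set" where
 "bdd_borel = {g : borel_measurable borel. EX b. ALL x. abs (g x) <= b}"

lemma bdd_borelI: "g : borel_measurable borel ==> (!!x. abs (g x) <= b) ==> g : bdd_borel" by (auto simp: bdd_borel_def)

lemma bdd_borel_closed: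
 assumes "g : bdd_borel" "k : bdd_borel" shows "(%x. g x + k x) : bdd_borel" "(%x. c * g x) : bdd_borel" "(%x. g x * k x) : bdd_borel"
  "(%x. g x - k x) : bdd_borel"
proof -
 obtain a b where ab: "!!x. abs (g x) <= a" "!!x. abs (k x) <= b" using assms by (auto simp: bdd_borel_def)
 have m[measurable]: "g : borel_measurable borel" "k : borel_measurable borel" using assms by (auto simp: bdd_borel_def)
 have "abs (g x + k x) <= a + b" "abs (g x - k x) <= a + b" for x using ab[of x] by linarith+
 thus "(%x. g x + k x) : bdd_borel" "(%x. g x - k x) : bdd_borel" by (auto intro!: bdd_borelI)
 have "0 <= a" using ab(1)[of undefined] by linarith
 hence "abs (c * g x) <= abs c * a" "abs (g x * k x) <= a * b" for x using ab[of x] by (auto simp: abs_mult intro!: mult_mono)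
 thus "(%x. c * g x) : bdd_borel" "(%x. g x * k x) : bdd_borel" by (auto intro!: bdd_borelI)
qed

lemma bdd_borel_const [simp]: "(%x. c) : bdd_borel" by (auto simp: bdd_borel_def)

lemma bdd_borel_indicator [simp]: "A : sets borel ==> indicator A : bdd_borel" by (auto intro!: bdd_borelI[of _ 1] simp: indicator_def)

lemma LIPb_bdd_borel: "f : LIPb ==> f : bdd_borel" using LIPb_measurable LIPb_bounded by (auto simp: bdd_borel_def)

lemma integrable_bounded_borel:
 assumes "finite_measure M" "sets M = sets borel" "h : bdd_borel" shows "integrable M h"
proof -
 interpret finite_measure M by fact
 have "h : borel_measurable M" using assms(2,3) by (simp add: bdd_borel_def cong: measurable_cong_sets)
 moreover obtain b where "!!x. abs (h x) <= b" using assms(3) by (auto simp: bdd_borel_def)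
 ultimately show ?thesis by (intro integrable_const_bound[of _ b]) auto
qed

lemma integrable_mult_bounded_borel:
 assumes M: "sets M = sets borel" and f: "integrable M f" and g: "g : bdd_borel" shows "integrable M (%x. f x * g x)"
proof -
 obtain b where b: "!!x. abs (g x) <= b" and gm: "g : borel_measurable borel" using g by (auto simp: bdd_borel_def)
 have "0 <= b" using b[of undefined] by linarith
 hence le: "norm (f x * g x) <= norm (b * f x)" for x using mult_right_mono[OF b[of x], of "abs (f x)"] by (simp add: abs_mult mult.commute)
 have "g : borel_measurable M" using gm M by (simp cong: measurable_cong_sets)
 hence m: "(%x. f x * g x) : borel_measurable M" using f by simp
 have "integrable M (%x. b * f x)" using f by simp
 thus ?thesis by (rule Bochner_Integration.integrable_bound[OF _ m AE_I2]) (rule le)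
qed

lemma integral_abs_le_bound:
 assumes M: "finite_measure M" and B: "!!x. abs (h x) <= B" and h: "integrable M (h :: _ => real)"
 shows "abs (LINT x|M. h x) <= B * measure M (space M)"
proof -
 interpret finite_measure M by fact
 have "abs (LINT x|M. h x) <= (LINT x|M. abs (h x))" by (rule integral_abs_bound)
 also have "... <= (LINT x|M. B)" using B h by (intro integral_mono) auto
 finally show ?thesis by (simp add: mult.commute)
qed

text \<open>Lipschitz functions increase to indicators of open sets, so dominated convergence gives
  equality on open sets, which form an intersection-stable generator.\<close>

lemma finite_measure_eq_LIPb:
 fixes M N :: "'a::metric_space measure"
 assumes M: "finite_measure M" "sets M = sets borel" and N: "finite_measure N" "sets N = sets borel"
  and eq: "!!h. h : LIPb ==> (LINT x|M. h x) = (LINT x|N. h x)" shows "M = N"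
proof -
 have lim: "(%k. LINT x|K. phi k x) ----> measure K U" if K: "finite_measure K" "sets K = sets borel" and U: "open U"
   and phi: "!!k. phi k : LIPb" "!!k x. 0 <= phi k x" "!!k x. phi k x <= 1"
    "!!x. (%k. phi k x) ----> indicator U x" for K :: "'a measure" and U and phi :: "nat => 'a => real"
 proof -
  interpret finite_measure K by fact
  have UK: "U : sets K" using K U by simp
  have "(%k. LINT x|K. phi k x) ----> (LINT x|K. indicator U x)"
  proof (rule integral_dominated_convergence[where w="%x. 1"])
   show "indicator U : borel_measurable K" using UK by simp
   show "phi k : borel_measurable K" for k using LIPb_measurable[OF phi(1)[of k]] K by (simp cong: measurable_cong_sets)
  qed (use phi in auto)
  thus ?thesis using UK by simp
 qed
 have "emeasure M U = emeasure N U" if U: "open U" for U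
 proof -
  obtain phi :: "nat => 'a => real" where phi: "!!k. phi k : LIPb" "!!k x. 0 <= phi k x" "!!k x. phi k x <= 1"
    "!!x. (%k. phi k x) ----> indicator U x" using open_approx_LIPb[OF U] by metis
  have "measure M U = measure N U" using lim[OF M U phi] lim[OF N U phi] eq[OF phi(1)] by (auto intro: LIMSEQ_unique)
  thus ?thesis using M N by (simp add: finite_measure.emeasure_eq_measure)
 qed
 thus ?thesis using M N by (intro measure_eqI_generator_eq[where \<Omega>=UNIV and E="{S. open S}" and A="%_. UNIV"])
   (auto simp: Int_stable_def borel_def finite_measure.emeasure_finite)
qed

text \<open>Induction over the Borel sigma-algebra. The gap \<open>U - K\<close> is unchanged under
  complements, and an open set is exhausted from inside by the closed sets where an approximating
  function is at least \<open>1/2\<close>.\<close>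

lemma finite_measure_regular:
 fixes M :: "'a::metric_space measure"
 assumes M: "finite_measure M" "sets M = sets borel" and B: "B : sets borel" and e: "e > 0"
 shows "EX K U. closed K & open U & K <= B & B <= U & measure M (U - K) < e"
proof -
 interpret finite_measure M by fact
 have m[measurable]: "open U ==> U : sets M" "closed U ==> U : sets M" for U using M by auto
 have sp: "space M = UNIV" using sets_eq_imp_space_eq[OF M(2)] by simp
 have "B : sigma_sets UNIV {S. open S}" using B by (simp add: borel_def)
 thus ?thesis using e
 proof (induction arbitrary: e)
  case (Basic U)
  obtain phi :: "nat => 'a => real" where phi: "!!k. phi k : LIPb" "!!k x. phi k x <= phi (Suc k) x"
   "!!k x. x ~: U ==> phi k x = 0" "!!x. x : U ==> EX k. ALL j>=k. phi j x = 1" using open_approx_LIPb[of U] Basic by (metis mem_Collect_eq)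
  define F where "F k = {x. phi k x >= 1/2}" for k
  have F: "closed (F k)" for k unfolding F_def using LIPb_continuous[OF phi(1)] by (intro closed_Collect_le) auto
  have inc: "incseq F" using phi(2) by (intro incseq_SucI) (auto simp: F_def intro: order_trans)
  have un: "(\<Union>k. F k) = U"
  proof (intro set_eqI iffI)
   fix x assume "x : (\<Union>k. F k)"
   thus "x : U" using phi(3)[of x] by (force simp: F_def)
  next
   fix x assume "x : U"
   then obtain k where "phi k x = 1" using phi(4) by blast
   thus "x : (\<Union>k. F k)" by (auto simp: F_def intro!: exI[of _ k])
  qed
  have "(%k. measure M (F k)) ----> measure M U" unfolding un[symmetric] using inc F by (intro finite_Lim_measure_incseq) auto
  then obtain k where k: "measure M U - e < measure M (F k)"
   using order_tendstoD(1)[of _ "measure M U" sequentially "measure M U - e"] Basic(2) by (auto simp: eventually_sequentially)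
  have "F k <= U" using un by blast
  thus ?case using k F Basic by (intro exI[of _ "F k"] exI[of _ U]) (auto simp: finite_measure_Diff)
 next
  case Empty
  thus ?case by (intro exI[of _ "{}"]) auto
 next
  case (Compl A)
  obtain K U where KU: "closed K" "open U" "K <= A" "A <= U" "measure M (U - K) < e" using Compl.IH[OF Compl.prems] by blast
  have "- K - (- U) = U - K" by auto
  thus ?case using KU by (intro exI[of _ "- U"] exI[of _ "- K"]) (simp add: Compl_eq_Diff_UNIV[symmetric] closed_Compl open_Compl)
 next
  case (Union A)
  \<comment> \<open>Half of \<open>e\<close> is distributed over the gaps \<open>U n - K n\<close>.
    The other half pays for replacing the union of all \<open>K n\<close>, which need not be closed,
    by a finite union.\<close>
  have "ALL n. EX K U. closed K & open U & K <= A n & A n <= U & measure M (U - K) < e / 2 * (1/2) ^ Suc n"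
   by (intro allI Union.IH) (use Union.prems in simp)
  then obtain K U where KU: "!!n. closed (K n)" "!!n. open (U n)" "!!n. K n <= A n" "!!n. A n <= U n"
   "!!n. measure M (U n - K n) < e / 2 * (1/2) ^ Suc n" by metis
  have gs: "(%n. e / 2 * (1/2) ^ Suc n) sums (e / 2)" using sums_mult[OF power_half_series, of "e/2"] by simp
  have sm: "summable (%n. measure M (U n - K n))" by (rule summable_comparison_test'[OF sums_summable[OF gs], of 0])
    (use KU(5) in \<open>auto intro: less_imp_le\<close>)
  have "measure M (\<Union>n. U n - K n) <= (\<Sum>n. measure M (U n - K n))"
   using KU sm by (intro finite_measure_subadditive_countably) auto
  also have "... <= e / 2" using suminf_le[OF _ sm sums_summable[OF gs]] KU(5) sums_unique[OF gs] by (metis less_imp_le)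
  finally have 1: "measure M (\<Union>n. U n - K n) <= e / 2" .
  define L where "L N = (\<Union>n\<le>N. K n)" for N
  have L: "closed (L N)" for N using KU(1) by (auto simp: L_def)
  have "(%N. measure M (L N)) ----> measure M (\<Union>N. L N)"
   using L by (intro finite_Lim_measure_incseq) (auto simp: L_def incseq_def intro: order_trans)
  then obtain N where N: "measure M (\<Union>N. L N) - e / 2 < measure M (L N)"
   using order_tendstoD(1)[of _ "measure M (\<Union>N. L N)" sequentially "measure M (\<Union>N. L N) - e / 2"]
    Union(3) by (auto simp: eventually_sequentially)
  have Ls: "(\<Union>N. L N) : sets M" using L m by (intro sets.countable_UN) auto
  have LK: "(\<Union>N. L N) = (\<Union>n. K n)" by (auto simp: L_def)
  have ms: "(\<Union>n. U n - K n) : sets M" "(\<Union>N. L N) - L N : sets M" using KU L Ls by (auto intro!: m sets.countable_UN sets.Diff)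
  have "(\<Union>n. U n) - L N <= (\<Union>n. U n - K n) Un ((\<Union>N. L N) - L N)" unfolding LK by blast
  hence "measure M ((\<Union>n. U n) - L N) <= measure M ((\<Union>n. U n - K n) Un ((\<Union>N. L N) - L N))"
   using ms by (intro finite_measure_mono) auto
  also have "... <= measure M (\<Union>n. U n - K n) + measure M ((\<Union>N. L N) - L N)" using ms by (intro measure_Un_le)
  also have "measure M ((\<Union>N. L N) - L N) < e / 2" using N Ls L by (subst finite_measure_Diff) auto
  finally have "measure M ((\<Union>n. U n) - L N) < e" using 1 by simp
  moreover have "L N <= (\<Union>n. A n)" "(\<Union>n. A n) <= (\<Union>n. U n)" unfolding L_def using KU(3,4) by blast+
  ultimately show ?case using L KU(2) by (intro exI[of _ "L N"] exI[of _ "\<Union>n. U n"]) auto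
 qed
qed

text \<open>Closed sets are compact here, so regularity gives the Radon property and membership in
  \<open>Meas\<close> comes down to finiteness.\<close>

lemma finite_measure_radon:
 fixes M :: "'a::metric_space measure"
 assumes X: "compact (UNIV :: 'a set)" and M: "finite_measure M" "sets M = sets borel" shows "radon_measure M" unfolding radon_measure_def
proof (intro conjI allI impI ballI M(2))
 interpret finite_measure M by fact
 show "emeasure M K < \<infinity>" for K using emeasure_finite[of K] by (simp add: less_top[symmetric])
 fix B :: "'a set" assume B: "B : sets borel"
 show "emeasure M B = (SUP K\<in>{K. compact K & K <= B}. emeasure M K)"
 proof (rule antisym)
  show "emeasure M B <= (SUP K\<in>{K. compact K & K <= B}. emeasure M K)"
  proof (rule ennreal_le_epsilon)
   fix e :: real assume e: "e > 0"
   obtain K U where KU: "closed K" "open U" "K <= B" "B <= U" "measure M (U - K) < e" using finite_measure_regular[OF M B e] by blast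
   have "compact K" using KU(1) X by (metis closed_Int_compact inf_top_right)
   hence le: "emeasure M K <= (SUP K\<in>{K. compact K & K <= B}. emeasure M K)" using KU(3) by (intro SUP_upper) auto
   have "emeasure M B <= emeasure M (K Un (U - K))" using KU M B by (intro emeasure_mono) auto
   also have "... <= emeasure M K + emeasure M (U - K)" using KU M by (intro emeasure_subadditive) auto
   also have "... <= (SUP K\<in>{K. compact K & K <= B}. emeasure M K) + ennreal e"
    using le KU(5) by (intro add_mono) (auto simp: emeasure_eq_measure intro: ennreal_leI)
   finally show "emeasure M B <= (SUP K\<in>{K. compact K & K <= B}. emeasure M K) + ennreal e" .
  qed
  show "(SUP K\<in>{K. compact K & K <= B}. emeasure M K) <= emeasure M B" using M B by (intro SUP_least emeasure_mono) auto
 qed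
qed

text \<open>Sums turn identities between differences of measures into identities between measures;
  the total variation is one as well.\<close>

definition msum :: "'a::metric_space measure => 'a measure => 'a measure" where
 "msum M N = measure_of UNIV (sets borel) (%B. emeasure M B + emeasure N B)"

lemma sets_msum [simp]: "sets (msum M N) = sets borel" "space (msum M N) = UNIV"
 using sets.sigma_sets_eq[of "borel :: 'a measure"] by (simp_all add: msum_def)

lemma countably_additive_add:
 assumes "countably_additive A f" "countably_additive A g" shows "countably_additive A (%B. f B + g B :: ennreal)"
 using assms unfolding countably_additive_def by (simp add: suminf_add[symmetric])

lemma emeasure_measure_of_borel:
 assumes "positive (sets borel) f" "countably_additive (sets borel) f" "B : sets borel"
 shows "emeasure (measure_of UNIV (sets borel) f) B = f B"
 using assms sets.sigma_algebra_axioms[of borel] by (intro emeasure_measure_of_sigma) auto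

lemma emeasure_msum:
 assumes "sets M = sets borel" "sets N = sets borel" "B : sets borel" shows "emeasure (msum M N) B = emeasure M B + emeasure N B"
 unfolding msum_def by (rule emeasure_measure_of_borel[OF _ countably_additive_add])
  (use assms emeasure_countably_additive[of M] emeasure_countably_additive[of N]
   in \<open>auto simp: positive_def\<close>)

lemma finite_msum:
 assumes "finite_measure M" "sets M = sets borel" "finite_measure N" "sets N = sets borel" shows "finite_measure (msum M N)"
 by (rule finite_measureI) (use assms in \<open>simp add: emeasure_msum finite_measure.emeasure_finite ennreal_add_eq_top\<close>)

lemma measure_msum:
 assumes "finite_measure M" "sets M = sets borel" "finite_measure N" "sets N = sets borel" "B : sets borel"
 shows "measure (msum M N) B = measure M B + measure N B" using assms emeasure_msum[OF assms(2,4,5)]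
 by (simp add: measure_def enn2real_plus finite_measure.emeasure_finite less_top[symmetric])

text \<open>
 Functionals that are continuous for the sup norm; they are determined by their values on
 indicators because simple functions are uniformly dense.
\<close>

definition bdd_functional :: "(('a::metric_space => real) => real) => bool" where
 "bdd_functional F \<longleftrightarrow> (ALL g:bdd_borel. (ALL k:bdd_borel. F (%x. g x + k x) = F g + F k) &
  (ALL c. F (%x. c * g x) = c * F g)) & (EX K. ALL g:bdd_borel. ALL b. (ALL x. abs (g x) <= b) --> abs (F g) <= K * b)"

lemma bdd_functionalI:
 assumes "!!g k. g : bdd_borel ==> k : bdd_borel ==> F (%x. g x + k x) = F g + F k"
  "!!g c. g : bdd_borel ==> F (%x. c * g x) = c * F g"
  "!!g b. g : bdd_borel ==> (!!x. abs (g x) <= b) ==> abs (F g) <= K * b" shows "bdd_functional F"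
 unfolding bdd_functional_def using assms by blast

lemma bdd_functional_comb:
 assumes F: "bdd_functional F" and G: "bdd_functional G" shows "bdd_functional (%h. a * F h + c * G h)"
proof -
 obtain K K' where K: "!!g b. g : bdd_borel ==> (!!x. abs (g x) <= b) ==> abs (F g) <= K * b"
  "!!g b. g : bdd_borel ==> (!!x. abs (g x) <= b) ==> abs (G g) <= K' * b" using F G unfolding bdd_functional_def by metis
 show ?thesis
 proof (rule bdd_functionalI)
  show "abs (a * F g + c * G g) <= (abs a * K + abs c * K') * b" if "g : bdd_borel" "!!x. abs (g x) <= b" for g b
  using mult_left_mono[OF K(1)[OF that], of "abs a"] mult_left_mono[OF K(2)[OF that], of "abs c"]
   abs_triangle_ineq[of "a * F g" "c * G g"] by (simp add: abs_mult algebra_simps)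
 qed (use F G in \<open>simp_all add: bdd_functional_def algebra_simps\<close>)
qed

lemma bdd_functional_integral:
 assumes M: "finite_measure M" "sets M = sets borel" shows "bdd_functional (%h. LINT x|M. h x)"
proof (rule bdd_functionalI)
 show "abs (LINT x|M. g x) <= measure M (space M) * b" if "g : bdd_borel" "!!x. abs (g x) <= b" for g b
  using integral_abs_le_bound[OF M(1) that(2) integrable_bounded_borel[OF M that(1)]] by (simp add: mult.commute)
qed (use integrable_bounded_borel[OF M] in simp_all)

lemma bdd_functional_density:
 assumes M: "sets M = sets borel" and f: "integrable M f" shows "bdd_functional (%g. LINT x|M. f x * g x)"
proof (rule bdd_functionalI)
 note i = integrable_mult_bounded_borel[OF M f]
 fix g :: "'a => real" and b assume g: "g : bdd_borel" "!!x. abs (g x) <= b"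
 have "abs (LINT x|M. f x * g x) <= (LINT x|M. abs (f x * g x))" by (rule integral_abs_bound)
 also have "... <= (LINT x|M. abs (f x) * b)"
  using f g i by (intro integral_mono integrable_abs) (auto simp: abs_mult intro!: mult_left_mono)
 finally show "abs (LINT x|M. f x * g x) <= (LINT x|M. abs (f x)) * b" by simp
qed (use integrable_mult_bounded_borel[OF M f] in \<open>simp_all add: distrib_left mult.left_commute\<close>)

lemma bdd_functional_eq:
 assumes F: "bdd_functional F" and G: "bdd_functional G"
  and eq: "!!B. B : sets borel ==> F (indicator B) = G (indicator B)" and g: "g : bdd_borel" shows "F g = G g"
proof -
 define H where "H h = 1 * F h + (-1) * G h" for h
 have bH: "bdd_functional H" unfolding H_def[abs_def] by (rule bdd_functional_comb[OF F G])
 then obtain K where H: "!!g k. g : bdd_borel ==> k : bdd_borel ==> H (%x. g x + k x) = H g + H k"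
  "!!g c. g : bdd_borel ==> H (%x. c * g x) = c * H g"
  "!!g b. g : bdd_borel ==> (!!x. abs (g x) <= b) ==> abs (H g) <= K * b" unfolding bdd_functional_def by metis
 have simple: "(%x. \<Sum>j\<in>J. c j * indicator (A j) x) : bdd_borel & H (%x. \<Sum>j\<in>J. c j * indicator (A j) x) = 0"
  if "finite J" "!!j. A j : sets borel" for J :: "int set" and c and A :: "int => 'a set" using that(1)
 proof induction
  case empty show ?case using H(2)[of "%x. 0" 0] by simp
 next
  case (insert j J)
  have i: "indicator (A j) : bdd_borel" using that(2) by simp
  note ij = bdd_borel_closed(2)[OF i i, of "c j"]
  have "H (indicator (A j)) = 0" using eq[OF that(2)] by (simp add: H_def)
  thus ?case using insert H(1)[OF ij conjunct1[OF insert(3)]] bdd_borel_closed(1)[OF ij conjunct1[OF insert(3)]] H(2)[OF i, of "c j"]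
   by (simp del: sum_mult_indicator)
 qed
 obtain b where b: "!!x. abs (g x) <= b" and gm: "g : borel_measurable borel" using g by (auto simp: bdd_borel_def)
 have "abs (H g) <= K * inverse (real (Suc n))" for n
 proof -
  \<comment> \<open>\<open>k\<close> rounds \<open>g\<close> down to multiples of
    \<open>1 / (n + 1)\<close>; it is within that distance of \<open>g\<close> everywhere, and
    boundedness of \<open>g\<close> leaves finitely many values \<open>j\<close>.\<close>
  define A where "A j = {x. \<lfloor>real (Suc n) * g x\<rfloor> = j}" for j
  define J where "J = {\<lfloor>- (real (Suc n) * b)\<rfloor>..\<lfloor>real (Suc n) * b\<rfloor>}"
  define k where "k x = (\<Sum>j\<in>J. (of_int j / real (Suc n)) * indicator (A j) x)" for x
  have A: "A j : sets borel" for j unfolding A_def using gm by measurable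
  have "finite J" by (simp add: J_def)
  from simple[where A=A, OF this A, of "%j. of_int j / real (Suc n)"]
  have k: "k : bdd_borel" "H k = 0" by (simp_all only: k_def[abs_def])
  have "abs (g x - k x) <= inverse (real (Suc n))" for x
  proof -
   define i where "i = \<lfloor>real (Suc n) * g x\<rfloor>"
   have "- b <= g x" "g x <= b" using b[of x] by linarith+
   hence "real (Suc n) * - b <= real (Suc n) * g x" "real (Suc n) * g x <= real (Suc n) * b" by (intro mult_left_mono; simp)+
   hence "i : J" unfolding J_def i_def by (auto intro!: floor_mono)
   hence "k x = of_int i / real (Suc n)" unfolding k_def by (subst sum.remove[of _ i]) (auto simp: J_def A_def i_def indicator_def)
   moreover have "of_int i <= real (Suc n) * g x" "real (Suc n) * g x < of_int i + 1" unfolding i_def by linarith+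
   ultimately show ?thesis by (auto simp: abs_le_iff field_simps)
  qed
  hence "abs (H (%x. g x - k x)) <= K * inverse (real (Suc n))" by (intro H(3) bdd_borel_closed(4) g k)
  thus ?thesis using H(1)[OF bdd_borel_closed(4)[OF g k(1)] k(1)] k(2) by simp
 qed
 moreover have "(%n. K * inverse (real (Suc n))) ----> K * 0" by (intro tendsto_intros LIMSEQ_inverse_real_of_nat)
 ultimately have "abs (H g) <= K * 0" by (intro LIMSEQ_le_const[of _ "K * 0"]) auto
 thus ?thesis by (simp add: H_def)
qed

lemma integral_msum:
 assumes M: "finite_measure M" "sets M = sets borel" and N: "finite_measure N" "sets N = sets borel" and h: "h : bdd_borel"
 shows "(LINT x|msum M N. h x) = (LINT x|M. h x) + (LINT x|N. h x)"
proof -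
 have "bdd_functional (%h. 1 * (LINT x|M. h x) + 1 * (LINT x|N. h x))" by (intro bdd_functional_comb bdd_functional_integral M N)
 from bdd_functional_eq[OF bdd_functional_integral[OF finite_msum[OF M N]] this _ h] show ?thesis
  using sets_eq_imp_space_eq[OF M(2)] sets_eq_imp_space_eq[OF N(2)] by (simp add: M N measure_msum)
qed

section \<open>Signed measures\<close>

text \<open>Countable additivity without extensionality, so that it applies to \<open>%A. - mu A\<close>.\<close>

definition signed_additive :: "('a::metric_space set => real) => bool" where
 "signed_additive mu \<longleftrightarrow> mu {} = 0 & (ALL A :: nat => 'a set. range A <= sets borel --> disjoint_family A -->
    (%i. mu (A i)) sums mu (\<Union>i. A i))"

lemma signed_measure_iff: "signed_measure mu \<longleftrightarrow> mu : extensional (sets borel) & signed_additive mu"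
 by (auto simp: signed_measure_def signed_additive_def)

lemma signed_additive_uminus: "signed_additive mu ==> signed_additive (%A. - mu A)" by (auto simp: signed_additive_def intro: sums_minus)

lemma signed_additive_Un:
 assumes mu: "signed_additive mu" and A: "A : sets borel" "B : sets borel" "A Int B = {}" shows "mu (A Un B) = mu A + mu B"
proof -
 have "range (binaryset A B) <= sets borel" "disjoint_family (binaryset A B)"
  using A by (auto simp: range_binaryset_eq disjoint_family_on_def binaryset_def)
 hence "(%i. mu (binaryset A B i)) sums mu (\<Union>i. binaryset A B i)" using mu unfolding signed_additive_def by blast
 hence "(%i. mu (binaryset A B i)) sums mu (A Un B)" by (simp add: UN_binaryset_eq)
 moreover have "(%i. mu (binaryset A B i)) sums (mu A + mu B)" using mu by (intro binaryset_sums) (simp add: signed_additive_def)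
 ultimately show ?thesis by (rule sums_unique2)
qed

text \<open>The positive part in the Jordan decomposition, through its supremum formula; no Hahn set
  is constructed.\<close>

definition pos_fun :: "('a::metric_space set => real) => 'a set => ennreal" where
 "pos_fun mu B = (SUP A\<in>{A : sets borel. A <= B}. ennreal (mu A))"

lemma pos_fun_upper: "A : sets borel ==> A <= B ==> ennreal (mu A) <= pos_fun mu B" unfolding pos_fun_def by (intro SUP_upper) auto

lemma pos_fun_least:
 "(!!A. A : sets borel ==> A <= B ==> ennreal (mu A) <= c) ==> pos_fun mu B <= c" unfolding pos_fun_def by (intro SUP_least) auto

lemma pos_fun_empty: "mu {} = 0 ==> pos_fun mu {} = 0" by (simp add: pos_fun_def)

lemma pos_fun_Un:
 assumes mu: "signed_additive mu" and BC: "B Int C = {}" shows "pos_fun mu B + pos_fun mu C <= pos_fun mu (B Un C)"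
proof -
 have 0: "mu {} = 0" using mu by (simp add: signed_additive_def)
 have 1: "ennreal (mu A) + ennreal (mu A') <= pos_fun mu (B Un C)" if "A : sets borel" "A <= B" "A' : sets borel" "A' <= C" for A A'
 proof -
  \<comment> \<open>Sets of negative measure are replaced by the empty set, because
    \<open>ennreal\<close> sends their value to 0 and additivity would be lost.\<close>
  define A1 where "A1 = (if mu A >= 0 then A else {})"
  define A2 where "A2 = (if mu A' >= 0 then A' else {})"
  have A: "A1 : sets borel" "A2 : sets borel" "A1 Int A2 = {}" "A1 Un A2 <= B Un C" "mu A1 >= 0" "mu A2 >= 0"
   "ennreal (mu A) = ennreal (mu A1)" "ennreal (mu A') = ennreal (mu A2)" using that BC 0 by (auto simp: A1_def A2_def ennreal_neg)
  hence "ennreal (mu A) + ennreal (mu A') = ennreal (mu (A1 Un A2))" by (simp add: signed_additive_Un[OF mu] ennreal_plus)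
  thus ?thesis using A pos_fun_upper[of "A1 Un A2" "B Un C" mu] by simp
 qed
 have ne: "{A : sets borel. A <= D} ~= {}" for D :: "'a set" by auto
 have "ennreal (mu A) + pos_fun mu C <= pos_fun mu (B Un C)" if "A : sets borel" "A <= B" for A
  unfolding pos_fun_def[of mu C] ennreal_SUP_add_right[OF ne] using 1 that by (intro SUP_least) auto
 thus ?thesis unfolding pos_fun_def[of mu B] ennreal_SUP_add_left[OF ne, symmetric] by (intro SUP_least) auto
qed

lemma pos_fun_mono: "B <= C ==> pos_fun mu B <= pos_fun mu C" by (rule pos_fun_least) (auto intro: pos_fun_upper)

text \<open>Finite superadditivity bounds the partial sums from above. Conversely, any
  \<open>A\<close> inside the union is cut into the pieces \<open>A Int B i\<close>, on which
  \<open>mu\<close> is countably additive.\<close>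

lemma countably_additive_pos_fun:
 assumes mu: "signed_additive mu" shows "countably_additive (sets borel) (pos_fun mu)"
proof (rule countably_additiveI)
 fix B :: "nat => 'a set" assume B: "range B <= sets borel" "disjoint_family B"
 have 0: "mu {} = 0" using mu by (simp add: signed_additive_def)
 show "(\<Sum>i. pos_fun mu (B i)) = pos_fun mu (\<Union> (range B))"
 proof (rule antisym)
  have fin: "(\<Sum>i<n. pos_fun mu (B i)) <= pos_fun mu (\<Union>i<n. B i)" for n
  proof (induction n)
   case (Suc n)
   have "B i Int B n = {}" if "i < n" for i using disjoint_family_onD[OF B(2), of i n] that by auto
   hence "(\<Union>i<n. B i) Int B n = {}" by blast
   from pos_fun_Un[OF mu this]
   have "pos_fun mu (\<Union>i<n. B i) + pos_fun mu (B n) <= pos_fun mu (\<Union>i<Suc n. B i)" by (simp add: lessThan_Suc Un_commute)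
   from order_trans[OF add_right_mono[OF Suc] this] show ?case by simp
  qed (simp add: pos_fun_empty 0)
  show "(\<Sum>i. pos_fun mu (B i)) <= pos_fun mu (\<Union> (range B))"
   unfolding suminf_eq_SUP by (intro SUP_least order_trans[OF fin] pos_fun_mono) auto
  show "pos_fun mu (\<Union> (range B)) <= (\<Sum>i. pos_fun mu (B i))"
  proof (rule pos_fun_least)
   fix A :: "'a set" assume A: "A : sets borel" "A <= \<Union> (range B)"
   have "range (%i. A Int B i) <= sets borel" using A B by auto
   moreover have "disjoint_family (%i. A Int B i)" using B(2) unfolding disjoint_family_on_def by blast
   ultimately have "(%i. mu (A Int B i)) sums mu (\<Union>i. A Int B i)" using mu unfolding signed_additive_def by blast
   moreover have "(\<Union>i. A Int B i) = A" using A by auto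
   ultimately have "(%n. \<Sum>i<n. mu (A Int B i)) ----> mu A" by (simp add: sums_def)
   hence "(%n. ennreal (\<Sum>i<n. mu (A Int B i))) ----> ennreal (mu A)" by (rule tendsto_ennrealI)
   moreover have "ennreal (\<Sum>i<n. mu (A Int B i)) <= (\<Sum>i. pos_fun mu (B i))" for n
   proof -
    have "ennreal (\<Sum>i<n. f i) <= (\<Sum>i<n. ennreal (f i))" for f :: "nat => real"
    proof (induction n)
     case (Suc n)
     have sub: "ennreal (a + b) <= ennreal a + ennreal b" for a b
      by (cases "a >= 0"; cases "b >= 0") (auto simp: ennreal_plus[symmetric] ennreal_neg
        simp del: ennreal_plus intro: ennreal_leI)
     show ?case using order_trans[OF sub add_right_mono[OF Suc]] by simp
    qed simp
    also have "(\<Sum>i<n. ennreal (mu (A Int B i))) <= (\<Sum>i<n. pos_fun mu (B i))" using A B by (intro sum_mono pos_fun_upper) auto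
    also have "... <= (\<Sum>i. pos_fun mu (B i))" by (intro sum_le_suminf) auto
    finally show ?thesis .
   qed
   ultimately show "ennreal (mu A) <= (\<Sum>i. pos_fun mu (B i))" by (intro LIMSEQ_le_const2[of _ "ennreal (mu A)"]) auto
  qed
 qed
qed

lemma pos_part_eq: "pos_part mu = measure_of UNIV (sets borel) (pos_fun mu)" by (simp add: pos_part_def pos_fun_def[abs_def])

lemma sets_parts [simp]: "sets (pos_part mu) = sets borel" "sets (neg_part mu) = sets borel"
 "sets (variation mu) = sets borel" "space (pos_part mu) = UNIV" "space (neg_part mu) = UNIV"
 "space (variation mu) = UNIV" using sets.sigma_sets_eq[of "borel :: 'a::metric_space measure"]
 by (simp_all add: pos_part_def neg_part_def variation_def)

lemma variation_eq: "variation mu = msum (pos_part mu) (neg_part mu)" by (simp add: variation_def msum_def)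

lemma emeasure_parts:
 assumes "signed_additive mu" "B : sets borel"
 shows "emeasure (pos_part mu) B = pos_fun mu B" "emeasure (neg_part mu) B = pos_fun (%A. - mu A) B"
proof -
 have *: "emeasure (pos_part nu) B = pos_fun nu B" if "signed_additive nu" for nu unfolding pos_part_eq
  by (rule emeasure_measure_of_borel[OF _ countably_additive_pos_fun[OF that] assms(2)])
   (use that in \<open>auto simp: positive_def signed_additive_def pos_fun_empty\<close>)
 show "emeasure (pos_part mu) B = pos_fun mu B" by (rule *[OF assms(1)])
 show "emeasure (neg_part mu) B = pos_fun (%A. - mu A) B" unfolding neg_part_def by (rule *[OF signed_additive_uminus[OF assms(1)]])
qed

lemma Meas_carrier_iff:
 fixes mu :: "'a::metric_space set => real"
 assumes "compact (UNIV :: 'a set)" shows "mu : carr Meas \<longleftrightarrow> mu : extensional (sets borel) & signed_additive mu &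
  finite_measure (pos_part mu) & finite_measure (neg_part mu)"
proof -
 have "finite_measure (pos_part mu) & finite_measure (neg_part mu) \<longleftrightarrow> emeasure (variation mu) UNIV < \<infinity>"
  unfolding variation_eq by (auto simp: emeasure_msum finite_measure.emeasure_finite less_top[symmetric] intro!: finite_measureI)
 moreover have "radon_measure (variation mu) \<longleftrightarrow> emeasure (variation mu) UNIV < \<infinity>"
 proof
  show "emeasure (variation mu) UNIV < \<infinity>" if "radon_measure (variation mu)" using that assms unfolding radon_measure_def by blast
  show "radon_measure (variation mu)" if "emeasure (variation mu) UNIV < \<infinity>"
   using that by (intro finite_measure_radon[OF assms] finite_measureI) auto
 qed
 ultimately show ?thesis by (auto simp: Meas_def signed_measure_iff)
qed

lemma Meas_simps:
 "vnorm Meas mu = measure (variation mu) UNIV" "vzero Meas = restrict (%B. 0) (sets borel)"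
 "vadd Meas mu nu = restrict (%B. mu B + nu B) (sets borel)"
 "vscale Meas c mu = restrict (%B. c * mu B) (sets borel)" by (simp_all add: Meas_def)

locale compact_space =
 fixes dummy :: "'a::metric_space itself"
 assumes compact_UNIV: "compact (UNIV :: 'a set)"
begin

lemma MeasD:
 fixes mu :: "'a set => real"
 assumes "mu : carr Meas" shows "mu : extensional (sets borel)" "signed_additive mu" "finite_measure (pos_part mu)"
  "finite_measure (neg_part mu)"
  "vnorm Meas mu = measure (pos_part mu) UNIV + measure (neg_part mu) UNIV"
 using assms by (auto simp: Meas_carrier_iff[OF compact_UNIV] Meas_simps variation_eq measure_msum)

text \<open>For \<open>A\<close> inside \<open>B\<close>, \<open>mu A = mu B - mu (B - A)\<close> is
  at most \<open>mu B\<close> plus the negative part of \<open>B\<close>. The supremum over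
  \<open>A\<close> gives one inequality, and the same for \<open>- mu\<close> the other.\<close>

lemma Meas_decomp:
 fixes mu :: "'a set => real"
 assumes mu: "mu : carr Meas" and B: "B : sets borel" shows "mu B = measure (pos_part mu) B - measure (neg_part mu) B"
proof -
 have le: "measure (pos_part nu) B <= nu B + measure (neg_part nu) B"
  if nu: "signed_additive nu" "finite_measure (pos_part nu)" "finite_measure (neg_part nu)" for nu :: "'a set => real"
 proof -
  interpret P: finite_measure "pos_part nu" by fact
  interpret N: finite_measure "neg_part nu" by fact
  have up: "- nu A <= measure (neg_part nu) B" if "A : sets borel" "A <= B" for A
  proof -
   have "ennreal (- nu A) <= emeasure (neg_part nu) B" unfolding emeasure_parts(2)[OF nu(1) B] using that by (intro pos_fun_upper)
   thus ?thesis by (simp add: N.emeasure_eq_measure ennreal_le_iff)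
  qed
  have "pos_fun nu B <= ennreal (nu B + measure (neg_part nu) B)"
  proof (rule pos_fun_least)
   fix A assume A: "A : sets borel" "A <= B"
   have "nu B = nu A + nu (B - A)" using signed_additive_Un[OF nu(1), of A "B - A"] A B by (simp add: Un_absorb1)
   thus "ennreal (nu A) <= ennreal (nu B + measure (neg_part nu) B)" using up[of "B - A"] A B by (intro ennreal_leI) auto
  qed
  hence "ennreal (measure (pos_part nu) B) <= ennreal (nu B + measure (neg_part nu) B)"
   by (simp add: emeasure_parts(1)[OF nu(1) B, symmetric] P.emeasure_eq_measure)
  thus ?thesis using up[OF B order_refl] by (simp add: ennreal_le_iff)
 qed
 note D = MeasD[OF mu]
 have "measure (neg_part mu) B <= - mu B + measure (pos_part mu) B"
  using le[of "%A. - mu A"] signed_additive_uminus[OF D(2)] D(3,4) by (simp add: neg_part_def)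
 thus ?thesis using le[OF D(2-4)] by simp
qed

lemma Meas_bound:
 assumes mu: "mu : carr Meas" and B: "B : sets borel"
 shows "mu B <= measure (pos_part mu) (UNIV :: 'a set)" "- mu B <= measure (neg_part mu) UNIV"
proof -
 interpret P: finite_measure "pos_part mu" by (rule MeasD(3)[OF mu])
 interpret N: finite_measure "neg_part mu" by (rule MeasD(4)[OF mu])
 have "measure (pos_part mu) B <= measure (pos_part mu) UNIV" "measure (neg_part mu) B <= measure (neg_part mu) UNIV"
  by (auto intro!: P.finite_measure_mono N.finite_measure_mono)
 thus "mu B <= measure (pos_part mu) UNIV" "- mu B <= measure (neg_part mu) UNIV"
  using Meas_decomp[OF mu B] measure_nonneg[of "pos_part mu" B] measure_nonneg[of "neg_part mu" B] by linarith+
qed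

lemma signed_additive_restrict [simp]: "signed_additive (restrict mu (sets borel)) \<longleftrightarrow> signed_additive mu"
 unfolding signed_additive_def by (auto simp: image_subset_iff sets.countable_UN)

text \<open>Membership and a norm bound from one-sided bounds on the values, with no computation of
  the Jordan parts.\<close>

lemma MeasI:
 fixes nu :: "'a set => real"
 assumes nu: "signed_additive nu" and le: "!!B. B : sets borel ==> nu B <= a" "!!B. B : sets borel ==> - nu B <= b"
 defines "mu \<equiv> restrict nu (sets borel)" shows "mu : carr Meas" "vnorm Meas mu <= a + b"
proof -
 have mu: "signed_additive mu" using nu by (simp add: mu_def)
 have ab: "0 <= a" "0 <= b" using le[of "{}"] nu by (simp_all add: signed_additive_def)
 have U: "UNIV : sets (borel :: 'a measure)" by simp
 have e: "emeasure (pos_part mu) UNIV <= ennreal a" "emeasure (neg_part mu) UNIV <= ennreal b"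
  unfolding emeasure_parts[OF mu U] by (auto intro!: pos_fun_least ennreal_leI simp: le mu_def)
 hence fin: "finite_measure (pos_part mu)" "finite_measure (neg_part mu)" by (auto intro!: finite_measureI simp: top_unique)
 thus mem: "mu : carr Meas" using mu by (simp add: Meas_carrier_iff[OF compact_UNIV] mu_def)
 show "vnorm Meas mu <= a + b" using e fin ab by (simp add: MeasD(5)[OF mem] finite_measure.emeasure_eq_measure ennreal_le_iff add_mono)
qed

lemma bdd_functional_signed: "mu : carr Meas ==> bdd_functional (sint (mu :: 'a set => real))"
 using bdd_functional_comb[OF bdd_functional_integral[of "pos_part mu"] bdd_functional_integral[of "neg_part mu"], of 1 "-1"]
 by (simp add: signed_integral_def[abs_def] MeasD)

lemma signed_integral_indicator:
 fixes mu :: "'a set => real"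
 assumes "mu : carr Meas" "B : sets borel" shows "sint mu (indicator B) = mu B"
 using Meas_decomp[OF assms] assms(2) by (simp add: signed_integral_def)

lemma signed_integral_eqI:
 fixes mu :: "'a set => real"
 assumes mu: "mu : carr Meas" and F: "bdd_functional F" "!!B. B : sets borel ==> mu B = F (indicator B)" and h: "h : bdd_borel"
 shows "sint mu h = F h" by (rule bdd_functional_eq[OF bdd_functional_signed[OF mu] F(1) _ h])
  (simp add: F(2)[symmetric] signed_integral_indicator[OF mu])

lemma signed_integral_bound:
 fixes mu :: "'a set => real"
 assumes mu: "mu : carr Meas" and h: "h : bdd_borel" "!!x. abs (h x) <= b" shows "abs (sint mu h) <= b * vnorm Meas mu"
proof -
 note D = MeasD[OF mu]
 have "abs (LINT x|pos_part mu. h x) <= b * measure (pos_part mu) UNIV"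
  "abs (LINT x|neg_part mu. h x) <= b * measure (neg_part mu) UNIV"
  using integral_abs_le_bound[OF D(3) h(2) integrable_bounded_borel[OF D(3) _ h(1)]]
   integral_abs_le_bound[OF D(4) h(2) integrable_bounded_borel[OF D(4) _ h(1)]] by simp_all
 thus ?thesis unfolding signed_integral_def D(5) distrib_left by linarith
qed

lemma signed_integral_one:
 fixes mu :: "'a set => real"
 assumes mu: "mu : carr Meas" shows "sint mu (%x. 1) = mu UNIV"
 using Meas_decomp[OF mu, of UNIV] by (simp add: signed_integral_def)

text \<open>\<open>M\<close> and \<open>N\<close> may overlap and so need not be the Jordan parts:
  hence an inequality for the norm, while integrals still subtract.\<close>

lemma Meas_dom:
 fixes M N :: "'a measure"
 assumes M: "finite_measure M" "sets M = sets borel" and N: "finite_measure N" "sets N = sets borel"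
 defines "mu \<equiv> restrict (%B. measure M B - measure N B) (sets borel)"
 shows "mu : carr Meas" "vnorm Meas mu <= measure M UNIV + measure N UNIV"
  "h : bdd_borel ==> sint mu h = (LINT x|M. h x) - (LINT x|N. h x)"
proof -
 interpret M: finite_measure M by fact
 interpret N: finite_measure N by fact
 have add: "signed_additive (%B. measure M B - measure N B)" unfolding signed_additive_def
  using M N by (auto intro!: sums_diff M.finite_measure_UNION N.finite_measure_UNION)
 have le: "measure M B - measure N B <= measure M UNIV" "- (measure M B - measure N B) <= measure N UNIV" if "B : sets borel" for B
 proof -
  have "measure M B <= measure M UNIV" "measure N B <= measure N UNIV"
   using M N by (auto intro: M.finite_measure_mono N.finite_measure_mono)
  thus "measure M B - measure N B <= measure M UNIV" "- (measure M B - measure N B) <= measure N UNIV"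
   using measure_nonneg[of M B] measure_nonneg[of N B] by linarith+
 qed
 show mem: "mu : carr Meas" "vnorm Meas mu <= measure M UNIV + measure N UNIV" unfolding mu_def using MeasI[OF add le] by blast+
 have "bdd_functional (%h. 1 * (LINT x|M. h x) + (-1) * (LINT x|N. h x))" by (intro bdd_functional_comb bdd_functional_integral M N)
 from signed_integral_eqI[OF mem(1) this]
 show "h : bdd_borel ==> sint mu h = (LINT x|M. h x) - (LINT x|N. h x)"
  using sets_eq_imp_space_eq[OF M(2)] sets_eq_imp_space_eq[OF N(2)] by (simp add: mu_def)
qed

lemma Meas_add:
 fixes mu nu :: "'a set => real"
 assumes mu: "mu : carr Meas" and nu: "nu : carr Meas"
 shows "vadd Meas mu nu : carr Meas" "vnorm Meas (vadd Meas mu nu) <= vnorm Meas mu + vnorm Meas nu"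
  "h : bdd_borel ==> sint (vadd Meas mu nu) h = sint mu h + sint nu h"
proof -
 have sa: "signed_additive (%B. mu B + nu B)" using MeasD(2)[OF mu] MeasD(2)[OF nu] by (auto simp: signed_additive_def intro: sums_add)
 have le: "mu B + nu B <= measure (pos_part mu) UNIV + measure (pos_part nu) UNIV"
  "- (mu B + nu B) <= measure (neg_part mu) UNIV + measure (neg_part nu) UNIV" if "B : sets borel" for B
  using Meas_bound[OF mu that] Meas_bound[OF nu that] by linarith+
 note mem = MeasI[OF sa le, folded Meas_simps(3)]
 show "vadd Meas mu nu : carr Meas" by (rule mem(1))
 show "vnorm Meas (vadd Meas mu nu) <= vnorm Meas mu + vnorm Meas nu" using mem(2) unfolding MeasD(5)[OF mu] MeasD(5)[OF nu] by linarith
 note comb = bdd_functional_comb[OF bdd_functional_signed[OF mu] bdd_functional_signed[OF nu], of 1 1, simplified]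
 show "sint (vadd Meas mu nu) h = sint mu h + sint nu h" if "h : bdd_borel"
  by (rule signed_integral_eqI[OF mem(1) comb _ that]) (simp_all add: Meas_simps(3) signed_integral_indicator[OF mu] signed_integral_indicator[OF nu])
qed

lemma Meas_scale:
 fixes mu :: "'a set => real"
 assumes mu: "mu : carr Meas" shows "vscale Meas c mu : carr Meas" "vnorm Meas (vscale Meas c mu) <= abs c * vnorm Meas mu"
  "h : bdd_borel ==> sint (vscale Meas c mu) h = c * sint mu h"
proof -
 let ?p = "measure (pos_part mu) UNIV" and ?n = "measure (neg_part mu) UNIV"
 have sa: "signed_additive (%B. c * mu B)" using MeasD(2)[OF mu] by (auto simp: signed_additive_def intro: sums_mult)
 have le: "c * mu B <= abs c * (if c >= 0 then ?p else ?n)" "- (c * mu B) <= abs c * (if c >= 0 then ?n else ?p)" if "B : sets borel" for B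
  using mult_left_mono[OF Meas_bound(1)[OF mu that], of "abs c"] mult_left_mono[OF Meas_bound(2)[OF mu that], of "abs c"]
  by (auto split: if_splits)
 note mem = MeasI[OF sa le, folded Meas_simps(4)]
 show "vscale Meas c mu : carr Meas" by (rule mem(1))
 show "vnorm Meas (vscale Meas c mu) <= abs c * vnorm Meas mu"
  using mem(2) unfolding MeasD(5)[OF mu] distrib_left by (cases "c >= 0") (simp_all only: if_True if_False add.commute)
 note comb = bdd_functional_comb[OF bdd_functional_signed[OF mu] bdd_functional_signed[OF mu], of c 0, simplified]
 show "sint (vscale Meas c mu) h = c * sint mu h" if "h : bdd_borel"
  by (rule signed_integral_eqI[OF mem(1) comb _ that]) (simp_all add: Meas_simps(4) signed_integral_indicator[OF mu])
qed

lemma Meas_zero: "vzero Meas : carr (Meas :: ('a set => real) nvs)"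
 unfolding Meas_simps(2) by (rule MeasI(1)[of _ 0 0]) (simp_all add: signed_additive_def)

lemma seminormed_Meas: "seminormed (Meas :: ('a set => real) nvs)"
proof (rule seminormedI)
 define F :: "('a set => real) set" where "F = carr Meas"
 have "mu : extensional (sets borel)" if "mu : F" for mu using MeasD(1) that by (simp add: F_def)
 hence "vspace_on (vmaps (sets borel) real_nvs F (vnorm Meas :: ('a set => real) => real))"
  using seminormed_real_nvs Meas_zero Meas_add(1) Meas_scale(1)
  by (intro vspace_vmaps) (auto simp: seminormed_def F_def Meas_simps PiE_def)
 thus "vspace_on (Meas :: ('a set => real) nvs)" by (simp add: F_def Meas_def)
qed (use Meas_add(2) Meas_scale(2) in \<open>simp_all add: MeasD(5)\<close>)

text \<open>Moving the negative parts across gives two nonnegative measures,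
  \<open>pos_part mu + neg_part nu\<close> and \<open>pos_part nu + neg_part mu\<close>, with equal
  Lipschitz integrals.\<close>

lemma Meas_eqI:
 fixes mu nu :: "'a set => real"
 assumes mu: "mu : carr Meas" and nu: "nu : carr Meas" and eq: "!!h. h : LIPb ==> sint mu h = sint nu h"
 shows "mu = nu"
proof -
 note D = MeasD[OF mu] MeasD[OF nu]
 let ?M = "msum (pos_part mu) (neg_part nu)" and ?N = "msum (pos_part nu) (neg_part mu)"
 have fin: "finite_measure ?M" "finite_measure ?N" using D by (auto intro!: finite_msum)
 have "?M = ?N"
 proof (rule finite_measure_eq_LIPb[OF fin(1) _ fin(2)])
  fix h :: "'a => real" assume h: "h : LIPb"
  show "(LINT x|?M. h x) = (LINT x|?N. h x)" using eq[OF h] D integral_msum[OF _ _ _ _ LIPb_bdd_borel[OF h]]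
   by (simp add: signed_integral_def)
 qed simp_all
 hence M: "measure ?M B = measure ?N B" for B by simp
 have "mu B = nu B" if B: "B : sets borel" for B using M[of B] measure_msum[OF D(3) _ D(9) _ B] measure_msum[OF D(8) _ D(4) _ B]
   Meas_decomp[OF mu B] Meas_decomp[OF nu B] by simp
 thus ?thesis using D(1,6) by (intro extensionalityI[of mu "sets borel" nu]) auto
qed

lemma Meas_integral:
 fixes M :: "'a measure"
 assumes M: "sets M = sets borel" and d: "integrable M d"
 defines "mu \<equiv> restrict (%B. LINT x|M. indicator B x * d x) (sets borel)"
 shows "mu : carr Meas" "k : bdd_borel ==> sint mu k = (LINT x|M. d x * k x)"
proof -
 have dm: "d : borel_measurable M" using d by simp
 have int: "integrable M (%x. indicator B x * d x)" if "B : sets borel" for B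
  using integrable_mult_bounded_borel[OF M d bdd_borel_indicator[OF that]] by (simp add: mult.commute)
 have add: "signed_additive (%B. LINT x|M. indicator B x * d x)" unfolding signed_additive_def
 proof (intro conjI allI impI)
  fix A :: "nat => 'a set" assume A: "range A <= sets borel" "disjoint_family A"
  have "(\<Sum>i<n. LINT x|M. indicator (A i) x * d x) = (LINT x|M. indicator (\<Union>i<n. A i) x * d x)" for n
  proof -
   have "integrable M (%x. indicator (A i) x * d x)" for i using A by (intro int) auto
   hence "(\<Sum>i<n. LINT x|M. indicator (A i) x * d x) = (LINT x|M. (\<Sum>i<n. indicator (A i) x) * d x)"
    by (simp add: sum_distrib_right del: sum_indicator_mult)
   thus ?thesis using A(2) by (simp add: indicator_UN_disjoint disjoint_family_on_def)
  qed
  moreover have "(%n. LINT x|M. indicator (\<Union>i<n. A i) x * d x) ----> (LINT x|M. indicator (\<Union>i. A i) x * d x)"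
  proof (rule integral_dominated_convergence[where w="%x. abs (d x)"])
   show "AE x in M. (%n. indicator (\<Union>i<n. A i) x * d x) ----> indicator (\<Union>i. A i) x * d x"
    by (intro AE_I2 tendsto_mult_right LIMSEQ_indicator_UN)
  qed (use A d dm M in \<open>auto simp: indicator_def intro!: borel_measurable_times borel_measurable_indicator\<close>)
  ultimately show "(%i. LINT x|M. indicator (A i) x * d x) sums (LINT x|M. indicator (\<Union> (range A)) x * d x)" by (simp add: sums_def)
 qed simp
 have "abs (LINT x|M. indicator B x * d x) <= (LINT x|M. abs (d x))" if "B : sets borel" for B
 proof -
  have "(LINT x|M. abs (indicator B x * d x)) <= (LINT x|M. abs (d x))"
   using d int[OF that] by (intro integral_mono integrable_abs) (auto simp: abs_mult indicator_def)
  thus ?thesis by (rule order_trans[OF integral_abs_bound])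
 qed
 thus mem: "mu : carr Meas"
  unfolding mu_def abs_le_iff by (intro MeasI(1)[OF add, of "LINT x|M. abs (d x)" "LINT x|M. abs (d x)"]) blast+
 show "sint mu k = (LINT x|M. d x * k x)" if "k : bdd_borel"
  by (rule signed_integral_eqI[OF mem bdd_functional_density[OF M d] _ that]) (simp add: mu_def mult.commute)
qed

text \<open>The measure splits as a combination of densities with respect to the two Jordan parts,
  and each of these is covered by \<open>Meas_integral\<close>.\<close>

lemma density_signed_Meas:
 fixes mu :: "'a set => real"
 assumes mu: "mu : carr Meas" and h: "h : bdd_borel" shows "density_signed h mu : carr Meas"
  "k : bdd_borel ==> sint (density_signed h mu) k = sint mu (%x. h x * k x)"
proof -
 note D = MeasD[OF mu]
 note P = Meas_integral[OF sets_parts(1) integrable_bounded_borel[OF D(3) sets_parts(1) h]]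
  and N = Meas_integral[OF sets_parts(2) integrable_bounded_borel[OF D(4) sets_parts(2) h]]
 have eq: "density_signed h mu = vadd Meas (restrict (%B. LINT x|pos_part mu. indicator B x * h x) (sets borel))
   (vscale Meas (-1) (restrict (%B. LINT x|neg_part mu. indicator B x * h x) (sets borel)))"
  by (auto simp: density_signed_def Meas_simps signed_integral_def intro!: restrict_ext)
 show "density_signed h mu : carr Meas" unfolding eq by (intro Meas_add Meas_scale P N)
 show "sint (density_signed h mu) k = sint mu (%x. h x * k x)" if "k : bdd_borel"
  unfolding eq Meas_add(3)[OF P(1) Meas_scale(1)[OF N(1)] that] Meas_scale(3)[OF N(1) that] P(2)[OF that] N(2)[OF that]
  by (simp add: signed_integral_def)
qed

end

lemma (in compact_space) continuous_bdd_borel: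
 fixes h :: "'a => real"
 assumes h: "continuous_on UNIV h" shows "h : bdd_borel"
 using compact_imp_bounded[OF compact_continuous_image[OF h compact_UNIV]] borel_measurable_continuous_onI[OF h]
 by (auto simp: bounded_iff bdd_borel_def)

section \<open>The Riesz representation theorem on a compact metric space\<close>

definition C_plus :: "('a::metric_space => real) set" where
 "C_plus = {h. continuous_on UNIV h & (ALL x. 0 <= h x)}"

text \<open>
 A Daniell-type outer measure: sets are covered by countable sums of nonnegative continuous functions
 instead of open sets. Multiplying a cover by \<open>phi\<^sub>k\<close> and \<open>1 - phi\<^sub>k\<close> with \<open>phi\<^sub>k\<close> increasing to
 the indicator of an open set shows directly that open sets are measurable.
\<close>

locale positive_functional = compact_space dummy for dummy :: "'a::metric_space itself" +
 fixes Lambda :: "('a => real) => real"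
 assumes nonneg: "h : C_plus ==> 0 <= Lambda h" and additive: "h : C_plus ==> k : C_plus ==> Lambda (%x. h x + k x) = Lambda h + Lambda k"
  and homogeneous: "h : C_plus ==> 0 <= c ==> Lambda (%x. c * h x) = c * Lambda h"
begin

lemma C_plusI: "continuous_on UNIV h ==> (!!x. 0 <= h x) ==> h : C_plus" by (simp add: C_plus_def)

lemma C_plusD: "h : C_plus ==> continuous_on UNIV h" "h : C_plus ==> 0 <= h x" by (simp_all add: C_plus_def)

lemma C_plus_const: "0 <= c ==> (%x. c) : C_plus" by (simp add: C_plus_def)

lemma C_plus_sum: "(!!i. i : I ==> f i : C_plus) ==> (%x. \<Sum>i\<in>I. f i x) : C_plus"
 by (auto simp: C_plus_def intro!: continuous_on_sum sum_nonneg)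

lemma zero: "Lambda (%x. 0) = 0" using homogeneous[OF C_plus_const[of 0], of 0] by simp

lemma functional_sum: "finite I ==> (!!i. i : I ==> f i : C_plus) ==> Lambda (%x. \<Sum>i\<in>I. f i x) = (\<Sum>i\<in>I. Lambda (f i))"
 by (induction I rule: finite_induct) (simp_all add: zero additive C_plus_sum)

lemma functional_diff:
 assumes "h : C_plus" "k : C_plus" "!!x. h x <= k x"
 shows "(%x. k x - h x) : C_plus" "Lambda (%x. k x - h x) = Lambda k - Lambda h" "Lambda h <= Lambda k"
proof -
 show d: "(%x. k x - h x) : C_plus" using assms by (auto simp: C_plus_def intro!: continuous_on_diff)
 show e: "Lambda (%x. k x - h x) = Lambda k - Lambda h" using additive[OF d assms(1)] by simp
 show "Lambda h <= Lambda k" using nonneg[OF d] e by simp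
qed

definition covers :: "'a set => (nat => 'a => real) => bool" where
 "covers A h \<longleftrightarrow> (ALL n. h n : C_plus) & (ALL x:A. 1 <= (\<Sum>n. ennreal (h n x)))"

definition outer :: "'a set => ennreal" where
 "outer A = (INF h\<in>{h. covers A h}. \<Sum>n. ennreal (Lambda (h n)))"

lemma outer_le: "covers A h ==> outer A <= (\<Sum>n. ennreal (Lambda (h n)))" unfolding outer_def by (rule INF_lower) simp

lemma outer_approx:
 assumes "outer A < \<infinity>" "e > 0"
 obtains h where "covers A h" "(\<Sum>n. ennreal (Lambda (h n))) <= outer A + ennreal e"
proof -
 have "outer A < outer A + ennreal e" using assms by (simp add: ennreal_add_left_cancel_less[of _ 0, simplified])
 thus thesis using that unfolding outer_def INF_less_iff by (auto intro: less_imp_le)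
qed

lemma outer_le_single:
 assumes h: "h : C_plus" and A: "!!x. x : A ==> 1 <= h x" shows "outer A <= ennreal (Lambda h)"
proof -
 define f where "f n = (if n = 0 then h else (%x. 0))" for n :: nat
 have s: "(\<Sum>n. ennreal (F (f n))) = ennreal (F h)" if "F (%x. 0) = 0" for F
  using that by (subst suminf_finite[of "{0}"]) (auto simp: f_def)
 have "1 <= ennreal (h x)" if "x : A" for x using ennreal_leI[OF A[OF that]] by simp
 hence "covers A f" unfolding covers_def using h C_plus_const[of 0] s[of "%g. g x" for x] by (auto simp: f_def)
 thus ?thesis using outer_le[of A f] s[of Lambda] zero by simp
qed

lemma outer_mono: "A <= B ==> outer A <= outer B"
proof -
 assume "A <= B"
 hence "{h. covers B h} <= {h. covers A h}" unfolding covers_def by blast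
 thus ?thesis unfolding outer_def by (rule INF_superset_mono) simp
qed

lemma outer_empty: "outer {} = 0" using outer_le_single[OF C_plus_const[of 0], of "{}"] zero by simp

lemma outer_subadditive: "outer (\<Union>n. A n) <= (\<Sum>n. outer (A n))" for A :: "nat => 'a set"
proof (cases "(\<Sum>n. outer (A n)) < \<infinity>")
 case False
 thus ?thesis by (simp add: less_top[symmetric])
next
 case True
 have fin: "outer (A n) < \<infinity>" for n using sum_le_suminf[of "%n. outer (A n)" "{n}"] True by auto
 show ?thesis
 proof (rule ennreal_le_epsilon)
  fix e :: real assume e: "e > 0"
  have "ALL n. EX h. covers (A n) h & (\<Sum>k. ennreal (Lambda (h k))) <= outer (A n) + ennreal (e * (1/2) ^ Suc n)"
   using outer_approx[OF fin] e by (metis mult_pos_pos zero_less_divide_1_iff zero_less_numeral zero_less_power)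
  then obtain h where h: "!!n. covers (A n) (h n)"
   "!!n. (\<Sum>k. ennreal (Lambda (h n k))) <= outer (A n) + ennreal (e * (1/2) ^ Suc n)" by metis
  define g where "g i = h (fst (prod_decode i)) (snd (prod_decode i))" for i
  have two: "(\<Sum>i. F (g i)) = (\<Sum>n. \<Sum>k. F (h n k))" for F :: "_ => ennreal"
   using suminf_ennreal_2dimen[of "%n. \<Sum>k. F (h n k)" "%p. F (h (fst p) (snd p))"] by (simp add: g_def)
  have "covers (\<Union>n. A n) g" unfolding covers_def
  proof (intro conjI allI ballI)
   show "g i : C_plus" for i using h(1) by (simp add: g_def covers_def)
   fix x assume "x : (\<Union>n. A n)"
   then obtain n where "x : A n" by blast
   hence "1 <= (\<Sum>k. ennreal (h n k x))" using h(1) by (simp add: covers_def)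
   also have "... <= (\<Sum>n. \<Sum>k. ennreal (h n k x))" using sum_le_suminf[of "%n. \<Sum>k. ennreal (h n k x)" "{n}"] by simp
   finally show "1 <= (\<Sum>i. ennreal (g i x))" using two[of "%f. ennreal (f x)"] by simp
  qed
  from outer_le[OF this]
  have "outer (\<Union>n. A n) <= (\<Sum>n. \<Sum>k. ennreal (Lambda (h n k)))" using two[of "%f. ennreal (Lambda f)"] by simp
  also have "... <= (\<Sum>n. outer (A n) + ennreal (e * (1/2) ^ Suc n))" using h(2) by (intro suminf_le) auto
  also have "... = (\<Sum>n. outer (A n)) + (\<Sum>n. ennreal (e * (1/2) ^ Suc n))" by (intro suminf_add[symmetric]) auto
  also have "(\<Sum>n. ennreal (e * (1/2) ^ Suc n)) = ennreal e" using sums_mult[OF power_half_series, of e] e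
   by (intro suminf_ennreal_eq) auto
  finally show "outer (\<Union>n. A n) <= (\<Sum>n. outer (A n)) + ennreal e" .
 qed
qed

lemma outer_Un: "outer (A Un B) <= outer A + outer B"
proof -
 have "outer (\<Union>n. binaryset A B n) <= (\<Sum>n. outer (binaryset A B n))" by (rule outer_subadditive)
 thus ?thesis by (simp add: UN_binaryset_eq suminf_binaryset_eq outer_empty)
qed

lemma outer_open_split:
 assumes U: "open U" shows "outer (T Int U) + outer (T - U) <= outer T"
proof (cases "outer T < \<infinity>")
 case False
 thus ?thesis by (simp add: less_top[symmetric])
next
 case True
 show ?thesis
 proof (rule ennreal_le_epsilon)
  fix e :: real assume e: "e > 0"
  hence e2: "e / 2 > 0" by simp
  obtain h where h: "covers T h" "(\<Sum>n. ennreal (Lambda (h n))) <= outer T + ennreal (e / 2)" using outer_approx[OF True e2] by blast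
  have hC: "h n : C_plus" for n using h(1) by (simp add: covers_def)
  obtain phi :: "nat => 'a => real" where phi: "!!k. phi k : LIPb" "!!k x. 0 <= phi k x" "!!k x. phi k x <= 1"
   "!!k x. phi k x <= phi (Suc k) x" "!!k x. x ~: U ==> phi k x = 0"
   "!!x. (%k. phi k x) ----> indicator U x" using open_approx_LIPb[OF U] by metis
  \<comment> \<open>The increments of \<open>h n * phi k\<close> in \<open>k\<close>: nonnegative
    since \<open>phi\<close> increases, with sum \<open>h n\<close> on \<open>U\<close> and 0
    outside. Taken over all \<open>n\<close> and \<open>k\<close> they cover
    \<open>T Int U\<close>.\<close>
  define a where "a n k x = (case k of 0 => h n x * phi 0 x | Suc j => h n x * (phi (Suc j) x - phi j x))" for n k x
  have hp: "(%x. h n x * phi k x) : C_plus" for n k using C_plusD[OF hC] LIPb_continuous[OF phi(1)] phi(2)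
   by (intro C_plusI continuous_on_mult) auto
  have aC: "a n k : C_plus" for n k using C_plusD[OF hC] LIPb_continuous[OF phi(1)] phi(2,4)
   by (cases k) (auto simp: a_def[abs_def] intro!: C_plusI continuous_on_mult continuous_on_diff)
  have asum: "(\<Sum>j\<le>k. a n j x) = h n x * phi k x" for n k x by (induction k) (auto simp: a_def algebra_simps)
  have asums: "(%k. a n k x) sums (h n x * indicator U x)" for n x
   unfolding sums_def_le asum using phi(6) by (intro tendsto_mult tendsto_const)
  have a_le: "(\<Sum>k. ennreal (Lambda (a n k))) <= ennreal (Lambda (h n))" for n
  proof (rule suminf_le_const)
   fix K
   have "(\<Sum>k<K. ennreal (Lambda (a n k))) <= (\<Sum>k\<le>K. ennreal (Lambda (a n k)))" by (intro sum_mono2) auto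
   also have "... = ennreal (Lambda (%x. \<Sum>k\<le>K. a n k x))" using aC nonneg by (simp add: functional_sum sum_ennreal)
   also have "... <= ennreal (Lambda (h n))" unfolding asum using phi(3) C_plusD(2)[OF hC]
    by (intro ennreal_leI functional_diff(3)[OF hp hC]) (simp add: mult_left_le)
   finally show "(\<Sum>k<K. ennreal (Lambda (a n k))) <= ennreal (Lambda (h n))" .
  qed auto
  \<comment> \<open>For large \<open>k\<close> the value on \<open>h n * phi k\<close> nearly
    exhausts the sum over the increments, so the remainder \<open>h n * (1 - phi k)\<close>, which
    equals \<open>h n\<close> off \<open>U\<close>, costs only the rest of
    \<open>Lambda (h n)\<close>.\<close>
  have "EX k. (\<Sum>k. ennreal (Lambda (a n k))) + ennreal (Lambda (%x. h n x - h n x * phi k x))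
    <= ennreal (Lambda (h n)) + ennreal (e / 2 * (1/2) ^ Suc n)" for n
  proof -
   let ?S = "\<Sum>k. ennreal (Lambda (a n k))"
   have top: "?S ~= \<infinity>" using a_le[of n] by (auto simp: top_unique)
   have "(%k. ennreal (Lambda (%x. h n x * phi k x))) ----> ?S"
   proof -
    have "(%k. \<Sum>j\<le>k. ennreal (Lambda (a n j))) ----> ?S" using summable_LIMSEQ'[of "%k. ennreal (Lambda (a n k))"] by simp
    moreover have "(\<Sum>j\<le>k. ennreal (Lambda (a n j))) = ennreal (Lambda (%x. h n x * phi k x))" for k
     using aC nonneg by (simp add: functional_sum[symmetric] sum_ennreal asum)
    ultimately show ?thesis by simp
   qed
   hence lim: "(%k. ennreal (Lambda (%x. h n x * phi k x)) + ennreal (e / 2 * (1/2) ^ Suc n)) ---->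
     ?S + ennreal (e / 2 * (1/2) ^ Suc n)" by (intro tendsto_add tendsto_const)
   have "?S < ?S + ennreal (e / 2 * (1/2) ^ Suc n)" using e top by (simp add: ennreal_add_left_cancel_less[of _ 0, simplified] less_top)
   from order_tendstoD(1)[OF lim this]
   obtain k where k: "?S <= ennreal (Lambda (%x. h n x * phi k x)) + ennreal (e / 2 * (1/2) ^ Suc n)"
    by (auto simp: eventually_sequentially intro: less_imp_le)
   have le: "h n x * phi k x <= h n x" for x using phi(3) C_plusD(2)[OF hC] by (simp add: mult_left_le)
   note d = functional_diff[OF hp hC le]
   have "ennreal (Lambda (%x. h n x * phi k x)) + ennreal (Lambda (%x. h n x - h n x * phi k x)) = ennreal (Lambda (h n))"
    using nonneg[OF hp] nonneg[OF d(1)] d(2) by (simp add: ennreal_plus[symmetric] del: ennreal_plus)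
   moreover have "a + d <= p + r" if "a <= b + r" "b + d = p" for a b d p r :: ennreal
    using add_right_mono[OF that(1), of d] that(2) by (metis add.assoc add.commute)
   ultimately show ?thesis using k by blast
  qed
  then obtain K where K: "!!n. (\<Sum>k. ennreal (Lambda (a n k))) + ennreal (Lambda (%x. h n x - h n x * phi (K n) x))
    <= ennreal (Lambda (h n)) + ennreal (e / 2 * (1/2) ^ Suc n)" by metis
  define g where "g i = a (fst (prod_decode i)) (snd (prod_decode i))" for i
  have two: "(\<Sum>i. F (g i)) = (\<Sum>n. \<Sum>k. F (a n k))" for F :: "_ => ennreal"
   using suminf_ennreal_2dimen[of "%n. \<Sum>k. F (a n k)" "%p. F (a (fst p) (snd p))"] by (simp add: g_def)
  have "covers (T Int U) g" unfolding covers_def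
  proof (intro conjI allI ballI)
   show "g i : C_plus" for i using aC by (simp add: g_def)
   fix x assume x: "x : T Int U"
   have "(\<Sum>k. ennreal (a n k x)) = ennreal (h n x)" for n using asums[of n x] x C_plusD(2)[OF aC] by (intro suminf_ennreal_eq) auto
   thus "1 <= (\<Sum>i. ennreal (g i x))" using two[of "%f. ennreal (f x)"] h(1) x by (simp add: covers_def)
  qed
  from outer_le[OF this] have 1: "outer (T Int U) <= (\<Sum>n. \<Sum>k. ennreal (Lambda (a n k)))"
   using two[of "%f. ennreal (Lambda f)"] by simp
  have "covers (T - U) (%n x. h n x - h n x * phi (K n) x)" unfolding covers_def
  proof (intro conjI allI ballI)
   show "(%x. h n x - h n x * phi (K n) x) : C_plus" for n
    using phi(3) C_plusD(2)[OF hC] by (intro functional_diff(1)[OF hp hC]) (simp add: mult_left_le)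
   show "1 <= (\<Sum>n. ennreal (h n x - h n x * phi (K n) x))" if "x : T - U" for x using that h(1) phi(5) by (simp add: covers_def)
  qed
  from outer_le[OF this] have 2: "outer (T - U) <= (\<Sum>n. ennreal (Lambda (%x. h n x - h n x * phi (K n) x)))" .
  have "outer (T Int U) + outer (T - U) <=
    (\<Sum>n. (\<Sum>k. ennreal (Lambda (a n k))) + ennreal (Lambda (%x. h n x - h n x * phi (K n) x)))"
   using add_mono[OF 1 2] by (simp add: suminf_add)
  also have "... <= (\<Sum>n. ennreal (Lambda (h n)) + ennreal (e / 2 * (1/2) ^ Suc n))" using K by (intro suminf_le) auto
  also have "... = (\<Sum>n. ennreal (Lambda (h n))) + (\<Sum>n. ennreal (e / 2 * (1/2) ^ Suc n))" by (intro suminf_add[symmetric]) auto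
  also have "(\<Sum>n. ennreal (e / 2 * (1/2) ^ Suc n)) = ennreal (e / 2)" using sums_mult[OF power_half_series, of "e / 2"] e
   by (intro suminf_ennreal_eq) auto
  also have "(\<Sum>n. ennreal (Lambda (h n))) + ennreal (e / 2) <= outer T + ennreal (e / 2) + ennreal (e / 2)"
   using h(2) by (rule add_right_mono)
  also have "... = outer T + ennreal e" using e by (simp add: add.assoc ennreal_plus[symmetric] del: ennreal_plus)
  finally show "outer (T Int U) + outer (T - U) <= outer T + ennreal e" .
 qed
qed

definition riesz :: "'a measure" where
 "riesz = measure_of UNIV (sets borel) outer"

lemma sets_riesz [simp]: "sets riesz = sets borel" "space riesz = UNIV"
 using sets.sigma_sets_eq[of "borel :: 'a measure"] by (simp_all add: riesz_def)

text \<open>\<open>outer_open_split\<close> puts open sets into the Caratheodory system of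
  \<open>outer\<close>, which therefore contains all Borel sets.\<close>

lemma emeasure_riesz: "B : sets borel ==> emeasure riesz B = outer B"
proof -
 interpret P: sigma_algebra UNIV "Pow (UNIV :: 'a set)" by (rule sigma_algebra_Pow)
 have om: "outer_measure_space (Pow UNIV) outer" unfolding outer_measure_space_def positive_def increasing_def countably_subadditive_def
  using outer_empty outer_mono outer_subadditive by auto
 have L: "measure_space UNIV (lambda_system UNIV (Pow UNIV) outer) outer" by (rule P.caratheodory_lemma[OF om])
 then interpret L: sigma_algebra UNIV "lambda_system UNIV (Pow UNIV) outer" by (simp add: measure_space_def)
 have "U : lambda_system UNIV (Pow UNIV) outer" if "open U" for U
 proof -
  have "outer (U Int T) + outer ((UNIV - U) Int T) = outer T" for T
  proof (rule antisym)
   show "outer (U Int T) + outer ((UNIV - U) Int T) <= outer T" using outer_open_split[OF that, of T] by (simp add: Int_commute Diff_eq)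
   show "outer T <= outer (U Int T) + outer ((UNIV - U) Int T)"
    using outer_Un[of "U Int T" "(UNIV - U) Int T"] by (simp add: Int_Un_distrib2[symmetric])
  qed
  thus ?thesis by (simp add: lambda_system_def)
 qed
 hence "sigma_sets UNIV {S. open S} <= lambda_system UNIV (Pow UNIV) outer" by (intro L.sigma_sets_subset) auto
 hence "sets borel <= lambda_system UNIV (Pow UNIV) outer" by (simp add: borel_def)
 hence "measure_space UNIV (sets borel) outer" using measure_down[OF L] sets.sigma_algebra_axioms[of "borel :: 'a measure"] by simp
 thus "emeasure riesz B = outer B" if "B : sets borel" unfolding riesz_def using that
  by (intro emeasure_measure_of_borel) (auto simp: measure_space_def)
qed

text \<open>By compactness, a countable cover of the space has a finite subsum above any given
  \<open>t < 1\<close> everywhere, which bounds its cost below by \<open>t\<close> times the value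
  at 1.\<close>

lemma outer_UNIV: "outer UNIV = ennreal (Lambda (%x. 1))"
proof (rule antisym)
 show "outer UNIV <= ennreal (Lambda (%x. 1))" by (rule outer_le_single) (auto simp: C_plus_const)
 show "ennreal (Lambda (%x. 1)) <= outer UNIV" unfolding outer_def
 proof (rule INF_greatest)
  fix h assume "h : {h. covers UNIV h}"
  hence h: "!!n. h n : C_plus" "!!x. 1 <= (\<Sum>n. ennreal (h n x))" by (auto simp: covers_def)
  have key: "ennreal (t * Lambda (%x. 1)) <= (\<Sum>n. ennreal (Lambda (h n)))" if t: "0 < t" "t < 1" for t
  proof -
   define V where "V N = {x. t < (\<Sum>n<N. h n x)}" for N
   have sumC: "(%x. \<Sum>n<N. h n x) : C_plus" for N using h(1) by (intro C_plus_sum)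
   have "open (V N)" for N unfolding V_def using C_plusD(1)[OF sumC] by (intro open_Collect_less) auto
   moreover have "UNIV <= (\<Union>N. V N)"
   proof
    fix x
    have "ennreal t < (\<Sum>n. ennreal (h n x))" using t h(2)[of x] by (meson ennreal_less_one_iff less_le_trans)
    then obtain N where "ennreal t < (\<Sum>n<N. ennreal (h n x))" unfolding suminf_eq_SUP less_SUP_iff by blast
    hence "x : V N" using t C_plusD(2)[OF h(1)] by (simp add: V_def sum_ennreal ennreal_less_iff)
    thus "x : (\<Union>N. V N)" by blast
   qed
   ultimately obtain D where D: "finite D" "UNIV <= (\<Union>N\<in>D. V N)" using compactE_image[OF compact_UNIV, of UNIV V] by auto
   define N where "N = Max (insert 0 D)"
   have "t <= (\<Sum>n<N. h n x)" for x
   proof -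
    obtain M where M: "M : D" "x : V M" using D(2) by blast
    hence "M <= N" unfolding N_def using D(1) by (intro Max_ge) auto
    hence "(\<Sum>n<M. h n x) <= (\<Sum>n<N. h n x)" using C_plusD(2)[OF h(1)] by (intro sum_mono2) auto
    thus ?thesis using M(2) by (simp add: V_def)
   qed
   hence "Lambda (%x. t * 1) <= Lambda (%x. \<Sum>n<N. h n x)" using t sumC by (intro functional_diff(3)) (auto intro: C_plus_const)
   hence "t * Lambda (%x. 1) <= (\<Sum>n<N. Lambda (h n))" using homogeneous[of "%x. 1" t] t h(1) by (simp add: functional_sum C_plus_const)
   hence "ennreal (t * Lambda (%x. 1)) <= (\<Sum>n<N. ennreal (Lambda (h n)))" using h(1) nonneg by (simp add: sum_ennreal ennreal_leI)
   also have "... <= (\<Sum>n. ennreal (Lambda (h n)))" by (intro sum_le_suminf) auto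
   finally show ?thesis .
  qed
  \<comment> \<open>The shift to \<open>n + 2\<close> keeps the factors at least \<open>1/2\<close>,
    hence admissible values of \<open>t\<close>.\<close>
  have lim: "(%n. ennreal ((1 - inverse (real (Suc (Suc n)))) * Lambda (%x. 1))) ----> ennreal ((1 - 0) * Lambda (%x. 1))"
   by (intro tendsto_ennrealI tendsto_intros LIMSEQ_Suc[OF LIMSEQ_inverse_real_of_nat])
  have le: "ennreal ((1 - inverse (real (Suc (Suc n)))) * Lambda (%x. 1)) <= (\<Sum>n. ennreal (Lambda (h n)))" for n
   by (rule key) (auto simp: field_simps)
  have "ennreal ((1 - 0) * Lambda (%x. 1)) <= (\<Sum>n. ennreal (Lambda (h n)))" by (rule LIMSEQ_le_const2[OF lim]) (use le in blast)
  thus "ennreal (Lambda (%x. 1)) <= (\<Sum>n. ennreal (Lambda (h n)))" by simp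
 qed
qed

lemma finite_riesz: "finite_measure riesz" by (rule finite_measureI) (simp add: emeasure_riesz outer_UNIV)

lemma measure_riesz_UNIV: "measure riesz UNIV = Lambda (%x. 1)"
 using nonneg[OF C_plus_const[of 1]] by (simp add: measure_def emeasure_riesz outer_UNIV)

lemma integrable_riesz:
 assumes "h : C_plus" shows "integrable riesz h" "EX b>0. ALL x. h x <= b"
proof -
 note h = continuous_bdd_borel[OF C_plusD(1)[OF assms]]
 then obtain b where b: "!!x. abs (h x) <= b" by (auto simp: bdd_borel_def)
 thus "EX b>0. ALL x. h x <= b"
  by (intro exI[of _ "abs b + 1"]) (auto intro: order_trans[OF abs_ge_self] simp: add_increasing2 order_trans[of _ b])
 show "integrable riesz h" by (rule integrable_bounded_borel[OF finite_riesz _ h]) simp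
qed

text \<open>\<open>h\<close> is cut horizontally into layers \<open>g j\<close> of height
  \<open>1 / n\<close>. Layer \<open>j + 1\<close> lives on \<open>S j\<close>, where layer
  \<open>j\<close> is full, so its integral is at most \<open>Lambda (g j)\<close>; this shift by
  one costs the bottom layer, of integral at most the total mass over \<open>n\<close>.\<close>

lemma integral_riesz_le:
 assumes h: "h : C_plus" "!!x. h x <= 1" shows "(LINT x|riesz. h x) <= Lambda h"
proof -
 interpret R: finite_measure riesz by (rule finite_riesz)
 have step: "(LINT x|riesz. h x) <= Lambda h + measure riesz UNIV / real (Suc N)" for N
 proof -
  define n where "n = real (Suc N)"
  have n: "n > 0" by (simp add: n_def)
  define g where "g j x = min (h x) (real (Suc j) / n) - min (h x) (real j / n)" for j x
  have g0: "0 <= g j x" "g j x <= 1 / n" for j x using n by (auto simp: g_def min_def field_simps)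
  have gC: "g j : C_plus" for j using g0 C_plusD(1)[OF h(1)] by (intro C_plusI) (auto simp: g_def[abs_def] intro!: continuous_intros)
  have sumg: "(\<Sum>j<Suc N. g j x) = h x" for x
   using sum_lessThan_telescope[of "%j. min (h x) (real j / n)" "Suc N"] h(2)[of x] C_plusD(2)[OF h(1), of x] by (simp add: g_def n_def)
  define S where "S j = {x. real (Suc j) / n <= h x}" for j
  have Sm: "S j : sets borel" for j unfolding S_def using C_plusD(1)[OF h(1)] by (intro borel_closed closed_Collect_le) auto
  have S_le: "measure riesz (S j) <= n * Lambda (g j)" for j
  proof -
   have "outer (S j) <= ennreal (Lambda (%x. n * g j x))"
   proof (rule outer_le_single)
    show "(%x. n * g j x) : C_plus" using gC[of j] n by (auto simp: C_plus_def intro!: continuous_intros)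
    show "1 <= n * g j x" if "x : S j" for x
    proof -
     have "real j / n <= real (Suc j) / n" using n by (intro divide_right_mono) auto
     hence "g j x = real (Suc j) / n - real j / n" using that by (simp add: S_def g_def min_def)
     thus ?thesis using n by (simp add: field_simps)
    qed
   qed
   hence "ennreal (measure riesz (S j)) <= ennreal (n * Lambda (g j))"
    using homogeneous[OF gC, of n j] n by (simp add: R.emeasure_eq_measure[symmetric] emeasure_riesz Sm)
   thus ?thesis using n nonneg[OF gC, of j] by (simp add: ennreal_le_iff)
  qed
  have gS: "g (Suc j) x <= (1 / n) * indicator (S j) x" for j x
  proof (cases "x : S j")
   case False
   hence "g (Suc j) x = 0" using n by (auto simp: S_def g_def min_def field_simps)
   thus ?thesis using False by simp
  qed (use g0 in simp)
  have int_g: "(LINT x|riesz. g (Suc j) x) <= Lambda (g j)" for j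
  proof -
   have "(LINT x|riesz. g (Suc j) x) <= (LINT x|riesz. (1 / n) * indicator (S j) x)" using integrable_riesz(1)[OF gC] gS
    by (intro integral_mono integrable_mult_right integrable_real_indicator) (auto simp: Sm R.emeasure_finite less_top[symmetric])
   also have "... = (1 / n) * measure riesz (S j)" using Sm by simp
   also have "... <= (1 / n) * (n * Lambda (g j))" using S_le n by (intro mult_left_mono) auto
   finally show ?thesis using n by simp
  qed
  have "(LINT x|riesz. h x) = (LINT x|riesz. (\<Sum>j<Suc N. g j x))" by (simp only: sumg)
  also have "... = (\<Sum>j<Suc N. LINT x|riesz. g j x)" using integrable_riesz(1)[OF gC] by (intro Bochner_Integration.integral_sum) auto
  also have "... = (LINT x|riesz. g 0 x) + (\<Sum>j<N. LINT x|riesz. g (Suc j) x)" by (rule sum.lessThan_Suc_shift)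
  also have "... <= (LINT x|riesz. 1 / n) + (\<Sum>j<N. Lambda (g j))"
   using integrable_riesz(1)[OF gC] g0 int_g by (intro add_mono integral_mono sum_mono) auto
  also have "(\<Sum>j<N. Lambda (g j)) <= (\<Sum>j<Suc N. Lambda (g j))" using nonneg[OF gC] by simp
  also have "(\<Sum>j<Suc N. Lambda (g j)) = Lambda (%x. \<Sum>j<Suc N. g j x)" using gC by (intro functional_sum[symmetric]) auto
  finally show ?thesis by (simp only: sumg) (simp add: n_def)
 qed
 have "(%N. Lambda h + measure riesz UNIV * inverse (real (Suc N))) ----> Lambda h + measure riesz UNIV * 0"
  by (intro tendsto_intros LIMSEQ_inverse_real_of_nat)
 thus ?thesis using step by (intro LIMSEQ_le_const[of _ "Lambda h"]) (auto simp: divide_inverse)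
qed

text \<open>After scaling below 1, the upper bound applied to \<open>1 - k\<close> becomes the lower
  bound for \<open>k\<close>, because the total mass is exactly \<open>Lambda\<close> of 1.\<close>

lemma integral_riesz:
 assumes h: "h : C_plus" shows "(LINT x|riesz. h x) = Lambda h"
proof -
 interpret R: finite_measure riesz by (rule finite_riesz)
 obtain b where b: "b > 0" "!!x. h x <= b" using integrable_riesz(2)[OF h] by blast
 define k where "k x = h x / b" for x
 have k: "k : C_plus" "!!x. k x <= 1" using h b by (auto simp: C_plus_def k_def[abs_def] intro!: continuous_intros)
 note d = functional_diff[OF k(1) C_plus_const[of 1] k(2), simplified]
 have "(LINT x|riesz. 1 - k x) <= Lambda (%x. 1 - k x)" using d(1) C_plusD(2)[OF k(1)] by (intro integral_riesz_le) auto
 hence "Lambda k <= (LINT x|riesz. k x)" using integrable_riesz(1)[OF k(1)] d(2) measure_riesz_UNIV by simp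
 hence "(LINT x|riesz. k x) = Lambda k" using integral_riesz_le[OF k] by simp
 thus ?thesis using homogeneous[OF k(1), of b] b by (simp add: k_def field_simps)
qed

end

text \<open>\<open>Lambda\<close> is the positive part of \<open>phi\<close>, and
  \<open>Lambda - phi\<close> is positive too, so each has a measure. Their masses are at most
  \<open>C\<close> and \<open>2 * C\<close>, which explains the factor 3.\<close>

theorem (in compact_space) riesz_representation:
 fixes phi :: "('a => real) => real"
 assumes add: "!!h k. continuous_on UNIV h ==> continuous_on UNIV k ==> phi (%x. h x + k x) = phi h + phi k"
  and scale: "!!c h. continuous_on UNIV h ==> phi (%x. c * h x) = c * phi h"
  and bd: "!!h b. continuous_on UNIV h ==> (!!x. abs (h x) <= b) ==> abs (phi h) <= C * b"
 obtains mu :: "'a set => real" where "mu : carr Meas" "vnorm Meas mu <= 3 * C"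
  "!!h. continuous_on UNIV h ==> sint mu h = phi h"
proof -
 define Lambda where "Lambda h = (SUP g\<in>{g : C_plus. ALL x. g x <= h x}. phi g)" for h
 have bdd: "EX b. ALL x. abs (h x) <= b" if "continuous_on UNIV h" for h :: "'a => real"
  using continuous_bdd_borel[OF that] by (simp add: bdd_borel_def)
 have C0: "0 <= C" using bd[of "%x. 0" 1] by auto
 have cont: "continuous_on UNIV h" if "h : C_plus" for h :: "'a => real" using that by (simp add: C_plus_def)
 have nn: "0 <= h x" if "h : C_plus" for h :: "'a => real" and x using that by (simp add: C_plus_def)
 have ub: "phi g <= C * b" if "g : C_plus" "!!x. g x <= h x" "!!x. h x <= b" for g h b
 proof -
  have "abs (g x) <= b" for x using nn[OF that(1), of x] that(2,3)[of x] by simp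
  thus ?thesis using bd[OF cont[OF that(1)]] by (meson abs_le_D1)
 qed
 have bddab: "bdd_above (phi ` {g : C_plus. ALL x. g x <= h x})" if h: "h : C_plus" for h
 proof -
  obtain b where "!!x. abs (h x) <= b" using bdd[OF cont[OF h]] by blast
  hence "h x <= b" for x by (meson abs_le_D1)
  thus ?thesis using ub by (intro bdd_aboveI[of _ "C * b"]) auto
 qed
 have up: "phi g <= Lambda h" if "h : C_plus" "g : C_plus" "!!x. g x <= h x" for g h
  unfolding Lambda_def using that by (intro cSUP_upper bddab) auto
 have z: "(%x. 0) : C_plus" by (simp add: C_plus_def)
 have phi0: "phi (%x. 0) = 0" using scale[of "%x. 0" 0] by simp
 have least: "Lambda h <= r" if "h : C_plus" "!!g. g : C_plus ==> (!!x. g x <= h x) ==> phi g <= r" for h r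
  unfolding Lambda_def using that z nn by (intro cSUP_least) auto
 have plus: "(%x. h x + k x) : C_plus" if "h : C_plus" "k : C_plus" for h k :: "'a => real"
  using that by (auto simp: C_plus_def intro!: continuous_intros)
 have times: "(%x. c * h x) : C_plus" if "h : C_plus" "0 <= c" for h :: "'a => real" and c
  using that by (auto simp: C_plus_def intro!: continuous_intros)
 have L_nonneg: "0 <= Lambda h" if "h : C_plus" for h using up[OF that z] nn[OF that] phi0 by simp
 have L_add: "Lambda (%x. h x + k x) = Lambda h + Lambda k" if h: "h : C_plus" and k: "k : C_plus" for h k
 proof (rule antisym)
  show "Lambda (%x. h x + k x) <= Lambda h + Lambda k"
  proof (rule least[OF plus[OF h k]])
   fix g assume g: "g : C_plus" "!!x. g x <= h x + k x"
   \<comment> \<open>The Riesz decomposition of \<open>g <= h + k\<close> into a part below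
     \<open>h\<close> and a rest below \<open>k\<close>.\<close>
   define g1 where "g1 x = min (g x) (h x)" for x
   have g1: "g1 : C_plus" "(%x. g x - g1 x) : C_plus" using cont[OF g(1)] cont[OF h] nn[OF g(1)] nn[OF h]
    by (auto simp: C_plus_def g1_def[abs_def] intro!: continuous_intros)
   have "phi g = phi g1 + phi (%x. g x - g1 x)" using add[OF cont[OF g1(1)] cont[OF g1(2)]] by simp
   also have "... <= Lambda h + Lambda k"
    using g(2) nn[OF k] by (intro add_mono up[OF h g1(1)] up[OF k g1(2)]) (auto simp: g1_def min_def algebra_simps)
   finally show "phi g <= Lambda h + Lambda k" .
  qed
  have "phi f + phi g <= Lambda (%x. h x + k x)" if "f : C_plus" "!!x. f x <= h x" "g : C_plus" "!!x. g x <= k x" for f g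
   using up[OF plus[OF h k] plus[OF that(1,3)]] add[OF cont[OF that(1)] cont[OF that(3)]] that(2,4) by (simp add: add_mono)
  hence "phi f <= Lambda (%x. h x + k x) - phi g" if "f : C_plus" "!!x. f x <= h x" "g : C_plus" "!!x. g x <= k x" for f g
   using that by (simp add: le_diff_eq)
  hence "Lambda h <= Lambda (%x. h x + k x) - phi g" if "g : C_plus" "!!x. g x <= k x" for g using that by (intro least[OF h]) auto
  hence "phi g <= Lambda (%x. h x + k x) - Lambda h" if "g : C_plus" "!!x. g x <= k x" for g
   using that by (simp add: le_diff_eq add.commute)
  hence "Lambda k <= Lambda (%x. h x + k x) - Lambda h" by (intro least[OF k]) auto
  thus "Lambda h + Lambda k <= Lambda (%x. h x + k x)" by simp
 qed
 have L_scale: "Lambda (%x. c * h x) = c * Lambda h" if h: "h : C_plus" and c: "0 <= c" for h c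
 proof (cases "c = 0")
  case True
  have "Lambda (%x. 0) <= 0"
  proof (rule least[OF z])
   fix g :: "'a => real" assume "g : C_plus" "!!x. g x <= 0"
   hence "g = (%x. 0)" using nn[of g] by (intro ext antisym) auto
   thus "phi g <= 0" using phi0 by simp
  qed
  thus ?thesis using True L_nonneg[OF z] by simp
 next
  case False
  have le: "Lambda (%x. c * h x) <= c * Lambda h" if h: "h : C_plus" and c: "0 < c" for h c
  proof (rule least)
   show "(%x. c * h x) : C_plus" using times[OF h] c by simp
   fix g :: "'a => real" assume g: "g : C_plus" "!!x. g x <= c * h x"
   have g': "(%x. (1 / c) * g x) : C_plus" using times[OF g(1), of "1/c"] c by simp
   have "phi (%x. (1 / c) * g x) <= Lambda h" using g c by (intro up[OF h g']) (simp add: field_simps)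
   thus "phi g <= c * Lambda h" unfolding scale[OF cont[OF g(1)]] using c by (simp add: field_simps)
  qed
  have "Lambda (%x. (1 / c) * (c * h x)) <= (1 / c) * Lambda (%x. c * h x)" using le[OF times[OF h c], of "1 / c"] False c by simp
  thus ?thesis using le[OF h, of c] False c by (simp add: field_simps)
 qed
 interpret P: positive_functional dummy Lambda by unfold_locales (use L_nonneg L_add L_scale in auto)
 interpret N: positive_functional dummy "%h. Lambda h - phi h" by unfold_locales
   (use up L_add L_scale add scale cont in \<open>auto simp: algebra_simps\<close>)
 define mu where "mu = restrict (%B. measure P.riesz B - measure N.riesz B) (sets borel)"
 note dom = Meas_dom[OF P.finite_riesz P.sets_riesz(1) N.finite_riesz N.sets_riesz(1), folded mu_def]
 have one: "(%x. 1) : (C_plus :: ('a => real) set)" by (simp add: C_plus_def)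
 have "Lambda (%x. 1) <= C" using ub[of _ "%x. 1" 1] by (intro least[OF one]) auto
 moreover have "abs (phi (%x. 1)) <= C" using bd[of "%x. 1" 1] by simp
 ultimately have "vnorm Meas mu <= 3 * C" using dom(2) unfolding P.measure_riesz_UNIV N.measure_riesz_UNIV by linarith
 moreover have "sint mu h = phi h" if h: "continuous_on UNIV h" for h
 proof -
  obtain b where b: "!!x. abs (h x) <= b" using bdd[OF h] by blast
  \<comment> \<open>The integral formula is available for nonnegative functions only, so
    \<open>h\<close> is lifted by a bound \<open>b\<close> and the constant is subtracted
    again.\<close>
  define k where "k x = h x + b" for x
  have h0: "0 <= h x + b" for x using b[of x] by linarith
  have k: "k : C_plus" "(%x. b) : C_plus" using h h0 b[of undefined] by (auto simp: C_plus_def k_def[abs_def] intro!: continuous_intros)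
  note hb = continuous_bdd_borel[OF h]
  have i: "integrable P.riesz h" "integrable N.riesz h"
   by (rule integrable_bounded_borel[OF P.finite_riesz _ hb], simp, rule integrable_bounded_borel[OF N.finite_riesz _ hb], simp)
  interpret PF: finite_measure P.riesz by (rule P.finite_riesz)
  interpret NF: finite_measure N.riesz by (rule N.finite_riesz)
  have "sint mu h = (LINT x|P.riesz. h x) - (LINT x|N.riesz. h x)" by (rule dom(3)[OF hb])
  also have "(LINT x|P.riesz. h x) = (LINT x|P.riesz. k x) - (LINT x|P.riesz. b)" using i by (simp add: k_def)
  also have "(LINT x|N.riesz. h x) = (LINT x|N.riesz. k x) - (LINT x|N.riesz. b)" using i by (simp add: k_def)
  finally have "sint mu h = phi k - phi (%x. b)" using P.integral_riesz[OF k(1)] P.integral_riesz[OF k(2)]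
    N.integral_riesz[OF k(1)] N.integral_riesz[OF k(2)] by simp
  also have "... = phi h" using add[OF h continuous_on_const[of UNIV b]] by (simp add: k_def[abs_def])
  finally show ?thesis .
 qed
 ultimately show thesis using that dom(1) by blast
qed

section \<open>Lebesgue spaces\<close>

text \<open>\<open>powr_convex\<close> handles positive arguments; with a zero argument the claim
  reduces to \<open>s powr p <= s\<close> for \<open>s\<close> between 0 and 1.\<close>

lemma convex_powr_nonneg:
 fixes x y t p :: real
 assumes p: "1 <= p" and xy: "0 <= x" "0 <= y" and t: "0 <= t" "t <= 1"
 shows "(t * x + (1 - t) * y) powr p <= t * x powr p + (1 - t) * y powr p"
proof -
 have le: "(s * z) powr p <= s * z powr p" if "0 <= s" "s <= 1" "0 <= z" for s z :: real
 proof (cases "s = 0")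
  case False
  hence "s powr p <= s powr 1" using that p by (intro powr_mono') auto
  hence "s powr p <= s" using that False by simp
  thus ?thesis using that by (simp add: powr_mult mult_right_mono)
 qed simp
 consider "x = 0" | "y = 0" | "0 < x" "0 < y" using xy by linarith
 thus ?thesis
 proof cases
  case 1 thus ?thesis using le[of "1 - t" y] t xy by simp
 next
  case 2 thus ?thesis using le[of t x] t xy by simp
 next
  case 3
  thus ?thesis using convex_onD[OF powr_convex[OF p], of "1 - t" x y] t by simp
 qed
qed

definition Lp_funs :: "'a measure => real => ('a => real) set" where
 "Lp_funs m p = {f : borel_measurable m. integrable m (%x. abs (f x) powr p)}"

definition Lp_norm :: "'a measure => real => ('a => real) => real" where
 "Lp_norm m p f = (LINT x|m. abs (f x) powr p) powr (1 / p)"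

definition Lp_pre :: "'a measure => real => ('a => real) nvs" where
 "Lp_pre m p = vmaps UNIV real_nvs (Lp_funs m p) (Lp_norm m p)"

lemma Lp_eq: "Lp m p = vquotient (Lp_pre m p) (null_funs m)" by (simp add: Lp_def Lp_pre_def Lp_funs_def Lp_norm_def[abs_def])

lemma Lp_pre_simps [simp]:
 "carr (Lp_pre m p) = Lp_funs m p" "vnorm (Lp_pre m p) = Lp_norm m p"
 "vzero (Lp_pre m p) = (%x. 0)" "vadd (Lp_pre m p) f g = (%x. f x + g x)"
 "vscale (Lp_pre m p) c f = (%x. c * f x)" "vdiff (Lp_pre m p) f g = (%x. f x - g x)" by (simp_all add: Lp_pre_def)

lemma Lp_norm_nonneg: "0 <= Lp_norm m p f" by (simp add: Lp_norm_def)

lemma Lp_norm_powr: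
 "1 <= p ==> Lp_norm m p f powr p = (LINT x|m. abs (f x) powr p)" by (simp add: Lp_norm_def powr_powr integral_nonneg_AE)

lemma Lp_norm_le:
 assumes "1 <= p" "0 <= C" "(LINT x|m. abs (f x) powr p) <= C powr p" shows "Lp_norm m p f <= C"
proof -
 have "Lp_norm m p f <= (C powr p) powr (1 / p)" unfolding Lp_norm_def using assms by (intro powr_mono2) (auto intro!: integral_nonneg_AE)
 thus ?thesis using assms by (simp add: powr_powr)
qed

lemma Lp_norm_ge:
 assumes p: "1 <= p" and c: "Lp_norm m p h <= c" "0 < c" shows "(LINT x|m. (abs (h x) / c) powr p) <= 1"
proof -
 have "(LINT x|m. (abs (h x) / c) powr p) = Lp_norm m p h powr p / c powr p" using c by (simp add: powr_divide Lp_norm_powr[OF p])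
 also have "... <= c powr p / c powr p" using c p by (intro divide_right_mono powr_mono2) (auto simp: Lp_norm_nonneg)
 finally show ?thesis using c by simp
qed

lemma Lp_norm_scale:
 assumes p: "1 <= p" shows "Lp_norm m p (%x. c * f x) = abs c * Lp_norm m p f"
proof -
 have "(LINT x|m. abs (c * f x) powr p) = abs c powr p * (LINT x|m. abs (f x) powr p)" by (simp add: abs_mult powr_mult)
 thus ?thesis using p by (simp add: Lp_norm_def powr_mult powr_powr integral_nonneg_AE)
qed

lemma Lp_funs_scale: "1 <= p ==> f : Lp_funs m p ==> (%x. c * f x) : Lp_funs m p" by (auto simp: Lp_funs_def abs_mult powr_mult)

text \<open>Convexity with weights \<open>a / (a + b)\<close> and \<open>b / (a + b)\<close>. With
  \<open>a\<close>, \<open>b\<close> in the role of the two norms this is the pointwise form of the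
  Minkowski inequality.\<close>

lemma Lp_add_bound:
 fixes a b f g p :: real
 assumes p: "1 <= p" and a: "0 < a" and b: "0 < b"
 shows "abs (f + g) powr p <= (a + b) powr p * (a / (a + b) * (abs f / a) powr p + b / (a + b) * (abs g / b) powr p)"
proof -
 define t where "t = a / (a + b)"
 have "a + b > 0" using a b by simp
 hence t: "0 <= t" "t <= 1" "1 - t = b / (a + b)" using a b by (auto simp: t_def field_simps)
 have "(t * (abs f / a) + (1 - t) * (abs g / b)) powr p <= t * (abs f / a) powr p + (1 - t) * (abs g / b) powr p"
  using a b t by (intro convex_powr_nonneg[OF p]) auto
 moreover have "t * (abs f / a) + (1 - t) * (abs g / b) = (abs f + abs g) / (a + b)"
  unfolding t(3) using a b by (simp add: t_def add_divide_distrib)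
 ultimately have "((abs f + abs g) / (a + b)) powr p <= t * (abs f / a) powr p + (1 - t) * (abs g / b) powr p" by simp
 hence "(a + b) powr p * ((abs f + abs g) / (a + b)) powr p
   <= (a + b) powr p * (t * (abs f / a) powr p + (1 - t) * (abs g / b) powr p)" by (intro mult_left_mono) auto
 moreover have "(a + b) powr p * ((abs f + abs g) / (a + b)) powr p = (abs f + abs g) powr p" using a b by (simp add: powr_divide)
 moreover have "abs (f + g) powr p <= (abs f + abs g) powr p" using p by (intro powr_mono2) auto
 ultimately show ?thesis unfolding t(3) by (simp add: t_def)
qed

lemma Lp_funs_add:
 assumes p: "1 <= p" and f: "f : Lp_funs m p" and g: "g : Lp_funs m p" shows "(%x. f x + g x) : Lp_funs m p"
proof -
 have m[measurable]: "f : borel_measurable m" "g : borel_measurable m" using f g by (auto simp: Lp_funs_def)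
 have "integrable m (%x. abs (f x + g x) powr p)"
 proof (rule Bochner_Integration.integrable_bound)
  show "integrable m (%x. 2 powr p * (1 / 2 * abs (f x) powr p + 1 / 2 * abs (g x) powr p))" using f g by (auto simp: Lp_funs_def)
  show "AE x in m. norm (abs (f x + g x) powr p) <= norm (2 powr p * (1 / 2 * abs (f x) powr p + 1 / 2 * abs (g x) powr p))"
   using Lp_add_bound[OF p, of 1 1] by (intro AE_I2) simp
 qed simp
 thus ?thesis by (simp add: Lp_funs_def)
qed

lemma minkowski:
 assumes p: "1 <= p" and f: "f : Lp_funs m p" and g: "g : Lp_funs m p" shows "Lp_norm m p (%x. f x + g x) <= Lp_norm m p f + Lp_norm m p g"
proof (rule field_le_epsilon)
 fix e :: real assume e: "e > 0"
 \<comment> \<open>The added \<open>e / 2\<close> keeps the normalizing factors positive even if a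
   norm vanishes.\<close>
 define a b where "a = Lp_norm m p f + e / 2" and "b = Lp_norm m p g + e / 2"
 have ab: "0 < a" "0 < b" using e Lp_norm_nonneg[of m p f] Lp_norm_nonneg[of m p g] by (auto simp: a_def b_def)
 have i: "integrable m (%x. (abs (f x) / a) powr p)" "integrable m (%x. (abs (g x) / b) powr p)"
  using f g ab by (auto simp: Lp_funs_def powr_divide)
 have "(LINT x|m. abs (f x + g x) powr p)
   <= (LINT x|m. (a + b) powr p * (a / (a + b) * (abs (f x) / a) powr p + b / (a + b) * (abs (g x) / b) powr p))"
  using Lp_add_bound[OF p ab] Lp_funs_add[OF p f g] i by (intro integral_mono) (auto simp: Lp_funs_def)
 also have "... = (a + b) powr p * (a / (a + b) * (LINT x|m. (abs (f x) / a) powr p) + b / (a + b) * (LINT x|m. (abs (g x) / b) powr p))"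
  using i by simp
 also have "... <= (a + b) powr p * (a / (a + b) * 1 + b / (a + b) * 1)"
  using ab Lp_norm_ge[OF p, of m f a] Lp_norm_ge[OF p, of m g b] e by (intro mult_left_mono add_mono) (auto simp: a_def b_def)
 also have "... = (a + b) powr p" using ab by (simp add: add_divide_distrib[symmetric])
 finally have "Lp_norm m p (%x. f x + g x) <= a + b" using ab by (intro Lp_norm_le[OF p]) auto
 thus "Lp_norm m p (%x. f x + g x) <= Lp_norm m p f + Lp_norm m p g + e" by (simp add: a_def b_def)
qed

lemma seminormed_Lp_pre: "1 <= p ==> seminormed (Lp_pre m p)" unfolding Lp_pre_def by (rule seminormed_fun)
  (simp_all add: Lp_funs_scale Lp_funs_add minkowski Lp_norm_scale Lp_norm_nonneg, simp add: Lp_funs_def)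

lemma null_funs_Lp:
 assumes p: "1 <= p" shows "null_funs m = {f : Lp_funs m p. Lp_norm m p f = 0}"
proof -
 have "f : Lp_funs m p & Lp_norm m p f = 0" if f: "f : null_funs m" for f
 proof -
  have m: "f : borel_measurable m" and ae: "AE x in m. abs (f x) powr p = 0" using f by (auto simp: null_funs_def)
  have "integrable m (%x. abs (f x) powr p) \<longleftrightarrow> integrable m (%x. 0 :: real)"
   using m ae by (intro integrable_cong_AE) auto
  moreover have "(LINT x|m. abs (f x) powr p) = (LINT x|m. 0 :: real)" using m ae by (intro integral_cong_AE) auto
  ultimately show ?thesis using m by (simp add: Lp_funs_def Lp_norm_def)
 qed
 moreover have "f : null_funs m" if f: "f : Lp_funs m p" "Lp_norm m p f = 0" for f
 proof -
  have "(LINT x|m. abs (f x) powr p) = 0" using f(2) p Lp_norm_powr[OF p, of m f] by simp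
  hence "AE x in m. abs (f x) powr p = 0" using f(1) by (subst (asm) integral_nonneg_eq_0_iff_AE) (auto simp: Lp_funs_def)
  thus ?thesis using f(1) by (auto simp: null_funs_def Lp_funs_def)
 qed
 ultimately show ?thesis by blast
qed

lemma vsubspace_null_funs_Lp:
 assumes p: "1 <= p" shows "vsubspace (Lp_pre m p) (null_funs m)" "vclosure (Lp_pre m p) (null_funs m) <= null_funs m"
proof -
 interpret seminormed "Lp_pre m p" by (rule seminormed_Lp_pre[OF p])
 show "vsubspace (Lp_pre m p) (null_funs m)" "vclosure (Lp_pre m p) (null_funs m) <= null_funs m"
  unfolding null_funs_Lp[OF p] using vsubspace_norm_zero vclosure_norm_zero by simp_all
qed

abbreviation ae_class :: "'a measure => ('a => real) => ('a => real) set" where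
 "ae_class m f \<equiv> {%x. f x + n x | n. n : null_funs m}"

lemma vcoset_Lp: "vcoset (Lp_pre m p) (null_funs m) f = ae_class m f" by (simp add: vcoset_def)

lemma normed_Lp: "1 <= p ==> normed_space_on (Lp m p)" unfolding Lp_eq
 by (intro seminormed.normed_vquotient seminormed_Lp_pre vsubspace_null_funs_Lp)

lemma null_funs_iff: "f : null_funs m \<longleftrightarrow> f : borel_measurable m & (AE x in m. f x = 0)" by (simp add: null_funs_def)

lemma mem_ae_class:
 assumes "f : borel_measurable m" shows "g : ae_class m f \<longleftrightarrow> g : borel_measurable m & (AE x in m. g x = f x)"
proof
 assume "g : borel_measurable m & (AE x in m. g x = f x)"
 hence "(%x. g x - f x) : null_funs m" using assms by (auto simp: null_funs_iff)
 thus "g : ae_class m f" by (intro CollectI exI[of _ "%x. g x - f x"]) auto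
next
 assume "g : ae_class m f"
 thus "g : borel_measurable m & (AE x in m. g x = f x)" using assms by (auto simp: null_funs_iff)
qed

lemma Lp_simps:
 assumes p: "1 <= p" shows "carr (Lp m p) = ae_class m ` Lp_funs m p" "vzero (Lp m p) = ae_class m (%x. 0)"
  "f : Lp_funs m p ==> g : Lp_funs m p ==>
   vadd (Lp m p) (ae_class m f) (ae_class m g) = ae_class m (%x. f x + g x)"
  "f : Lp_funs m p ==> vscale (Lp m p) c (ae_class m f) = ae_class m (%x. c * f x)"
  "f : Lp_funs m p ==> vnorm (Lp m p) (ae_class m f) = Lp_norm m p f"
proof -
 interpret seminormed "Lp_pre m p" by (rule seminormed_Lp_pre[OF p])
 note N = vsubspace_null_funs_Lp(1)[OF p, of m]
 note q = vquotient_simps[OF N, unfolded vcoset_Lp Lp_eq[symmetric]]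
 show "carr (Lp m p) = ae_class m ` Lp_funs m p" "vzero (Lp m p) = ae_class m (%x. 0)"
  using q(1,2) by (simp_all add: image_def vcoset_Lp)
 show "f : Lp_funs m p ==> g : Lp_funs m p ==>
   vadd (Lp m p) (ae_class m f) (ae_class m g) = ae_class m (%x. f x + g x)" using q(3)[of f g] by simp
 show "f : Lp_funs m p ==> vscale (Lp m p) c (ae_class m f) = ae_class m (%x. c * f x)" using q(4)[of f c] by simp
 show "f : Lp_funs m p ==> vnorm (Lp m p) (ae_class m f) = Lp_norm m p f"
 proof -
  assume f: "f : Lp_funs m p"
  have "Lp_norm m p n = 0" if "n : null_funs m" for n using that null_funs_Lp[OF p] by blast
  thus ?thesis using vquotient_norm_const[OF N, of f] f unfolding Lp_eq vcoset_Lp by simp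
 qed
qed

lemma holder:
 assumes p: "1 < p" and q: "1 < q" and pq: "1 / p + 1 / q = 1" and f: "f : Lp_funs m p" and g: "g : Lp_funs m q"
 shows "integrable m (%x. f x * g x)" "abs (LINT x|m. f x * g x) <= Lp_norm m p f * Lp_norm m q g"
proof -
 have m[measurable]: "f : borel_measurable m" "g : borel_measurable m" using f g by (auto simp: Lp_funs_def)
 have int: "integrable m (%x. abs (f x) powr p)" "integrable m (%x. abs (g x) powr q)" using f g by (auto simp: Lp_funs_def)
 show i: "integrable m (%x. f x * g x)"
 proof (rule Bochner_Integration.integrable_bound)
  show "integrable m (%x. abs (f x) powr p / p + abs (g x) powr q / q)" using int by simp
  show "AE x in m. norm (f x * g x) <= norm (abs (f x) powr p / p + abs (g x) powr q / q)"
   using Youngs_inequality[OF p q pq, of "abs (f x)" "abs (g x)" for x] p q by (intro AE_I2) (simp add: abs_mult)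
 qed simp
 \<comment> \<open>Young's inequality after division by numbers slightly larger than the norms, so
   that vanishing norms need no separate case.\<close>
 have bd: "abs (LINT x|m. f x * g x) <= (Lp_norm m p f + e) * (Lp_norm m q g + e)" if e: "e > 0" for e
 proof -
  define a b where "a = Lp_norm m p f + e" and "b = Lp_norm m q g + e"
  have ab: "0 < a" "0 < b" "Lp_norm m p f <= a" "Lp_norm m q g <= b"
   using e Lp_norm_nonneg[of m p f] Lp_norm_nonneg[of m q g] by (auto simp: a_def b_def)
  have i': "integrable m (%x. (abs (f x) / a) powr p)" "integrable m (%x. (abs (g x) / b) powr q)" using int ab by (auto simp: powr_divide)
  have "abs (LINT x|m. f x * g x) <= (LINT x|m. abs (f x * g x))" by (rule integral_abs_bound)
  also have "... <= (LINT x|m. (a * b) * ((abs (f x) / a) powr p / p + (abs (g x) / b) powr q / q))"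
  proof (rule integral_mono)
   fix x
   have "(abs (f x) / a) * (abs (g x) / b) <= (abs (f x) / a) powr p / p + (abs (g x) / b) powr q / q"
    using ab by (intro Youngs_inequality[OF p q pq]) auto
   hence "(a * b) * ((abs (f x) / a) * (abs (g x) / b)) <= (a * b) * ((abs (f x) / a) powr p / p + (abs (g x) / b) powr q / q)"
    using ab by (intro mult_left_mono) auto
   thus "abs (f x * g x) <= (a * b) * ((abs (f x) / a) powr p / p + (abs (g x) / b) powr q / q)" using ab by (simp add: abs_mult)
  qed (use i i' in auto)
  also have "... = (a * b) * ((LINT x|m. (abs (f x) / a) powr p) / p + (LINT x|m. (abs (g x) / b) powr q) / q)" using i' by simp
  also have "... <= (a * b) * (1 / p + 1 / q)"
   using ab p q Lp_norm_ge[of p m f a] Lp_norm_ge[of q m g b] by (intro mult_left_mono add_mono divide_right_mono) auto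
  finally show ?thesis using pq by (simp add: a_def b_def)
 qed
 have "(%n. (Lp_norm m p f + inverse (real (Suc n))) * (Lp_norm m q g + inverse (real (Suc n))))
   ----> (Lp_norm m p f + 0) * (Lp_norm m q g + 0)" by (intro tendsto_intros LIMSEQ_inverse_real_of_nat)
 thus "abs (LINT x|m. f x * g x) <= Lp_norm m p f * Lp_norm m q g"
  using bd by (intro LIMSEQ_le_const[of _ "Lp_norm m p f * Lp_norm m q g"]) auto
qed

section \<open>Densities, duality and completeness over a finite Borel measure\<close>

locale borel_space = compact_space dummy + finite_measure m for dummy :: "'a::metric_space itself" and m :: "'a measure" +
 assumes sets_m: "sets m = sets borel"
begin

lemma space_m [simp]: "space m = UNIV" using sets_eq_imp_space_eq[OF sets_m] by simp

lemma measurable_m [simp]: "borel_measurable m = borel_measurable borel" by (simp add: sets_m cong: measurable_cong_sets)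

lemma in_sets_m [simp]: "A : sets m \<longleftrightarrow> A : sets borel" by (simp add: sets_m)

lemma integrable_bdd_borel: "g : bdd_borel ==> integrable m g" by (rule integrable_bounded_borel[OF finite_measure_axioms sets_m])

lemmas integrable_mult_bdd_borel = integrable_mult_bounded_borel[OF sets_m]

lemma bdd_borel_Lp:
 assumes p: "1 <= p" and g: "g : bdd_borel" shows "g : Lp_funs m p"
proof -
 obtain b where b: "!!x. abs (g x) <= b" and gm: "g : borel_measurable borel" using g by (auto simp: bdd_borel_def)
 have "abs (g x) powr p <= b powr p" for x using b[of x] p by (intro powr_mono2) auto
 hence "integrable m (%x. abs (g x) powr p)" using gm by (intro integrable_const_bound[of _ "b powr p"]) auto
 thus ?thesis using gm by (simp add: Lp_funs_def)
qed

lemma Lp_norm_bounded_le: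
 assumes p: "1 <= p" and g: "g : borel_measurable borel" "!!x. abs (g x) <= b" shows "Lp_norm m p g <= b * measure m UNIV powr (1 / p)"
proof (rule Lp_norm_le[OF p])
 have b: "0 <= b" using g(2)[of undefined] by linarith
 thus "0 <= b * measure m UNIV powr (1 / p)" by simp
 have "(LINT x|m. abs (g x) powr p) <= (LINT x|m. b powr p)" using bdd_borel_Lp[OF p bdd_borelI[OF g]] g p
  by (intro integral_mono) (auto simp: Lp_funs_def intro: powr_mono2)
 also have "... = (b * measure m UNIV powr (1 / p)) powr p" using p b by (simp add: powr_mult powr_powr)
 finally show "(LINT x|m. abs (g x) powr p) <= (b * measure m UNIV powr (1 / p)) powr p" .
qed

lemma Lp_norm_tendsto_0:
 assumes p: "1 <= p" and g: "!!n. g n : borel_measurable borel" "!!x. (%n. g n x) ----> 0"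
  and w: "w : Lp_funs m p" "!!n x. abs (g n x) <= abs (w x)" shows "(%n. Lp_norm m p (g n)) ----> 0"
proof -
 have "(%n. LINT x|m. abs (g n x) powr p) ----> (LINT x|m. 0)"
 proof (rule integral_dominated_convergence[where w="%x. abs (w x) powr p"])
  show "integrable m (%x. abs (w x) powr p)" using w by (simp add: Lp_funs_def)
  show "AE x in m. (%n. abs (g n x) powr p) ----> 0"
  proof (rule AE_I2)
   fix x
   have "(%n. abs (g n x) powr p) ----> 0 powr p" using tendsto_rabs[OF g(2)[of x]] p by (intro tendsto_powr') auto
   thus "(%n. abs (g n x) powr p) ----> 0" using p by simp
  qed
  show "AE x in m. norm (abs (g n x) powr p) <= abs (w x) powr p" for n using w p by (intro AE_I2) (auto intro: powr_mono2)
 qed (use g in auto)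
 hence "(%n. (LINT x|m. abs (g n x) powr p) powr (1 / p)) ----> 0 powr (1 / p)"
  using p by (intro tendsto_powr') (auto intro!: always_eventually integral_nonneg_AE)
 thus ?thesis by (simp add: Lp_norm_def)
qed

lemma Radon_Nikodym_finite:
 assumes N: "finite_measure N" "sets N = sets borel" and ac: "!!B. B : sets borel ==> measure m B = 0 ==> measure N B = 0"
 obtains f where "f : borel_measurable borel" "integrable m f" "!!x. 0 <= f x"
  "!!B. B : sets borel ==> measure N B = (LINT x|m. f x * indicator B x)"
proof -
 interpret N: finite_measure N by fact
 have "absolutely_continuous m N" unfolding absolutely_continuous_def null_sets_def
  using ac N(2) by (auto simp: emeasure_eq_measure N.emeasure_eq_measure)
 then obtain F where F: "F : borel_measurable m" "density m F = N" using Radon_Nikodym[of N] N(2) sets_m by auto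
 have int: "(\<integral>\<^sup>+x. F x * indicator B x \<partial>m) = emeasure N B" if "B : sets borel" for B
  using F that emeasure_density[of F m B] by simp
 have "(\<integral>\<^sup>+x. F x \<partial>m) ~= \<infinity>" using int[of UNIV] by (simp add: N.emeasure_finite)
 hence fin: "AE x in m. F x ~= \<infinity>" using F(1) by (intro nn_integral_PInf_AE) auto
 define f where "f x = enn2real (F x)" for x
 have fm: "f : borel_measurable borel" using F(1) unfolding f_def[abs_def] by simp
 have eq: "(\<integral>\<^sup>+x. ennreal (f x * indicator B x) \<partial>m) = emeasure N B" if "B : sets borel" for B
  unfolding int[OF that, symmetric] using fin by (intro nn_integral_cong_AE) (auto simp: f_def indicator_def less_top)
 have fi: "integrable m f" using eq[of UNIV] fm by (intro integrableI_nonneg) (auto simp: f_def N.emeasure_finite less_top[symmetric])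
 have "measure N B = (LINT x|m. f x * indicator B x)" if "B : sets borel" for B
 proof -
  have i: "integrable m (%x. f x * indicator B x)" using fi that by (intro integrable_mult_bdd_borel) auto
  show ?thesis using nn_integral_eq_integral[OF i] eq[OF that] by (simp add: f_def N.emeasure_eq_measure integral_nonneg_AE)
 qed
 thus thesis using that[of f] fm fi by (simp add: f_def)
qed

text \<open>The bound by a power of the measure yields countable additivity, since the tails of a
  disjoint union have measure tending to 0, and absolute continuity. Radon--Nikodym is then applied
  to both Jordan parts.\<close>

lemma functional_density:
 fixes phi :: "('a => real) => real"
 assumes phi: "bdd_functional phi" and r: "0 < r" and bd: "!!A. A : sets borel ==> abs (phi (indicator A)) <= C * measure m A powr r"
 obtains f where "f : borel_measurable borel" "integrable m f"
  "!!g. g : bdd_borel ==> phi g = (LINT x|m. f x * g x)"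
proof -
 let ?nu = "%A. phi (indicator A)"
 define nu where "nu = restrict ?nu (sets borel)"
 have add: "phi (%x. g x + k x) = phi g + phi k" if "g : bdd_borel" "k : bdd_borel" for g k using phi that by (simp add: bdd_functional_def)
 have e: "?nu {} = 0" using bd[of "{}"] r by simp
 moreover have "indicator {} = (%x::'a. 0 :: real)" by (simp add: fun_eq_iff)
 ultimately have z: "phi (%x. 0) = 0" by simp
 have Un: "?nu (A Un B) = ?nu A + ?nu B" if "A : sets borel" "B : sets borel" "A Int B = {}" for A B
 proof -
  have "indicator (A Un B) = (%x. indicator A x + indicator B x :: real)" using that(3) by (auto simp: indicator_def fun_eq_iff)
  thus ?thesis using add[of "indicator A" "indicator B"] that by simp
 qed
 have sa: "signed_additive ?nu" unfolding signed_additive_def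
 proof (intro conjI allI impI e)
  fix A :: "nat => 'a set" assume A: "range A <= sets borel" "disjoint_family A"
  define R where "R n = (\<Union>i. A i) - (\<Union>i<n. A i)" for n
  have sm: "(\<Union>i. A i) : sets borel" "(\<Union>i<n. A i) : sets borel" "R n : sets borel" for n using A by (auto simp: R_def)
  have fin: "?nu (\<Union>i<n. A i) = (\<Sum>i<n. ?nu (A i)) & measure m (\<Union>i<n. A i) = (\<Sum>i<n. measure m (A i))" for n
  proof (induction n)
   case (Suc n)
   have "A n Int A i = {}" if "i < n" for i using disjoint_family_onD[OF A(2), of n i] that by auto
   hence "A n Int (\<Union>i<n. A i) = {}" by blast
   thus ?case using Un[of "A n" "\<Union>i<n. A i"] A sm(2) Suc by (simp add: lessThan_Suc finite_measure_Union range_subsetD)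
  qed (use e z in simp)
  have U: "(\<Union>i. A i) = (\<Union>i<n. A i) Un R n" "(\<Union>i<n. A i) Int R n = {}" for n by (auto simp: R_def)
  have 1: "?nu (\<Union>i. A i) = ?nu (\<Union>i<n. A i) + ?nu (R n)" for n
   using Un[OF sm(2,3) U(2), of n] by (simp only: U(1)[of n, symmetric])
  have 2: "measure m (\<Union>i. A i) = measure m (\<Union>i<n. A i) + measure m (R n)" for n
   using finite_measure_Union[OF _ _ U(2)[of n]] sm(2,3)[of n] by (simp only: U(1)[of n, symmetric] in_sets_m simp_thms)
  have d: "?nu (\<Union>i. A i) - (\<Sum>i<n. ?nu (A i)) = ?nu (R n)"
   "measure m (R n) = measure m (\<Union>i. A i) - (\<Sum>i<n. measure m (A i))" for n
   using 1[of n] 2[of n] conjunct1[OF fin[of n]] conjunct2[OF fin[of n]] by linarith+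
  have "(%n. measure m (\<Union>i. A i) - (\<Sum>i<n. measure m (A i))) ----> measure m (\<Union>i. A i) - measure m (\<Union>i. A i)"
   using finite_measure_UNION[OF _ A(2)] A(1) sets_m by (intro tendsto_diff tendsto_const) (simp add: sums_def)
  hence "(%n. measure m (R n)) ----> 0" by (simp add: d(2))
  hence "(%n. measure m (R n) powr r) ----> 0" using r by (intro tendsto_zero_powrI[of _ _ _ r]) auto
  from tendsto_mult_right_zero[OF this, of C] have "(%n. ?nu (\<Union>i. A i) - (\<Sum>i<n. ?nu (A i))) ----> 0"
   unfolding d(1) by (rule Lim_null_comparison[rotated]) (use bd[OF sm(3)] in auto)
  from tendsto_diff[OF tendsto_const[of "?nu (\<Union>i. A i)"] this] show "(%i. ?nu (A i)) sums ?nu (\<Union>i. A i)"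
   by (simp add: sums_def)
 qed
 have "abs (?nu A) <= abs C * measure m UNIV powr r" if "A : sets borel" for A
  using order_trans[OF bd[OF that] mult_mono[OF abs_ge_self powr_mono2[OF less_imp_le[OF r] measure_nonneg finite_measure_mono]]]
   that by auto
 hence mem: "nu : carr Meas"
  unfolding nu_def by (intro MeasI(1)[OF sa, of "abs C * measure m UNIV powr r" "abs C * measure m UNIV powr r"]) (auto simp: abs_le_iff)
 have nul: "nu A = 0" if "A : sets borel" "A <= B" "B : sets borel" "measure m B = 0" for A B
 proof -
  have "measure m A <= measure m B" using that by (intro finite_measure_mono) auto
  hence "measure m A = 0" using that(4) measure_nonneg[of m A] by linarith
  thus ?thesis using bd[OF that(1)] that(1) r by (simp add: nu_def)
 qed
 note sa = MeasD(2)[OF mem]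
 have ac: "measure (pos_part nu) B = 0" "measure (neg_part nu) B = 0" if "B : sets borel" "measure m B = 0" for B
 proof -
  have "pos_fun nu B <= 0" "pos_fun (%A. - nu A) B <= 0" using nul[OF _ _ that] by (intro pos_fun_least; simp)+
  thus "measure (pos_part nu) B = 0" "measure (neg_part nu) B = 0" using emeasure_parts[OF sa that(1)] by (simp_all add: measure_def)
 qed
 obtain f1 where f1: "f1 : borel_measurable borel" "integrable m f1"
  "!!B. B : sets borel ==> measure (pos_part nu) B = (LINT x|m. f1 x * indicator B x)"
  using Radon_Nikodym_finite[OF MeasD(3)[OF mem] sets_parts(1) ac(1)] by metis
 obtain f2 where f2: "f2 : borel_measurable borel" "integrable m f2"
  "!!B. B : sets borel ==> measure (neg_part nu) B = (LINT x|m. f2 x * indicator B x)"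
  using Radon_Nikodym_finite[OF MeasD(4)[OF mem] sets_parts(2) ac(2)] by metis
 define f where "f x = f1 x - f2 x" for x
 have f: "f : borel_measurable borel" "integrable m f" using f1 f2 by (auto simp: f_def[abs_def])
 have ind: "phi (indicator B) = (LINT x|m. f x * indicator B x)" if B: "B : sets borel" for B
 proof -
  have "phi (indicator B) = (LINT x|m. f1 x * indicator B x) - (LINT x|m. f2 x * indicator B x)"
   using Meas_decomp[OF mem B] f1(3)[OF B] f2(3)[OF B] B by (simp add: nu_def)
  also have "... = (LINT x|m. f x * indicator B x)" using integrable_mult_bdd_borel[OF f1(2)] integrable_mult_bdd_borel[OF f2(2)] B
   by (simp add: f_def left_diff_distrib)
  finally show ?thesis .
 qed
 from bdd_functional_eq[OF phi bdd_functional_density[OF sets_m f(2)] ind] show thesis by (rule that[OF f])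
qed

text \<open>The converse of the Hoelder inequality, tested with \<open>sgn f \<cdot> |f|\<^sup>p\<^sup>-\<^sup>1\<close> cut off at height \<open>n\<close>.\<close>

lemma Lp_converse_holder:
 assumes p: "1 < p" and q: "1 < q" and pq: "1 / p + 1 / q = 1" and f: "f : borel_measurable borel" and C: "0 <= C"
  and bd: "!!g. g : bdd_borel ==> (LINT x|m. f x * g x) <= C * Lp_norm m q g" shows "f : Lp_funs m p" "Lp_norm m p f <= C"
proof -
 define F where "F n x = abs (f x) powr p * indicator {x. abs (f x) <= real n} x" for n x
 have Fm: "F n : borel_measurable borel" for n unfolding F_def[abs_def] using f by measurable
 have F0: "0 <= F n x" for n x by (simp add: F_def)
 have Fb: "F n x <= real n powr p" for n x using p by (auto simp: F_def indicator_def intro: powr_mono2)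
 have Fi: "integrable m (F n)" for n using Fm Fb F0 by (intro integrable_bdd_borel bdd_borelI[of _ "real n powr p"]) auto
 have le: "(LINT x|m. F n x) <= C powr p" for n
 proof -
  define g where "g x = sgn (f x) * abs (f x) powr (p - 1) * indicator {x. abs (f x) <= real n} x" for x
  have gm: "g : borel_measurable borel" unfolding g_def[abs_def] using f by measurable
  have "abs (g x) <= real n powr (p - 1)" for x using p by (auto simp: g_def indicator_def abs_mult abs_sgn_eq intro: powr_mono2)
  hence g: "g : bdd_borel" using gm by (intro bdd_borelI) auto
  have fg: "f x * g x = F n x" for x
  proof -
   have "f x * sgn (f x) * abs (f x) powr (p - 1) = abs (f x) powr p" by (cases "f x = 0") (auto simp: abs_sgn[symmetric] powr_mult_base)
   thus ?thesis by (simp add: F_def g_def mult.assoc)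
  qed
  have "(p - 1) * q = p" using p q pq by (simp add: field_simps)
  hence gq: "abs (g x) powr q = F n x" for x by (cases "f x = 0") (auto simp: F_def g_def indicator_def abs_mult abs_sgn_eq powr_powr)
  let ?I = "LINT x|m. F n x"
  have I0: "0 <= ?I" using F0 by simp
  have I: "?I <= C * ?I powr (1 / q)" using bd[OF g] by (simp add: fg gq Lp_norm_def)
  show ?thesis
  proof (cases "?I = 0")
   case False
   hence pos: "0 < ?I" using I0 by simp
   \<comment> \<open>Cancelling the power of the integral is legitimate because the cut-off makes it
     finite and the case 0 has been set aside.\<close>
   have "?I powr (1 / p) * ?I powr (1 / q) <= C * ?I powr (1 / q)" using I pos by (simp add: powr_add[symmetric] pq)
   hence "?I powr (1 / p) <= C" using pos by simp
   hence "(?I powr (1 / p)) powr p <= C powr p" using p by (intro powr_mono2) auto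
   thus ?thesis using p I0 by (simp add: powr_powr)
  qed simp
 qed
 have mono: "incseq (%n x. ennreal (F n x))" by (rule incseq_SucI) (auto simp: le_fun_def F_def indicator_def intro!: ennreal_leI)
 have sup: "(SUP n. ennreal (F n x)) = ennreal (abs (f x) powr p)" for x
 proof -
  obtain k where k: "abs (f x) <= real k" using real_arch_simple by blast
  show ?thesis
  proof (rule antisym)
   show "(SUP n. ennreal (F n x)) <= ennreal (abs (f x) powr p)" by (intro SUP_least ennreal_leI) (auto simp: F_def indicator_def)
   show "ennreal (abs (f x) powr p) <= (SUP n. ennreal (F n x))" using k by (intro SUP_upper2[of k]) (auto simp: F_def)
  qed
 qed
 have "(\<integral>\<^sup>+x. ennreal (abs (f x) powr p) \<partial>m) = (SUP n. \<integral>\<^sup>+x. ennreal (F n x) \<partial>m)"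
  unfolding sup[symmetric] using mono Fm by (intro nn_integral_monotone_convergence_SUP) auto
 also have "... <= ennreal (C powr p)" using le Fi F0 by (intro SUP_least) (simp add: nn_integral_eq_integral ennreal_leI)
 finally have nn: "(\<integral>\<^sup>+x. ennreal (abs (f x) powr p) \<partial>m) <= ennreal (C powr p)" .
 have i: "integrable m (%x. abs (f x) powr p)" using nn f by (intro integrableI_nonneg) (auto intro: le_less_trans)
 thus "f : Lp_funs m p" using f by (simp add: Lp_funs_def)
 have "(LINT x|m. abs (f x) powr p) <= C powr p" using nn nn_integral_eq_integral[OF i] by (simp add: ennreal_le_iff)
 thus "Lp_norm m p f <= C" using p C by (intro Lp_norm_le) auto
qed

lemma Lp_cutoff:
 assumes q: "1 <= q" and g: "g : Lp_funs m q"
 obtains k where "!!n. k n : bdd_borel" "!!n x. abs (k n x) <= abs (g x)" "!!x. (%n. k n x) ----> g x"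
  "(%n. Lp_norm m q (%x. k n x - g x)) ----> 0"
proof -
 have gm: "g : borel_measurable borel" using g by (simp add: Lp_funs_def)
 define k where "k n x = g x * indicator {x. abs (g x) <= real n} x" for n x
 have km: "k n : borel_measurable borel" for n unfolding k_def[abs_def] using gm by measurable
 have "k n : bdd_borel" for n using km by (intro bdd_borelI[of _ "real n"]) (auto simp: k_def indicator_def)
 moreover have "abs (k n x) <= abs (g x)" for n x by (simp add: k_def indicator_def)
 moreover have lim: "(%n. k n x) ----> g x" for x
 proof -
  obtain N where N: "abs (g x) <= real N" using real_arch_simple by blast
  hence "\<forall>\<^sub>F n in sequentially. k n x = g x" by (auto simp: eventually_sequentially k_def indicator_def intro!: exI[of _ N])
  thus ?thesis by (rule tendsto_eventually)
 qed
 moreover have "(%n. Lp_norm m q (%x. k n x - g x)) ----> 0"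
 proof (rule Lp_norm_tendsto_0[OF q _ _ g])
  show "(%x. k n x - g x) : borel_measurable borel" for n using km gm by simp
  show "(%n. k n x - g x) ----> 0" for x using lim by (rule LIM_zero)
  show "abs (k n x - g x) <= abs (g x)" for n x by (auto simp: k_def indicator_def)
 qed
 ultimately show thesis using that by blast
qed

text \<open>\<open>functional_density\<close> with exponent \<open>1 / q\<close> gives the density
  on bounded functions, the converse Hoelder inequality puts it into the dual space, and cut-offs
  extend the formula to all of the given space.\<close>

lemma Lp_duality:
 assumes p: "1 < p" and q: "1 < q" and pq: "1 / p + 1 / q = 1" and phi: "vfunc (Lp_pre m q) phi C" and C: "0 <= C"
 obtains f where "f : Lp_funs m p" "Lp_norm m p f <= C"
  "!!g. g : Lp_funs m q ==> phi g = (LINT x|m. f x * g x)"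
proof -
 have q1: "1 <= q" using q by simp
 interpret L: seminormed "Lp_pre m q" by (rule seminormed_Lp_pre[OF q1])
 note D = vfuncD[OF phi, simplified]
 note b = bdd_borel_Lp[OF q1]
 obtain f where f: "f : borel_measurable borel" "integrable m f"
  "!!g. g : bdd_borel ==> phi g = (LINT x|m. f x * g x)"
 proof (rule functional_density)
  show "bdd_functional phi"
  proof (rule bdd_functionalI)
   show "abs (phi g) <= C * measure m UNIV powr (1 / q) * c" if "g : bdd_borel" "!!x. abs (g x) <= c" for g c
    using order_trans[OF D(3)[OF b[OF that(1)]] mult_left_mono[OF Lp_norm_bounded_le[OF q1 _ that(2)] C]] that(1)
    by (simp add: bdd_borel_def mult_ac)
  qed (use D(1,2) b in blast)+
  show "abs (phi (indicator A)) <= C * measure m A powr (1 / q)" if A: "A : sets borel" for A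
  proof -
   have e: "(indicator A x :: real) powr q = indicator A x" for x by (auto simp: indicator_def)
   have "Lp_norm m q (indicator A) = measure m A powr (1 / q)" using A by (simp add: Lp_norm_def e)
   thus ?thesis using D(3)[OF b[OF bdd_borel_indicator[OF A]]] by simp
  qed
 qed (use q in simp, rule that)
 have bd: "(LINT x|m. f x * g x) <= C * Lp_norm m q g" if "g : bdd_borel" for g
  using abs_le_D1[OF D(3)[OF b[OF that]]] by (simp only: f(3)[OF that])
 note fp = Lp_converse_holder[OF p q pq f(1) C bd]
 have "phi g = (LINT x|m. f x * g x)" if g: "g : Lp_funs m q" for g
 proof -
  obtain k where k: "!!n. k n : bdd_borel" "!!n x. abs (k n x) <= abs (g x)" "!!x. (%n. k n x) ----> g x"
   "(%n. Lp_norm m q (%x. k n x - g x)) ----> 0" by (rule Lp_cutoff[OF q1 g]) (rule that)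
  have "(%n. phi (k n)) ----> phi g" using L.vfunc_tendsto[OF phi, of k g] b[OF k(1)] g k(4) by simp
  moreover have "(%n. LINT x|m. f x * k n x) ----> (LINT x|m. f x * g x)"
  proof (rule integral_dominated_convergence[where w="%x. abs (f x * g x)"])
   show "integrable m (%x. abs (f x * g x))" using holder(1)[OF p q pq fp(1) g] by simp
   show "AE x in m. norm (f x * k n x) <= abs (f x * g x)" for n using k(2) by (intro AE_I2) (simp add: abs_mult mult_left_mono)
   show "AE x in m. (%n. f x * k n x) ----> f x * g x" using k(3) by (intro AE_I2 tendsto_mult_left) auto
   have "k n : borel_measurable borel" for n using k(1) by (simp add: bdd_borel_def)
   thus "(%x. f x * k n x) : borel_measurable m" for n using f(1) by simp
  qed (use f(1) g in \<open>auto simp: Lp_funs_def\<close>)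
  ultimately show ?thesis using f(3)[OF k(1)] by (auto intro: LIMSEQ_unique)
 qed
 thus thesis using that fp by blast
qed

text \<open>\<open>L\<^sup>p\<close> is complete because it is the dual of \<open>L\<^sup>q\<close>.\<close>

lemma vcomplete_Lp_pre:
 assumes p: "1 < p" shows "vcomplete (Lp_pre m p)"
proof -
 define q where "q = p / (p - 1)"
 have q: "1 < q" and pq: "1 / p + 1 / q = 1" using p by (auto simp: q_def field_simps)
 have p1: "1 <= p" and q1: "1 <= q" using p q by auto
 let ?E = "Lp_pre m q"
 have E: "seminormed ?E" by (rule seminormed_Lp_pre[OF q1])
 define T where "T f = restrict (%g. LINT x|m. f x * g x) (Lp_funs m q)" for f
 have Tf: "vfunc ?E (T f) (Lp_norm m p f)" if "f : Lp_funs m p" for f unfolding T_def Lp_pre_simps(1)[symmetric]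
  using that holder[OF p q pq that] by (intro vfunc_restrict[OF E]) (simp add: vfunc_def algebra_simps)
 have Tmem: "T f : carr (vdual ?E)" if "f : Lp_funs m p" for f using Tf[OF that] by (auto simp: vdual_carrier_iff[OF E] T_def)
 show ?thesis
 proof (rule vcomplete_transfer[OF seminormed_Lp_pre[OF p1] vcomplete_vdual[OF E], where T=T and C=1 and D=1]; simp only: Lp_pre_simps mult_1)
  show "T (%x. f x - g x) = vdiff (vdual ?E) (T f) (T g)" if "f : Lp_funs m p" "g : Lp_funs m p" for f g
   using holder(1)[OF p q pq that(1)] holder(1)[OF p q pq that(2)] by (auto simp: vdual_ops T_def left_diff_distrib intro!: restrict_ext)
  show "vnorm (vdual ?E) (T f) <= Lp_norm m p f" if "f : Lp_funs m p" for f by (rule vdual_norm_le[OF Tf[OF that] Lp_norm_nonneg])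
  show "Lp_norm m p f <= vnorm (vdual ?E) (T f)" if f: "f : Lp_funs m p" for f
  proof (rule Lp_converse_holder(2)[OF p q pq])
   show "f : borel_measurable borel" using f by (simp add: Lp_funs_def)
   show "0 <= vnorm (vdual ?E) (T f)" using vdual_norm(2)[OF E Tmem[OF f]] .
   show "(LINT x|m. f x * g x) <= vnorm (vdual ?E) (T f) * Lp_norm m q g" if "g : bdd_borel" for g
   proof -
    have "g : carr ?E" using bdd_borel_Lp[OF q1 that] by simp
    from abs_le_D1[OF vfuncD(3)[OF vdual_norm(1)[OF E Tmem[OF f]] this]]
    show ?thesis using bdd_borel_Lp[OF q1 that] by (simp only: T_def restrict_apply' Lp_pre_simps)
   qed
  qed
  show "EX f:Lp_funs m p. T f = L" if L: "L : carr (vdual ?E)" for L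
  proof -
   obtain f where f: "f : Lp_funs m p" "!!g. g : Lp_funs m q ==> L g = (LINT x|m. f x * g x)"
    using Lp_duality[OF p q pq vdual_norm[OF E L]] by metis
   hence "T f = L" using L unfolding vdual_carrier_iff[OF E] T_def by (intro extensionalityI[of _ "Lp_funs m q"]) auto
   thus ?thesis using f(1) by blast
  qed
 qed (rule Tmem)
qed

lemma vcomplete_Lp: "1 < p ==> vcomplete (Lp m p)" unfolding Lp_eq
 using seminormed.vcomplete_vquotient[OF seminormed_Lp_pre vsubspace_null_funs_Lp(1) vcomplete_Lp_pre] by simp

end

section \<open>The asymptotic Lipschitz constant\<close>

lemma LIPb_Lip: "f : LIPb ==> f : Lip_funs" by (simp add: LIPb_def)

lemma Lip_funsE:
 assumes "f : Lip_funs" obtains L where "L-lipschitz_on U f" using assms lipschitz_on_subset[of _ UNIV f U] by (auto simp: Lip_funs_def)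

lemma bdd_below_lipschitz: "bdd_below {L. L-lipschitz_on U f}" by (rule bdd_belowI[of _ 0]) (auto dest: lipschitz_on_nonneg)

lemma Lip_const_nonneg: "f : Lip_funs ==> 0 <= Lip_const f U" unfolding Lip_const_def
 by (rule cInf_greatest) (auto elim: Lip_funsE[of f U] dest: lipschitz_on_nonneg)

lemma Lip_const_le: "L-lipschitz_on U f ==> Lip_const f U <= L" unfolding Lip_const_def by (rule cInf_lower[OF _ bdd_below_lipschitz]) simp

lemma bdd_below_Lip_const: "f : Lip_funs ==> bdd_below {Lip_const f U | U. open U & x : U}"
 by (rule bdd_belowI[of _ 0]) (auto intro: Lip_const_nonneg)

lemma lip_a_nonneg: "f : Lip_funs ==> 0 <= lip_a f x" unfolding lip_a_def by (rule cInf_greatest) (auto intro: Lip_const_nonneg)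

lemma lip_a_le:
 assumes "f : Lip_funs" "open U" "x : U" "L-lipschitz_on U f" shows "lip_a f x <= L"
proof -
 have "lip_a f x <= Lip_const f U" unfolding lip_a_def using assms by (intro cInf_lower bdd_below_Lip_const) auto
 thus ?thesis using Lip_const_le[OF assms(4)] by simp
qed

lemma lip_a_less:
 assumes f: "f : Lip_funs" and r: "lip_a f x < r"
 obtains U L where "open U" "x : U" "L-lipschitz_on U f" "L < r"
proof -
 have "{Lip_const f U | U. open U & x : U} ~= {}" by (auto intro: exI[of _ UNIV])
 from cInf_lessD[OF this r[unfolded lip_a_def]]
 obtain U where U: "open U" "x : U" "Lip_const f U < r" by blast
 have "{L. L-lipschitz_on U f} ~= {}" by (auto intro: Lip_funsE[OF f, of U])
 from cInf_lessD[OF this U(3)[unfolded Lip_const_def]] show thesis using that U by blast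
qed

text \<open>Differences are compared on one neighbourhood only. The case \<open>c = 1\<close> covers
  contractions, and \<open>c = 0\<close> shows that \<open>lip_a\<close> vanishes where a function
  is locally constant.\<close>

lemma lip_a_dominated:
 assumes g: "g : Lip_funs" and f: "f : Lip_funs" and U: "open U" "x : U" and c: "0 <= c"
  and le: "!!y z. y : U ==> z : U ==> abs (g y - g z) <= c * abs (f y - f z)" shows "lip_a g x <= c * lip_a f x"
proof (rule le_mult_limit[OF c])
 fix t assume "lip_a f x < t"
 from lip_a_less[OF f this] obtain V L where V: "open V" "x : V" "L-lipschitz_on V f" "L < t" by metis
 have "(c * L)-lipschitz_on (U Int V) g"
 proof (rule lipschitz_onI)
  fix y z assume yz: "y : U Int V" "z : U Int V"
  have "c * abs (f y - f z) <= c * (L * dist y z)"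
   using lipschitz_onD[OF V(3), of y z] yz c by (intro mult_left_mono) (auto simp: dist_real_def)
  thus "dist (g y) (g z) <= c * L * dist y z" using le[of y z] yz by (simp add: dist_real_def mult.assoc)
 qed (use c lipschitz_on_nonneg[OF V(3)] in simp)
 from lip_a_le[OF g open_Int[OF U(1) V(1)] IntI[OF U(2) V(2)] this]
 show "lip_a g x <= c * t" using mult_left_mono[OF less_imp_le[OF V(4)] c] by linarith
qed

lemma LIPb_contraction:
 assumes f: "f : LIPb" and le: "!!y z. abs (g y - g z) <= abs (f y - f z)" shows "g : LIPb" "lip_a g x <= lip_a f x"
proof -
 obtain L B where L: "L-lipschitz_on UNIV f" "!!x. abs (f x) <= B" using LIPbE[OF f] by metis
 have "L-lipschitz_on UNIV g" using L(1) le unfolding lipschitz_on_def dist_real_def by (meson order_trans)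
 moreover have "abs (g y) <= abs (g x) + (B + B)" for y using le[of y x] L(2)[of x] L(2)[of y] by linarith
 ultimately show g: "g : LIPb" unfolding LIPb_iff by blast
 show "lip_a g x <= lip_a f x" using lip_a_dominated[OF LIPb_Lip[OF g] LIPb_Lip[OF f] open_UNIV UNIV_I, of 1] le by simp
qed

lemma lip_a_const [simp]: "lip_a (%y. c) x = 0"
proof -
 have f: "(%y :: 'a. c) : Lip_funs" by (intro LIPb_Lip) simp
 have "lip_a (%y. c) x <= 0" by (rule lip_a_le[OF f open_UNIV UNIV_I lipschitz_on_constant])
 thus ?thesis using lip_a_nonneg[OF f, of x] by simp
qed

lemma Lip_funs_add: "f : Lip_funs ==> g : Lip_funs ==> (%x. f x + g x) : Lip_funs" unfolding Lip_funs_def using lipschitz_on_add by blast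

lemma lip_a_add:
 assumes f: "f : Lip_funs" and g: "g : Lip_funs" shows "lip_a (%y. f y + g y) x <= lip_a f x + lip_a g x"
proof (rule field_le_epsilon)
 fix e :: real assume e: "e > 0"
 then obtain U L where U: "open U" "x : U" "L-lipschitz_on U f" "L < lip_a f x + e / 2"
  using lip_a_less[OF f, of x "lip_a f x + e / 2"] by auto
 obtain V M where V: "open V" "x : V" "M-lipschitz_on V g" "M < lip_a g x + e / 2"
  using lip_a_less[OF g, of x "lip_a g x + e / 2"] e by auto
 have "(L + M)-lipschitz_on (U Int V) (%y. f y + g y)"
  using lipschitz_on_subset[OF U(3), of "U Int V"] lipschitz_on_subset[OF V(3), of "U Int V"] by (intro lipschitz_on_add) auto
 from lip_a_le[OF Lip_funs_add[OF f g] _ _ this, of x]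
 show "lip_a (%y. f y + g y) x <= lip_a f x + lip_a g x + e" using U V by (simp add: open_Int)
qed

lemma Lip_funs_scale: "f : Lip_funs ==> (%x. c * f x) : Lip_funs" unfolding Lip_funs_def using lipschitz_on_cmult_real by blast

lemma lip_a_scale_le: "f : Lip_funs ==> lip_a (%y. c * f y) x <= abs c * lip_a f x"
 by (rule lip_a_dominated[OF Lip_funs_scale _ open_UNIV]) (simp_all add: abs_mult right_diff_distrib[symmetric])

text \<open>Upper semicontinuity: a neighbourhood that witnesses a value below \<open>r\<close> at
  one point does so at each of its points.\<close>

lemma lip_a_measurable:
 assumes f: "f : Lip_funs" shows "lip_a f : borel_measurable borel"
proof -
 have "open {x. lip_a f x < r}" for r
 proof (rule iffD2[OF open_subopen], rule ballI)
  fix x assume "x : {x. lip_a f x < r}"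
  then obtain U L where U: "open U" "x : U" "L-lipschitz_on U f" "L < r" using lip_a_less[OF f, of x r] by auto
  hence "U <= {x. lip_a f x < r}" using lip_a_le[OF f U(1) _ U(3)] by force
  thus "EX T. open T & x : T & T <= {x. lip_a f x < r}" using U by blast
 qed
 thus ?thesis by (intro borel_measurableI_less) simp
qed

lemma lip_a_bdd_borel:
 assumes f: "f : Lip_funs" shows "lip_a f : bdd_borel"
proof -
 obtain L where "L-lipschitz_on UNIV f" using Lip_funsE[OF f] by blast
 hence "abs (lip_a f x) <= L" for x using lip_a_le[OF f open_UNIV, of x L] lip_a_nonneg[OF f, of x] by simp
 thus ?thesis by (intro bdd_borelI[OF lip_a_measurable[OF f]])
qed

text \<open>
 The Leibniz defect \<open>fg - f(x)g - g(x)f\<close> differs from \<open>(f - f(x))(g - g(x))\<close> by a constant, and both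
 factors are small near \<open>x\<close>.
\<close>

lemma lip_a_leibniz:
 assumes f: "f : LIPb" and g: "g : LIPb" shows "lip_a (%y. f y * g y - f x * g y - g x * f y) x = 0"
proof -
 let ?h = "%y. f y * g y - f x * g y - g x * f y"
 have h: "?h : Lip_funs" using f g by (intro LIPb_Lip LIPb_diff LIPb_mult LIPb_cmult)
 obtain L where L: "L-lipschitz_on UNIV f" "0 <= L" using LIPbE[OF f] by metis
 obtain M where M: "M-lipschitz_on UNIV g" "0 <= M" using LIPbE[OF g] by metis
 have le: "lip_a ?h x <= 2 * L * M * d" if d: "d > 0" for d
 proof (rule lip_a_le[OF h])
  show "open (ball x d)" "x : ball x d" using d by auto
  have fL: "L-lipschitz_on (ball x d) (%y. f y - f x)" "M-lipschitz_on (ball x d) (%y. g y - g x)"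
   using L M by (auto simp: lipschitz_on_def dist_real_def)
  have b: "abs (f y - f x) <= L * d" "abs (g y - g x) <= M * d" if "y : ball x d" for y
  proof -
   have "dist y x <= d" using that by (simp add: dist_commute)
   hence "L * dist y x <= L * d" "M * dist y x <= M * d" using L M by (auto intro: mult_left_mono)
   thus "abs (f y - f x) <= L * d" "abs (g y - g x) <= M * d"
    using lipschitz_onD[OF L(1), of y x] lipschitz_onD[OF M(1), of y x] by (auto simp: dist_real_def)
  qed
  have "(L * d * M + M * d * L)-lipschitz_on (ball x d) (%y. (f y - f x) * (g y - g x))"
   using L M d b by (intro lipschitz_on_mult_real fL) auto
  hence "(L * d * M + M * d * L)-lipschitz_on (ball x d) ?h" unfolding lipschitz_on_def dist_real_def by (simp add: algebra_simps)
  thus "(2 * L * M * d)-lipschitz_on (ball x d) ?h" by (simp add: algebra_simps)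
 qed
 have "lip_a ?h x <= 2 * L * M * 0" by (rule le_mult_limit) (use L M in \<open>auto intro: le\<close>)
 thus ?thesis using lip_a_nonneg[OF h, of x] by simp
qed

definition truncate :: "real => real => ('a => real) => 'a => real" where
 "truncate a c u x = min (max (u x - a) 0) c"

text \<open>Off the closed band the truncation is locally constant. The boundary levels stay in the
  indicator, so neighbouring bands overlap in level sets.\<close>

lemma lip_a_truncate:
 assumes u: "u : LIPb" shows "truncate a c u : LIPb" "lip_a (truncate a c u) x <= lip_a u x * indicator {x. a <= u x & u x <= a + c} x"
proof -
 have le: "abs (truncate a c u y - truncate a c u z) <= abs (u y - u z)" for y z by (auto simp: truncate_def min_def max_def)
 show t: "truncate a c u : LIPb" by (rule LIPb_contraction[OF u le])
 have "open {x. u x < a}" "open {x. a + c < u x}" using LIPb_continuous[OF u] by (auto intro!: open_Collect_less)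
 note op = this
 have le0: "lip_a (truncate a c u) x <= 0" if "open U" "x : U" "!!y. y : U ==> truncate a c u y = k" for U k
  using lip_a_dominated[OF LIPb_Lip[OF t] LIPb_Lip[OF u] that(1,2), of 0] that(3) by simp
 consider "u x < a" | "a + c < u x" | "a <= u x" "u x <= a + c" by linarith
 thus "lip_a (truncate a c u) x <= lip_a u x * indicator {x. a <= u x & u x <= a + c} x"
 proof cases
  case 1 thus ?thesis using le0[OF op(1), of "min 0 c"] by (simp add: truncate_def)
 next
  case 2 thus ?thesis using le0[OF op(2), of c] by (simp add: truncate_def min_def max_def)
 next
  case 3 thus ?thesis using LIPb_contraction(2)[OF u le, of x] by simp
 qed
qed

section \<open>Bounded PI spaces\<close>

lemma doublingD:
 fixes m :: "'a::metric_space measure"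
 assumes m: "finite_measure m" and d: "doubling m C" and r: "r > 0"
 shows "0 < measure m (ball x r)" "measure m (ball x (2 * r)) <= C * measure m (ball x r)" "0 < C"
proof -
 interpret finite_measure m by fact
 have C: "0 < C" using d by (simp add: doubling_def)
 thus "0 < C" .
 have d': "0 < emeasure m (ball x (2 * r))" "emeasure m (ball x (2 * r)) <= ennreal C * emeasure m (ball x r)"
  if "r > 0" for r using d that by (auto simp: doubling_def)
 show "0 < measure m (ball x r)" using d'(1)[of "r / 2"] r by (simp add: emeasure_eq_measure)
 show "measure m (ball x (2 * r)) <= C * measure m (ball x r)"
  using d'(2)[OF r] C by (simp add: emeasure_eq_measure ennreal_mult[symmetric] ennreal_le_iff)
qed

lemma bounded_radius:
 assumes "bounded (UNIV :: 'a::metric_space set)"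
 obtains R where "R > 0" "!!x :: 'a. ball x R = UNIV"
proof -
 obtain e where e: "!!x y :: 'a. dist x y <= e" using assms bounded_two_points[of "UNIV :: 'a set"] by auto
 have "dist x y < abs e + 1" for x y :: 'a using e[of x y] by linarith
 hence "ball x (abs e + 1) = UNIV" for x :: 'a by auto
 thus thesis using that[of "abs e + 1"] by simp
qed

text \<open>Doubling iterated down from radius \<open>R\<close>; together with
  \<open>CD <= 2 powr s\<close> this is the lower mass bound of dimension \<open>s\<close>.\<close>

lemma doubling_mass_bound:
 fixes m :: "'a::metric_space measure"
 assumes m: "finite_measure m" and d: "doubling m C" and R: "R > 0" "!!x :: 'a. ball x R = UNIV"
 shows "measure m UNIV <= C ^ k * measure m (ball x (R / 2 ^ k))"
proof (induction k)
 case (Suc k)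
 have "measure m (ball x (2 * (R / 2 ^ Suc k))) <= C * measure m (ball x (R / 2 ^ Suc k))" using R by (intro doublingD(2)[OF m d]) auto
 hence "C ^ k * measure m (ball x (R / 2 ^ k)) <= C ^ k * (C * measure m (ball x (R / 2 ^ Suc k)))"
  using doublingD(3)[OF m d, of 1] by (intro mult_left_mono) auto
 thus ?case using Suc by (simp add: mult.assoc mult.left_commute)
qed (use R in simp)

text \<open>Balls of radius \<open>e / 2\<close> have mass at least a fixed \<open>delta\<close>.
  Without a finite \<open>e\<close>-net, arbitrarily large \<open>e\<close>-separated sets could be
  built, and their disjoint half-balls would exceed the finite total mass.\<close>

lemma doubling_compact:
 fixes m :: "'a::metric_space measure"
 assumes m: "finite_measure m" "sets m = sets borel" and d: "doubling m C" and X: "complete (UNIV :: 'a set)" "bounded (UNIV :: 'a set)"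
 shows "compact (UNIV :: 'a set)" unfolding compact_eq_totally_bounded
proof (intro conjI X(1) allI impI)
 interpret finite_measure m by fact
 fix e :: real assume e: "e > 0"
 obtain R where R: "R > 0" "!!x :: 'a. ball x R = UNIV" using bounded_radius[OF X(2)] by blast
 have C: "C > 0" using doublingD(3)[OF m(1) d, of 1] by simp
 obtain k where "(1/2) ^ k < e / (2 * R)" using real_arch_pow_inv[of "e / (2 * R)" "1/2"] e R by auto
 hence k: "R / 2 ^ k <= e / 2" using R by (simp add: field_simps power_one_over)
 define delta where "delta = measure m UNIV / C ^ k"
 have mX: "0 < measure m UNIV" using doublingD(1)[OF m(1) d R(1), of undefined] R by simp
 hence delta0: "delta > 0" using C by (simp add: delta_def)
 have delta: "delta <= measure m (ball x (e / 2))" for x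
 proof -
  have "delta <= measure m (ball x (R / 2 ^ k))"
   using doubling_mass_bound[OF m(1) d R, of k x] C by (simp add: delta_def divide_le_eq mult.commute)
  also have "... <= measure m (ball x (e / 2))" using k m by (intro finite_measure_mono subset_ball) auto
  finally show ?thesis .
 qed
 show "EX K. finite K & (UNIV :: 'a set) <= (\<Union>x\<in>K. ball x e)"
 proof (rule ccontr)
  assume no: "\<not> (EX K. finite K & (UNIV :: 'a set) <= (\<Union>x\<in>K. ball x e))"
  have sep: "EX S :: 'a set. finite S & card S = n & (ALL x:S. ALL y:S. x ~= y --> e <= dist x y)" for n
  proof (induction n)
   case (Suc n)
   then obtain S :: "'a set" where S: "finite S" "card S = n" "ALL x:S. ALL y:S. x ~= y --> e <= dist x y" by blast
   have "EX z. ALL x:S. e <= dist x z"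
   proof (rule ccontr)
    assume "\<nexists>z. ALL x:S. e <= dist x z"
    hence "UNIV <= (\<Union>x\<in>S. ball x e)" by (force simp: not_le)
    with S(1) have "EX K. finite K & (UNIV :: 'a set) <= (\<Union>x\<in>K. ball x e)" by (intro exI[of _ S] conjI)
    with no show False by (rule notE)
   qed
   then obtain z where z: "ALL x:S. e <= dist x z" by blast
   have "z ~: S" using z e by fastforce
   hence "finite (insert z S) & card (insert z S) = Suc n & (ALL x:insert z S. ALL y:insert z S. x ~= y --> e <= dist x y)"
    using S z by (auto simp: dist_commute)
   thus ?case by blast
  qed (auto intro: exI[of _ "{}"])
  obtain n where n: "measure m UNIV < real n * delta" using reals_Archimedean3[OF delta0] by blast
  obtain S :: "'a set" where S: "finite S" "card S = n" "ALL x:S. ALL y:S. x ~= y --> e <= dist x y" using sep[of n] by (elim exE conjE)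
  have disj: "disjoint_family_on (%x. ball x (e / 2)) S" unfolding disjoint_family_on_def
  proof (intro ballI impI)
   fix x y assume xy: "x : S" "y : S" "x ~= y"
   have "dist x y < e" if "z : ball x (e / 2)" "z : ball y (e / 2)" for z
    using that dist_triangle_half_r[of z x e y] by (simp add: dist_commute)
   thus "ball x (e / 2) Int ball y (e / 2) = {}" using S(3) xy by force
  qed
  have "real n * delta <= (\<Sum>x\<in>S. measure m (ball x (e / 2)))"
   using sum_mono[of S "%x. delta" "%x. measure m (ball x (e / 2))"] delta S by simp
  also have "... = measure m (\<Union>x\<in>S. ball x (e / 2))" using S disj m by (intro finite_measure_finite_Union[symmetric]) auto
  also have "... <= measure m UNIV" using m by (intro finite_measure_mono) auto
  finally show False using n by simp
 qed
qed

text \<open>Greedy selection: a ball of largest radius is kept, every ball meeting it lies in its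
  triple, and the induction continues with the balls disjoint from it.\<close>

lemma finite_vitali:
 fixes I :: "('a::metric_space \<times> real) set"
 assumes "finite I"
 shows "EX J<=I. disjoint_family_on (%(x, r). ball x r) J & (\<Union>(x, r)\<in>I. ball x r) <= (\<Union>(x, r)\<in>J. ball x (3 * r))" using assms
proof (induction "card I" arbitrary: I rule: less_induct)
 case less
 show ?case
 proof (cases "I = {}")
  case True
  thus ?thesis by (auto simp: disjoint_family_on_def)
 next
  case False
  obtain x0 r0 where p0: "(x0, r0) : I" and mx: "!!x r. (x, r) : I ==> r <= r0"
  proof -
   have "Max (snd ` I) : snd ` I" using less.prems False by (intro Max_in) auto
   then obtain p where p: "p : I" "snd p = Max (snd ` I)" by force
   have "r <= snd p" if "(x, r) : I" for x r unfolding p(2) using that less.prems by (intro Max_ge) force+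
   thus thesis using that[of "fst p" "snd p"] p(1) by simp
  qed
  \<comment> \<open>The chosen pair is excluded explicitly, because with a nonpositive radius its
    ball is empty and would be disjoint from itself.\<close>
  define I' where "I' = {(x, r) : I. ball x r Int ball x0 r0 = {} & (x, r) ~= (x0, r0)}"
  have sub: "I' \<subset> I" using p0 by (auto simp: I'_def)
  obtain J where J: "J <= I'" "disjoint_family_on (%(x, r). ball x r) J"
   "(\<Union>(x, r)\<in>I'. ball x r) <= (\<Union>(x, r)\<in>J. ball x (3 * r))"
   using less.hyps[OF psubset_card_mono[OF less.prems sub]] less.prems sub finite_subset[of I' I] by blast
  have "disjoint_family_on (%(x, r). ball x r) (insert (x0, r0) J)" unfolding disjoint_family_on_def
  proof (intro ballI impI)
   fix p q assume pq: "p : insert (x0, r0) J" "q : insert (x0, r0) J" "p ~= q"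
   show "(case p of (x, r) => ball x r) Int (case q of (x, r) => ball x r) = {}"
   proof (cases "p : J & q : J")
    case True
    thus ?thesis using J(2) pq(3) by (simp add: disjoint_family_on_def)
   next
    case False
    hence "(p = (x0, r0) & q : I') \<or> (q = (x0, r0) & p : I')" using pq J(1) by blast
    thus ?thesis unfolding I'_def by auto
   qed
  qed
  moreover have "ball x r <= (\<Union>(x, r)\<in>insert (x0, r0) J. ball x (3 * r))" if xr: "(x, r) : I" for x r
  proof (cases "(x, r) : I'")
   case True
   thus ?thesis using J(3) by blast
  next
   case False
   have "ball x r <= ball x0 (3 * r0)"
   proof (cases "(x, r) = (x0, r0)")
    case True
    show ?thesis
    proof (cases "r0 > 0")
     case True
     thus ?thesis using \<open>(x, r) = (x0, r0)\<close> by (auto intro!: subset_ball)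
    next
     case False
     thus ?thesis using \<open>(x, r) = (x0, r0)\<close> by (simp add: ball_empty)
    qed
   next
    case ne: False
    then obtain z where z: "z : ball x r" "z : ball x0 r0" using False xr by (auto simp: I'_def)
    have "dist x0 y < 3 * r0" if "y : ball x r" for y
    proof -
     have "dist x0 y <= dist x0 z + dist z x + dist x y" using dist_triangle[of x0 y z] dist_triangle[of z y x] by linarith
     thus ?thesis using z that mx[OF xr] by (simp add: dist_commute)
    qed
    thus ?thesis by auto
   qed
   thus ?thesis by blast
  qed
  ultimately show ?thesis using J(1) sub p0 by (intro exI[of _ "insert (x0, r0) J"]) blast
 qed
qed

section \<open>The Sobolev inequality\<close>

text \<open>\<open>s\<close> is the exponent \<alpha> of the theorem, used as a dimension, and
  \<open>R\<close> is a radius at which every ball is the whole space, where all chains of balls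
  start.\<close>

locale bounded_PI = borel_space dummy m for dummy :: "'a::metric_space itself" and m :: "'a measure" +
 fixes CD CP lam s R :: real
 assumes doubling: "doubling m CD" and poincare: "poincare m CP lam" and R: "R > 0" and ball_R: "!!x :: 'a. ball x R = UNIV"
  and s: "1 < s" and log_CD: "log 2 CD <= s"
begin

definition p where "p = s / (s - 1)"

lemma p: "1 < p" "1 / p + 1 / s = 1" "1 / s + 1 / p = 1" "p = 1 + 1 / (s - 1)" "1 <= p" using s by (auto simp: p_def field_simps)

definition energy :: "('a => real) => real" where
 "energy f = (LINT x|m. lip_a f x)"

lemma energy_nonneg: "f : Lip_funs ==> 0 <= energy f" unfolding energy_def by (intro integral_nonneg_AE AE_I2 lip_a_nonneg)

lemma integrable_lip_a: "f : Lip_funs ==> integrable m (lip_a f)" by (intro integrable_bdd_borel lip_a_bdd_borel)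

lemma ball_pos: "r > 0 ==> 0 < measure m (ball x r)" by (rule doublingD(1)[OF finite_measure_axioms doubling])

lemma UNIV_pos: "0 < measure m UNIV" using ball_pos[OF R] ball_R by metis

lemma ball_double: "r > 0 ==> measure m (ball x (2 * r)) <= CD * measure m (ball x r)"
 by (rule doublingD(2)[OF finite_measure_axioms doubling])

lemma CD_pos: "0 < CD" using doublingD(3)[OF finite_measure_axioms doubling, of 1] by simp

lemma CD_le: "CD <= 2 powr s" using log_CD CD_pos by (simp add: log_le_iff)

lemma CP_lambda: "0 < CP" "1 <= lam" using poincare by (auto simp: poincare_def)

lemma mass_bound: "measure m UNIV <= (2 powr s) ^ k * measure m (ball x (R / 2 ^ k))"
proof -
 have "measure m UNIV <= CD ^ k * measure m (ball x (R / 2 ^ k))" by (rule doubling_mass_bound[OF finite_measure_axioms doubling R ball_R])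
 also have "... <= (2 powr s) ^ k * measure m (ball x (R / 2 ^ k))" using CD_le CD_pos by (intro mult_right_mono power_mono) auto
 finally show ?thesis .
qed

definition energy_on :: "('a => real) => 'a set => real" where
 "energy_on f B = (LINT x|m. lip_a f x * indicator B x)"

lemma energy_on_le: "f : Lip_funs ==> B : sets borel ==> energy_on f B <= energy f" unfolding energy_on_def energy_def
 by (intro integral_mono integrable_mult_bdd_borel integrable_lip_a bdd_borel_indicator) (auto simp: indicator_def lip_a_nonneg)

lemma energy_on_nonneg: "f : Lip_funs ==> 0 <= energy_on f B"
 unfolding energy_on_def by (intro integral_nonneg_AE AE_I2) (simp add: lip_a_nonneg)

lemma avg_eq: "avg m B f = (LINT x|m. f x * indicator B x) / measure m B" by (simp add: avg_def set_lebesgue_integral_def mult.commute)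

lemma poincare_ball:
 assumes f: "f : LIPb" and r: "r > 0" shows "(LINT y|m. abs (f y - avg m (ball x r) f) * indicator (ball x r) y) / measure m (ball x r)
   <= CP * r * (energy_on f (ball x (lam * r)) / measure m (ball x (lam * r)))"
 using poincare LIPb_Lip[OF f] r unfolding poincare_def avg_eq energy_on_def by blast

lemma LIPb_dev:
 assumes f: "f : LIPb" and B: "B : sets borel" shows "integrable m (%y. abs (f y - c) * indicator B y)"
  "0 < measure m B ==> abs (avg m B f - c) <= (LINT y|m. abs (f y - c) * indicator B y) / measure m B"
proof -
 have int: "integrable m (%y. g y * indicator B y)" if "g : LIPb" for g
  using that B by (simp add: integrable_mult_bdd_borel integrable_bdd_borel LIPb_bdd_borel)
 show i: "integrable m (%y. abs (f y - c) * indicator B y)"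
  using integrable_abs[OF int[OF LIPb_diff[OF f LIPb_const[of c]]]] by (simp add: abs_mult)
 assume pos: "0 < measure m B"
 have "avg m B f - c = (LINT y|m. (f y - c) * indicator B y) / measure m B"
  using B pos int[OF f] int[OF LIPb_const[of c]] by (simp add: avg_eq left_diff_distrib diff_divide_distrib)
 moreover have "abs (LINT y|m. (f y - c) * indicator B y) <= (LINT y|m. abs (f y - c) * indicator B y)"
  using integral_abs_bound[of m "%y. (f y - c) * indicator B y"] by (simp add: abs_mult)
 ultimately show "abs (avg m B f - c) <= (LINT y|m. abs (f y - c) * indicator B y) / measure m B"
  using pos by (simp add: abs_divide divide_right_mono)
qed

text \<open>The deviation on the half ball is at most that on the full ball; dividing by the smaller
  mass costs a factor \<open>CD\<close>, and Poincare bounds the rest.\<close>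

lemma avg_ball_half:
 assumes f: "f : LIPb" and r: "r > 0" shows "abs (avg m (ball x r) f - avg m (ball x (r / 2)) f)
   <= CD * CP * r * (energy_on f (ball x (lam * r)) / measure m (ball x (lam * r)))"
proof -
 define B B' where "B = ball x r" and "B' = ball x (r / 2)"
 define a where "a = avg m B f"
 have B': "B' : sets borel" "B : sets borel" "B' <= B" "0 < measure m B'" "0 < measure m B"
  using r ball_pos[of "r / 2" x] ball_pos[OF r, of x] by (auto simp: B_def B'_def)
 have "abs (avg m B' f - a) <= (LINT y|m. abs (f y - a) * indicator B' y) / measure m B'" by (rule LIPb_dev(2)[OF f B'(1,4)])
 also have "... <= (LINT y|m. abs (f y - a) * indicator B y) / (measure m B / CD)" using ball_double[of "r / 2" x] r CD_pos B'
  by (intro frac_le integral_mono LIPb_dev(1)[OF f] integral_nonneg_AE AE_I2) (auto simp: B_def B'_def field_simps indicator_def)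
 also have "... = CD * ((LINT y|m. abs (f y - a) * indicator B y) / measure m B)" by simp
 also have "... <= CD * (CP * r * (energy_on f (ball x (lam * r)) / measure m (ball x (lam * r))))"
  unfolding a_def B_def using CD_pos by (intro mult_left_mono poincare_ball[OF f r]) auto
 finally show ?thesis by (simp add: a_def B_def B'_def abs_minus_commute mult.assoc)
qed

lemma avg_tendsto:
 assumes f: "f : LIPb" shows "(%k. avg m (ball x (R / 2 ^ k)) f) ----> f x"
proof -
 obtain L where L: "L-lipschitz_on UNIV f" "0 <= L" using LIPbE[OF f] by metis
 have "(%k. L * R * (1/2) ^ k) ----> L * R * 0" by (intro tendsto_mult_left LIMSEQ_power_zero) simp
 hence lim: "(%k. L * R * (1/2) ^ k) ----> 0" by simp
 have "norm (avg m (ball x (R / 2 ^ k)) f - f x) <= L * R * (1/2) ^ k" for k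
 proof -
  define B where "B = ball x (R / 2 ^ k)"
  have B: "B : sets borel" "0 < measure m B" using ball_pos[of "R / 2 ^ k" x] R by (auto simp: B_def)
  have "(LINT y|m. abs (f y - f x) * indicator B y) <= (LINT y|m. (L * R * (1/2) ^ k) * indicator B y)"
  proof (rule integral_mono[OF LIPb_dev(1)[OF f B(1)]])
   show "integrable m (%y. (L * R * (1/2) ^ k) * indicator B y)" using B by (intro integrable_mult_bdd_borel) auto
   show "abs (f y - f x) * indicator B y <= (L * R * (1/2) ^ k) * indicator B y" for y
   proof (cases "y : B")
    case True
    hence "L * dist y x <= L * (R / 2 ^ k)" using L(2) by (intro mult_left_mono) (auto simp: B_def dist_commute)
    hence "abs (f y - f x) <= L * (R / 2 ^ k)" using lipschitz_onD[OF L(1), of y x] by (simp add: dist_real_def)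
    thus ?thesis using True by (simp add: power_one_over)
   qed simp
  qed
  hence "(LINT y|m. abs (f y - f x) * indicator B y) / measure m B <= L * R * (1/2) ^ k" using B by (simp add: divide_le_eq)
  thus ?thesis using LIPb_dev(2)[OF f B, of "f x"] by (simp add: B_def)
 qed
 thus ?thesis by (intro LIM_zero_cancel[OF Lim_null_comparison[OF always_eventually lim]] allI)
qed

definition mean :: "('a => real) => real" where
 "mean f = avg m UNIV f"

text \<open>
 Chaining along balls of radius \<open>R / 2\<^sup>k\<close>. Scales below \<open>rho\<close> are controlled by the bound \<open>tau\<close> on the
 averages of \<open>lip_a f\<close>, scales above \<open>rho\<close> by the total energy and the lower mass bound.
\<close>

lemma chain_bound:
 assumes f: "f : LIPb" and tau: "0 <= tau" and rho: "0 < rho"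
  and good: "!!k. energy_on f (ball x (lam * (R / 2 ^ k))) <= tau * measure m (ball x (lam * (R / 2 ^ k)))"
 shows "abs (f x - mean f) <= CD * CP * (2 * tau * rho
   + (energy f * R powr s / measure m UNIV) * (2 powr (s - 1) / (2 powr (s - 1) - 1)) * rho powr (1 - s))" (is "_ <= CD * CP * ?T")
proof -
 define r where "r k = R / 2 ^ k" for k
 have r: "r k > 0" for k using R by (simp add: r_def)
 define E where "E k = energy_on f (ball x (lam * r k)) / measure m (ball x (lam * r k))" for k
 define t where "t = 2 powr (s - 1)"
 have t: "t > 1" using s by (simp add: t_def)
 define D where "D = energy f / measure m UNIV"
 have D0: "0 <= D" using energy_nonneg[OF LIPb_Lip[OF f]] by (simp add: D_def)
 have rl: "lam * r k > 0" "r k <= lam * r k" for k using r[of k] CP_lambda by (auto simp: mult_le_cancel_right1)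
 have E0: "0 <= E k" for k by (simp add: E_def energy_on_nonneg LIPb_Lip[OF f])
 have E_tau: "E k <= tau" for k using good[of k] ball_pos[OF rl(1)[of k], of x] by (simp add: E_def r_def divide_le_eq mult.commute)
 \<comment> \<open>Here the lower mass bound enters: the total energy over the mass of a ball at
   scale \<open>k\<close> grows at most like \<open>2 powr s\<close> to the power
   \<open>k\<close>.\<close>
 have E_D: "E k <= D * (2 powr s) ^ k" for k
 proof -
  have pos: "0 < measure m (ball x (r k))" using ball_pos[OF r] .
  have "E k <= energy f / measure m (ball x (r k))" unfolding E_def using rl[of k] pos
   by (intro frac_le energy_on_le energy_nonneg LIPb_Lip[OF f] finite_measure_mono subset_ball) auto
  also have "... <= energy f * ((2 powr s) ^ k / measure m UNIV)" using mass_bound[of k x] pos UNIV_pos energy_nonneg[OF LIPb_Lip[OF f]]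
   unfolding divide_inverse[of "energy f"] by (intro mult_left_mono) (auto simp: r_def field_simps)
  finally show ?thesis by (simp add: D_def)
 qed
 have step: "abs (avg m (ball x (r k)) f - avg m (ball x (r (Suc k))) f) <= CD * CP * (r k * E k)" for k
  using avg_ball_half[OF f r[of k], of x] by (simp add: r_def E_def mult.assoc mult.commute[of 2])
 \<comment> \<open>The first scale not exceeding \<open>rho\<close>. Minimality bounds
   \<open>2 ^ k\<close> by \<open>R / rho\<close> for all earlier scales.\<close>
 obtain k0 where k0: "r k0 <= rho" "!!k. k < k0 ==> rho < r k"
 proof -
  obtain k where "(1/2) ^ k < rho / R" using real_arch_pow_inv[of "rho / R" "1/2"] rho R by auto
  hence "r k <= rho" using R by (simp add: r_def field_simps power_one_over)
  hence ex: "EX k. r k <= rho" by blast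
  show thesis using that[of "LEAST k. r k <= rho"] LeastI_ex[OF ex] not_less_Least by (metis not_le)
 qed
 have geo1: "(\<Sum>k<n. r (k0 + k)) <= 2 * rho" for n
 proof -
  have "(\<Sum>k<n. r (k0 + k)) = r k0 * (\<Sum>k<n. (1/2) ^ k)" by (simp add: r_def power_add sum_distrib_left power_one_over)
  also have "... = r k0 * (2 * (1 - (1/2) ^ n))" by (simp add: sum_gp_strict)
  also have "... <= rho * 2" using k0(1) r[of k0] by (intro mult_mono) (auto simp: power_le_one)
  finally show ?thesis by simp
 qed
 \<comment> \<open>Each term is \<open>R * t ^ k\<close> with \<open>t = 2 powr (s - 1)\<close>.
   Since \<open>s > 1\<close> this ratio exceeds 1, so the last term dominates and yields the power
   of \<open>rho\<close>.\<close>
 have geo2: "(\<Sum>k<k0. r k * (2 powr s) ^ k) <= R powr s * (t / (t - 1)) * rho powr (1 - s)"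
 proof -
  have eq: "r k * (2 powr s) ^ k = R * t ^ k" for k by (simp add: r_def t_def powr_diff power_divide)
  have "(\<Sum>k<k0. r k * (2 powr s) ^ k) = R * (\<Sum>k<k0. t ^ k)" by (simp add: eq sum_distrib_left)
  also have "... = R * ((t ^ k0 - 1) / (t - 1))" using t by (simp add: power_diff_1_eq)
  also have "... <= R * ((t * (R / rho) powr (s - 1)) / (t - 1))"
  proof -
   have "t ^ k0 - 1 <= t * (R / rho) powr (s - 1)"
   proof (cases k0)
    case 0
    thus ?thesis using t by simp
   next
    case (Suc k)
    have "2 ^ k <= R / rho" using k0(2)[of k] Suc rho R by (simp add: r_def field_simps)
    hence "(2 ^ k) powr (s - 1) <= (R / rho) powr (s - 1)" using s by (intro powr_mono2) auto
    moreover have "(2 ^ k) powr (s - 1) = t ^ k" by (simp add: t_def powr_realpow[symmetric] powr_powr mult.commute)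
    ultimately have "t ^ k0 <= t * (R / rho) powr (s - 1)" using t Suc by simp
    thus ?thesis by simp
   qed
   thus ?thesis using R t by (intro mult_left_mono divide_right_mono) auto
  qed
  also have "... = R powr s * (t / (t - 1)) * rho powr (1 - s)"
  proof -
   have "R * (R / rho) powr (s - 1) = R powr s * rho powr (1 - s)" using R rho by (simp add: powr_divide powr_diff field_simps)
   thus ?thesis by (simp add: field_simps)
  qed
  finally show ?thesis .
 qed
 have sum: "(\<Sum>k<n. r k * E k) <= ?T" for n
 proof -
  have "(\<Sum>k<n. r k * E k) <= (\<Sum>k<k0 + n. r k * E k)" using mult_nonneg_nonneg[OF less_imp_le[OF r] E0] by (intro sum_mono2) auto
  also have "... = (\<Sum>k<k0. r k * E k) + (\<Sum>k<n. r (k0 + k) * E (k0 + k))"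
   using sum.nat_group[of "%k. r k * E k"] by (induction n) (simp_all add: add.assoc)
  also have "... <= (\<Sum>k<k0. r k * (D * (2 powr s) ^ k)) + (\<Sum>k<n. r (k0 + k) * tau)"
   using r E_tau E_D by (intro add_mono sum_mono mult_left_mono) (auto intro: less_imp_le)
  also have "... = D * (\<Sum>k<k0. r k * (2 powr s) ^ k) + tau * (\<Sum>k<n. r (k0 + k))" by (simp add: sum_distrib_left mult_ac)
  also have "... <= D * (R powr s * (t / (t - 1)) * rho powr (1 - s)) + tau * (2 * rho)"
   using D0 tau geo1 geo2 by (intro add_mono mult_left_mono) auto
  also have "... = ?T" by (simp add: D_def t_def)
  finally show ?thesis .
 qed
 have tel: "abs (avg m (ball x (r n)) f - mean f) <= CD * CP * (\<Sum>k<n. r k * E k)" for n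
 proof (induction n)
  case 0
  thus ?case by (simp add: r_def ball_R mean_def)
 next
  case (Suc n)
  thus ?case using step[of n] by (simp add: distrib_left)
 qed
 have "abs (avg m (ball x (r n)) f - mean f) <= CD * CP * ?T" for n
 proof -
  have "CD * CP * (\<Sum>k<n. r k * E k) <= CD * CP * ?T" using sum[of n] CD_pos CP_lambda by (intro mult_left_mono) auto
  thus ?thesis using tel[of n] by simp
 qed
 moreover have "(%n. abs (avg m (ball x (r n)) f - mean f)) ----> abs (f x - mean f)"
  using avg_tendsto[OF f, of x] unfolding r_def by (intro tendsto_intros)
 ultimately show ?thesis by (intro LIMSEQ_le_const2[of _ "abs (f x - mean f)"]) auto
qed

text \<open>The weak-type estimate for a dyadic maximal function of \<open>lip_a f\<close>.
  Compactness of \<open>A\<close> gives finitely many bad balls, Vitali makes them disjoint so that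
  their energies add up, and the triples lie in balls of four times the radius, whence
  \<open>CD\<^sup>2\<close>.\<close>

lemma maximal_bound:
 assumes f: "f : LIPb" and tau: "tau > 0" and A: "closed A"
  and bad: "!!x. x : A ==> EX k. tau * measure m (ball x (lam * (R / 2 ^ k))) < energy_on f (ball x (lam * (R / 2 ^ k)))"
 shows "measure m A <= CD\<^sup>2 * energy f / tau"
proof -
 note fl = LIPb_Lip[OF f]
 obtain k where k: "!!x. x : A ==> tau * measure m (ball x (lam * (R / 2 ^ k x))) < energy_on f (ball x (lam * (R / 2 ^ k x)))"
  using bad by metis
 define r where "r x = lam * (R / 2 ^ k x)" for x
 have r: "r x > 0" for x using R CP_lambda by (simp add: r_def)
 have "compact A" using A compact_UNIV by (metis closed_Int_compact inf_top_right)
 then obtain S where S: "finite S" "S <= A" "A <= (\<Union>x\<in>S. ball x (r x))"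
 proof (rule compactE_image[of A A "%x. ball x (r x)"])
  show "A <= (\<Union>x\<in>A. ball x (r x))" using r by auto
 qed auto
 obtain J where J: "J <= (%x. (x, r x)) ` S" "disjoint_family_on (%(x, r). ball x r) J"
  "(\<Union>(x, r)\<in>(%x. (x, r x)) ` S. ball x r) <= (\<Union>(x, r)\<in>J. ball x (3 * r))"
  using finite_vitali[of "(%x. (x, r x)) ` S"] S(1) by blast
 have Jfin: "finite J" using J(1) S(1) finite_subset by blast
 have JA: "EX x:A. j = (x, r x)" if "j : J" for j using that J(1) S(2) by blast
 have ball4: "measure m (case j of (x, r) => ball x (3 * r)) <= CD\<^sup>2 / tau * energy_on f (case j of (x, r) => ball x r)"
  if jJ: "j : J" for j
 proof -
  obtain x where x: "x : A" "j = (x, r x)" using JA[OF jJ] by blast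
  have "measure m (ball x (3 * r x)) <= measure m (ball x (2 * (2 * r x)))" using r[of x] by (intro finite_measure_mono subset_ball) auto
  also have "... <= CD * measure m (ball x (2 * r x))" using r[of x] by (intro ball_double) auto
  also have "... <= CD * (CD * measure m (ball x (r x)))" using r[of x] CD_pos by (intro mult_left_mono ball_double) auto
  also have "... <= CD * (CD * (energy_on f (ball x (r x)) / tau))"
   using k[OF x(1)] tau CD_pos by (intro mult_left_mono) (auto simp: r_def field_simps)
  finally show ?thesis by (simp add: x(2) power2_eq_square)
 qed
 have "measure m A <= measure m (\<Union>j\<in>J. case j of (x, r) => ball x (3 * r))"
  using S(3) J(3) Jfin by (intro finite_measure_mono) (force intro!: borel_open open_UN)+
 also have "... <= (\<Sum>j\<in>J. measure m (case j of (x, r) => ball x (3 * r)))"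
  using Jfin by (intro measure_UNION_le) (auto split: prod.split)
 also have "... <= (\<Sum>j\<in>J. CD\<^sup>2 / tau * energy_on f (case j of (x, r) => ball x r))" by (rule sum_mono[OF ball4])
 also have "... = CD\<^sup>2 / tau * (\<Sum>j\<in>J. energy_on f (case j of (x, r) => ball x r))" by (simp add: sum_distrib_left)
 also have "(\<Sum>j\<in>J. energy_on f (case j of (x, r) => ball x r)) <= energy f"
 proof -
  have i: "integrable m (%y. lip_a f y * indicator (case j of (x, r) => ball x r) y)" for j
   by (intro integrable_mult_bdd_borel integrable_lip_a[OF fl]) (auto split: prod.split)
  have "(\<Sum>j\<in>J. energy_on f (case j of (x, r) => ball x r))
    = (LINT y|m. (\<Sum>j\<in>J. lip_a f y * indicator (case j of (x, r) => ball x r) y))"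
   unfolding energy_on_def using i by (intro Bochner_Integration.integral_sum[symmetric])
  also have "... = (LINT y|m. lip_a f y * indicator (\<Union>j\<in>J. case j of (x, r) => ball x r) y)"
   using J(2) Jfin by (simp add: sum_distrib_left[symmetric] indicator_UN_disjoint)
  also have "... <= energy f"
  proof -
   have "(\<Union>j\<in>J. case j of (x, r) => ball x r) : sets borel" by (intro borel_open open_UN) (auto split: prod.split)
   from energy_on_le[OF fl this] show ?thesis unfolding energy_on_def .
  qed
  finally show ?thesis .
 qed
 finally show ?thesis using tau CD_pos by (simp add: mult_left_mono divide_right_mono)
qed

text \<open>Where no ball is bad for \<open>tau\<close>, \<open>chain_bound\<close> keeps the
  deviation below \<open>T\<close>; the remaining set is small by \<open>maximal_bound\<close>.
  Optimizing over \<open>rho\<close> turns the linear estimate into the power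
  \<open>p = 1 + 1 / (s - 1)\<close>.\<close>

lemma weak_type:
 obtains K where "0 <= K"
  "!!f T. f : LIPb ==> 0 < T ==> measure m {x. T <= abs (f x - mean f)} <= K * (energy f / T) powr p"
proof -
 define a where "a = CD * CP * (R powr s / measure m UNIV) * (2 powr (s - 1) / (2 powr (s - 1) - 1))"
 define b where "b = 2 * CD * CP"
 have t: "2 powr (s - 1) > 1" using s by simp
 have a: "a > 0" using t CD_pos CP_lambda R UNIV_pos by (simp add: a_def)
 have b: "b > 0" using CD_pos CP_lambda by (simp add: b_def)
 have chain: "abs (f x - mean f) <= b * tau * rho + a * energy f * rho powr (1 - s)" if "f : LIPb" "0 <= tau" "0 < rho"
   "!!k. energy_on f (ball x (lam * (R / 2 ^ k))) <= tau * measure m (ball x (lam * (R / 2 ^ k)))" for f x tau rho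
  using chain_bound[OF that] by (simp add: a_def b_def algebra_simps)
 define K where "K = CD\<^sup>2 * (4 * b) * (2 * a) powr (1 / (s - 1))"
 have "measure m {x. T <= abs (f x - mean f)} <= K * (energy f / T) powr p" if f: "f : LIPb" and T: "0 < T" for f T
 proof -
  note fl = LIPb_Lip[OF f]
  define A where "A = {x. T <= abs (f x - mean f)}"
  have Am: "closed A" unfolding A_def using LIPb_continuous[OF f] by (intro closed_Collect_le continuous_intros)
  show ?thesis
  proof (cases "energy f = 0")
   case True
   \<comment> \<open>Without energy the choice of \<open>rho\<close> below degenerates to 0, but the
     chain bound with \<open>tau = 0\<close> already shows that \<open>f\<close> is
     constant.\<close>
   have "abs (f x - mean f) <= 0" for x
   proof -
    have "energy_on f B <= 0 * measure m B" if "B : sets borel" for B using energy_on_le[OF fl that] True by simp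
    thus ?thesis using chain[OF f, of 0 1 x] True by simp
   qed
   hence "A = {}" using T by (auto simp: A_def not_le intro: le_less_trans)
   thus ?thesis using True by (simp add: A_def)
  next
   case False
   hence En: "energy f > 0" using energy_nonneg[OF fl] by simp
   \<comment> \<open>\<open>rho\<close> makes the large-scale term equal to \<open>T / 2\<close> and
     \<open>tau\<close> makes the small-scale term equal to \<open>T / 4\<close>, so together they
     stay strictly below \<open>T\<close>.\<close>
   define rho where "rho = (2 * a * energy f / T) powr (1 / (s - 1))"
   define tau where "tau = T / (4 * b * rho)"
   have rho: "rho > 0" using a En T by (simp add: rho_def)
   have tau: "tau > 0" using T b rho by (simp add: tau_def)
   have "(1 / (s - 1)) * (1 - s) = -1" using s by (simp add: field_simps)
   hence "rho powr (1 - s) = (2 * a * energy f / T) powr (-1)" by (simp only: rho_def powr_powr)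
   also have "... = T / (2 * a * energy f)" using a En T by (simp add: powr_minus_divide)
   finally have rhos: "a * energy f * rho powr (1 - s) = T / 2" using a En by simp
   have taurho: "b * tau * rho = T / 4" using b rho by (simp add: tau_def)
   have "measure m A <= CD\<^sup>2 * energy f / tau"
   proof (rule maximal_bound[OF f tau Am], rule ccontr)
    fix x assume x: "x : A"
     "\<nexists>k. tau * measure m (ball x (lam * (R / 2 ^ k))) < energy_on f (ball x (lam * (R / 2 ^ k)))"
    hence "abs (f x - mean f) < T" using chain[OF f less_imp_le[OF tau] rho, of x] taurho rhos T by (simp add: not_less)
    thus False using x(1) by (simp add: A_def)
   qed
   also have "... = CD\<^sup>2 * (4 * b) * ((energy f / T) * rho)" using T by (simp add: tau_def)
   also have "(energy f / T) * rho = (2 * a) powr (1 / (s - 1)) * (energy f / T) powr p"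
   proof -
    have "rho = (2 * a) powr (1 / (s - 1)) * (energy f / T) powr (1 / (s - 1))" using a En T by (simp add: rho_def powr_mult[symmetric])
    thus ?thesis using En T by (simp add: p(4) powr_add)
   qed
   finally show ?thesis by (simp add: A_def K_def)
  qed
 qed
 moreover have "0 <= K" using b by (simp add: K_def)
 ultimately show thesis using that by blast
qed

lemma weak_type_zero:
 obtains K where "0 <= K"
  "!!v T. [|v : LIPb; !!x. 0 <= v x; measure m UNIV / 2 <= measure m {x. v x = 0}; 0 < T|] ==>
   measure m {x. T <= v x} <= K * (energy v / T) powr p"
proof -
 obtain K where K: "0 <= K"
  "!!f T. f : LIPb ==> 0 < T ==> measure m {x. T <= abs (f x - mean f)} <= K * (energy f / T) powr p" using weak_type by blast
 have "measure m {x. T <= v x} <= (K * 2 powr p) * (energy v / T) powr p"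
  if v: "v : LIPb" "!!x. 0 <= v x" "measure m UNIV / 2 <= measure m {x. v x = 0}" and T: "0 < T" for v T
 proof -
  note [measurable] = LIPb_measurable[OF v(1)]
  have ms: "{x. T <= v x} : sets borel" "{x. v x = 0} : sets borel" "{x. T / 2 <= abs (v x - mean v)} : sets borel" by measurable
  have "measure m {x. T <= v x} <= measure m {x. T / 2 <= abs (v x - mean v)}"
  proof (cases "mean v <= T / 2")
   case True
   hence "T / 2 <= abs (v x - mean v)" if "T <= v x" for x using that abs_ge_self[of "v x - mean v"] by linarith
   thus ?thesis using ms by (intro finite_measure_mono) auto
  next
   case False
   have "measure m {x. T <= v x} <= measure m (UNIV - {x. v x = 0})" using ms T by (intro finite_measure_mono) auto
   also have "... <= measure m {x. v x = 0}" using v(3) ms finite_measure_compl[of "{x. v x = 0}"] by simp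
   also have "... <= measure m {x. T / 2 <= abs (v x - mean v)}" using False ms by (intro finite_measure_mono) auto
   finally show ?thesis .
  qed
  also have "... <= K * (energy v / (T / 2)) powr p" using v T by (intro K) auto
  also have "... = (K * 2 powr p) * (energy v / T) powr p" using T powr_mult[of 2 "energy v / T" p] by (simp add: field_simps)
  finally show ?thesis .
 qed
 thus thesis using that[of "K * 2 powr p"] K(1) by auto
qed

end

lemma powr_superadditive:
 fixes a b p :: real
 assumes "1 <= p" "0 <= a" "0 <= b" shows "a powr p + b powr p <= (a + b) powr p"
proof -
 have "x powr p <= x * (a + b) powr (p - 1)" if "0 <= x" "x <= a + b" for x
  using that assms powr_mult_base[of x "p - 1"] mult_left_mono[OF powr_mono2[of "p - 1" x "a + b"], of x] by simp
 from add_mono[OF this[of a] this[of b]] show ?thesis using assms powr_mult_base[of "a + b" "p - 1"] by (simp add: distrib_right[symmetric])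
qed

lemma sum_powr_le:
 fixes A :: "nat => real"
 assumes p: "1 <= p" and A: "!!j. 0 <= A j" shows "(\<Sum>j<n. A j powr p) <= (\<Sum>j<n. A j) powr p"
proof (induction n)
 case (Suc n)
 thus ?case using powr_superadditive[OF p sum_nonneg[of "{..<n}" A] A[of n]] A by simp
qed simp

context bounded_PI
begin

text \<open>The bound 2 alone is not inductive, so the topmost level is counted exactly.\<close>

lemma card_dyadic_levels:
 fixes a :: "nat => real"
 assumes a: "!!j. a (Suc j) < a j"
 shows "(\<Sum>j<n. indicator {a (j + 2)..a (j + 1)} t) <= (if t < a (Suc n) then 0 else if t = a (Suc n) then 1 else 2 :: real)"
proof (induction n)
 case (Suc n)
 thus ?case using a[of "Suc n"] by (auto simp: indicator_def split: if_splits)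
qed simp

text \<open>Maz'ya's truncation argument upgrades the weak-type bound to a strong one.\<close>

lemma strong_type_zero:
 obtains K where "0 <= K"
  "!!u. [|u : LIPb; !!x. 0 <= u x; measure m UNIV / 2 <= measure m {x. u x = 0}|] ==> (LINT x|m. u x powr p) <= K * energy u powr p"
proof -
 obtain K where K: "0 <= K"
  "!!v T. [|v : LIPb; !!x. 0 <= v x; measure m UNIV / 2 <= measure m {x. v x = 0}; 0 < T|] ==>
   measure m {x. T <= v x} <= K * (energy v / T) powr p" using weak_type_zero by blast
 have "(LINT x|m. u x powr p) <= (K * 8 powr p * 2 powr p) * energy u powr p"
  if u: "u : LIPb" "!!x. 0 <= u x" "measure m UNIV / 2 <= measure m {x. u x = 0}" for u
 proof -
  note ul = LIPb_Lip[OF u(1)] and [measurable] = LIPb_measurable[OF u(1)]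
  obtain b0 where b0: "!!x. abs (u x) <= b0" using LIPb_bounded[OF u(1)] by blast
  define b where "b = abs b0 + 1"
  have "u x <= b" for x using b0[of x] unfolding b_def by linarith
  hence b: "b > 0" "!!x. u x <= b" by (simp_all add: b_def add_nonneg_pos)
  define a where "a j = b / 2 ^ j" for j
  have apos: "0 < a j" for j using b by (simp add: a_def)
  have a2: "a (Suc j) = a j / 2" for j by (simp add: a_def)
  \<comment> \<open>The closed band that carries the energy of the truncation belonging to level
    \<open>j\<close>. Adjacent bands meet in a level set, so their energies sum to at most twice the
    total.\<close>
  define D where "D j = {x. a (j + 2) <= u x & u x <= a (j + 1)}" for j
  define A where "A j = energy_on u (D j)" for j
  have Ai: "integrable m (%x. lip_a u x * indicator (D j) x)" for j
   unfolding D_def by (intro integrable_mult_bdd_borel integrable_lip_a[OF ul] bdd_borel_indicator) measurable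
  have A0: "0 <= A j" for j unfolding A_def by (rule energy_on_nonneg[OF ul])
  have sumA: "(\<Sum>j<n. A j) <= 2 * energy u" for n
  proof -
   have "(\<Sum>j<n. A j) = (LINT x|m. (\<Sum>j<n. lip_a u x * indicator (D j) x))"
    unfolding A_def energy_on_def using Ai by (intro Bochner_Integration.integral_sum[symmetric])
   also have "... <= (LINT x|m. 2 * lip_a u x)"
   proof (rule integral_mono)
    fix x
    have "(\<Sum>j<n. indicator (D j) x) = (\<Sum>j<n. indicator {a (j + 2)..a (j + 1)} (u x) :: real)" by (simp add: D_def indicator_def)
    also have "... <= 2" using card_dyadic_levels[of a, where n=n and t="u x"] apos by (force simp: a2 split: if_splits)
    finally show "(\<Sum>j<n. lip_a u x * indicator (D j) x) <= 2 * lip_a u x"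
     using mult_left_mono[OF _ lip_a_nonneg[OF ul, of x]] by (fastforce simp: sum_distrib_left[symmetric] mult.commute simp del: sum_mult_indicator)
   qed (use Ai integrable_lip_a[OF ul] in \<open>simp_all add: Bochner_Integration.integrable_sum del: sum_mult_indicator\<close>)
   finally show ?thesis by (simp add: energy_def)
  qed
  \<comment> \<open>Since \<open>p >= 1\<close>, powers of the energies of the bands can be summed
    over all levels without loss.\<close>
  have sumAp: "(\<Sum>j<n. A j powr p) <= (2 * energy u) powr p" for n
   using order_trans[OF sum_powr_le[OF p(5) A0] powr_mono2[OF _ sum_nonneg sumA]] A0 p(5) by simp
  define S where "S j = {x. a (Suc j) < u x & u x <= a j}" for j
  have Sm: "S j : sets borel" for j unfolding S_def by measurable
  have level: "a j powr p * measure m (S j) <= K * 8 powr p * A j powr p" for j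
  proof -
   \<comment> \<open>The truncation rises across the band \<open>D j\<close> and equals
     \<open>a (j + 2)\<close> on \<open>S j\<close>. Testing at the height \<open>a (j + 3)\<close>,
     which is \<open>a j / 8\<close>, produces the factor \<open>8 powr p\<close>.\<close>
   define v where "v = truncate (a (j + 2)) (a (j + 2)) u"
   note v = lip_a_truncate[OF u(1), of "a (j + 2)" "a (j + 2)", folded v_def]
   note [measurable] = LIPb_measurable[OF v(1)]
   have v0: "0 <= v x" for x using apos[of "j + 2"] by (simp add: v_def truncate_def)
   have ms: "{x. v x = 0} : sets borel" "{x. a (j + 3) <= v x} : sets borel" by measurable
   have "measure m {x. u x = 0} <= measure m {x. v x = 0}"
    using ms apos[of "j + 2"] by (intro finite_measure_mono) (auto simp: v_def truncate_def)
   hence half: "measure m UNIV / 2 <= measure m {x. v x = 0}" using u(3) by linarith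
   have "measure m (S j) <= measure m {x. a (j + 3) <= v x}" using ms apos[of j] by (intro finite_measure_mono)
     (auto simp: S_def v_def truncate_def a2 numeral_eq_Suc)
   also have "... <= K * (energy v / a (j + 3)) powr p" by (rule K(2)[OF v(1) v0 half apos])
   also have "... <= K * (A j / a (j + 3)) powr p"
   proof -
    have "energy v <= A j" unfolding energy_def A_def energy_on_def
     using v(2) by (intro integral_mono[OF integrable_lip_a[OF LIPb_Lip[OF v(1)]] Ai]) (simp add: D_def a2)
    thus ?thesis using K(1) apos[of "j + 3"] energy_nonneg[OF LIPb_Lip[OF v(1)]] p(1)
     by (intro mult_left_mono powr_mono2 divide_right_mono) auto
   qed
   finally have "a j powr p * measure m (S j) <= a j powr p * (K * (A j / a (j + 3)) powr p)" by (intro mult_left_mono) auto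
   also have "... = K * (a j * (A j / a (j + 3))) powr p" by (simp only: powr_mult[of "a j" "A j / a (j + 3)"] mult.left_commute)
   also have "a j * (A j / a (j + 3)) = 8 * A j" using apos[of j] by (simp add: a2 numeral_eq_Suc)
   finally show ?thesis by (simp add: powr_mult mult.assoc)
  qed
  define C where "C = K * 8 powr p * (2 * energy u) powr p"
  \<comment> \<open>Only finitely many levels are summed; the values not above \<open>a n\<close>
    contribute the last term, which vanishes as \<open>n\<close> grows.\<close>
  have "(LINT x|m. u x powr p) <= C + a n powr p * measure m UNIV" for n
  proof -
   have s0: "0 <= (\<Sum>j<n. a j powr p * indicator (S j) x)" for n x by (intro sum_nonneg) simp
   have pw: "u x <= a n \<or> u x powr p <= (\<Sum>j<n. a j powr p * indicator (S j) x)" for x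
   proof (induction n)
    case 0 show ?case using b(2) by (simp add: a_def)
   next
    case (Suc n)
    have "u x powr p <= a n powr p" if "u x <= a n" using that u(2) p(1) by (intro powr_mono2) auto
    thus ?case using Suc s0[of x n] by (cases "u x <= a (Suc n)"; cases "u x <= a n") (simp_all add: S_def del: sum_mult_indicator)
   qed
   have i: "integrable m (%x. a j powr p * indicator (S j) x)" for j using Sm by (simp add: less_top[symmetric])
   have "(LINT x|m. u x powr p) <= (LINT x|m. (\<Sum>j<n. a j powr p * indicator (S j) x) + a n powr p)"
   proof (rule integral_mono)
    show "integrable m (%x. u x powr p)" using bdd_borel_Lp[OF p(5) LIPb_bdd_borel[OF u(1)]] u(2) by (simp add: Lp_funs_def)
    show "integrable m (%x. (\<Sum>j<n. a j powr p * indicator (S j) x) + a n powr p)" using i by (intro Bochner_Integration.integrable_add Bochner_Integration.integrable_sum) auto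
    show "u x powr p <= (\<Sum>j<n. a j powr p * indicator (S j) x) + a n powr p" for x
     using pw[of x] powr_mono2[of p "u x" "a n"] u(2)[of x] p(1) s0[of x n] powr_ge_zero[of "a n" p] by linarith
   qed
   also have "... = (\<Sum>j<n. a j powr p * measure m (S j)) + a n powr p * measure m UNIV"
    using i Sm by (simp add: Bochner_Integration.integral_sum Bochner_Integration.integrable_sum del: sum_mult_indicator)
   also have "... <= (\<Sum>j<n. K * 8 powr p * A j powr p) + a n powr p * measure m UNIV" using level by (intro add_right_mono sum_mono)
   also have "... <= C + a n powr p * measure m UNIV"
    unfolding C_def sum_distrib_left[symmetric] using K(1) sumAp by (intro add_right_mono mult_left_mono) auto
   finally show ?thesis .
  qed
  moreover have "(%n. a n) ----> 0" unfolding a_def using tendsto_mult_right_zero[OF LIMSEQ_power_zero[of "1/2 :: real"], of b] by (simp add: power_one_over)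
  hence "(%n. C + a n powr p * measure m UNIV) ----> C + 0 * measure m UNIV"
   using p(1) apos by (intro tendsto_intros tendsto_zero_powrI[of _ _ _ p]) (auto intro!: always_eventually less_imp_le)
  ultimately have "(LINT x|m. u x powr p) <= C" by (intro LIMSEQ_le_const[of _ C]) auto
  thus ?thesis using energy_nonneg[OF ul] by (simp add: C_def powr_mult mult.assoc)
 qed
 moreover have "0 <= K * 8 powr p * 2 powr p" using K(1) by simp
 ultimately show thesis using that by blast
qed

text \<open>
 At a height comparable to the energy, the weak-type bound leaves \<open>|f - mean f|\<close> below that height on
 at least half of the space.
\<close>

lemma sobolev:
 obtains K where "0 <= K" "!!f. f : LIPb ==> Lp_norm m p (%x. f x - mean f) <= K * energy f"
proof -
 obtain K1 where K1: "0 <= K1"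
  "!!f T. f : LIPb ==> 0 < T ==> measure m {x. T <= abs (f x - mean f)} <= K1 * (energy f / T) powr p" using weak_type by blast
 obtain K where K: "0 <= K"
  "!!u. [|u : LIPb; !!x. 0 <= u x; measure m UNIV / 2 <= measure m {x. u x = 0}|] ==> (LINT x|m. u x powr p) <= K * energy u powr p"
  using strong_type_zero by blast
 define M where "M = measure m UNIV"
 \<comment> \<open>Chosen so that the weak bound at height \<open>k * t\<close> is at most half of
   the mass; adding 1 to \<open>K1\<close> keeps \<open>k\<close> positive.\<close>
 define k where "k = (2 * (K1 + 1) / M) powr (1 / p)"
 have M: "0 < M" using UNIV_pos by (simp add: M_def)
 have k: "0 < k" "k powr p = 2 * (K1 + 1) / M" using K1(1) M p(1) by (simp_all add: k_def powr_powr)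
 define K' where "K' = K powr (1 / p) + k * M powr (1 / p)"
 have K': "0 <= K'" using k by (simp add: K'_def)
 have "Lp_norm m p (%x. f x - mean f) <= K' * energy f" if f: "f : LIPb" for f
 \<comment> \<open>The energy is replaced by any larger \<open>t\<close>, which makes the truncation
   height positive even when the energy is 0.\<close>
 proof (rule le_mult_limit[OF K'])
  fix t assume t: "energy f < t"
  note E0 = energy_nonneg[OF LIPb_Lip[OF f]]
  define T where "T = k * t"
  have T: "0 < T" using t E0 k by (simp add: T_def)
  \<comment> \<open>The excess over the height \<open>T\<close>. It vanishes on half of the space,
    and \<open>u + T\<close> dominates the deviation from the mean.\<close>
  define u where "u x = max (abs (f x - mean f) - T) 0" for x
  have "abs (u x - u y) <= abs (f x - f y)" for x y unfolding u_def by linarith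
  note u = LIPb_contraction[OF f this]
  note [measurable] = LIPb_measurable[OF f]
  have ms: "{x. T <= abs (f x - mean f)} : sets borel" "{x. u x = 0} : sets borel" unfolding u_def by measurable
  have "measure m {x. T <= abs (f x - mean f)} <= K1 * (energy f / T) powr p" by (rule K1(2)[OF f T])
  also have "... <= K1 * (1 / k) powr p" using K1(1) E0 t k p(1) T by (intro mult_left_mono powr_mono2) (auto simp: T_def field_simps)
  also have "... <= M / 2" using K1(1) k M by (simp add: powr_divide field_simps)
  finally have "M / 2 <= measure m (UNIV - {x. T <= abs (f x - mean f)})"
   using ms finite_measure_compl[of "{x. T <= abs (f x - mean f)}"] by (simp add: M_def)
  also have "... <= measure m {x. u x = 0}" using ms by (intro finite_measure_mono) (auto simp: u_def)
  finally have half: "measure m UNIV / 2 <= measure m {x. u x = 0}" by (simp add: M_def)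
  have E: "energy u <= energy f" unfolding energy_def using u(2) integrable_lip_a LIPb_Lip u(1) f by (intro integral_mono) auto
  have "(LINT x|m. u x powr p) <= K * energy u powr p" by (rule K(2)[OF u(1) _ half]) (simp add: u_def)
  also have "... <= K * t powr p" using E t energy_nonneg[OF LIPb_Lip[OF u(1)]] K(1) p(1) by (intro mult_left_mono powr_mono2) auto
  also have "... = (K powr (1 / p) * t) powr p" using K(1) E0 t p(1) by (simp add: powr_mult powr_powr)
  finally have ul: "Lp_norm m p u <= K powr (1 / p) * t" using E0 t by (intro Lp_norm_le[OF p(5)]) (auto simp: u_def)
  have L: "u : Lp_funs m p" "(%x. T) : Lp_funs m p" "(%x. f x - mean f) : Lp_funs m p"
   using u(1) f by (auto intro!: bdd_borel_Lp[OF p(5)] LIPb_bdd_borel)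
  have "(LINT x|m. abs (f x - mean f) powr p) <= (LINT x|m. abs (u x + T) powr p)" using L(3) Lp_funs_add[OF p(5) L(1,2)] p(1) T
   by (intro integral_mono powr_mono2) (auto simp: Lp_funs_def u_def)
  hence "Lp_norm m p (%x. f x - mean f) <= Lp_norm m p (%x. u x + T)"
   by (intro Lp_norm_le[OF p(5)] Lp_norm_nonneg) (simp add: Lp_norm_powr[OF p(5)])
  also have "... <= Lp_norm m p u + Lp_norm m p (%x. T)" by (rule minkowski[OF p(5) L(1,2)])
  also have "... <= K powr (1 / p) * t + T * M powr (1 / p)" using T unfolding M_def by (intro add_mono ul Lp_norm_bounded_le[OF p(5)]) auto
  also have "... = K' * t" by (simp add: K'_def T_def algebra_simps)
  finally show "Lp_norm m p (%x. f x - mean f) <= K' * t" .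
 qed
 thus thesis using that K' by blast
qed

end

section \<open>The Hahn--Banach theorem for spaces of real functions\<close>

text \<open>
 A partial functional is a linear subspace \<open>g\<close> of \<open>V \<times> \<real>\<close> below the graph of \<open>P\<close>; it is
 automatically single-valued because \<open>P 0 = 0\<close>.
\<close>

lemma hahn_banach_fun:
 fixes V :: "('i => real) set" and P :: "('i => real) => real"
 assumes V: "!!u v. u : V ==> v : V ==> (%i. u i + v i) : V" "!!c u. u : V ==> (%i. c * u i) : V"
  and P: "!!u v. u : V ==> v : V ==> P (%i. u i + v i) <= P u + P v"
   "!!c u. u : V ==> P (%i. c * u i) <= abs c * P u" and g0: "g0 ~= {}" "!!u r. (u, r) : g0 ==> u : V" "!!u r. (u, r) : g0 ==> r <= P u"
   "!!u r v q. (u, r) : g0 ==> (v, q) : g0 ==> ((%i. u i + v i), r + q) : g0"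
   "!!c u r. (u, r) : g0 ==> ((%i. c * u i), c * r) : g0"
 obtains L where "!!u v. u : V ==> v : V ==> L (%i. u i + v i) = L u + L v"
  "!!c u. u : V ==> L (%i. c * u i) = c * L u" "!!u. u : V ==> L u <= P u" "!!u r. (u, r) : g0 ==> L u = r"
proof -
 define G where "G = {g. g0 <= g & (ALL u r. (u, r) : g --> u : V & r <= P u) &
  (ALL u r v q. (u, r) : g --> (v, q) : g --> ((%i. u i + v i), r + q) : g) & (ALL c u r. (u, r) : g --> ((%i. c * u i), c * r) : g)}"
 note G = G_def mem_Collect_eq
 have "g0 : G" unfolding G using g0 by blast
 moreover have "\<Union>\<C> : G" if \<C>: "\<C> ~= {}" "subset.chain G \<C>" for \<C>
 proof -
  have sub: "\<C> <= G" and lin: "!!g h. g : \<C> ==> h : \<C> ==> g <= h \<or> h <= g" using \<C>(2) by (auto simp: subset_chain_def)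
  have g: "g : G" if "g : \<C>" for g using sub that by blast
  show ?thesis unfolding G
  proof (intro conjI allI impI)
   show "g0 <= \<Union>\<C>" using \<C>(1) g unfolding G by blast
   show "u : V" "r <= P u" if "(u, r) : \<Union>\<C>" for u r using that g unfolding G by blast+
   show "((%i. c * u i), c * r) : \<Union>\<C>" if "(u, r) : \<Union>\<C>" for c u r using that g unfolding G by blast
   show "((%i. u i + v i), r + q) : \<Union>\<C>" if uv: "(u, r) : \<Union>\<C>" "(v, q) : \<Union>\<C>" for u r v q
   proof -
    obtain g1 g2 where g12: "g1 : \<C>" "(u, r) : g1" "g2 : \<C>" "(v, q) : g2" using uv by blast
    then obtain g3 where "g3 : \<C>" "(u, r) : g3" "(v, q) : g3" using lin[of g1 g2] by blast
    thus ?thesis using g[of g3] unfolding G by blast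
   qed
  qed
 qed
 ultimately obtain M where M: "M : G" and max: "!!X. X : G ==> M <= X ==> X = M" using subset_Zorn_nonempty[of G] by blast
 have Mg0: "g0 <= M" and MV: "!!u r. (u, r) : M ==> u : V" and MP: "!!u r. (u, r) : M ==> r <= P u"
  and Madd: "!!u r v q. (u, r) : M ==> (v, q) : M ==> ((%i. u i + v i), r + q) : M"
  and Mscale: "!!c u r. (u, r) : M ==> ((%i. c * u i), c * r) : M" using M unfolding G by blast+
 obtain w0 r0 where w0: "(w0, r0) : M" using g0(1) Mg0 by auto
 have M0: "((%i. 0), 0) : M" using Mscale[OF w0, of 0] by simp
 have P0: "P (%i. 0) <= 0" using P(2)[OF MV[OF w0], of 0] by simp
 have uniq: "r = q" if "(u, r) : M" "(u, q) : M" for u r q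
 proof -
  have "((%i. u i + (-1) * u i), r + (-1) * q) : M" "((%i. u i + (-1) * u i), q + (-1) * r) : M" using Madd Mscale that by blast+
  from MP[OF this(1)] MP[OF this(2)] show ?thesis using P0 by simp
 qed
 have dom: "EX r. (v, r) : M" if v: "v : V" for v
 proof (rule ccontr)
  assume no: "\<nexists>r. (v, r) : M"
  \<comment> \<open>Every lower bound for a value at \<open>v\<close> lies below every upper bound,
    so a value \<open>a\<close> compatible with \<open>P\<close> exists.\<close>
  have sep: "r - P (%i. u i - v i) <= P (%i. u' i + v i) - r'" if "(u, r) : M" "(u', r') : M" for u r u' r'
  proof -
   have mv: "(%i. u i - v i) : V" "(%i. u' i + v i) : V"
    using V(1)[OF MV[OF that(1)] V(2)[OF v, of "-1"]] V(1)[OF MV[OF that(2)] v] by simp_all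
   have "r + r' <= P (%i. u i + u' i)" using MP[OF Madd[OF that]] .
   also have "(%i. u i + u' i) = (%i. (u i - v i) + (u' i + v i))" by auto
   also have "P ... <= P (%i. u i - v i) + P (%i. u' i + v i)" by (rule P(1)[OF mv])
   finally show ?thesis by simp
  qed
  define A where "A = {r - P (%i. u i - v i) | u r. (u, r) : M}"
  define a where "a = Sup A"
  have Ane: "A ~= {}" using M0 by (auto simp: A_def)
  have Ab: "bdd_above A" using sep[OF _ M0] by (auto simp: A_def intro!: bdd_aboveI)
  have a1: "r - P (%i. u i - v i) <= a" if "(u, r) : M" for u r unfolding a_def using that Ab by (intro cSup_upper) (auto simp: A_def)
  have a2: "a <= P (%i. u i + v i) - r" if "(u, r) : M" for u r
   unfolding a_def using sep[OF _ that] Ane by (intro cSup_least) (auto simp: A_def)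
  define M' where "M' = {((%i. u i + t * v i), r + t * a) | u r t. (u, r) : M}"
  have M'I: "((%i. u i + t * v i), r + t * a) : M'" if "(u, r) : M" for u r t
   unfolding M'_def using that by (intro CollectI exI[of _ u] exI[of _ r] exI[of _ t] conjI refl)
  have sub: "M <= M'"
  proof
   fix z assume "z : M"
   thus "z : M'" unfolding M'_def by (intro CollectI exI[of _ "fst z"] exI[of _ "snd z"] exI[of _ 0]) simp
  qed
  \<comment> \<open>Dividing by the absolute value of \<open>t\<close> reduces the estimate to
    adding or subtracting \<open>v\<close>, which are the two conditions on
    \<open>a\<close>.\<close>
  have bound: "r + t * a <= P (%i. u i + t * v i)" if ur: "(u, r) : M" for u r t
  proof (cases "t = 0")
   case True thus ?thesis using MP[OF ur] by simp
  next
   case False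
   let ?w = "%i. u i + t * v i"
   have w: "?w : V" using V(1)[OF MV[OF ur] V(2)[OF v]] .
   note sc = Mscale[OF ur, of "1 / abs t"]
   have "(1 / abs t) * r + sgn t * a <= P (%i. (1 / abs t) * ?w i)"
    using a1[OF sc] a2[OF sc] False by (cases "t > 0") (simp_all add: distrib_left)
   also have "... <= abs (1 / abs t) * P ?w" by (rule P(2)[OF w])
   finally have "abs t * ((1 / abs t) * r + sgn t * a) <= abs t * (abs (1 / abs t) * P ?w)" by (rule mult_left_mono) simp
   thus ?thesis using False by (cases "t > 0") (simp_all add: distrib_left right_diff_distrib)
  qed
  have "M' : G" unfolding G
  proof (intro conjI allI impI)
   show "g0 <= M'" using sub Mg0 by blast
   show "u : V" "r <= P u" if "(u, r) : M'" for u r using that bound V(1)[OF MV V(2)[OF v]] by (auto simp: M'_def)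
   show "((%i. c * u i), c * r) : M'" if ur: "(u, r) : M'" for c u r
   proof -
    obtain u0 r0 t where e: "u = (%i. u0 i + t * v i)" "r = r0 + t * a" "(u0, r0) : M" using ur by (auto simp: M'_def)
    have "((%i. c * u0 i + (c * t) * v i), c * r0 + (c * t) * a) : M'" by (rule M'I[OF Mscale[OF e(3)]])
    thus ?thesis by (simp add: e algebra_simps)
   qed
   show "((%i. u i + w i), r + q) : M'" if uw: "(u, r) : M'" "(w, q) : M'" for u r w q
   proof -
    obtain u0 r0 t where e: "u = (%i. u0 i + t * v i)" "r = r0 + t * a" "(u0, r0) : M" using uw(1) by (auto simp: M'_def)
    obtain u1 r1 t1 where e1: "w = (%i. u1 i + t1 * v i)" "q = r1 + t1 * a" "(u1, r1) : M" using uw(2) by (auto simp: M'_def)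
    have "((%i. (u0 i + u1 i) + (t + t1) * v i), (r0 + r1) + (t + t1) * a) : M'" by (rule M'I[OF Madd[OF e(3) e1(3)]])
    thus ?thesis by (simp add: e e1 algebra_simps)
   qed
  qed
  hence "M' = M" using max sub by blast
  moreover have "((%i. 0 + 1 * v i), 0 + 1 * a) : M'" by (rule M'I[OF M0])
  ultimately show False using no by simp
 qed
 define L where "L v = (THE r. (v, r) : M)" for v
 have LM: "(v, L v) : M" if "v : V" for v
 proof -
  obtain r where "(v, r) : M" using dom[OF \<open>v : V\<close>] by blast
  thus ?thesis unfolding L_def using uniq by (intro theI[of "%r. (v, r) : M" r]) auto
 qed
 have L_eq: "L v = r" if "(v, r) : M" for v r using uniq[OF LM[OF MV[OF that]] that] .
 show thesis
 proof (rule that[of L])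
  show "L (%i. u i + v i) = L u + L v" if "u : V" "v : V" for u v by (rule L_eq[OF Madd[OF LM[OF that(1)] LM[OF that(2)]]])
  show "L (%i. c * u i) = c * L u" if "u : V" for c u by (rule L_eq[OF Mscale[OF LM[OF that]]])
  show "L u <= P u" if "u : V" for u by (rule MP[OF LM[OF that]])
  show "L u = r" if "(u, r) : g0" for u r using L_eq Mg0 that by blast
 qed
qed

section \<open>Essentially bounded functions\<close>

definition Linf_norm :: "'a measure => ('a => real) => real" where
 "Linf_norm m f = Inf {C. 0 <= C & (AE x in m. abs (f x) <= C)}"

definition Linf_pre :: "'a measure => ('a => real) nvs" where
 "Linf_pre m = vmaps UNIV real_nvs (Linf_funs m) (Linf_norm m)"

lemma Linf_eq: "Linf m = vquotient (Linf_pre m) (null_funs m)" by (simp add: Linf_def Linf_pre_def Linf_norm_def[abs_def])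

lemma Linf_pre_simps [simp]:
 "carr (Linf_pre m) = Linf_funs m" "vnorm (Linf_pre m) = Linf_norm m"
 "vzero (Linf_pre m) = (%x. 0)" "vadd (Linf_pre m) f g = (%x. f x + g x)"
 "vscale (Linf_pre m) c f = (%x. c * f x)" "vdiff (Linf_pre m) f g = (%x. f x - g x)" by (simp_all add: Linf_pre_def)

lemma Linf_norm_le: "0 <= C ==> AE x in m. abs (f x) <= C ==> Linf_norm m f <= C"
 unfolding Linf_norm_def by (intro cInf_lower) (auto intro: bdd_belowI[of _ 0])

lemma Linf_norm_nonneg:
 assumes "f : Linf_funs m" shows "0 <= Linf_norm m f"
proof -
 obtain C where "AE x in m. abs (f x) <= C" using assms by (auto simp: Linf_funs_def)
 hence "AE x in m. abs (f x) <= abs C" by eventually_elim simp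
 thus ?thesis unfolding Linf_norm_def by (intro cInf_greatest) (auto intro: exI[of _ "abs C"])
qed

lemma Linf_norm_AE:
 assumes "f : Linf_funs m" shows "AE x in m. abs (f x) <= Linf_norm m f"
proof (rule AE_upper_bound_inf)
 fix e :: real assume e: "e > 0"
 obtain C where "AE x in m. abs (f x) <= C" using assms by (auto simp: Linf_funs_def)
 hence "AE x in m. abs (f x) <= abs C" by eventually_elim simp
 hence "{C. 0 <= C & (AE x in m. abs (f x) <= C)} ~= {}" by (auto intro: exI[of _ "abs C"])
 from cInf_lessD[OF this, of "Linf_norm m f + e"] e
 obtain D where "AE x in m. abs (f x) <= D" "D < Linf_norm m f + e" by (auto simp: Linf_norm_def)
 thus "AE x in m. abs (f x) <= Linf_norm m f + e" by (auto elim: eventually_mono)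
qed

lemma Linf_funs_add:
 assumes f: "f : Linf_funs m" and g: "g : Linf_funs m"
 shows "(%x. f x + g x) : Linf_funs m" "Linf_norm m (%x. f x + g x) <= Linf_norm m f + Linf_norm m g"
proof -
 have ae: "AE x in m. abs (f x + g x) <= Linf_norm m f + Linf_norm m g"
  using Linf_norm_AE[OF f] Linf_norm_AE[OF g] by eventually_elim linarith
 show "(%x. f x + g x) : Linf_funs m" using f g ae by (auto simp: Linf_funs_def)
 show "Linf_norm m (%x. f x + g x) <= Linf_norm m f + Linf_norm m g"
  using ae Linf_norm_nonneg[OF f] Linf_norm_nonneg[OF g] by (intro Linf_norm_le) auto
qed

lemma Linf_funs_scale:
 assumes f: "f : Linf_funs m" shows "(%x. c * f x) : Linf_funs m" "Linf_norm m (%x. c * f x) <= abs c * Linf_norm m f"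
proof -
 have ae: "AE x in m. abs (c * f x) <= abs c * Linf_norm m f"
  using Linf_norm_AE[OF f] by eventually_elim (simp add: abs_mult mult_left_mono)
 show "(%x. c * f x) : Linf_funs m" using f ae by (auto simp: Linf_funs_def)
 show "Linf_norm m (%x. c * f x) <= abs c * Linf_norm m f" using ae Linf_norm_nonneg[OF f] by (intro Linf_norm_le) auto
qed

lemma zero_Linf: "(%x. 0) : Linf_funs m" by (auto simp: Linf_funs_def intro: exI[of _ 0])

lemma seminormed_Linf_pre: "seminormed (Linf_pre m)" unfolding Linf_pre_def
 by (rule seminormed_fun) (auto intro: Linf_funs_add Linf_funs_scale Linf_norm_nonneg zero_Linf)

lemma null_funs_Linf: "null_funs m = {f : Linf_funs m. Linf_norm m f = 0}"
proof (intro set_eqI iffI)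
 fix f assume "f : null_funs m"
 hence f: "f : borel_measurable m" "AE x in m. abs (f x) <= 0" by (auto simp: null_funs_iff)
 hence "f : Linf_funs m" by (auto simp: Linf_funs_def)
 thus "f : {f : Linf_funs m. Linf_norm m f = 0}" using Linf_norm_le[OF order_refl f(2)] Linf_norm_nonneg[of f m] by simp
next
 fix f assume "f : {f : Linf_funs m. Linf_norm m f = 0}"
 thus "f : null_funs m" using Linf_norm_AE[of f m] by (auto simp: null_funs_iff Linf_funs_def)
qed

lemma vsubspace_null_funs_Linf: "vsubspace (Linf_pre m) (null_funs m)"
 using seminormed.vsubspace_norm_zero[OF seminormed_Linf_pre, of m] by (simp add: null_funs_Linf)

lemma Linf_simps:
 "carr (Linf m) = ae_class m ` Linf_funs m" "vzero (Linf m) = ae_class m (%x. 0)"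
 "f : Linf_funs m ==> g : Linf_funs m ==>
  vadd (Linf m) (ae_class m f) (ae_class m g) = ae_class m (%x. f x + g x)"
 "f : Linf_funs m ==> vscale (Linf m) c (ae_class m f) = ae_class m (%x. c * f x)"
 "vnorm (Linf m) A = Inf (Linf_norm m ` A)"
proof -
 interpret seminormed "Linf_pre m" by (rule seminormed_Linf_pre)
 note N = vsubspace_null_funs_Linf[of m]
 have c: "vcoset (Linf_pre m) (null_funs m) f = ae_class m f" for f by (simp add: vcoset_def)
 note q = vquotient_simps[OF N, unfolded c Linf_eq[symmetric]]
 show "carr (Linf m) = ae_class m ` Linf_funs m" "vzero (Linf m) = ae_class m (%x. 0)"
  "f : Linf_funs m ==> g : Linf_funs m ==>
   vadd (Linf m) (ae_class m f) (ae_class m g) = ae_class m (%x. f x + g x)"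
  "f : Linf_funs m ==> vscale (Linf m) c (ae_class m f) = ae_class m (%x. c * f x)"
  "vnorm (Linf m) A = Inf (Linf_norm m ` A)" using q(1,2) q(3)[of f g] q(4)[of f c] q(5)[of A] by (simp_all add: image_def c)
qed

lemma vspace_Linf: "vspace_on (Linf m)" unfolding Linf_eq by (rule seminormed.axioms(1)[OF
   seminormed.seminormed_vquotient[OF seminormed_Linf_pre vsubspace_null_funs_Linf]])

lemma ae_class_eq_iff:
 assumes "f : borel_measurable m" "g : borel_measurable m" shows "ae_class m f = ae_class m g \<longleftrightarrow> (AE x in m. f x = g x)"
proof
 assume "ae_class m f = ae_class m g"
 moreover have "f : ae_class m f" using assms(1) by (simp only: mem_ae_class) simp
 ultimately have "f : ae_class m g" by simp
 thus "AE x in m. f x = g x" using assms(2) by (simp only: mem_ae_class)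
next
 assume ae: "AE x in m. f x = g x"
 have "h : ae_class m f \<longleftrightarrow> h : ae_class m g" for h unfolding mem_ae_class[OF assms(1)] mem_ae_class[OF assms(2)]
 proof (intro conj_cong refl iffI)
  show "AE x in m. h x = g x" if "AE x in m. h x = f x" using that ae by eventually_elim simp
  show "AE x in m. h x = f x" if "AE x in m. h x = g x" using that ae by eventually_elim simp
 qed
 thus "ae_class m f = ae_class m g" by (intro set_eqI)
qed

lemma self_ae_class: "f : borel_measurable m ==> f : ae_class m f" by (simp only: mem_ae_class) simp

lemma fmult_ae_class:
 assumes h: "h : borel_measurable m" and u: "u : borel_measurable m" shows "fmult m h (ae_class m u) = ae_class m (%x. h x * u x)"
proof -
 have hu: "(%x. h x * u x) : borel_measurable m" using h u by simp
 show ?thesis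
 proof (intro set_eqI iffI)
  fix v assume "v : fmult m h (ae_class m u)"
  hence "EX u' n. v = (%x. h x * u' x + n x) & u' : ae_class m u & n : null_funs m" unfolding fmult_def mem_Collect_eq .
  then obtain u' n where v: "v = (%x. h x * u' x + n x)" "u' : ae_class m u" "n : null_funs m" by (elim exE conjE)
  have u': "u' : borel_measurable m" "AE x in m. u' x = u x" using v(2) unfolding mem_ae_class[OF u] by auto
  have n: "n : borel_measurable m" "AE x in m. n x = 0" using v(3) by (auto simp: null_funs_iff)
  have "AE x in m. v x = h x * u x" using u'(2) n(2) by eventually_elim (simp add: v(1))
  thus "v : ae_class m (%x. h x * u x)" unfolding mem_ae_class[OF hu] using h u'(1) n(1) by (simp add: v(1))
 next
  fix v assume "v : ae_class m (%x. h x * u x)"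
  thus "v : fmult m h (ae_class m u)" unfolding fmult_def using self_ae_class[OF u] by blast
 qed
qed

section \<open>Tests for equality almost everywhere, and derivations obtained from
  functionals\<close>

context borel_space
begin

lemma AE_le_of_integrals:
 fixes u w :: "'a => real"
 assumes u: "integrable m u" and w: "integrable m w"
  and le: "!!A. A : sets borel ==> (LINT x|m. u x * indicator A x) <= (LINT x|m. w x * indicator A x)" shows "AE x in m. u x <= w x"
proof -
 define A where "A = {x. w x < u x}"
 have [measurable]: "u : borel_measurable borel" "w : borel_measurable borel"
  using borel_measurable_integrable[OF u] borel_measurable_integrable[OF w] by simp_all
 have A: "A : sets borel" unfolding A_def by measurable
 have i: "integrable m (%x. u x * indicator A x)" "integrable m (%x. w x * indicator A x)"
  using u w A by (auto intro!: integrable_mult_bdd_borel)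
 have "(LINT x|m. u x * indicator A x - w x * indicator A x) <= 0" using le[OF A] i by simp
 moreover have nn: "AE x in m. 0 <= u x * indicator A x - w x * indicator A x" by (intro AE_I2) (auto simp: A_def indicator_def)
 ultimately have "(LINT x|m. u x * indicator A x - w x * indicator A x) = 0" using integral_nonneg_AE[OF nn] by simp
 hence "AE x in m. u x * indicator A x - w x * indicator A x = 0" using i nn by (subst (asm) integral_nonneg_eq_0_iff_AE) auto
 thus ?thesis by eventually_elim (auto simp: A_def indicator_def split: if_splits)
qed

lemma AE_eq_of_integrals:
 fixes u w :: "'a => real"
 assumes u: "integrable m u" and w: "integrable m w"
  and eq: "!!A. A : sets borel ==> (LINT x|m. u x * indicator A x) = (LINT x|m. w x * indicator A x)" shows "AE x in m. u x = w x"
proof -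
 have "AE x in m. u x <= w x" "AE x in m. w x <= u x" using AE_le_of_integrals[OF u w] AE_le_of_integrals[OF w u] eq by simp_all
 thus ?thesis by eventually_elim simp
qed

text \<open>The signed measure with density \<open>d\<close> is determined by Lipschitz tests, hence
  equals its own multiple by 0, the form in which the zero measure is used.\<close>

lemma AE_eq_0_of_LIPb:
 assumes d: "integrable m d" and 0: "!!f. f : LIPb ==> (LINT x|m. f x * d x) = 0" shows "AE x in m. d x = 0"
proof -
 note mu = Meas_integral[OF sets_m d]
 define mu where "mu = restrict (%B. LINT x|m. indicator B x * d x) (sets borel)"
 note mu = mu[folded mu_def]
 have "mu = vscale Meas 0 mu"
  using 0 by (intro Meas_eqI mu Meas_scale(1)) (simp add: mu(2) Meas_scale(3)[OF mu(1)] LIPb_bdd_borel mult.commute)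
 hence "mu B = 0" if "B : sets borel" for B using that by (metis Meas_simps(4) mult_zero_left restrict_apply')
 thus ?thesis using AE_eq_of_integrals[OF d, of "%x. 0"] by (simp add: mu_def mult.commute)
qed

text \<open>A derivation given by chosen representatives. The exceptional null sets may depend on
  the functions involved, and the bound is a constant in place of a function
  \<open>G\<close>.\<close>

definition der_rep :: "(('a => real) => 'a => real) => real => bool" where
 "der_rep beta C \<longleftrightarrow> 0 <= C &
   (ALL f:LIPb. beta f : borel_measurable borel & (AE x in m. abs (beta f x) <= C * lip_a f x)) &
   (ALL f:LIPb. ALL g:LIPb. AE x in m. beta (%x. f x + g x) x = beta f x + beta g x) &
   (ALL c. ALL f:LIPb. AE x in m. beta (%x. c * f x) x = c * beta f x) &
   (ALL f:LIPb. ALL g:LIPb. AE x in m. beta (%x. f x * g x) x = f x * beta g x + g x * beta f x)"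

text \<open>
 Every functional on Lipschitz functions dominated by \<open>f \<mapsto> C \<integral> lip_a f\<close> comes from a derivation.
 Extend it by Hahn--Banach to fields \<open>omega\<close> assigning to each point \<open>x\<close> a Lipschitz function
 \<open>omega(x, \<cdot>)\<close>, with the integral of \<open>lip_a (omega(x, \<cdot>)) x\<close> as seminorm. The value of the derivation on
 \<open>f\<close> is the density of \<open>h \<mapsto> L (h \<otimes> f)\<close>; the Leibniz rule holds since the Leibniz defect at \<open>x\<close> has
 asymptotic Lipschitz constant zero at \<open>x\<close>.
\<close>

lemma derivation_extension:
 assumes l_add: "!!f g. f : LIPb ==> g : LIPb ==> l (%x. f x + g x) = l f + l g"
  and l_scale: "!!c f. f : LIPb ==> l (%x. c * f x) = c * l f"
  and l_le: "!!f. f : LIPb ==> l f <= C * (LINT x|m. lip_a f x)" and C: "0 <= C"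
 obtains b where "der_rep b C" "!!f. f : LIPb ==> (LINT x|m. b f x) = l f"
proof -
 \<comment> \<open>The pointwise seminorm of a field need not be measurable in \<open>x\<close>, so
   integrable majorants \<open>G\<close> are used; \<open>P\<close> is \<open>C\<close> times the
   resulting upper integral.\<close>
 define dom where "dom omega G \<longleftrightarrow> integrable m G & (ALL x. lip_a (%y. omega (x, y)) x <= G x)" for omega :: "'a \<times> 'a => real" and G
 define V where "V = {omega :: 'a \<times> 'a => real. (ALL x. (%y. omega (x, y)) : LIPb) & (EX G. dom omega G)}"
 define P where "P omega = C * Inf {LINT x|m. G x | G. dom omega G}" for omega :: "'a \<times> 'a => real"
 define g0 where "g0 = {(%z :: 'a \<times> 'a. f (snd z), l f) | f. f : LIPb}"
 have VL: "(%y. omega (x, y)) : LIPb" if "omega : V" for omega x using that by (simp add: V_def)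
 have G0: "0 <= (LINT x|m. G x)" if "omega : V" "dom omega G" for omega G
  using that lip_a_nonneg[OF LIPb_Lip[OF VL[OF that(1)]]] order_trans unfolding dom_def by (intro integral_nonneg_AE AE_I2) blast
 have bdd: "bdd_below {LINT x|m. G x | G. dom omega G}" if "omega : V" for omega using G0[OF that] by (auto intro!: bdd_belowI[of _ 0])
 have ne: "{LINT x|m. G x | G. dom omega G} ~= {}" if "omega : V" for omega using that by (auto simp: V_def)
 have P_le: "P omega <= C * (LINT x|m. G x)" if "omega : V" "dom omega G" for omega G
  unfolding P_def using that bdd C by (intro mult_left_mono cInf_lower) auto
 have P_ge: "r <= k * P omega" if w: "omega : V" and k: "0 <= k" and r: "!!G. dom omega G ==> r <= k * (C * (LINT x|m. G x))" for omega r k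
 proof -
  have "r <= (k * C) * Inf {LINT x|m. G x | G. dom omega G}"
  proof (rule le_mult_limit)
   fix t assume "Inf {LINT x|m. G x | G. dom omega G} < t"
   from cInf_lessD[OF ne[OF w] this] obtain G where "dom omega G" "(LINT x|m. G x) < t" by blast
   thus "r <= (k * C) * t" using r[of G] k C mult_left_mono[of "LINT x|m. G x" t "k * C"] by (simp add: mult.assoc)
  qed (use k C in simp)
  thus ?thesis by (simp add: P_def mult.assoc)
 qed
 have dom_add: "dom (%z. u z + v z) (%x. G x + H x)" if "u : V" "v : V" "dom u G" "dom v H" for u v G H
 proof -
  have "lip_a (%y. u (x, y) + v (x, y)) x <= G x + H x" for x
  proof -
   have "lip_a (%y. u (x, y)) x <= G x" "lip_a (%y. v (x, y)) x <= H x" using that(3,4) by (simp_all add: dom_def)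
   thus ?thesis using lip_a_add[OF LIPb_Lip[OF VL[OF that(1), of x]] LIPb_Lip[OF VL[OF that(2), of x]], of x] by linarith
  qed
  thus ?thesis using that(3,4) by (simp add: dom_def)
 qed
 have dom_scale: "dom (%z. c * u z) (%x. abs c * G x)" if "u : V" "dom u G" for c u G
 proof -
  have "lip_a (%y. c * u (x, y)) x <= abs c * G x" for x
  proof -
   have "lip_a (%y. u (x, y)) x <= G x" using that(2) by (simp add: dom_def)
   from mult_left_mono[OF this, of "abs c"] lip_a_scale_le[OF LIPb_Lip[OF VL[OF that(1), of x]], of c x]
   show ?thesis by simp
  qed
  thus ?thesis using that(2) by (simp add: dom_def)
 qed
 have V_add: "(%z. u z + v z) : V" if uv: "u : V" "v : V" for u v
 proof -
  obtain G H where "dom u G" "dom v H" using uv unfolding V_def by blast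
  thus ?thesis using dom_add[OF uv] VL[OF uv(1)] VL[OF uv(2)] by (auto simp: V_def)
 qed
 have V_scale: "(%z. c * u z) : V" if u: "u : V" for c u
 proof -
  obtain G where "dom u G" using u unfolding V_def by blast
  thus ?thesis using dom_scale[OF u] VL[OF u] by (auto simp: V_def)
 qed
 \<comment> \<open>The self-conjugate exponent 2 is used to find densities; the essential bound is
   recovered afterwards by testing on indicators.\<close>
 have two: "1 < (2 :: real)" "1 <= (2 :: real)" "1 / 2 + 1 / 2 = (1 :: real)" by simp_all
 have L2: "h : Lp_funs m 2" if "h : bdd_borel" for h by (rule bdd_borel_Lp[OF two(2) that])
 have la: "lip_a f : Lp_funs m 2" if "f : LIPb" for f by (rule L2[OF lip_a_bdd_borel[OF LIPb_Lip[OF that]]])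
 have L2_abs: "(%x. abs (h x)) : Lp_funs m 2" "Lp_norm m 2 (%x. abs (h x)) = Lp_norm m 2 h" if "h : Lp_funs m 2" for h
  using that by (auto simp: Lp_funs_def Lp_norm_def)
 have domI: "dom (%(x, y). h x * f y) (%x. abs (h x) * lip_a f x)" "(%(x, y). h x * f y) : V"
  if h: "h : Lp_funs m 2" and f: "f : LIPb" for h f
 proof -
  show d: "dom (%(x, y). h x * f y) (%x. abs (h x) * lip_a f x)"
   unfolding dom_def using lip_a_scale_le[OF LIPb_Lip[OF f]] holder(1)[OF two(1,1,3) L2_abs(1)[OF h] la[OF f]] by simp
  thus "(%(x, y). h x * f y) : V" using f by (auto simp: V_def)
 qed
 obtain L where L: "!!u v. u : V ==> v : V ==> L (%z. u z + v z) = L u + L v"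
  "!!c u. u : V ==> L (%z. c * u z) = c * L u" "!!u. u : V ==> L u <= P u" "!!u r. (u, r) : g0 ==> L u = r"
 proof (rule hahn_banach_fun[of V P g0])
  show "P (%z. u z + v z) <= P u + P v" if uv: "u : V" "v : V" for u v
  proof -
   have "P (%z. u z + v z) - C * (LINT x|m. H x) <= 1 * P u" if H: "dom v H" for H
   proof (rule P_ge[OF uv(1)])
    fix G assume G: "dom u G"
    have "P (%z. u z + v z) <= C * (LINT x|m. G x + H x)" by (rule P_le[OF V_add[OF uv] dom_add[OF uv G H]])
    thus "P (%z. u z + v z) - C * (LINT x|m. H x) <= 1 * (C * (LINT x|m. G x))" using G H by (simp add: dom_def distrib_left)
   qed simp
   hence "P (%z. u z + v z) - P u <= 1 * P v" by (intro P_ge[OF uv(2)]) (simp_all add: algebra_simps)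
   thus ?thesis by simp
  qed
  show "P (%z. c * u z) <= abs c * P u" if u: "u : V" for c u
   by (rule P_ge[OF u]) (use P_le[OF V_scale[OF u] dom_scale[OF u], of _ c] in \<open>simp_all add: mult.left_commute\<close>)
  show "g0 ~= {}" unfolding g0_def using LIPb_const by blast
  fix u r assume u: "(u, r) : g0"
  then obtain f where f: "f : LIPb" "u = (%z. f (snd z))" "r = l f" by (auto simp: g0_def)
  have "u = (%(x, y). 1 * f y)" by (auto simp: f(2))
  thus uV: "u : V" using domI(2)[OF L2[OF bdd_borel_const[of 1]] f(1)] by simp
  have "r <= 1 * P u"
  proof (rule P_ge[OF uV])
   fix G assume G: "dom u G"
   have "l f <= C * (LINT x|m. lip_a f x)" by (rule l_le[OF f(1)])
   also have "... <= C * (LINT x|m. G x)" using G C integrable_bdd_borel[OF lip_a_bdd_borel[OF LIPb_Lip[OF f(1)]]]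
    by (intro mult_left_mono integral_mono) (auto simp: dom_def f(2))
   finally show "r <= 1 * (C * (LINT x|m. G x))" by (simp add: f(3))
  qed simp
  thus "r <= P u" by simp
  show "((%z. c * u z), c * r) : g0" for c using f l_scale[OF f(1), of c] by (auto simp: g0_def intro!: exI[of _ "%x. c * f x"])
  fix v q assume "(v, q) : g0"
  then obtain g where "g : LIPb" "v = (%z. g (snd z))" "q = l g" by (auto simp: g0_def)
  thus "((%z. u z + v z), r + q) : g0" using f l_add[OF f(1), of g] by (auto simp: g0_def intro!: exI[of _ "%x. f x + g x"])
 qed (use V_add V_scale in \<open>blast+\<close>)
 have L_abs: "abs (L u) <= C * (LINT x|m. G x)" if u: "u : V" "dom u G" for u G
 proof -
  have "- L u = L (%z. (-1) * u z)" using L(2)[OF u(1), of "-1"] by simp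
  also have "... <= C * (LINT x|m. abs (-1) * G x)"
   using L(3)[OF V_scale[OF u(1)]] P_le[OF V_scale[OF u(1)] dom_scale[OF u]] by (rule order_trans)
  finally show ?thesis using order_trans[OF L(3)[OF u(1)] P_le[OF u]] by (simp add: abs_le_iff)
 qed
 define phi where "phi f h = L (%(x, y). h x * f y)" for f h :: "'a => real"
 have phi_abs: "abs (phi f h) <= C * (LINT x|m. abs (h x) * lip_a f x)" if "f : LIPb" "h : Lp_funs m 2" for f h
  unfolding phi_def by (rule L_abs[OF domI(2,1)[OF that(2,1)]])
 have "EX u. u : Lp_funs m 2 & (ALL g:Lp_funs m 2. phi f g = (LINT x|m. u x * g x))" if f: "f : LIPb" for f
 proof -
  have "vfunc (Lp_pre m 2) (phi f) (C * Lp_norm m 2 (lip_a f))" unfolding vfunc_def Lp_pre_simps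
  proof (intro conjI ballI allI)
   fix g k c assume g: "g : Lp_funs m 2"
   show "phi f (%x. c * g x) = c * phi f g" using L(2)[OF domI(2)[OF g f], of c] by (simp add: phi_def case_prod_unfold mult.assoc)
   have "abs (LINT x|m. abs (g x) * lip_a f x) <= Lp_norm m 2 g * Lp_norm m 2 (lip_a f)"
    using holder(2)[OF two(1,1,3) L2_abs(1)[OF g] la[OF f]] by (simp only: L2_abs(2)[OF g])
   from order_trans[OF phi_abs[OF f g] mult_left_mono[OF abs_le_D1[OF this] C]]
   show "abs (phi f g) <= C * Lp_norm m 2 (lip_a f) * Lp_norm m 2 g" by (simp add: mult_ac)
   assume k: "k : Lp_funs m 2"
   show "phi f (%x. g x + k x) = phi f g + phi f k"
    using L(1)[OF domI(2)[OF g f] domI(2)[OF k f]] by (simp add: phi_def case_prod_unfold distrib_right)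
  qed
  thus ?thesis by (rule Lp_duality[OF two(1,1,3) _ mult_nonneg_nonneg[OF C Lp_norm_nonneg]]) blast
 qed
 then obtain b where b0: "!!f. f : LIPb ==> b f : Lp_funs m 2"
  "!!f g. f : LIPb ==> g : Lp_funs m 2 ==> phi f g = (LINT x|m. b f x * g x)" by metis
 have b: "b f : borel_measurable borel" "integrable m (b f)" "g : bdd_borel ==> phi f g = (LINT x|m. b f x * g x)" if "f : LIPb" for f g
  using b0[OF that] L2 holder(1)[OF two(1,1,3) b0(1)[OF that] L2[OF bdd_borel_const[of 1]]] by (auto simp: Lp_funs_def)
 have bi: "integrable m (%x. b f x * g x)" if "f : LIPb" "g : bdd_borel" for f g
  by (rule integrable_mult_bdd_borel[OF b(2)[OF that(1)] that(2)])
 \<comment> \<open>The single source of additivity, homogeneity and the Leibniz rule: a combination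
   whose \<open>lip_a\<close> vanishes at the base point is a field of seminorm zero, also after
   multiplication by indicators in \<open>x\<close>.\<close>
 have comb: "AE x in m. u x * b f x + v x * b g x + w x * b k x = 0"
  if h: "u : bdd_borel" "v : bdd_borel" "w : bdd_borel" and f: "f : LIPb" "g : LIPb" "k : LIPb"
   and 0: "!!x. lip_a (%y. u x * f y + v x * g y + w x * k y) x = 0" for u v w f g k
 proof (rule AE_eq_of_integrals)
  show "integrable m (%x. u x * b f x + v x * b g x + w x * b k x)"
   using bi[OF f(1) h(1)] bi[OF f(2) h(2)] bi[OF f(3) h(3)] by (simp add: mult.commute)
  fix A :: "'a set" assume A: "A : sets borel"
  note ih = bdd_borel_closed(3)[OF bdd_borel_indicator[OF A] h(1)] bdd_borel_closed(3)[OF bdd_borel_indicator[OF A] h(2)]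
   bdd_borel_closed(3)[OF bdd_borel_indicator[OF A] h(3)]
  let ?u = "%(x, y). (indicator A x * u x) * f y" and ?v = "%(x, y). (indicator A x * v x) * g y"
   and ?w = "%(x, y). (indicator A x * w x) * k y"
  note V = domI(2)[OF L2[OF ih(1)] f(1)] domI(2)[OF L2[OF ih(2)] f(2)] domI(2)[OF L2[OF ih(3)] f(3)]
  have V2: "(%z. ?u z + ?v z) : V" and V3: "(%z. ?u z + ?v z + ?w z) : V" by (intro V_add V)+
  have "lip_a (%y. indicator A x * (u x * f y + v x * g y + w x * k y)) x <= 0" for x
   using lip_a_scale_le[of "%y. u x * f y + v x * g y + w x * k y" "indicator A x" x] 0[of x] f by (simp add: LIPb_Lip)
  hence "dom (%z. ?u z + ?v z + ?w z) (%x. 0)" by (simp add: dom_def distrib_left mult.assoc)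
  from L_abs[OF V3 this] have "L ?u + L ?v + L ?w = 0" using L(1)[OF V2 V(3)] L(1)[OF V(1,2)] by simp
  hence "(LINT x|m. b f x * (indicator A x * u x)) + (LINT x|m. b g x * (indicator A x * v x)) + (LINT x|m. b k x * (indicator A x * w x)) = 0"
   using b(3)[OF f(1) ih(1)] b(3)[OF f(2) ih(2)] b(3)[OF f(3) ih(3)] by (simp add: phi_def)
  thus "(LINT x|m. (u x * b f x + v x * b g x + w x * b k x) * indicator A x) = (LINT x|m. 0 * indicator A x)"
   using bi[OF f(1) ih(1)] bi[OF f(2) ih(2)] bi[OF f(3) ih(3)] by (simp add: algebra_simps)
 qed simp
 show thesis
 proof (rule that[of b]; (unfold der_rep_def, intro conjI ballI allI C)?)
  show "b f : borel_measurable borel" if "f : LIPb" for f by (rule b(1)[OF that])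
  show "(LINT x|m. b f x) = l f" if f: "f : LIPb" for f
  proof -
   have "(LINT x|m. b f x) = phi f (%x. 1)" using b(3)[OF f bdd_borel_const[of 1]] by simp
   also have "... = L (%z. f (snd z))" by (simp add: phi_def case_prod_unfold)
   also have "... = l f" using L(4)[of "%z. f (snd z)" "l f"] f by (auto simp: g0_def)
   finally show ?thesis .
  qed
  show "AE x in m. abs (b f x) <= C * lip_a f x" if f: "f : LIPb" for f
  proof -
   have w: "integrable m (%x. C * lip_a f x)" using integrable_bdd_borel[OF lip_a_bdd_borel[OF LIPb_Lip[OF f]]] by simp
   \<comment> \<open>Testing on all Borel sets turns domination of integrals into the pointwise
     bound with the same constant \<open>C\<close>.\<close>
   have A: "abs (LINT x|m. b f x * indicator A x) <= (LINT x|m. C * lip_a f x * indicator A x)" if "A : sets borel" for A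
   proof -
    have e: "abs (indicator A x) * lip_a f x = lip_a f x * indicator A x" for x by (simp add: indicator_def)
    show ?thesis using phi_abs[OF f L2[OF bdd_borel_indicator[OF that]]] b(3)[OF f bdd_borel_indicator[OF that]]
     unfolding e by (simp add: mult.assoc)
   qed
   have "AE x in m. b f x <= C * lip_a f x" using A by (intro AE_le_of_integrals b(2)[OF f] w) (rule abs_le_D1)
   moreover have "AE x in m. - b f x <= C * lip_a f x" using A by (intro AE_le_of_integrals w) (auto simp: b(2)[OF f] intro: abs_le_D2)
   ultimately show ?thesis by eventually_elim simp
  qed
  show "AE x in m. b (%x. f x + g x) x = b f x + b g x" if fg: "f : LIPb" "g : LIPb" for f g
   using comb[of "%x. 1" "%x. -1" "%x. -1", OF _ _ _ LIPb_add[OF fg] fg] by (simp add: algebra_simps)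
  show "AE x in m. b (%x. c * f x) x = c * b f x" if f: "f : LIPb" for f c
   using comb[of "%x. 1" "%x. - c" "%x. 0", OF _ _ _ LIPb_cmult[OF f] f f] by (simp add: algebra_simps)
  show "AE x in m. b (%x. f x * g x) x = f x * b g x + g x * b f x" if fg: "f : LIPb" "g : LIPb" for f g
   using comb[of "%x. 1" "%x. - f x" "%x. - g x", OF _ _ _ LIPb_mult[OF fg] fg(2,1)] lip_a_leibniz[OF fg] fg
   by (simp add: algebra_simps LIPb_bdd_borel)
 qed
qed

end

section \<open>Derivations\<close>

context compact_space
begin

text \<open>On a compact space the support condition is vacuous, and uniform limits of continuous
  functions are continuous.\<close>

lemma C0_carrier: "carr (C0 :: ('a => real) nvs) = {h. continuous_on UNIV h}"
proof (intro set_eqI iffI; unfold mem_Collect_eq)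
 fix h :: "'a => real" assume "h : carr C0"
 hence h: "EX k. continuous_on UNIV k & (ALL x. abs (h x - k x) < e)" if "e > 0" for e :: real using that by (auto simp: C0_def)
 have "EX k. continuous_on UNIV k & (ALL x. abs (h x - k x) < 1 / (1 + real n))" for n by (rule h) simp
 then obtain k where k: "!!n. continuous_on UNIV (k n)" "!!n x. abs (h x - k n x) < 1 / (1 + real n)" by metis
 show "continuous_on UNIV h"
 proof (rule uniform_limit_theorem[OF _ _ trivial_limit_sequentially])
  show "\<forall>\<^sub>F n in sequentially. continuous_on UNIV (k n)" using k(1) by simp
  show "uniform_limit UNIV k h sequentially"
  proof (rule uniform_limitI)
   fix e :: real assume "e > 0"
   then obtain N where N: "1 / (1 + real N) < e" using nat_approx_posE[of e] by (auto simp: add.commute)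
   have "dist (k n x) (h x) < e" if "n >= N" for n x
   proof -
    have "1 / (1 + real n) <= 1 / (1 + real N)" using that by (intro divide_left_mono) auto
    thus ?thesis using k(2)[of x n] N by (simp add: dist_real_def abs_minus_commute)
   qed
   thus "\<forall>\<^sub>F n in sequentially. ALL x:UNIV. dist (k n x) (h x) < e" by (intro eventually_sequentiallyI) auto
  qed
 qed
next
 fix h :: "'a => real" assume "continuous_on UNIV h"
 moreover have "compact (closure A)" for A :: "'a set" using compact_UNIV compact_Int_closed[OF compact_UNIV closed_closure, of A] by simp
 ultimately show "h : carr C0" by (auto simp: C0_def intro!: exI[of _ h])
qed

lemma C0_simps [simp]:
 "vzero C0 = (%x. 0)" "vadd C0 h k = (%x. h x + k x)" "vscale C0 c h = (%x. c * h x)" "vnorm C0 = sup_norm" by (simp_all add: C0_def)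

lemma sup_norm_ge: assumes "h : bdd_borel" shows "abs (h x) <= sup_norm h"
proof -
 obtain b where "abs (h x) <= b" for x using assms by (auto simp: bdd_borel_def)
 thus ?thesis unfolding sup_norm_def by (intro cSUP_upper) (auto intro!: bdd_aboveI[of _ b])
qed

lemma sup_norm_le: "(!!x. abs (h x) <= b) ==> sup_norm h <= b" unfolding sup_norm_def by (intro cSUP_least) auto

lemma seminormed_C0: "seminormed (C0 :: ('a => real) nvs)"
proof -
 have g: "abs (h x) <= sup_norm h" if "continuous_on UNIV h" for h :: "'a => real" and x
  by (rule sup_norm_ge[OF continuous_bdd_borel[OF that]])
 have eq: "C0 = vmaps UNIV real_nvs {h :: 'a => real. continuous_on UNIV h} sup_norm" using C0_carrier by (simp add: C0_def)
 show ?thesis unfolding eq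
 proof (rule seminormed_fun; unfold mem_Collect_eq)
  show "0 <= sup_norm h" if "continuous_on UNIV h" for h :: "'a => real"
   using g[OF that, of undefined] abs_ge_zero[of "h undefined"] by linarith
  show "sup_norm (%x. c * h x) <= abs c * sup_norm h" if "continuous_on UNIV h" for c and h :: "'a => real"
   using g[OF that] by (intro sup_norm_le) (simp add: abs_mult mult_left_mono)
  show "sup_norm (%x. h x + k x) <= sup_norm h + sup_norm k" if hk: "continuous_on UNIV h" "continuous_on UNIV k" for h k :: "'a => real"
  proof (rule sup_norm_le)
   fix x show "abs (h x + k x) <= sup_norm h + sup_norm k" using g[OF hk(1), of x] g[OF hk(2), of x] by linarith
  qed
 qed (auto intro!: continuous_intros)
qed

end

context borel_space
begin

definition der_of :: "(('a => real) => 'a => real) => ('a => real) => ('a => real) set" where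
 "der_of beta = restrict (%f. ae_class m (beta f)) LIPb"

lemma der_repD:
 assumes "der_rep beta C" shows "0 <= C" "f : LIPb ==> beta f : borel_measurable borel"
  "f : LIPb ==> AE x in m. abs (beta f x) <= C * lip_a f x"
  "f : LIPb ==> g : LIPb ==> AE x in m. beta (%x. f x + g x) x = beta f x + beta g x"
  "f : LIPb ==> AE x in m. beta (%x. c * f x) x = c * beta f x"
  "f : LIPb ==> g : LIPb ==> AE x in m. beta (%x. f x * g x) x = f x * beta g x + g x * beta f x"
 using assms unfolding der_rep_def by blast+

lemma der_rep_measurable: "der_rep beta C ==> ALL f:LIPb. beta f : borel_measurable borel" by (simp add: der_rep_def)

lemma der_of_app: "f : LIPb ==> der_of beta f = ae_class m (beta f)" by (simp add: der_of_def)

lemma der_rep_Linf: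
 assumes beta: "der_rep beta C" and f: "f : LIPb" shows "beta f : Linf_funs m"
proof -
 obtain b where b: "abs (lip_a f x) <= b" for x using lip_a_bdd_borel[OF LIPb_Lip[OF f]] by (auto simp: bdd_borel_def)
 have "C * lip_a f x <= C * b" for x using b[of x] der_repD(1)[OF beta] by (intro mult_left_mono) auto
 hence "AE x in m. abs (beta f x) <= C * b" by (intro eventually_mono[OF der_repD(3)[OF beta f]]) (rule order_trans)
 thus ?thesis using der_repD(2)[OF beta f] by (auto simp: Linf_funs_def)
qed

lemma Linf_funs_mult_bdd:
 assumes h: "h : bdd_borel" and u: "u : Linf_funs m" shows "(%x. h x * u x) : Linf_funs m"
proof -
 obtain b where b: "abs (h x) <= b" for x using h by (auto simp: bdd_borel_def)
 have "AE x in m. abs (h x * u x) <= b * Linf_norm m u" using Linf_norm_AE[OF u] b order_trans[OF abs_ge_zero b]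
  by (auto elim!: eventually_mono simp: abs_mult intro!: mult_mono)
 moreover have "u : borel_measurable borel" "h : borel_measurable borel" using u h by (auto simp: Linf_funs_def bdd_borel_def)
 ultimately show ?thesis by (auto simp: Linf_funs_def)
qed

lemma Linf_funs_integrable: "u : Linf_funs m ==> integrable m u"
 using Linf_norm_AE[of u m] by (intro integrable_const_bound[of _ "Linf_norm m u"]) (auto simp: Linf_funs_def)

lemma Linf_bound_mult:
 assumes G: "G : Linf_funs m" and f: "f : LIPb" and u: "AE x in m. abs (u x) <= G x * lip_a f x"
 shows "AE x in m. abs (u x) <= Linf_norm m G * lip_a f x" using u Linf_norm_AE[OF G]
proof eventually_elim
 case (elim x)
 have "G x * lip_a f x <= Linf_norm m G * lip_a f x" using elim(2) lip_a_nonneg[OF LIPb_Lip[OF f]] by (intro mult_right_mono) auto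
 thus ?case using elim(1) by simp
qed

lemma der_bound_der_of:
 assumes "ALL f:LIPb. beta f : borel_measurable borel"
 shows "der_bound m (der_of beta) H \<longleftrightarrow> H : Linf_funs m & (AE x in m. 0 <= H x) &
  (ALL f:LIPb. AE x in m. abs (beta f x) <= H x * lip_a f x)"
proof -
 have "(ALL u:der_of beta f. AE x in m. abs (u x) <= H x * lip_a f x) \<longleftrightarrow> (AE x in m. abs (beta f x) <= H x * lip_a f x)"
  if f: "f : LIPb" for f
 proof
  have betam: "beta f : borel_measurable m" using assms f by simp
  show "AE x in m. abs (beta f x) <= H x * lip_a f x" if "ALL u:der_of beta f. AE x in m. abs (u x) <= H x * lip_a f x"
   using that self_ae_class[OF betam] unfolding der_of_app[OF f] by blast
  assume a: "AE x in m. abs (beta f x) <= H x * lip_a f x"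
  show "ALL u:der_of beta f. AE x in m. abs (u x) <= H x * lip_a f x"
  proof
   fix u assume "u : der_of beta f"
   hence "AE x in m. u x = beta f x" unfolding der_of_app[OF f] mem_ae_class[OF betam] by blast
   thus "AE x in m. abs (u x) <= H x * lip_a f x" using a by eventually_elim simp
  qed
 qed
 thus ?thesis by (simp add: der_bound_def)
qed

lemma derivation_der_of_iff:
 assumes "ALL f:LIPb. beta f : Linf_funs m" shows "derivation m (der_of beta) \<longleftrightarrow>
   (ALL f:LIPb. ALL g:LIPb. AE x in m. beta (%x. f x + g x) x = beta f x + beta g x) &
   (ALL c. ALL f:LIPb. AE x in m. beta (%x. c * f x) x = c * beta f x) &
   (ALL f:LIPb. ALL g:LIPb. AE x in m. beta (%x. f x * g x) x = f x * beta g x + g x * beta f x) & (EX G. der_bound m (der_of beta) G)"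
proof -
 have beta: "beta f : Linf_funs m" if "f : LIPb" for f using assms that by blast
 have m: "beta f : borel_measurable borel" if "f : LIPb" for f using beta[OF that] by (simp add: Linf_funs_def)
 have eq: "ae_class m u = ae_class m v \<longleftrightarrow> (AE x in m. u x = v x)"
  if "u : borel_measurable borel" "v : borel_measurable borel" for u v using that by (intro ae_class_eq_iff) simp_all
 have ext: "der_of beta : carr LIPb_space \<rightarrow>\<^sub>E carr (Linf m)"
  using beta unfolding LIPb_space_def PiE_iff vmaps_simps Linf_simps(1) by (simp add: der_of_def)
 have add: "der_of beta (%x. f x + g x) = vadd (Linf m) (der_of beta f) (der_of beta g) \<longleftrightarrow>
   (AE x in m. beta (%x. f x + g x) x = beta f x + beta g x)" if f: "f : LIPb" and g: "g : LIPb" for f g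
  unfolding der_of_app[OF f] der_of_app[OF g] der_of_app[OF LIPb_add[OF f g]] Linf_simps(3)[OF beta[OF f] beta[OF g]]
  using m[OF f] m[OF g] by (intro eq m[OF LIPb_add[OF f g]]) simp
 have scale: "der_of beta (%x. c * f x) = vscale (Linf m) c (der_of beta f) \<longleftrightarrow> (AE x in m. beta (%x. c * f x) x = c * beta f x)"
  if f: "f : LIPb" for c f unfolding der_of_app[OF f] der_of_app[OF LIPb_cmult[OF f]] Linf_simps(4)[OF beta[OF f]]
  using m[OF f] by (intro eq m[OF LIPb_cmult[OF f]]) simp
 have fm: "fmult m f (der_of beta g) = ae_class m (%x. f x * beta g x)" if "f : LIPb" "g : LIPb" for f g
  unfolding der_of_app[OF that(2)] using m[OF that(2)] LIPb_measurable[OF that(1)] by (intro fmult_ae_class) simp_all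
 have mult: "der_of beta (%x. f x * g x) = vadd (Linf m) (fmult m f (der_of beta g)) (fmult m g (der_of beta f)) \<longleftrightarrow>
   (AE x in m. beta (%x. f x * g x) x = f x * beta g x + g x * beta f x)" if f: "f : LIPb" and g: "g : LIPb" for f g
  unfolding fm[OF f g] fm[OF g f] der_of_app[OF LIPb_mult[OF f g]]
   Linf_simps(3)[OF Linf_funs_mult_bdd[OF LIPb_bdd_borel[OF f] beta[OF g]] Linf_funs_mult_bdd[OF LIPb_bdd_borel[OF g] beta[OF f]]]
  using m[OF f] m[OF g] LIPb_measurable[OF f] LIPb_measurable[OF g] by (intro eq m[OF LIPb_mult[OF f g]]) simp
 show ?thesis unfolding derivation_def vlinear_def using ext by (simp add: LIPb_space_def add scale mult ball_conj_distrib cong: ball_cong)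
qed

lemma derivation_der_of:
 assumes beta: "der_rep beta C" shows "derivation m (der_of beta)"
proof -
 have "der_bound m (der_of beta) (%x. C)"
  unfolding der_bound_der_of[OF der_rep_measurable[OF beta]] using der_repD(1,3)[OF beta] by (auto simp: Linf_funs_def)
 thus ?thesis using beta der_rep_Linf[OF beta] by (subst derivation_der_of_iff) (auto simp: der_rep_def)
qed

lemma derivation_rep:
 assumes b: "derivation m b"
 obtains beta C where "der_rep beta C" "b = der_of beta"
proof -
 have lin: "b : LIPb \<rightarrow>\<^sub>E ae_class m ` Linf_funs m" using b by (simp add: derivation_def vlinear_def LIPb_space_def Linf_simps(1))
 have "ALL f:LIPb. EX u. u : Linf_funs m & b f = ae_class m u"
 proof
  fix f :: "'a => real" assume "f : LIPb"
  from PiE_mem[OF lin this] show "EX u. u : Linf_funs m & b f = ae_class m u" unfolding image_iff by (elim bexE) (rule exI, rule conjI)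
 qed
 from bchoice[OF this] obtain beta where beta: "ALL f:LIPb. beta f : Linf_funs m & b f = ae_class m (beta f)" ..
 have bL: "ALL f:LIPb. beta f : Linf_funs m" using beta by blast
 hence m: "ALL f:LIPb. beta f : borel_measurable borel" by (simp add: Linf_funs_def)
 have eq: "b = der_of beta"
 proof (rule extensionalityI[of _ LIPb])
  show "b : extensional LIPb" using lin by (simp add: PiE_iff)
  show "der_of beta : extensional LIPb" by (simp add: der_of_def)
  show "b f = der_of beta f" if "f : LIPb" for f unfolding der_of_app[OF that] by (rule conjunct2[OF bspec[OF beta that]])
 qed
 note D = b[unfolded eq derivation_der_of_iff[OF bL]]
 then obtain G where "der_bound m (der_of beta) G" by blast
 note G = this[unfolded der_bound_der_of[OF m]]
 have "AE x in m. abs (beta f x) <= Linf_norm m G * lip_a f x" if f: "f : LIPb" for f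
  using Linf_bound_mult[OF conjunct1[OF G] f] G f by blast
 hence "der_rep beta (Linf_norm m G)" unfolding der_rep_def using D m Linf_norm_nonneg[OF conjunct1[OF G]] by blast
 thus thesis using eq by (rule that)
qed

text \<open>The minimal bound is the infimum of a sequence of bounds whose integrals are minimizing.\<close>

lemma der_modulus_nonempty:
 assumes beta: "der_rep beta C"
 obtains G where "G : der_modulus m (der_of beta)"
proof -
 note iff = der_bound_der_of[OF der_rep_measurable[OF beta]]
 let ?B = "{H. der_bound m (der_of beta) H}"
 have int: "integrable m H" and H0: "AE x in m. 0 <= H x" if "H : ?B" for H using that Linf_funs_integrable unfolding iff by auto
 define i where "i = Inf ((%H. LINT x|m. H x) ` ?B)"
 have C: "(%x. C) : ?B" unfolding mem_Collect_eq iff using der_repD(1,3)[OF beta] by (auto simp: Linf_funs_def)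
 have bdd: "bdd_below ((%H. LINT x|m. H x) ` ?B)" using integral_nonneg_AE[OF H0] by (auto intro!: bdd_belowI[of _ 0])
 have i_le: "i <= (LINT x|m. H x)" if "H : ?B" for H unfolding i_def using bdd that by (intro cInf_lower) auto
 have "EX H:?B. (LINT x|m. H x) < i + inverse (real (Suc n))" for n
  using cInf_lessD[of "(%H. LINT x|m. H x) ` ?B" "i + inverse (real (Suc n))"] C unfolding i_def by fastforce
 then obtain H where H: "!!n. H n : ?B" "!!n. (LINT x|m. H n x) < i + inverse (real (Suc n))" by metis
 \<comment> \<open>The bounds are nonnegative only almost everywhere; taking the maximum with 0
   makes the infimum well behaved at every point.\<close>
 define G where "G x = (INF n. max (H n x) 0)" for x
 have G_le: "G x <= max (H n x) 0" for n x unfolding G_def by (intro cINF_lower) (auto intro!: bdd_belowI[of _ 0])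
 have G_ge: "r <= G x" if "!!n. r <= max (H n x) 0" for r x unfolding G_def using that by (intro cINF_greatest) auto
 have Hm: "H n : borel_measurable borel" for n using H(1)[of n] by (simp add: iff Linf_funs_def)
 have Gm: "G : borel_measurable borel" unfolding G_def using Hm by (intro borel_measurable_cINF_real) auto
 have GL: "G : Linf_funs m"
 proof -
  have L: "H 0 : Linf_funs m" using H(1)[of 0] by (simp add: iff)
  have "AE x in m. abs (G x) <= Linf_norm m (H 0)" using Linf_norm_AE[OF L]
  proof eventually_elim
   case (elim x)
   thus ?case using G_le[of x 0] G_ge[of 0 x] by auto
  qed
  thus ?thesis using Gm by (auto simp: Linf_funs_def)
 qed
 have GB: "G : ?B" unfolding mem_Collect_eq iff
 proof (intro conjI ballI)
  show "AE x in m. 0 <= G x" by (intro AE_I2 G_ge) simp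
  fix f :: "'a => real" assume f: "f : LIPb"
  have "AE x in m. ALL n. abs (beta f x) <= H n x * lip_a f x" using H(1) f unfolding mem_Collect_eq iff AE_all_countable by blast
  thus "AE x in m. abs (beta f x) <= G x * lip_a f x"
  proof eventually_elim
   case (elim x)
   show ?case
   proof (cases "lip_a f x = 0")
    case False
    hence l: "0 < lip_a f x" using lip_a_nonneg[OF LIPb_Lip[OF f], of x] by simp
    have "abs (beta f x) / lip_a f x <= G x"
    proof (rule G_ge)
     fix n have "abs (beta f x) / lip_a f x <= H n x" using elim[rule_format, of n] l by (simp add: field_simps)
     thus "abs (beta f x) / lip_a f x <= max (H n x) 0" by simp
    qed
    thus ?thesis using l by (simp add: field_simps)
   qed (use elim in simp)
  qed
 qed (rule GL)
 have "(LINT x|m. G x) <= (LINT x|m. H n x)" for n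
  using H0[OF H(1)[of n]] by (intro integral_mono_AE int GB H(1)) (auto elim!: eventually_mono intro: G_le order_trans[OF G_le])
 hence "(LINT x|m. G x) <= i + inverse (real (Suc n))" for n using H(2)[of n] by (meson order.strict_implies_order order_trans)
 hence Gi: "(LINT x|m. G x) <= i" using LIMSEQ_inverse_real_of_nat_add[of i] by (intro LIMSEQ_le_const) auto
 have "AE x in m. G x <= K x" if K: "der_bound m (der_of beta) K" for K
 proof -
  have KB: "K : ?B" using K by simp
  \<comment> \<open>The minimum with any other bound is again a bound, and its integral cannot drop
    below the minimal value \<open>i\<close>; hence it agrees with \<open>G\<close> almost
    everywhere.\<close>
  have "(%x. min (G x) (K x)) : ?B" unfolding mem_Collect_eq iff
  proof (intro conjI ballI)
   have K': "K : Linf_funs m" using K by (simp add: iff)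
   have "AE x in m. abs (min (G x) (K x)) <= Linf_norm m G + Linf_norm m K"
    using Linf_norm_AE[OF GL] Linf_norm_AE[OF K'] by eventually_elim auto
   thus "(%x. min (G x) (K x)) : Linf_funs m" using GL K' by (auto simp: Linf_funs_def)
   show "AE x in m. 0 <= min (G x) (K x)" using H0[OF GB] H0[OF KB] by eventually_elim simp
   fix f :: "'a => real" assume f: "f : LIPb"
   have "AE x in m. abs (beta f x) <= G x * lip_a f x" "AE x in m. abs (beta f x) <= K x * lip_a f x" using GB K f by (auto simp: iff)
   thus "AE x in m. abs (beta f x) <= min (G x) (K x) * lip_a f x" by eventually_elim (simp add: min_def)
  qed
  note mB = this
  have n: "AE x in m. 0 <= G x - min (G x) (K x)" by simp
  have i2: "integrable m (%x. G x - min (G x) (K x))" using int[OF GB] int[OF mB] by simp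
  have "(LINT x|m. G x - min (G x) (K x)) <= 0"
   using i_le[OF mB] Gi by (simp add: Bochner_Integration.integral_diff[OF int[OF GB] int[OF mB]])
  hence "(LINT x|m. G x - min (G x) (K x)) = 0" using integral_nonneg_AE[OF n] by linarith
  hence "AE x in m. G x - min (G x) (K x) = 0" using integral_nonneg_eq_0_iff_AE[OF i2 n] by simp
  thus ?thesis by eventually_elim (simp add: min_def split: if_splits)
 qed
 thus thesis using GB by (intro that[of G]) (simp add: der_modulus_def)
qed

lemma Der_simps:
 "carr (Der m) = {b. derivation m b}" "vzero (Der m) = restrict (%f. vzero (Linf m)) LIPb"
 "vadd (Der m) b b' = restrict (%f. vadd (Linf m) (b f) (b' f)) LIPb"
 "vscale (Der m) c b = restrict (%f. vscale (Linf m) c (b f)) LIPb"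
 "vnorm (Der m) b = Inf (Linf_norm m ` der_modulus m b)" by (simp_all add: Der_def Linf_simps(5))

text \<open>Connects the norm, defined through the minimal function \<open>|b|\<close>, with the
  constants of \<open>der_rep\<close>: it is the least such constant and is attained.\<close>

lemma der_of_Der:
 assumes beta: "der_rep beta C"
 shows "der_of beta : carr (Der m)" "vnorm (Der m) (der_of beta) <= C" "der_rep beta (vnorm (Der m) (der_of beta))"
proof -
 show "der_of beta : carr (Der m)" using derivation_der_of[OF beta] by (simp add: Der_simps)
 obtain G where G: "G : der_modulus m (der_of beta)" using der_modulus_nonempty[OF beta] .
 have GL: "H : Linf_funs m" "AE x in m. 0 <= H x" if "H : der_modulus m (der_of beta)" for H
  using that by (auto simp: der_modulus_def der_bound_def)
 have min: "Linf_norm m G <= D" if "der_bound m (der_of beta) K" "AE x in m. K x <= D" "0 <= D" for K D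
 proof (rule Linf_norm_le[OF that(3)])
  have "AE x in m. G x <= K x" using G that(1) by (simp add: der_modulus_def)
  thus "AE x in m. abs (G x) <= D" using that(2) GL(2)[OF G] by eventually_elim simp
 qed
 have "Linf_norm m G <= Linf_norm m H" if H: "H : der_modulus m (der_of beta)" for H
 proof (rule min)
  show "der_bound m (der_of beta) H" using H by (simp add: der_modulus_def)
  show "AE x in m. H x <= Linf_norm m H" using Linf_norm_AE[OF GL(1)[OF H]] by eventually_elim simp
 qed (rule Linf_norm_nonneg[OF GL(1)[OF H]])
 hence N: "vnorm (Der m) (der_of beta) = Linf_norm m G" unfolding Der_simps(5) using G by (intro cInf_eq_minimum) auto
 show "vnorm (Der m) (der_of beta) <= C" unfolding N
 proof (rule min)
  show "der_bound m (der_of beta) (%x. C)"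
   unfolding der_bound_der_of[OF der_rep_measurable[OF beta]] using der_repD(1,3)[OF beta] by (auto simp: Linf_funs_def)
 qed (use der_repD(1)[OF beta] in auto)
 have "AE x in m. abs (beta f x) <= Linf_norm m G * lip_a f x" if f: "f : LIPb" for f
 proof -
  have "AE x in m. abs (beta f x) <= G x * lip_a f x" using G f by (simp add: der_modulus_def der_bound_der_of[OF der_rep_measurable[OF beta]])
  thus ?thesis by (rule Linf_bound_mult[OF GL(1)[OF G] f])
 qed
 thus "der_rep beta (vnorm (Der m) (der_of beta))" unfolding N using beta Linf_norm_nonneg[OF GL(1)[OF G]] by (simp add: der_rep_def)
qed

lemma DerE:
 assumes "b : carr (Der m)"
 obtains beta where "der_rep beta (vnorm (Der m) b)" "b = der_of beta"
 using assms der_of_Der(3) derivation_rep[of b] unfolding Der_simps(1) mem_Collect_eq by metis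

lemma der_rep_ops:
 assumes beta: "der_rep beta C" and gamma: "der_rep gamma D"
 shows "der_rep (%f x. beta f x + gamma f x) (C + D)" "der_rep (%f x. c * beta f x) (abs c * C)"
  "[|h : borel_measurable borel; !!x. abs (h x) <= B|] ==> der_rep (%f x. h x * beta f x) (B * C)"
proof -
 note b = der_repD[OF beta] and g = der_repD[OF gamma]
 have comb: "der_rep (%f x. h x * beta f x + t * gamma f x) (B * C + abs t * D)"
  if h: "h : borel_measurable borel" "!!x. abs (h x) <= B" for h t B unfolding der_rep_def
 proof (intro conjI ballI allI)
  have B: "0 <= B" using order_trans[OF abs_ge_zero h(2)] .
  thus "0 <= B * C + abs t * D" using b(1) g(1) by simp
  fix f k :: "'a => real" and c assume f: "f : LIPb"
  show "(%x. h x * beta f x + t * gamma f x) : borel_measurable borel" using h(1) b(2)[OF f] g(2)[OF f] by simp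
  show "AE x in m. abs (h x * beta f x + t * gamma f x) <= (B * C + abs t * D) * lip_a f x" using b(3)[OF f] g(3)[OF f]
  proof eventually_elim
   case (elim x)
   have "abs (h x) * abs (beta f x) <= B * (C * lip_a f x)" "abs t * abs (gamma f x) <= abs t * (D * lip_a f x)"
    using elim h(2) B by (auto intro!: mult_mono)
   thus ?case using abs_triangle_ineq[of "h x * beta f x" "t * gamma f x"] by (simp add: abs_mult algebra_simps)
  qed
  show "AE x in m. h x * beta (%x. c * f x) x + t * gamma (%x. c * f x) x = c * (h x * beta f x + t * gamma f x)"
   using b(5)[OF f, of c] g(5)[OF f, of c] by eventually_elim (simp add: algebra_simps)
  assume k: "k : LIPb"
  show "AE x in m. h x * beta (%x. f x + k x) x + t * gamma (%x. f x + k x) x = h x * beta f x + t * gamma f x + (h x * beta k x + t * gamma k x)"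
   using b(4)[OF f k] g(4)[OF f k] by eventually_elim (simp add: algebra_simps)
  show "AE x in m. h x * beta (%x. f x * k x) x + t * gamma (%x. f x * k x) x = f x * (h x * beta k x + t * gamma k x) + k x * (h x * beta f x + t * gamma f x)"
   using b(6)[OF f k] g(6)[OF f k] by eventually_elim (simp add: algebra_simps)
 qed
 show "[|h : borel_measurable borel; !!x. abs (h x) <= B|] ==> der_rep (%f x. h x * beta f x) (B * C)" using comb[of h B 0] by simp
 show "der_rep (%f x. c * beta f x) (abs c * C)" using comb[of "%x. c" "abs c" 0] by simp
 show "der_rep (%f x. beta f x + gamma f x) (C + D)" using comb[of "%x. 1" 1 1] by simp
qed

lemma der_of_ops:
 assumes beta: "der_rep beta C" and gamma: "der_rep gamma D"
 shows "vadd (Der m) (der_of beta) (der_of gamma) = der_of (%f x. beta f x + gamma f x)"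
  "vscale (Der m) c (der_of beta) = der_of (%f x. c * beta f x)"
  "h : borel_measurable borel ==> der_mult m h (der_of beta) = der_of (%f x. h x * beta f x)"
proof -
 note L = der_rep_Linf[OF beta] der_rep_Linf[OF gamma]
 show "vadd (Der m) (der_of beta) (der_of gamma) = der_of (%f x. beta f x + gamma f x)"
  unfolding Der_simps der_of_def[of "%f x. beta f x + gamma f x"] by (rule restrict_ext) (simp only: der_of_app Linf_simps(3) L)
 show "vscale (Der m) c (der_of beta) = der_of (%f x. c * beta f x)" unfolding Der_simps der_of_def[of "%f x. c * beta f x"]
  by (rule restrict_ext) (simp only: der_of_app Linf_simps(4) L)
 show "der_mult m h (der_of beta) = der_of (%f x. h x * beta f x)" if "h : borel_measurable borel"
  unfolding der_mult_def der_of_def[of "%f x. h x * beta f x"]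
  using that by (intro restrict_ext) (simp only: der_of_app fmult_ae_class der_repD(2)[OF beta] measurable_m)
qed

lemma der_zero: "der_rep (%f x. 0) 0" "vzero (Der m) = der_of (%f x. 0)"
 unfolding Der_simps Linf_simps(2) der_of_def by (simp_all only: der_rep_def) simp_all

lemma seminormed_Der: "seminormed (Der m)"
proof -
 have c: "{b. derivation m b} = carr (Der m)" by (simp add: Der_simps)
 have zero: "vzero (Der m) : carr (Der m)" unfolding der_zero(2) by (rule der_of_Der(1)[OF der_zero(1)])
 have add: "vadd (Der m) b b' : carr (Der m)" "vnorm (Der m) (vadd (Der m) b b') <= vnorm (Der m) b + vnorm (Der m) b'"
  if b: "b : carr (Der m)" and b': "b' : carr (Der m)" for b b'
 proof -
  obtain beta gamma where beta: "der_rep beta (vnorm (Der m) b)" "b = der_of beta" and gamma: "der_rep gamma (vnorm (Der m) b')" "b' = der_of gamma"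
   using DerE[OF b] DerE[OF b'] by metis
  note s = der_of_Der[OF der_rep_ops(1)[OF beta(1) gamma(1)], folded der_of_ops(1)[OF beta(1) gamma(1)], folded beta(2) gamma(2)]
  show "vadd (Der m) b b' : carr (Der m)" "vnorm (Der m) (vadd (Der m) b b') <= vnorm (Der m) b + vnorm (Der m) b'"
   by (rule s(1), rule s(2))
 qed
 have scale: "vscale (Der m) c b : carr (Der m)" "vnorm (Der m) (vscale (Der m) c b) <= abs c * vnorm (Der m) b"
  if b: "b : carr (Der m)" for c b
 proof -
  obtain beta where beta: "der_rep beta (vnorm (Der m) b)" "b = der_of beta" using DerE[OF b] .
  note s = der_of_Der[OF der_rep_ops(2)[OF beta(1) beta(1)], of c, folded der_of_ops(2)[OF beta(1) beta(1)], folded beta(2)]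
  show "vscale (Der m) c b : carr (Der m)" "vnorm (Der m) (vscale (Der m) c b) <= abs c * vnorm (Der m) b" by (rule s(1), rule s(2))
 qed
 have nonneg: "0 <= vnorm (Der m) b" if "b : carr (Der m)" for b using DerE[OF that] der_repD(1) by metis
 have V: "vspace_on (Der m)" unfolding Der_def
 proof (rule vspace_vmaps[OF vspace_Linf])
  show "{b. derivation m b} <= LIPb \<rightarrow>\<^sub>E carr (Linf m)" by (auto simp: derivation_def vlinear_def LIPb_space_def)
 qed (use zero add(1) scale(1) in \<open>simp_all add: c Der_simps(2-4)\<close>)
 show ?thesis by (rule seminormedI[OF V nonneg scale(2) add(2)])
qed

section \<open>Derivations with divergence\<close>

lemma divergence_iff:
 assumes beta: "der_rep beta C" shows "d : divergence m (der_of beta) \<longleftrightarrow>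
  d : Linf_funs m & (ALL f:LIPb. (LINT x|m. beta f x) = - (LINT x|m. f x * d x))"
proof -
 have "(ALL u:der_of beta f. (LINT x|m. u x) = r) \<longleftrightarrow> (LINT x|m. beta f x) = r" if f: "f : LIPb" for f r
 proof -
  have betam: "beta f : borel_measurable m" using der_repD(2)[OF beta f] by simp
  have "(LINT x|m. u x) = (LINT x|m. beta f x)" if "u : der_of beta f" for u
   using that betam unfolding der_of_app[OF f] mem_ae_class[OF betam] by (auto intro: integral_cong_AE)
  thus ?thesis using self_ae_class[OF betam] unfolding der_of_app[OF f, symmetric] by metis
 qed
 thus ?thesis by (simp add: divergence_def)
qed

lemma Linf_mult_integrable: "f : bdd_borel ==> d : Linf_funs m ==> integrable m (%x. f x * d x)"
 by (intro Linf_funs_integrable Linf_funs_mult_bdd)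

text \<open>Two divergences have the same Lipschitz integrals and so agree almost everywhere; thus
  the set of divergences is one full class and an element of \<open>Linf\<close>.\<close>

lemma divergence_ae_class:
 assumes b: "b : carr (Der m)" and d: "d : divergence m b" shows "divergence m b = ae_class m d"
proof (intro set_eqI)
 fix e
 obtain beta where beta: "der_rep beta (vnorm (Der m) b)" "b = der_of beta" using DerE[OF b] .
 note iff = divergence_iff[OF beta(1), folded beta(2)]
 have dL: "d : Linf_funs m" and dm: "d : borel_measurable m" using d by (auto simp: iff Linf_funs_def)
 show "e : divergence m b \<longleftrightarrow> e : ae_class m d" unfolding mem_ae_class[OF dm]
 proof
  assume e: "e : divergence m b"
  hence eL: "e : Linf_funs m" by (simp add: iff)
  have "AE x in m. e x - d x = 0"
  proof (rule AE_eq_0_of_LIPb)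
   show "integrable m (%x. e x - d x)" using Linf_funs_integrable[OF eL] Linf_funs_integrable[OF dL] by simp
   show "(LINT x|m. f x * (e x - d x)) = 0" if f: "f : LIPb" for f
   proof -
    have "(LINT x|m. f x * e x) = (LINT x|m. f x * d x)" using e d f by (simp add: iff)
    thus ?thesis using Linf_mult_integrable[OF LIPb_bdd_borel[OF f] eL] Linf_mult_integrable[OF LIPb_bdd_borel[OF f] dL]
     by (simp add: right_diff_distrib)
   qed
  qed
  thus "e : borel_measurable m & (AE x in m. e x = d x)" using eL by (simp add: Linf_funs_def)
 next
  assume e: "e : borel_measurable m & (AE x in m. e x = d x)"
  have "AE x in m. abs (e x) <= Linf_norm m d" using e[THEN conjunct2] Linf_norm_AE[OF dL] by eventually_elim simp
  hence "e : Linf_funs m" using e by (auto simp: Linf_funs_def)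
  moreover have "(LINT x|m. f x * e x) = (LINT x|m. f x * d x)" if f: "f : LIPb" for f
   using e dm LIPb_measurable[OF f] by (intro integral_cong_AE) auto
  ultimately show "e : divergence m b" using d by (simp add: iff)
 qed
qed

lemma DerDivE:
 assumes "b : DD m"
 obtains beta d where "der_rep beta (vnorm (Der m) b)" "b = der_of beta" "d : divergence m b" "d : Linf_funs m"
  "!!f. f : LIPb ==> (LINT x|m. beta f x) = - (LINT x|m. f x * d x)"
proof -
 have b: "b : carr (Der m)" "divergence m b ~= {}" using assms by (auto simp: DerDiv_def)
 obtain beta where beta: "der_rep beta (vnorm (Der m) b)" "b = der_of beta" using DerE[OF b(1)] .
 obtain d where "d : divergence m b" using b(2) by blast
 thus thesis using that[OF beta] divergence_iff[OF beta(1), folded beta(2)] by blast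
qed

lemma DerDivI:
 assumes beta: "der_rep beta C" and d: "d : Linf_funs m" and i: "!!f. f : LIPb ==> (LINT x|m. beta f x) = - (LINT x|m. f x * d x)"
 shows "der_of beta : DD m" "d : divergence m (der_of beta)"
proof -
 show "d : divergence m (der_of beta)" using d i by (simp add: divergence_iff[OF beta])
 thus "der_of beta : DD m" using der_of_Der(1)[OF beta] by (auto simp: DerDiv_def)
qed

lemma divergence_ops:
 assumes b: "b : DD m" "d : divergence m b" and b': "b' : DD m" "d' : divergence m b'"
 shows "vadd (Der m) b b' : DD m" "(%x. d x + d' x) : divergence m (vadd (Der m) b b')"
  "vscale (Der m) c b : DD m" "(%x. c * d x) : divergence m (vscale (Der m) c b)"
proof -
 have D: "b : carr (Der m)" "b' : carr (Der m)" using b b' by (auto simp: DerDiv_def)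
 obtain beta gamma where beta: "der_rep beta (vnorm (Der m) b)" "b = der_of beta" and gamma: "der_rep gamma (vnorm (Der m) b')" "b' = der_of gamma"
  using DerE[OF D(1)] DerE[OF D(2)] by metis
 have d: "d : Linf_funs m" "!!f. f : LIPb ==> (LINT x|m. beta f x) = - (LINT x|m. f x * d x)"
  using b(2) divergence_iff[OF beta(1), folded beta(2)] by auto
 have d': "d' : Linf_funs m" "!!f. f : LIPb ==> (LINT x|m. gamma f x) = - (LINT x|m. f x * d' x)"
  using b'(2) divergence_iff[OF gamma(1), folded gamma(2)] by auto
 have i: "integrable m (%x. f x * d x)" "integrable m (%x. f x * d' x)" "integrable m (beta f)" "integrable m (gamma f)" if "f : LIPb" for f
  using Linf_mult_integrable[OF LIPb_bdd_borel[OF that]] d(1) d'(1)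
   Linf_funs_integrable[OF der_rep_Linf[OF beta(1) that]] Linf_funs_integrable[OF der_rep_Linf[OF gamma(1) that]] by auto
 have "(LINT x|m. beta f x + gamma f x) = - (LINT x|m. f x * (d x + d' x))" if "f : LIPb" for f
  using i[OF that] d(2)[OF that] d'(2)[OF that] by (simp add: distrib_left)
 from DerDivI[OF der_rep_ops(1)[OF beta(1) gamma(1)] Linf_funs_add(1)[OF d(1) d'(1)] this]
 show "vadd (Der m) b b' : DD m" "(%x. d x + d' x) : divergence m (vadd (Der m) b b')"
  unfolding der_of_ops(1)[OF beta(1) gamma(1), folded beta(2) gamma(2)] by simp_all
 have "(LINT x|m. c * beta f x) = - (LINT x|m. f x * (c * d x))" if "f : LIPb" for f using d(2)[OF that] by (simp add: mult.left_commute)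
 from DerDivI[OF der_rep_ops(2)[OF beta(1) beta(1)] Linf_funs_scale(1)[OF d(1)] this]
 show "vscale (Der m) c b : DD m" "(%x. c * d x) : divergence m (vscale (Der m) c b)"
  unfolding der_of_ops(2)[OF beta(1) beta(1), folded beta(2)] by simp_all
qed

lemma zero_DerDiv: "vzero (Der m) : DD m" "(%x. 0) : divergence m (vzero (Der m))"
 unfolding der_zero(2) by (rule DerDivI[OF der_zero(1) zero_Linf], simp)+

lemma vsubspace_DerDiv: "vsubspace (Der m) (DD m)" unfolding vsubspace_def
proof (intro conjI ballI allI zero_DerDiv(1))
 show "DD m <= carr (Der m)" by (auto simp: DerDiv_def)
 fix b b' :: "('a => real) => ('a => real) set" and c
 assume b: "b : DD m"
 then obtain d where d: "d : divergence m b" by (auto simp: DerDiv_def)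
 show "vscale (Der m) c b : DD m" by (rule divergence_ops(3)[OF b d b d])
 assume b': "b' : DD m"
 then obtain d' where d': "d' : divergence m b'" by (auto simp: DerDiv_def)
 show "vadd (Der m) b b' : DD m" by (rule divergence_ops(1)[OF b d b' d'])
qed

text \<open>The divergence of \<open>hb\<close> is \<open>h div(b) + b(h)\<close>, from the Leibniz
  rule for \<open>h * f\<close>.\<close>

lemma der_mult_DerDiv:
 assumes b: "b : DD m" and h: "h : LIPb" shows "der_mult m h b : DD m"
proof -
 obtain beta d where beta: "der_rep beta (vnorm (Der m) b)" "b = der_of beta" "d : divergence m b"
  "d : Linf_funs m" "!!f. f : LIPb ==> (LINT x|m. beta f x) = - (LINT x|m. f x * d x)" by (rule DerDivE[OF b]) (rule that)
 obtain B where B: "abs (h x) <= B" for x using LIPb_bounded[OF h] by blast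
 have L: "(%x. h x * d x + beta h x) : Linf_funs m"
  by (intro Linf_funs_add(1) Linf_funs_mult_bdd[OF LIPb_bdd_borel[OF h] beta(4)] der_rep_Linf[OF beta(1) h])
 have "(LINT x|m. h x * beta f x) = - (LINT x|m. f x * (h x * d x + beta h x))" if f: "f : LIPb" for f
 proof -
  note fh = LIPb_mult[OF h f]
  have "(LINT x|m. beta (%x. h x * f x) x) = (LINT x|m. h x * beta f x + f x * beta h x)"
   using der_repD(2)[OF beta(1) fh] der_repD(2)[OF beta(1) f] der_repD(2)[OF beta(1) h] LIPb_measurable[OF f] LIPb_measurable[OF h]
   by (intro integral_cong_AE der_repD(6)[OF beta(1) h f]) simp_all
  hence e: "(LINT x|m. h x * beta f x + f x * beta h x) = - (LINT x|m. h x * f x * d x)" using beta(5)[OF fh] by simp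
  have i: "integrable m (%x. h x * beta f x)" "integrable m (%x. f x * beta h x)" "integrable m (%x. h x * f x * d x)"
   using Linf_mult_integrable[OF LIPb_bdd_borel[OF h] der_rep_Linf[OF beta(1) f]]
    Linf_mult_integrable[OF LIPb_bdd_borel[OF f] der_rep_Linf[OF beta(1) h]] Linf_mult_integrable[OF LIPb_bdd_borel[OF fh] beta(4)] .
  have "(LINT x|m. f x * (h x * d x + beta h x)) = (LINT x|m. h x * f x * d x + f x * beta h x)" by (simp add: algebra_simps)
  thus ?thesis using e i by simp
 qed
 from DerDivI(1)[OF der_rep_ops(3)[OF beta(1,1) LIPb_measurable[OF h] B] L this]
 show ?thesis unfolding beta(2) der_of_ops(3)[OF beta(1,1) LIPb_measurable[OF h]] .
qed

lemma der_mult_one: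
 assumes "b : DD m" shows "der_mult m (%x. 1) b = b"
proof -
 obtain beta where beta: "der_rep beta (vnorm (Der m) b)" "b = der_of beta" by (rule DerDivE[OF assms])
 show ?thesis unfolding beta(2) der_of_ops(3)[OF beta(1,1) borel_measurable_const[of 1]] by simp
qed

lemma der_mult_mult:
 assumes "b : DD m" and h: "h : LIPb" and k: "k : LIPb" shows "der_mult m k (der_mult m h b) = der_mult m (%x. h x * k x) b"
proof -
 obtain beta where beta: "der_rep beta (vnorm (Der m) b)" "b = der_of beta" using DerDivE[OF assms(1)] by metis
 obtain B where B: "abs (h x) <= B" for x using LIPb_bounded[OF h] by blast
 have hb: "der_rep (%f x. h x * beta f x) (B * vnorm (Der m) b)" by (rule der_rep_ops(3)[OF beta(1,1) LIPb_measurable[OF h] B])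
 show ?thesis unfolding beta(2) der_of_ops(3)[OF beta(1,1) LIPb_measurable[OF h]] der_of_ops(3)[OF hb hb LIPb_measurable[OF k]]
   der_of_ops(3)[OF beta(1,1) LIPb_measurable[OF LIPb_mult[OF h k]]] by (simp add: mult.left_commute mult.assoc)
qed

end

text \<open>
 Sobolev's inequality makes the equation \<open>div b = g\<close> solvable for bounded \<open>g\<close> of mean zero, with a
 bound on \<open>b\<close> in terms of the norm of \<open>g\<close> in \<open>L\<^sup>s\<close>. This gives the \<open>L\<^sup>p\<close> bound for BV functions.
\<close>

lemma (in bounded_PI) divergence_solvable:
 obtains K where "0 <= K" "!!g. g : bdd_borel ==> (LINT x|m. g x) = 0 ==>
  EX b:DD m. vnorm (Der m) b <= K * Lp_norm m s g & g : divergence m b"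
proof -
 obtain K where K: "0 <= K" "!!f. f : LIPb ==> Lp_norm m p (%x. f x - mean f) <= K * energy f" using sobolev by blast
 show thesis
 proof (rule that[OF K(1)])
  fix g :: "'a => real" assume g: "g : bdd_borel" and g0: "(LINT x|m. g x) = 0"
  let ?l = "%f. - (LINT x|m. f x * g x)" and ?C = "K * Lp_norm m s g"
  have s1: "1 <= s" using s by simp
  have int: "integrable m (%x. f x * g x)" if "f : LIPb" for f by (intro integrable_bdd_borel bdd_borel_closed LIPb_bdd_borel that g)
  have le: "?l f <= ?C * (LINT x|m. lip_a f x)" if f: "f : LIPb" for f
  proof -
   \<comment> \<open>As \<open>g\<close> has integral zero, \<open>f\<close> may be replaced by its
     deviation from the mean, to which Hoelder and \<open>sobolev\<close> apply.\<close>
   define c where "c = mean f"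
   have fc: "(%x. f x - c) : LIPb" using f by simp
   have "(LINT x|m. (f x - c) * g x) = (LINT x|m. f x * g x) - (LINT x|m. c * g x)"
    using int[OF f] integrable_bdd_borel[OF g] by (simp add: left_diff_distrib)
   hence "(LINT x|m. f x * g x) = (LINT x|m. (f x - c) * g x)" using g0 by simp
   hence "abs (LINT x|m. f x * g x) <= Lp_norm m p (%x. f x - c) * Lp_norm m s g"
    using holder(2)[OF p(1) s p(2) bdd_borel_Lp[OF p(5) LIPb_bdd_borel[OF fc]] bdd_borel_Lp[OF s1 g]] by simp
   also have "... <= K * energy f * Lp_norm m s g" unfolding c_def by (intro mult_right_mono Lp_norm_nonneg K f)
   finally show ?thesis by (simp add: energy_def algebra_simps)
  qed
  obtain beta where beta: "der_rep beta ?C" "!!f. f : LIPb ==> (LINT x|m. beta f x) = ?l f"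
  proof (rule derivation_extension[of ?l ?C])
   show "?l (%x. f x + g x) = ?l f + ?l g" if "f : LIPb" "g : LIPb" for f g
    using int[OF that(1)] int[OF that(2)] by (simp add: distrib_right)
   show "?l (%x. c * f x) = c * ?l f" if "f : LIPb" for c f by (simp add: mult.assoc)
   show "0 <= ?C" using K(1) Lp_norm_nonneg by (rule mult_nonneg_nonneg)
  qed (use le in \<open>blast+\<close>)
  obtain B where "abs (g x) <= B" for x using g by (auto simp: bdd_borel_def)
  hence gL: "g : Linf_funs m" using g by (auto simp: Linf_funs_def bdd_borel_def)
  from DerDivI[OF beta(1) gL beta(2)] der_of_Der(2)[OF beta(1)]
  show "EX b:DD m. vnorm (Der m) b <= ?C & g : divergence m b" by blast
 qed
qed

section \<open>Functions of bounded variation\<close>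

context borel_space
begin

lemma DerDiv_simps [simp]:
 "vzero (DerDiv m) = vzero (Der m)" "vadd (DerDiv m) = vadd (Der m)" "vscale (DerDiv m) = vscale (Der m)"
 "vnorm (DerDiv m) = vnorm (Der m)" "vdiff (DerDiv m) = vdiff (Der m)" by (simp_all add: DerDiv_def)

lemma DerDiv_eq: "DerDiv m = (Der m)\<lparr>vcarrier := DD m\<rparr>" by (simp add: DerDiv_def)

lemma seminormed_DerDiv: "seminormed (DerDiv m)"
 by (subst DerDiv_eq) (rule seminormed.seminormed_subspace[OF seminormed_Der vsubspace_DerDiv])

text \<open>A reformulation of \<open>BV_operator\<close> for a function instead of a class, with an
  explicit constant. The total-mass and module conditions are merged into one formula for the
  integral of \<open>h\<close> against \<open>L b\<close>.\<close>

definition bv :: "('a => real) => ((('a => real) => ('a => real) set) => 'a set => real) => real => bool" where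
 "bv f L C \<longleftrightarrow> f : Lp_funs m 1 & 0 <= C & L : DD m \<rightarrow>\<^sub>E carr Meas &
   (ALL b:DD m. ALL b':DD m. L (vadd (Der m) b b') = vadd Meas (L b) (L b')) &
   (ALL c. ALL b:DD m. L (vscale (Der m) c b) = vscale Meas c (L b)) &
   (ALL b:DD m. vnorm Meas (L b) <= C * vnorm (Der m) b) &
   (ALL b:DD m. ALL h:LIPb. ALL d:divergence m (der_mult m h b).
    sint (L b) h = - (LINT x|m. f x * d x))"

lemma bvD:
 assumes "bv f L C" shows "f : Lp_funs m 1" "0 <= C" "L : DD m \<rightarrow>\<^sub>E carr Meas"
  "b : DD m ==> L b : carr Meas"
  "b : DD m ==> b' : DD m ==> L (vadd (Der m) b b') = vadd Meas (L b) (L b')"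
  "b : DD m ==> L (vscale (Der m) c b) = vscale Meas c (L b)"
  "b : DD m ==> vnorm Meas (L b) <= C * vnorm (Der m) b"
  "b : DD m ==> h : LIPb ==> d : divergence m (der_mult m h b) ==>
   sint (L b) h = - (LINT x|m. f x * d x)" using assms by (auto simp: bv_def PiE_iff)

lemma bv_one:
 assumes "bv f L C" "b : DD m" "d : divergence m b" shows "sint (L b) (%x. 1) = - (LINT x|m. f x * d x)"
 using bvD(8)[OF assms(1,2) LIPb_const, of d 1] assms(3) by (simp add: der_mult_one[OF assms(2)])

lemma bv_unique:
 assumes L: "bv f L C" and L': "bv f L' C'" shows "L = L'"
proof (rule extensionalityI[of _ "DD m"])
 fix b assume b: "b : DD m"
 show "L b = L' b"
 proof (rule Meas_eqI[OF bvD(4)[OF L b] bvD(4)[OF L' b]])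
  fix h :: "'a => real" assume h: "h : LIPb"
  obtain d where "d : divergence m (der_mult m h b)" using der_mult_DerDiv[OF b h] by (auto simp: DerDiv_def)
  thus "sint (L b) h = sint (L' b) h" using bvD(8)[OF L b h] bvD(8)[OF L' b h] by metis
 qed
qed (use bvD(3)[OF L] bvD(3)[OF L'] in \<open>auto simp: PiE_iff\<close>)

text \<open>The module rule is verified on Lipschitz tests \<open>k\<close>: both sides are minus
  the integral of \<open>f\<close> against the divergence of the product of \<open>h\<close>,
  \<open>k\<close> and \<open>b\<close>.\<close>

lemma bv_operator:
 assumes L: "bv f L C" shows "BV_operator m (ae_class m f) L" unfolding BV_operator_def vbounded_linear_def vlinear_def DerDiv_simps
proof (intro conjI ballI allI exI)
 have fm: "f : borel_measurable m" using bvD(1)[OF L] by (simp add: Lp_funs_def)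
 fix b :: "('a => real) => ('a => real) set" and h :: "'a => real" assume b: "b : DD m"
 show "L b UNIV = - (LINT x|m. g x * d x)" if g: "g : ae_class m f" and d: "d : divergence m b" for g d
 proof -
  have "d : borel_measurable m" using d by (simp add: divergence_def Linf_funs_def)
  moreover have "g : borel_measurable m" "AE x in m. g x = f x" using g unfolding mem_ae_class[OF fm] by blast+
  ultimately have "(LINT x|m. f x * d x) = (LINT x|m. g x * d x)" using fm by (intro integral_cong_AE) auto
  thus ?thesis using bv_one[OF L b d] signed_integral_one[OF bvD(4)[OF L b]] by simp
 qed
 assume h: "h : LIPb"
 note hb = der_mult_DerDiv[OF b h]
 note mu = bvD(4)[OF L b]
 show "L (der_mult m h b) = density_signed h (L b)"
 proof (rule Meas_eqI[OF bvD(4)[OF L hb] density_signed_Meas(1)[OF mu LIPb_bdd_borel[OF h]]])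
  fix k :: "'a => real" assume k: "k : LIPb"
  obtain d where d: "d : divergence m (der_mult m k (der_mult m h b))" using der_mult_DerDiv[OF hb k] by (auto simp: DerDiv_def)
  show "sint (L (der_mult m h b)) k = sint (density_signed h (L b)) k"
   unfolding density_signed_Meas(2)[OF mu LIPb_bdd_borel[OF h] LIPb_bdd_borel[OF k]]
    bvD(8)[OF L hb k d] bvD(8)[OF L b LIPb_mult[OF h k] d[unfolded der_mult_mult[OF b h k]]] ..
 qed
qed (use bvD[OF L] in blast)+

text \<open>Evaluating the module rule on the whole space turns the total mass of
  \<open>L (der_mult m h b)\<close> into the integral of \<open>h\<close> against
  \<open>L b\<close>.\<close>

lemma BV_op_bv:
 assumes A: "BV_operator m A L" and f: "f : Lp_funs m 1" "f : A" shows "bv f L (vopnorm (DerDiv m) Meas L)"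
proof -
 have bl: "vbounded_linear (DerDiv m) Meas L" using A by (simp add: BV_operator_def)
 note n = vopnorm_bound[OF seminormed_DerDiv seminormed_Meas bl]
 have "sint (L b) h = - (LINT x|m. f x * d x)"
  if b: "b : DD m" and h: "h : LIPb" and d: "d : divergence m (der_mult m h b)" for b h d
 proof -
  have mu: "L b : carr Meas" using bl b by (auto simp: vbounded_linear_def vlinear_def)
  have hb: "der_mult m h b : DD m" by (rule der_mult_DerDiv[OF b h])
  have "L (der_mult m h b) UNIV = - (LINT x|m. f x * d x)" "L (der_mult m h b) = density_signed h (L b)"
   using A b h d f(2) hb unfolding BV_operator_def by blast+
  thus ?thesis using density_signed_Meas(2)[OF mu LIPb_bdd_borel[OF h] bdd_borel_const[of 1]]
    signed_integral_one[OF density_signed_Meas(1)[OF mu LIPb_bdd_borel[OF h]]] by simp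
 qed
 thus ?thesis using f bl n unfolding bv_def vbounded_linear_def vlinear_def by simp
qed

lemma BV_simps:
 "carr (BV m) = {A : carr (Lp m 1). EX L. BV_operator m A L}"
 "vnorm (BV m) A = vnorm (Lp m 1) A + BV_variation m A"
 "vzero (BV m) = vzero (Lp m 1)" "vadd (BV m) = vadd (Lp m 1)" "vscale (BV m) = vscale (Lp m 1)" by (simp_all add: BV_def)

lemma bv_BV:
 assumes L: "bv f L C" shows "ae_class m f : carr (BV m)" "BV_op m (ae_class m f) = L" "BV_variation m (ae_class m f) <= C"
  "vnorm (BV m) (ae_class m f) = Lp_norm m 1 f + BV_variation m (ae_class m f)"
proof -
 have f: "f : Lp_funs m 1" "f : ae_class m f" using bvD(1)[OF L] self_ae_class[of f m] by (simp_all only: Lp_funs_def mem_Collect_eq)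
 show "ae_class m f : carr (BV m)"
  unfolding BV_simps(1) mem_Collect_eq Lp_simps(1)[OF order_refl] by (intro conjI exI[of _ L] imageI f(1) bv_operator[OF L])
 show op: "BV_op m (ae_class m f) = L" unfolding BV_op_def
  by (rule the_equality, rule bv_operator[OF L]) (rule bv_unique[OF BV_op_bv[OF _ f] L])
 show "BV_variation m (ae_class m f) <= C" unfolding BV_variation_def op using bvD(2,7)[OF L] by (intro vopnorm_le) simp_all
 show "vnorm (BV m) (ae_class m f) = Lp_norm m 1 f + BV_variation m (ae_class m f)" unfolding BV_simps(2) Lp_simps(5)[OF order_refl f(1)] ..
qed

lemma BV_E:
 assumes "A : carr (BV m)"
 obtains f where "A = ae_class m f" "bv f (BV_op m A) (BV_variation m A)"
proof -
 have "A : carr (Lp m 1)" "EX L. BV_operator m A L" using assms by (auto simp: BV_simps)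
 then obtain f L where f: "f : Lp_funs m 1" "A = ae_class m f" and L: "BV_operator m A L"
  unfolding Lp_simps(1)[OF order_refl] image_iff by blast
 have "f : A" unfolding f(2) using f(1) by (intro self_ae_class) (simp add: Lp_funs_def)
 note b = BV_op_bv[OF L f(1) this]
 have "BV_op m A = L" unfolding f(2) by (rule bv_BV(2)[OF b])
 thus thesis using that[OF f(2)] b unfolding BV_variation_def by simp
qed

lemma bv_zero: "bv (%x. 0) (restrict (%b. vzero Meas) (DD m)) 0"
proof -
 interpret M: seminormed "Meas :: ('a set => real) nvs" by (rule seminormed_Meas)
 interpret D: seminormed "DerDiv m" by (rule seminormed_DerDiv)
 have "sint (vzero Meas :: 'a set => real) h = 0" if "h : LIPb" for h
  using Meas_scale(3)[OF M.zero_closed LIPb_bdd_borel[OF that], of 0] by simp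
 thus ?thesis unfolding bv_def using D.add_closed D.scale_closed by (auto simp: Lp_funs_def)
qed

lemma bv_comb:
 assumes L: "bv f L C" and L': "bv g L' C'" shows "EX K. bv (%x. c * f x + t * g x) K (abs c * C + abs t * C')"
proof -
 interpret M: seminormed "Meas :: ('a set => real) nvs" by (rule seminormed_Meas)
 interpret D: seminormed "DerDiv m" by (rule seminormed_DerDiv)
 note D = bvD[OF L] and D' = bvD[OF L'] and cl = D.add_closed[simplified] D.scale_closed[simplified]
 have int: "integrable m (%x. k x * d x)" if d: "d : Linf_funs m" and k: "k : Lp_funs m 1" for k d
 proof (rule Bochner_Integration.integrable_bound)
  show "integrable m (%x. Linf_norm m d * abs (k x))" using k by (simp add: Lp_funs_def)
  show "(%x. k x * d x) : borel_measurable m" using k d by (auto simp: Lp_funs_def Linf_funs_def)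
  show "AE x in m. norm (k x * d x) <= norm (Linf_norm m d * abs (k x))" using Linf_norm_AE[OF d]
  proof eventually_elim
   case (elim x)
   hence "abs (d x) * abs (k x) <= Linf_norm m d * abs (k x)" by (intro mult_right_mono) auto
   thus ?case using Linf_norm_nonneg[OF d] by (simp add: abs_mult mult.commute)
  qed
 qed
 define K where "K = (\<lambda>b\<in>DD m. vadd Meas (vscale Meas c (L b)) (vscale Meas t (L' b)))"
 have K: "K b = vadd Meas (vscale Meas c (L b)) (vscale Meas t (L' b))" if "b : DD m" for b using that by (simp add: K_def)
 have "bv (%x. c * f x + t * g x) K (abs c * C + abs t * C')" unfolding bv_def
 proof (intro conjI ballI allI)
  show "(%x. c * f x + t * g x) : Lp_funs m 1" by (intro Lp_funs_add Lp_funs_scale order_refl D(1) D'(1))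
  show "0 <= abs c * C + abs t * C'" using D(2) D'(2) by simp
  show "K : DD m \<rightarrow>\<^sub>E carr Meas" unfolding K_def using D(4) D'(4) by auto
  fix b b' h d r assume b: "b : DD m"
  note B = D(4)[OF b] D'(4)[OF b]
  show "K (vscale (Der m) r b) = vscale Meas r (K b)"
   unfolding K[OF b] K[OF cl(2)[OF b]] using D(6)[OF b] D'(6)[OF b] B by (simp add: M.scale_add_right mult.commute)
  show "vnorm Meas (K b) <= (abs c * C + abs t * C') * vnorm (Der m) b"
   unfolding K[OF b] using M.norm_triangle[OF M.scale_closed[OF B(1), of c] M.scale_closed[OF B(2), of t]]
    mult_left_mono[OF D(7)[OF b], of "abs c"] mult_left_mono[OF D'(7)[OF b], of "abs t"] B by (simp add: M.norm_scale algebra_simps)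
  show "K (vadd (Der m) b b') = vadd Meas (K b) (K b')" if b': "b' : DD m"
   unfolding K[OF b] K[OF b'] K[OF cl(1)[OF b b']] D(5)[OF b b'] D'(5)[OF b b']
   using B D(4)[OF b'] D'(4)[OF b'] by (simp add: M.scale_add_right M.add_ac)
  assume h: "h : LIPb" and d: "d : divergence m (der_mult m h b)"
  have "d : Linf_funs m" using d by (simp add: divergence_def)
  note i = int[OF this D(1)] int[OF this D'(1)] and h' = LIPb_bdd_borel[OF h]
  show "sint (K b) h = - (LINT x|m. (c * f x + t * g x) * d x)"
   unfolding K[OF b] Meas_add(3)[OF Meas_scale(1)[OF B(1)] Meas_scale(1)[OF B(2)] h'] Meas_scale(3)[OF B(1) h']
    Meas_scale(3)[OF B(2) h'] D(8)[OF b h d] D'(8)[OF b h d] using i by (simp add: distrib_right mult.assoc)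
 qed
 thus ?thesis by blast
qed

lemma BV_bv_ops:
 assumes A: "A = ae_class m f" "bv f L C" and B: "B = ae_class m g" "bv g L' C'"
 shows "vadd (BV m) A B = ae_class m (%x. f x + g x)" "vscale (BV m) c A = ae_class m (%x. c * f x)"
 unfolding A(1) B(1) BV_simps(3-5) Lp_simps(3)[OF order_refl bvD(1)[OF A(2)] bvD(1)[OF B(2)]]
  Lp_simps(4)[OF order_refl bvD(1)[OF A(2)]] by (rule refl)+

lemma normed_BV: "normed_space_on (BV m)"
proof -
 interpret L1: seminormed "Lp m 1" by (rule normed_imp_seminormed[OF normed_Lp[OF order_refl]])
 have sub: "A : carr (Lp m 1)" "0 <= BV_variation m A" if "A : carr (BV m)" for A
  by (rule BV_E[OF that], use that in \<open>simp add: BV_simps(1)\<close>, rule BV_E[OF that], rule bvD(2))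
 have add: "vadd (BV m) A B : carr (BV m)" "BV_variation m (vadd (BV m) A B) <= BV_variation m A + BV_variation m B"
  and scale: "vscale (BV m) c A : carr (BV m)" "BV_variation m (vscale (BV m) c A) <= abs c * BV_variation m A"
  if AB: "A : carr (BV m)" "B : carr (BV m)" for A B c
 proof -
  obtain f where f: "A = ae_class m f" "bv f (BV_op m A) (BV_variation m A)" by (rule BV_E[OF AB(1)])
  obtain g where g: "B = ae_class m g" "bv g (BV_op m B) (BV_variation m B)" by (rule BV_E[OF AB(2)])
  obtain L L' where "bv (%x. f x + g x) L (BV_variation m A + BV_variation m B)" "bv (%x. c * f x) L' (abs c * BV_variation m A)"
   using bv_comb[OF f(2) g(2), of 1 1, simplified] bv_comb[OF f(2) g(2), of c 0, simplified] by blast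
  from this[THEN bv_BV(1)] this[THEN bv_BV(3)] show
   "vadd (BV m) A B : carr (BV m)" "BV_variation m (vadd (BV m) A B) <= BV_variation m A + BV_variation m B"
   "vscale (BV m) c A : carr (BV m)" "BV_variation m (vscale (BV m) c A) <= abs c * BV_variation m A"
   unfolding BV_bv_ops(1)[OF f g] BV_bv_ops(2)[OF f f] by blast+
 qed
 have zero: "vzero (BV m) : carr (BV m)" unfolding BV_simps(3-5) Lp_simps(2)[OF order_refl] by (rule bv_BV(1)[OF bv_zero])
 have "vsubspace (Lp m 1) (carr (BV m))" unfolding vsubspace_def BV_simps(3-5)[symmetric] using sub(1) zero add(1) scale(1) by blast
 hence "vspace_on (BV m)" by (rule vspace_on.vspace_cong[OF L1.vspace_subspace]) (simp_all add: BV_simps)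
 hence "seminormed (BV m)"
 proof (rule seminormedI)
  fix A B c assume A: "A : carr (BV m)"
  show "0 <= vnorm (BV m) A" using sub[OF A] by (simp add: BV_simps(2))
  show "vnorm (BV m) (vscale (BV m) c A) <= abs c * vnorm (BV m) A"
   using scale(2)[OF A A, of c] L1.norm_scale[OF sub(1)[OF A], of c] by (simp add: BV_simps(2-5) distrib_left)
  assume B: "B : carr (BV m)"
  show "vnorm (BV m) (vadd (BV m) A B) <= vnorm (BV m) A + vnorm (BV m) B"
   using add(2)[OF A B] L1.norm_triangle[OF sub(1)[OF A] sub(1)[OF B]] by (simp add: BV_simps(2-5))
 qed
 thus ?thesis
 proof (rule normed_space_onI)
  fix A assume A: "A : carr (BV m)" "vnorm (BV m) A = 0"
  hence "vnorm (Lp m 1) A = 0" using sub(2)[OF A(1)] L1.norm_nonneg[OF sub(1)[OF A(1)]] A(2)[unfolded BV_simps(2)] by linarith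
  thus "A = vzero (BV m)" using normed_space_on.norm_eq_zero[OF normed_Lp[OF order_refl] sub(1)[OF A(1)]] by (simp add: BV_simps)
 qed
qed

end

text \<open>If \<open>b\<close> has divergence \<open>g - a\<close>, with \<open>a\<close> the mean
  of \<open>g\<close>, then the total mass of \<open>L b\<close> controls the integral of
  \<open>f * (g - a)\<close>. The mean part is bounded with the L^1 norm of \<open>f\<close>, and
  the converse Hoelder inequality concludes.\<close>

lemma (in bounded_PI) bv_Lp:
 obtains K where "0 <= K" "!!f L C. bv f L C ==> f : Lp_funs m p & Lp_norm m p f <= K * (Lp_norm m 1 f + C)"
proof -
 obtain K where K: "0 <= K" "!!g. g : bdd_borel ==> (LINT x|m. g x) = 0 ==>
  EX b:DD m. vnorm (Der m) b <= K * Lp_norm m s g & g : divergence m b" using divergence_solvable by blast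
 have s1: "1 <= s" using s by simp
 \<comment> \<open>The constant with which Hoelder bounds the mean of \<open>g\<close> by its L^s
   norm.\<close>
 define J where "J = Lp_norm m p (%x. 1) / measure m UNIV"
 have J: "0 <= J" unfolding J_def by (intro divide_nonneg_nonneg Lp_norm_nonneg measure_nonneg)
 let ?M = "1 + J * Lp_norm m s (%x. 1)"
 have M: "0 <= ?M" by (rule add_nonneg_nonneg[OF zero_le_one mult_nonneg_nonneg[OF J Lp_norm_nonneg]])
 show thesis
 proof (rule that)
  show "0 <= K * ?M + J" using K(1) J M by simp
  fix f L C assume L: "bv f L C"
  have fi: "integrable m (%x. abs (f x))" "f : borel_measurable borel" using bvD(1)[OF L] by (auto simp: Lp_funs_def)
  hence f: "integrable m f" by (simp add: integrable_abs_iff)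
  have f1: "Lp_norm m 1 f = (LINT x|m. abs (f x))" by (simp add: Lp_norm_def)
  let ?C = "C * K * ?M + J * Lp_norm m 1 f"
  have C0: "0 <= ?C" using bvD(2)[OF L] K(1) M J Lp_norm_nonneg[of m 1 f] by simp
  have "(LINT x|m. f x * g x) <= ?C * Lp_norm m s g" if g: "g : bdd_borel" for g
  proof -
   define a where "a = (LINT x|m. g x) / measure m UNIV"
   have "abs (LINT x|m. 1 * g x) <= Lp_norm m p (%x. 1) * Lp_norm m s g"
    by (rule holder(2)[OF p(1) s p(2) bdd_borel_Lp[OF p(5)] bdd_borel_Lp[OF s1 g]]) simp
   hence a: "abs a <= J * Lp_norm m s g" using UNIV_pos by (simp add: a_def J_def divide_right_mono)
   have g0: "(%x. g x + (- a)) : bdd_borel" by (intro bdd_borel_closed g bdd_borel_const)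
   have "(LINT x|m. g x + (- a)) = 0" using integrable_bdd_borel[OF g] UNIV_pos by (simp add: a_def)
   from K(2)[OF g0 this] obtain b where b: "b : DD m"
    "vnorm (Der m) b <= K * Lp_norm m s (%x. g x + (- a))" "(%x. g x + (- a)) : divergence m b" by blast
   have "Lp_norm m s (%x. g x + (- a)) <= Lp_norm m s g + Lp_norm m s (%x. (- a) * 1)"
    using minkowski[OF s1 bdd_borel_Lp[OF s1 g] bdd_borel_Lp[OF s1 bdd_borel_const[of "- a"]]] by simp
   also have "... = Lp_norm m s g + abs a * Lp_norm m s (%x. 1)" by (subst Lp_norm_scale[OF s1]) simp
   also have "... <= Lp_norm m s g + J * Lp_norm m s g * Lp_norm m s (%x. 1)"
    using a by (intro add_left_mono mult_right_mono Lp_norm_nonneg)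
   finally have n: "Lp_norm m s (%x. g x + (- a)) <= ?M * Lp_norm m s g" by (simp add: algebra_simps)
   have "abs (sint (L b) (%x. 1)) <= 1 * vnorm Meas (L b)" by (rule signed_integral_bound[OF bvD(4)[OF L b(1)]]) simp_all
   also have "... <= C * vnorm (Der m) b" using bvD(7)[OF L b(1)] by simp
   also have "... <= C * (K * (?M * Lp_norm m s g))"
    using order_trans[OF b(2) mult_left_mono[OF n K(1)]] by (rule mult_left_mono[OF _ bvD(2)[OF L]])
   finally have 1: "abs (LINT x|m. f x * (g x + (- a))) <= C * (K * (?M * Lp_norm m s g))" using bv_one[OF L b(1,3)] by simp
   have "(LINT x|m. f x * (g x + (- a))) = (LINT x|m. f x * g x) - a * (LINT x|m. f x)"
    using f integrable_mult_bdd_borel[OF f g] by (simp add: right_diff_distrib mult.commute[of _ a])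
   moreover have "abs (a * (LINT x|m. f x)) <= (J * Lp_norm m s g) * Lp_norm m 1 f"
    unfolding abs_mult f1 using a J Lp_norm_nonneg by (intro mult_mono integral_abs_bound mult_nonneg_nonneg) auto
   moreover have "?C * Lp_norm m s g = C * (K * (?M * Lp_norm m s g)) + (J * Lp_norm m s g) * Lp_norm m 1 f" by (simp add: algebra_simps)
   ultimately show ?thesis using 1 by linarith
  qed
  note h = Lp_converse_holder[OF p(1) s p(2) fi(2) C0 this]
  have "?C <= (K * ?M + J) * (Lp_norm m 1 f + C)"
  proof -
   have "0 <= K * ?M * Lp_norm m 1 f" "0 <= J * C" using K(1) M J bvD(2)[OF L] Lp_norm_nonneg[of m 1 f] by simp_all
   thus ?thesis by (simp add: algebra_simps)
  qed
  thus "f : Lp_funs m p & Lp_norm m p f <= (K * ?M + J) * (Lp_norm m 1 f + C)" using h by simp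
 qed
qed

section \<open>The predual\<close>

text \<open>Extension to the closure along prescribed approximating sequences \<open>t\<close>.
  Because \<open>t\<close> is a parameter, a whole family of functionals can be extended along the
  same sequences, which keeps the extension linear in the family parameter.\<close>

lemma (in seminormed) vfunc_closure:
 assumes S: "vsubspace E S" and t: "!!x n. x : vclosure E S ==> t x n : S"
   "!!x. x : vclosure E S ==> (%n. vdist E (t x n) x) ----> 0"
  and phi: "vfunc (E\<lparr>vcarrier := S\<rparr>) phi C" and C: "0 <= C"
 defines "psi x \<equiv> lim (%n. phi (t x n))"
 shows "vfunc (E\<lparr>vcarrier := vclosure E S\<rparr>) psi C" "x : S ==> psi x = phi x"
  "y : vclosure E S ==> (%n. phi (t y n)) ----> psi y"
proof -
 interpret S: seminormed "E\<lparr>vcarrier := S\<rparr>" by (rule seminormed_subspace[OF S])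
 note D = vfuncD[OF phi, simplified] and sD = subspaceD[OF S] and N = vsubspace_vclosure[OF S]
 have cl: "x : carr E" if "x : vclosure E S" for x using that vclosure_subset by blast
 have conv: "(%n. phi (t x n)) ----> psi x" if x: "x : vclosure E S" for x
 proof -
  have "vCauchy E (t x)" using convergent_imp_vCauchy[of "t x" x] sD(2)[OF t(1)[OF x]] cl[OF x] t(2)[OF x] by blast
  hence "vCauchy (E\<lparr>vcarrier := S\<rparr>) (t x)" using t(1)[OF x] by (simp add: vCauchy_def)
  thus ?thesis unfolding psi_def by (rule S.vfunc_convergent[OF phi])
 qed
 \<comment> \<open>The limit is the same along any other sequence in \<open>S\<close>; sums and
   multiples of the prescribed sequences are of this kind.\<close>
 have lim: "psi x = l" if x: "x : vclosure E S" and u: "!!n. u n : S"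
  "(%n. vdist E (u n) x) ----> 0" "(%n. phi (u n)) ----> l" for x u l
 proof -
  have "abs (phi (t x n) - phi (u n)) <= C * (vdist E (t x n) x + vdist E (u n) x)" for n
  proof -
   note T = t(1)[OF x, of n] and U = u(1)[of n]
   have "abs (phi (t x n) - phi (u n)) <= C * vdist E (t x n) (u n)"
    using S.vfunc_simps(2)[OF phi] D(3)[OF sD(6)[OF T U]] T U by simp
   also have "... <= C * (vdist E (t x n) x + vdist E (u n) x)"
    using norm_diff_triangle[OF sD(2)[OF T] cl[OF x] sD(2)[OF U]] norm_diff_commute[OF cl[OF x] sD(2)[OF U]] C
    by (intro mult_left_mono) auto
   finally show ?thesis .
  qed
  hence "ALL n. norm (phi (t x n) - phi (u n)) <= C * (vdist E (t x n) x + vdist E (u n) x)" by simp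
  moreover have "(%n. C * (vdist E (t x n) x + vdist E (u n) x)) ----> 0"
   using tendsto_mult_left[OF tendsto_add[OF t(2)[OF x] u(2)], of C] by simp
  ultimately have "(%n. phi (t x n) - phi (u n)) ----> 0" by (rule Lim_null_comparison[OF always_eventually])
  from tendsto_add[OF this u(3)] show ?thesis using LIMSEQ_unique[OF conv[OF x]] by simp
 qed
 show "y : vclosure E S ==> (%n. phi (t y n)) ----> psi y" by (rule conv)
 show "x : S ==> psi x = phi x" using subset_vclosure[OF sD(1)] sD(2) by (intro lim[of x "%n. x"]) auto
 show "vfunc (E\<lparr>vcarrier := vclosure E S\<rparr>) psi C" unfolding vfunc_def
 proof (simp, intro conjI ballI allI)
  fix x y c assume x: "x : vclosure E S"
  note X = t(1)[OF x] sD(2)[OF t(1)[OF x]] cl[OF x]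
  have "(%n. vdist E (vscale E c (t x n)) (vscale E c x)) ----> 0"
   using tendsto_mult_left[OF t(2)[OF x], of "abs c"] X by (simp add: scale_diff[symmetric] norm_scale)
  from lim[OF subspaceD(5)[OF N x] sD(5)[OF X(1)] this] show "psi (vscale E c x) = c * psi x"
   using tendsto_mult_left[OF conv[OF x], of c] D(2)[OF X(1)] by simp
  have "(%n. vnorm E (t x n)) ----> vnorm E x"
   by (rule LIM_zero_cancel, rule Lim_null_comparison[OF _ t(2)[OF x]]) (simp add: norm_abs_diff[OF X(2,3)])
  thus "abs (psi x) <= C * vnorm E x" using D(3)[OF X(1)] by (intro LIMSEQ_le[OF tendsto_rabs[OF conv[OF x]] tendsto_mult_left]) auto
  assume y: "y : vclosure E S"
  note Y = t(1)[OF y] sD(2)[OF t(1)[OF y]] cl[OF y]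
  have le: "vdist E (vadd E (t x n) (t y n)) (vadd E x y) <= vdist E (t x n) x + vdist E (t y n) y" for n
   using diff_add_add[OF X(2) Y(2) X(3) Y(3)] norm_triangle[OF diff_closed[OF X(2,3)] diff_closed[OF Y(2,3)]] by metis
  have "(%n. vdist E (vadd E (t x n) (t y n)) (vadd E x y)) ----> 0"
   by (rule Lim_null_comparison[OF _ tendsto_add_zero[OF t(2)[OF x] t(2)[OF y]]]) (use X Y le in simp)
  from lim[OF subspaceD(4)[OF N x y] sD(4)[OF X(1) Y(1)] this] show "psi (vadd E x y) = psi x + psi y"
   using tendsto_add[OF conv[OF x] conv[OF y]] D(1)[OF X(1) Y(1)] by simp
 qed
qed

lemma vfunc_prod:
 assumes E: "seminormed E" and F: "seminormed F"
  and phi: "vfunc E phi C" and psi: "vfunc F psi D" and CD: "0 <= C" "0 <= D"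
 shows "vfunc (vprod_max E F) (%(x, y). phi x + psi y) (C + D)" unfolding vfunc_def
proof (intro conjI ballI allI; clarsimp simp: vprod_max_simps)
 interpret E: seminormed E by (rule E)
 interpret F: seminormed F by (rule F)
 note a = vfuncD[OF phi] and b = vfuncD[OF psi]
 fix x y c assume xy: "x : carr E" "y : carr F"
 show "phi (vscale E c x) + psi (vscale F c y) = c * (phi x + psi y)" using a b xy by (simp add: distrib_left)
 have "C * vnorm E x <= C * max (vnorm E x) (vnorm F y)" "D * vnorm F y <= D * max (vnorm E x) (vnorm F y)"
  using CD by (auto intro: mult_left_mono)
 thus "abs (phi x + psi y) <= (C + D) * max (vnorm E x) (vnorm F y)" using a(3)[OF xy(1)] b(3)[OF xy(2)] by (simp add: distrib_right)
 fix x' y' assume "x' : carr E" "y' : carr F"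
 thus "phi (vadd E x x') + psi (vadd F y y') = phi x + psi y + (phi x' + psi y')" using a b xy by simp
qed

lemma vfunc_components:
 assumes E: "seminormed E" and F: "seminormed F" and Phi: "vfunc (vprod_max E F) Phi C"
 shows "vfunc E (%x. Phi (x, vzero F)) C" "vfunc F (%y. Phi (vzero E, y)) C"
  "x : carr E ==> y : carr F ==> Phi (x, y) = Phi (x, vzero F) + Phi (vzero E, y)"
proof -
 interpret E: seminormed E by (rule E)
 interpret F: seminormed F by (rule F)
 note D = vfuncD[OF Phi, unfolded vprod_max_simps]
 note s = vprod_max_simps[of E F]
 show "vfunc E (%x. Phi (x, vzero F)) C" unfolding vfunc_def
  using D(1)[of "(_, vzero F)" "(_, vzero F)"] D(2)[of "(_, vzero F)"] D(3)[of "(_, vzero F)"] by (auto simp: s max_absorb1)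
 show "vfunc F (%y. Phi (vzero E, y)) C" unfolding vfunc_def
  using D(1)[of "(vzero E, _)" "(vzero E, _)"] D(2)[of "(vzero E, _)"] D(3)[of "(vzero E, _)"] by (auto simp: s max_absorb2)
 show "x : carr E ==> y : carr F ==> Phi (x, y) = Phi (x, vzero F) + Phi (vzero E, y)"
  using D(1)[of "(x, vzero F)" "(vzero E, y)"] by (simp add: s)
qed

lemma (in tensor_pair) functional_tensor_sum:
 assumes "vfunc PT phi C"
 shows "set ps <= carr E \<times> carr F ==> phi (tensor_sum E F ps) = (\<Sum>(x, y)\<leftarrow>ps. phi (tensor E F x y))"
proof (induction ps)
 interpret PT: seminormed PT by (rule seminormed_proj_tensor_alg)
 case Nil
 thus ?case using PT.vfunc_simps(1)[OF assms] by simp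
next
 case (Cons q ps)
 thus ?case using vfuncD(1)[OF assms, of "tensor E F (fst q) (snd q)" "tensor_sum E F ps"] by (cases q) auto
qed

context borel_space
begin

lemma DC_carrier: "carr (cDer m) = vclosure (Der m) (DD m)" by (simp add: DerDiv_closure_def)

lemma DC_simps [simp]:
 "vzero (cDer m) = vzero (Der m)" "vadd (cDer m) = vadd (Der m)" "vscale (cDer m) = vscale (Der m)"
 "vnorm (cDer m) = vnorm (Der m)" "vdiff (cDer m) = vdiff (Der m)" by (simp_all add: DerDiv_closure_def)

interpretation Der: seminormed "Der m" by (rule seminormed_Der)

lemma DerDiv_DC: "b : DD m ==> b : carr (cDer m)"
 using Der.subset_vclosure[of "DD m"] Der.subspaceD(1)[OF vsubspace_DerDiv] by (auto simp: DC_carrier)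

lemma seminormed_DC: "seminormed (cDer m)" unfolding DerDiv_closure_def
 by (rule Der.seminormed_subspace[OF Der.vsubspace_vclosure[OF vsubspace_DerDiv]])

interpretation D: seminormed "DerDiv m" by (rule seminormed_DerDiv)
interpretation DC: seminormed "cDer m" by (rule seminormed_DC)
interpretation C: seminormed "C0 :: ('a => real) nvs" by (rule seminormed_C0)
interpretation TP: tensor_pair "cDer m" "C0 :: ('a => real) nvs" by unfold_locales
interpretation PT: seminormed "proj_tensor_alg (cDer m) (C0 :: ('a => real) nvs)" by (rule TP.seminormed_proj_tensor_alg)

abbreviation PC where "PC \<equiv> proj_tensor (cDer m) (C0 :: ('a => real) nvs)"

interpretation PC: seminormed "proj_tensor (cDer m) (C0 :: ('a => real) nvs)"
 unfolding proj_tensor_def by (rule PT.seminormed_vcompletion)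

lemma vcomplete_PC: "vcomplete PC" and seminormed_PC: "seminormed PC"
 unfolding proj_tensor_def by (rule PT.vcomplete_vcompletion, rule PT.seminormed_vcompletion)

definition tens :: "(('a => real) => ('a => real) set) => ('a => real) =>
  (nat => ((('a => real) => ('a => real) set) \<times> ('a => real) => real) set) set" where
 "tens b h = vembed (proj_tensor_alg (cDer m) C0) (tensor (cDer m) C0 b h)"

lemma tens_bilinear:
 assumes b: "b : carr (cDer m)" and h: "h : carr C0"
 shows "tens b h : carr PC" "vnorm PC (tens b h) <= vnorm (Der m) b * sup_norm h"
  "b' : carr (cDer m) ==> tens (vadd (Der m) b b') h = vadd PC (tens b h) (tens b' h)"
  "k : carr C0 ==> tens b (%x. h x + k x) = vadd PC (tens b h) (tens b k)"
  "tens (vscale (Der m) c b) h = vscale PC c (tens b h)" "tens b (%x. c * h x) = vscale PC c (tens b h)"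
proof -
 have t: "tensor (cDer m) C0 b h : carr (proj_tensor_alg (cDer m) C0)"
  if "b : carr (cDer m)" "h : carr C0" for b and h :: "'a => real" using that by simp
 note e = PT.vembed_simps[OF t[OF b h], folded proj_tensor_def tens_def]
 show "tens b h : carr PC" unfolding proj_tensor_def tens_def by (rule PT.vembed_closed[OF t[OF b h]])
 show "vnorm PC (tens b h) <= vnorm (Der m) b * sup_norm h" using TP.projective_norm_tensor_le[OF b h] by (simp add: e(3))
 show "tens (vadd (Der m) b b') h = vadd PC (tens b h) (tens b' h)" if b': "b' : carr (cDer m)"
  using e(1)[OF t[OF b' h]] TP.tensor_add_left[OF b b' h] by (simp add: tens_def)
 show "tens b (%x. h x + k x) = vadd PC (tens b h) (tens b k)" if k: "k : carr C0"
  using e(1)[OF t[OF b k]] TP.tensor_add_right[OF b h k] by (simp add: tens_def)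
 show "tens (vscale (Der m) c b) h = vscale PC c (tens b h)" using e(2)[of c] TP.tensor_scale_left[OF b h, of c] by (simp add: tens_def)
 show "tens b (%x. c * h x) = vscale PC c (tens b h)" using e(2)[of c] TP.tensor_scale_right[OF b h, of c] by (simp add: tens_def)
qed

text \<open>Three density steps: from \<open>DD m\<close> to its closure, from elementary tensors to
  sums, and from the algebraic tensor product to its completion.\<close>

lemma PC_functional_eq:
 assumes phi: "vfunc PC phi C" and psi: "vfunc PC psi C'"
  and eq: "!!b h. b : DD m ==> h : carr C0 ==> phi (tens b h) = psi (tens b h)" and y: "y : carr PC"
 shows "phi y = psi y"
proof -
 let ?v = "vembed (proj_tensor_alg (cDer m) (C0 :: ('a => real) nvs))"
 have fb: "vfunc (cDer m) (%b. phi (tens b h)) (abs C * sup_norm h)"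
  if phi: "vfunc PC phi C" and h: "h : carr C0" for phi C and h :: "'a => real" unfolding vfunc_def
 proof (intro conjI ballI allI)
  fix b b' c assume b: "b : carr (cDer m)"
  note tb = tens_bilinear[OF b h]
  show "phi (tens (vscale (cDer m) c b) h) = c * phi (tens b h)" using vfuncD(2)[OF phi tb(1)] by (simp add: tb(5))
  have "abs (phi (tens b h)) <= abs C * vnorm PC (tens b h)"
   by (rule vfuncD(3)[OF vfunc_mono[OF seminormed_PC phi abs_ge_self] tb(1)])
  also have "... <= abs C * (vnorm (Der m) b * sup_norm h)" using tb(2) by (intro mult_left_mono) auto
  finally show "abs (phi (tens b h)) <= abs C * sup_norm h * vnorm (cDer m) b" by (simp add: mult_ac)
  assume b': "b' : carr (cDer m)"
  show "phi (tens (vadd (cDer m) b b') h) = phi (tens b h) + phi (tens b' h)"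
   using vfuncD(1)[OF phi tb(1) tens_bilinear(1)[OF b' h]] by (simp add: tb(3)[OF b'])
 qed
 have eq': "phi (tens b h) = psi (tens b h)" if b: "b : carr (cDer m)" and h: "h : carr C0" for b h
 proof (rule DC.vfunc_eq_closure[OF fb[OF phi h] fb[OF psi h]])
  show "DD m <= carr (cDer m)" using DerDiv_DC by blast
  show "b : vclosure (cDer m) (DD m)" using b by (simp add: vclosure_def DC_carrier)
 qed (rule eq[OF _ h])
 have emb: "vfunc (proj_tensor_alg (cDer m) C0) (%u. phi (?v u)) C" if phi: "vfunc PC phi C" for phi C
  unfolding vfunc_def using vfuncD[OF phi[unfolded proj_tensor_def]] PT.vembed_closed PT.vembed_simps by metis
 show ?thesis
 proof (rule PC.vfunc_eq_closure[OF phi psi])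
  show "?v ` carr (proj_tensor_alg (cDer m) C0) <= carr PC" unfolding proj_tensor_def using PT.vembed_closed by blast
  show "y : vclosure PC (?v ` carr (proj_tensor_alg (cDer m) C0))" using PT.vembed_dense y unfolding proj_tensor_def by blast
  fix z assume "z : ?v ` carr (proj_tensor_alg (cDer m) C0)"
  then obtain u where u: "u : carr (alg_tensor (cDer m) C0)" "z = ?v u" by auto
  obtain ps where ps: "set ps <= carr (cDer m) \<times> carr C0" "tensor_sum (cDer m) C0 ps = u"
   by (rule TP.tensor_sum_surj[OF u(1)])
  have "map (%(b, h). phi (tens b h)) ps = map (%(b, h). psi (tens b h)) ps" using ps(1) eq' by (intro map_cong refl) auto
  thus "phi z = psi z" unfolding u(2) ps(2)[symmetric]
   using TP.functional_tensor_sum[OF emb[OF phi] ps(1)] TP.functional_tensor_sum[OF emb[OF psi] ps(1)]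
   unfolding tens_def[symmetric] by metis
 qed
qed

text \<open>Integration of \<open>h\<close> against \<open>L b\<close> is defined for
  \<open>b\<close> with divergence; it is extended by limits in \<open>b\<close>, then by the
  universal property of the tensor product, then to the completion.\<close>

lemma bv_PC_functional:
 assumes L: "bv f L C"
 obtains phi where "vfunc PC phi C"
  "!!b h. b : DD m ==> h : carr C0 ==> phi (tens b h) = sint (L b) h"
proof -
 have bd: "h : bdd_borel" if "h : carr C0" for h :: "'a => real" using that continuous_bdd_borel by (simp add: C0_carrier)
 \<comment> \<open>The approximating sequence of \<open>b\<close> is fixed before \<open>h\<close>,
   so that linearity in \<open>h\<close> survives the limit.\<close>
 have "ALL b:carr (cDer m). EX t. (ALL n. t n : DD m) & (%n. vdist (Der m) (t n) b) ----> 0"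
  unfolding DC_carrier using Der.vclosure_seq[OF _ Der.subspaceD(1)[OF vsubspace_DerDiv]] by metis
 from bchoice[OF this] obtain t where t: "!!b n. b : carr (cDer m) ==> t b n : DD m"
  "!!b. b : carr (cDer m) ==> (%n. vdist (Der m) (t b n) b) ----> 0" by blast
 define beta where "beta b h = lim (%n. sint (L (t b n)) h)" for b h
 have fb: "vfunc ((Der m)\<lparr>vcarrier := DD m\<rparr>) (%b. sint (L b) h) (C * sup_norm h)"
  if h: "h : carr C0" for h unfolding vfunc_def DerDiv_eq[symmetric] DerDiv_simps
 proof (intro conjI ballI allI)
  fix b b' c assume b: "b : DD m"
  note mu = bvD(4)[OF L b]
  show "sint (L (vscale (Der m) c b)) h = c * sint (L b) h" using Meas_scale(3)[OF mu bd[OF h]] bvD(6)[OF L b] by simp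
  have "abs (sint (L b) h) <= sup_norm h * vnorm Meas (L b)"
   using bd[OF h] by (intro signed_integral_bound[OF mu] sup_norm_ge) (auto simp: bdd_borel_def)
  also have "... <= sup_norm h * (C * vnorm (Der m) b)" using bvD(7)[OF L b] C.norm_nonneg[OF h] by (intro mult_left_mono) simp_all
  finally show "abs (sint (L b) h) <= C * sup_norm h * vnorm (Der m) b" by (simp add: mult_ac)
  assume b': "b' : DD m"
  show "sint (L (vadd (Der m) b b')) h = sint (L b) h + sint (L b') h"
   using Meas_add(3)[OF mu bvD(4)[OF L b'] bd[OF h]] bvD(5)[OF L b b'] by simp
 qed
 have beta: "vfunc (cDer m) (%b. beta b h) (C * sup_norm h)"
  "b : DD m ==> beta b h = sint (L b) h"
  "b : carr (cDer m) ==> (%n. sint (L (t b n)) h) ----> beta b h" if h: "h : carr C0" for h b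
 proof -
  have C: "0 <= C * sup_norm h" using bvD(2)[OF L] C.norm_nonneg[OF h] by simp
  note ext = Der.vfunc_closure[OF vsubspace_DerDiv, of t, folded DC_carrier, OF t fb[OF h] C, folded beta_def]
  show "vfunc (cDer m) (%b. beta b h) (C * sup_norm h)" using ext(1) by (simp add: DerDiv_closure_def)
  show "b : DD m ==> beta b h = sint (L b) h" by (rule ext(2))
  show "b : carr (cDer m) ==> (%n. sint (L (t b n)) h) ----> beta b h" by (rule ext(3))
 qed
 note B = vfuncD[OF beta(1)]
 obtain phi0 where phi0: "vfunc (proj_tensor_alg (cDer m) C0) phi0 C"
  "!!b h. b : carr (cDer m) ==> h : carr C0 ==> phi0 (tensor (cDer m) C0 b h) = beta b h"
 proof (rule TP.tensor_functional[of beta C])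
  fix b b' and h k :: "'a => real" and c
  assume b: "b : carr (cDer m)" and h: "h : carr C0"
  have F: "bdd_functional (sint (L (t b n)))" for n by (rule bdd_functional_signed[OF bvD(4)[OF L t(1)[OF b]]])
  show "beta (vscale (cDer m) c b) h = c * beta b h" by (rule B(2)[OF h b])
  show "abs (beta b h) <= C * (vnorm (cDer m) b * vnorm C0 h)" using B(3)[OF h b] by (simp add: mult_ac)
  show "beta (vadd (cDer m) b b') h = beta b h + beta b' h" if "b' : carr (cDer m)" by (rule B(1)[OF h b that])
  have "(%n. sint (L (t b n)) (vscale C0 c h)) ----> c * beta b h"
   using tendsto_mult_left[OF beta(3)[OF h b], of c] F bd[OF h] by (simp add: bdd_functional_def)
  thus "beta b (vscale C0 c h) = c * beta b h" by (rule LIMSEQ_unique[OF beta(3)[OF C.scale_closed[OF h] b]])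
  assume k: "k : carr C0"
  have "(%n. sint (L (t b n)) (vadd C0 h k)) ----> beta b h + beta b k"
   using tendsto_add[OF beta(3)[OF h b] beta(3)[OF k b]] F bd[OF h] bd[OF k] by (simp add: bdd_functional_def)
  thus "beta b (vadd C0 h k) = beta b h + beta b k" by (rule LIMSEQ_unique[OF beta(3)[OF C.add_closed[OF h k] b]])
 qed (use bvD(2)[OF L] in auto)
 obtain phi where phi: "vfunc PC phi C" "!!u. u : carr (alg_tensor (cDer m) C0) ==>
   phi (vembed (proj_tensor_alg (cDer m) C0) u) = phi0 u"
  using PT.vcompletion_functional[OF phi0(1) bvD(2)[OF L]] unfolding proj_tensor_def by auto
 show thesis using phi(2)[OF TP.tensor_closed] phi0(2) beta(2) DerDiv_DC by (intro that[OF phi(1)]) (simp add: tens_def)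
qed

end

section \<open>The divergence relations and their pairing with BV functions\<close>

context borel_space
begin

lemma Linf_Lp:
 assumes u: "u : Linf_funs m" and q: "1 <= q" shows "u : Lp_funs m q"
proof -
 have um: "u : borel_measurable m" using u by (simp add: Linf_funs_def)
 have "AE x in m. norm (abs (u x) powr q) <= Linf_norm m u powr q"
  using Linf_norm_AE[OF u] by eventually_elim (use q in \<open>simp add: powr_mono2\<close>)
 thus ?thesis using um by (auto simp: Lp_funs_def intro!: integrable_const_bound)
qed

lemma der_mult_scale:
 assumes b: "b : DD m" and h: "h : LIPb" shows "der_mult m h (vscale (Der m) c b) = vscale (Der m) c (der_mult m h b)"
proof -
 obtain beta where beta: "der_rep beta (vnorm (Der m) b)" "b = der_of beta" by (rule DerDivE[OF b])
 obtain B where B: "abs (h x) <= B" for x using LIPb_bounded[OF h] by blast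
 note hm = LIPb_measurable[OF h]
 note cb = der_rep_ops(2)[OF beta(1,1), of c] and hb = der_rep_ops(3)[OF beta(1,1) hm B]
 show ?thesis
  unfolding beta(2) der_of_ops(2)[OF beta(1,1)] der_of_ops(3)[OF cb cb hm] der_of_ops(3)[OF beta(1,1) hm] der_of_ops(2)[OF hb hb]
  by (simp add: mult.left_commute)
qed

abbreviation div_sum where
 "div_sum bhs \<equiv> vlist_sum (Der m) (map (%(b, h). der_mult m h b) bhs)"

abbreviation tsum where
 "tsum bhs \<equiv> vembed (proj_tensor_alg (cDer m) (C0 :: ('a => real) nvs)) (tensor_sum (cDer m) C0 bhs)"

interpretation D: seminormed "DerDiv m" by (rule seminormed_DerDiv)
interpretation DC: seminormed "cDer m" by (rule seminormed_DC)
interpretation C: seminormed "C0 :: ('a => real) nvs" by (rule seminormed_C0)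
interpretation TP: tensor_pair "cDer m" "C0 :: ('a => real) nvs" by unfold_locales
interpretation PT: seminormed "proj_tensor_alg (cDer m) (C0 :: ('a => real) nvs)" by (rule TP.seminormed_proj_tensor_alg)
interpretation M: seminormed "Meas :: ('a set => real) nvs" by (rule seminormed_Meas)

lemma vlist_sum_DerDiv: "vlist_sum (Der m) = vlist_sum (DerDiv m)" by (simp add: vlist_sum_def fun_eq_iff)

lemma V_list_closed:
 assumes "set bhs <= DD m \<times> LIPb"
 shows "set (map (%(b, h). der_mult m h b) bhs) <= DD m" "div_sum bhs : DD m"
  "set bhs <= carr (cDer m) \<times> carr C0"
proof -
 show s: "set (map (%(b, h). der_mult m h b) bhs) <= DD m" using assms der_mult_DerDiv by auto
 show "div_sum bhs : DD m" unfolding vlist_sum_DerDiv by (rule D.vlist_sum_closed[OF s])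
 show "set bhs <= carr (cDer m) \<times> carr C0" using assms DerDiv_DC LIPb_continuous by (auto simp: C0_carrier)
qed

text \<open>The divergence, a set by definition, is replaced by the class of a representative
  \<open>d\<close>, which is the form needed in \<open>Lp\<close>.\<close>

lemma V_set_iff:
 "w : V_set m \<longleftrightarrow> (EX bhs d. set bhs <= DD m \<times> LIPb & d : divergence m (div_sum bhs) &
   w = (ae_class m d, tsum bhs))"
proof -
 have Der: "b : carr (Der m)" if "b : DD m" for b using that by (simp add: DerDiv_def)
 have "(EX d:divergence m b. g = ae_class m d) \<longleftrightarrow> g : carr (Linf m) & g = divergence m b"
  if b: "b : DD m" for b g
 proof
  assume "EX d:divergence m b. g = ae_class m d"
  then obtain d where d: "d : divergence m b" "g = ae_class m d" ..
  have "d : Linf_funs m" using d(1) by (simp add: divergence_def)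
  from imageI[OF this, of "ae_class m"] show "g : carr (Linf m) & g = divergence m b"
   unfolding Linf_simps(1) d(2) divergence_ae_class[OF Der[OF b] d(1)] by (rule conjI[OF _ refl])
 next
  assume g: "g : carr (Linf m) & g = divergence m b"
  obtain d where d: "d : divergence m b" using b by (auto simp: DerDiv_def)
  show "EX d:divergence m b. g = ae_class m d" by (rule bexI[OF _ d]) (rule trans[OF g[THEN conjunct2] divergence_ae_class[OF Der[OF b] d]])
 qed
 note eq = this[OF V_list_closed(2)]
 show ?thesis
 proof
  assume "w : V_set m"
  then obtain g bhs where w: "w = (g, tsum bhs)" "g : carr (Linf m)" "g = divergence m (div_sum bhs)"
   and b: "set bhs <= DD m \<times> LIPb" unfolding V_set_def mem_Collect_eq by (elim exE conjE)
  from iffD2[OF eq[OF b] conjI[OF w(2,3)]] obtain d where "d : divergence m (div_sum bhs)" "g = ae_class m d" by (elim bexE)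
  thus "EX bhs d. set bhs <= DD m \<times> LIPb & d : divergence m (div_sum bhs) & w = (ae_class m d, tsum bhs)"
   using b w(1) by (intro exI conjI) simp_all
 next
  assume "EX bhs d. set bhs <= DD m \<times> LIPb & d : divergence m (div_sum bhs) & w = (ae_class m d, tsum bhs)"
  then obtain bhs d where b: "set bhs <= DD m \<times> LIPb" and d: "d : divergence m (div_sum bhs)"
   and w: "w = (ae_class m d, tsum bhs)" by (elim exE conjE)
  note c = iffD1[OF eq[OF b] bexI[OF refl d]]
  show "w : V_set m" unfolding V_set_def mem_Collect_eq w
   by (rule exI[of _ "ae_class m d"], rule exI[of _ bhs], intro conjI refl b c[THEN conjunct1] c[THEN conjunct2])
 qed
qed

lemma seminormed_W: "1 <= q ==> seminormed (W_space m q)" and vcomplete_W: "1 < q ==> vcomplete (W_space m q)"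
proof -
 have L: "seminormed (Lp m q)" if "1 <= q" for q by (rule normed_imp_seminormed[OF normed_Lp[OF that]])
 show "1 <= q ==> seminormed (W_space m q)" unfolding W_space_def by (rule seminormed_vprod_max[OF L seminormed_PC])
 show "1 < q ==> vcomplete (W_space m q)"
  unfolding W_space_def by (rule vcomplete_vprod_max[OF L seminormed_PC vcomplete_Lp vcomplete_PC]) simp_all
qed

text \<open>Sums correspond to concatenated lists, and scalars are absorbed into the derivations of
  the list.\<close>

lemma vsubspace_V_set:
 assumes q: "1 <= q" shows "vsubspace (W_space m q) (V_set m)"
proof -
 interpret W: seminormed "W_space m q" by (rule seminormed_W[OF q])
 note ws = vprod_max_simps[of "Lp m q" PC, folded W_space_def]
 have sub: "V_set m <= carr (W_space m q)"
 proof
  fix w assume "w : V_set m"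
  then obtain bhs d where b: "set bhs <= DD m \<times> LIPb" "d : divergence m (div_sum bhs)"
   "w = (ae_class m d, tsum bhs)" unfolding V_set_iff by (elim exE conjE)
  have "d : Lp_funs m q" using b(2) by (intro Linf_Lp[OF _ q]) (simp add: divergence_def)
  moreover have "tsum bhs : carr PC"
   unfolding proj_tensor_def using TP.tensor_sum_closed[OF V_list_closed(3)[OF b(1)]] by (intro PT.vembed_closed) simp
  ultimately show "w : carr (W_space m q)" unfolding b(3) ws(1) Lp_simps(1)[OF q] by (intro SigmaI imageI)
 qed
 have scale: "vscale (W_space m q) c w : V_set m" if w: "w : V_set m" for c w
 proof -
  obtain bhs d where b: "set bhs <= DD m \<times> LIPb" "d : divergence m (div_sum bhs)"
   and w: "w = (ae_class m d, tsum bhs)" using w unfolding V_set_iff by (elim exE conjE)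
  let ?cs = "map (%(b, h). (vscale (Der m) c b, h)) bhs"
  have dL: "d : Lp_funs m q" using b(2) by (intro Linf_Lp[OF _ q]) (simp add: divergence_def)
  have cs: "set ?cs <= DD m \<times> LIPb" using b(1) D.scale_closed by auto
  have "map (%(b, h). der_mult m h b) ?cs = map (vscale (Der m) c) (map (%(b, h). der_mult m h b) bhs)" using b(1) der_mult_scale by auto
  hence "div_sum ?cs = vscale (Der m) c (div_sum bhs)"
   by (simp only: vlist_sum_DerDiv D.vscale_vlist_sum[OF V_list_closed(1)[OF b(1)], unfolded DerDiv_simps])
  hence d: "(%x. c * d x) : divergence m (div_sum ?cs)"
   using divergence_ops(4)[OF V_list_closed(2)[OF b(1)] b(2) V_list_closed(2)[OF b(1)] b(2)] by simp
  have t: "tensor_sum (cDer m) C0 ?cs = vscale (alg_tensor (cDer m) C0) c (tensor_sum (cDer m) C0 bhs)"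
   using TP.tensor_sum_scale[OF V_list_closed(3)[OF b(1)], of c] by simp
  show ?thesis unfolding V_set_iff
  proof (rule exI[of _ ?cs], rule exI[of _ "%x. c * d x"], intro conjI cs d)
   show "vscale (W_space m q) c w = (ae_class m (%x. c * d x), tsum ?cs)" unfolding w ws(4) Lp_simps(4)[OF q dL] t
    using PT.vembed_simps(2)[of "tensor_sum (cDer m) C0 bhs" c] TP.tensor_sum_closed[OF V_list_closed(3)[OF b(1)]]
    by (simp only: TP.PT_simps proj_tensor_def)
  qed
 qed
 have add: "vadd (W_space m q) w w' : V_set m" if w: "w : V_set m" and w': "w' : V_set m" for w w'
 proof -
  obtain bhs d where b: "set bhs <= DD m \<times> LIPb" "d : divergence m (div_sum bhs)"
   and w: "w = (ae_class m d, tsum bhs)" using w unfolding V_set_iff by (elim exE conjE)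
  obtain bhs' d' where b': "set bhs' <= DD m \<times> LIPb" "d' : divergence m (div_sum bhs')"
   and w': "w' = (ae_class m d', tsum bhs')" using w' unfolding V_set_iff by (elim exE conjE)
  have dL: "d : Lp_funs m q" "d' : Lp_funs m q" using b(2) b'(2) by (auto intro!: Linf_Lp[OF _ q] simp: divergence_def)
  have cs: "set (bhs @ bhs') <= DD m \<times> LIPb" using b(1) b'(1) by simp
  have "div_sum (bhs @ bhs') = vadd (Der m) (div_sum bhs) (div_sum bhs')"
   using D.vlist_sum_append[OF V_list_closed(1)[OF b(1)] V_list_closed(1)[OF b'(1)]] by (simp add: vlist_sum_DerDiv)
  hence d: "(%x. d x + d' x) : divergence m (div_sum (bhs @ bhs'))"
   using divergence_ops(2)[OF V_list_closed(2)[OF b(1)] b(2) V_list_closed(2)[OF b'(1)] b'(2)] by simp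
  note t = TP.tensor_sum_append[OF V_list_closed(3)[OF b(1)] V_list_closed(3)[OF b'(1)]]
  show ?thesis unfolding V_set_iff
  proof (rule exI[of _ "bhs @ bhs'"], rule exI[of _ "%x. d x + d' x"], intro conjI cs d)
   show "vadd (W_space m q) w w' = (ae_class m (%x. d x + d' x), tsum (bhs @ bhs'))" unfolding w w' ws(3) Lp_simps(3)[OF q dL] t
    using PT.vembed_simps(1)[of "tensor_sum (cDer m) C0 bhs" "tensor_sum (cDer m) C0 bhs'"]
     TP.tensor_sum_closed[OF V_list_closed(3)[OF b(1)]] TP.tensor_sum_closed[OF V_list_closed(3)[OF b'(1)]]
    by (simp only: TP.PT_simps proj_tensor_def)
  qed
 qed
 have "EX w. w : V_set m" unfolding V_set_iff using zero_DerDiv(2) by (intro exI[of _ "[]"] exI conjI) (auto simp: vlist_sum_def)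
 then obtain w where w: "w : V_set m" ..
 have "vzero (W_space m q) = vscale (W_space m q) 0 w" using sub w by (intro W.scale_zero_left[symmetric]) blast
 hence "vzero (W_space m q) : V_set m" using scale[OF w] by simp
 thus ?thesis unfolding vsubspace_def using sub scale add by blast
qed

text \<open>A functional on \<open>W_space m q\<close> is determined by its values on these two
  kinds of elements, as \<open>pairing_unique\<close> shows.\<close>

definition pairing where
 "pairing q f L Phi \<longleftrightarrow> (ALL g:Lp_funs m q. Phi (ae_class m g, vzero PC) = (LINT x|m. f x * g x)) &
   (ALL b:DD m. ALL h:carr C0. Phi (vzero (Lp m q), tens b h) = sint (L b) h)"

lemma pairingD:
 assumes "pairing q f L Phi" shows "g : Lp_funs m q ==> Phi (ae_class m g, vzero PC) = (LINT x|m. f x * g x)"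
  "b : DD m ==> h : carr C0 ==> Phi (vzero (Lp m q), tens b h) = sint (L b) h"
 using assms unfolding pairing_def by blast+

lemma pairing_unique:
 assumes q: "1 <= q" and Phi: "vfunc (W_space m q) Phi C" and Psi: "vfunc (W_space m q) Psi D"
  and p1: "pairing q f L Phi" and p2: "pairing q f L Psi" and w: "w : carr (W_space m q)" shows "Phi w = Psi w"
proof -
 note Ls = normed_imp_seminormed[OF normed_Lp[OF q, of m]]
 note c1 = vfunc_components[OF Ls seminormed_PC Phi[unfolded W_space_def]]
  and c2 = vfunc_components[OF Ls seminormed_PC Psi[unfolded W_space_def]]
 obtain x y where xy: "w = (x, y)" "x : carr (Lp m q)" "y : carr PC" using w unfolding W_space_def vprod_max_simps(1) by blast
 obtain g where g: "g : Lp_funs m q" "x = ae_class m g" using xy(2) unfolding Lp_simps(1)[OF q] by (elim imageE)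
 have "Phi (x, vzero PC) = Psi (x, vzero PC)" unfolding g(2) pairingD(1)[OF p1 g(1)] pairingD(1)[OF p2 g(1)] ..
 moreover have "Phi (vzero (Lp m q), y) = Psi (vzero (Lp m q), y)"
  by (rule PC_functional_eq[OF c1(2) c2(2) _ xy(3)]) (use p1 p2 in \<open>simp add: pairing_def\<close>)
 ultimately show ?thesis unfolding xy(1) c1(3)[OF xy(2,3)] c2(3)[OF xy(2,3)] by simp
qed

text \<open>The integrals of \<open>h\<close> against \<open>L b\<close> add up to the total mass of
  \<open>L\<close> at the sum of the products \<open>hb\<close>. This is minus the integral of
  \<open>f\<close> times the divergence and cancels the first component.\<close>

lemma pairing_V_set:
 assumes q: "1 <= q" and Phi: "vfunc (W_space m q) Phi C" and pr: "pairing q f L Phi" and L: "bv f L C'" and w: "w : V_set m"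
 shows "Phi w = 0"
proof -
 note Ls = normed_imp_seminormed[OF normed_Lp[OF q, of m]]
 note c = vfunc_components[OF Ls seminormed_PC Phi[unfolded W_space_def]]
 obtain bhs d where b: "set bhs <= DD m \<times> LIPb" "d : divergence m (div_sum bhs)"
  and weq: "w = (ae_class m d, tsum bhs)" using w unfolding V_set_iff by (elim exE conjE)
 note vl = V_list_closed[OF b(1)]
 have dL: "d : Lp_funs m q" using b(2) by (intro Linf_Lp[OF _ q]) (simp add: divergence_def)
 have emb: "vfunc (proj_tensor_alg (cDer m) C0) (%u. Phi (vzero (Lp m q), vembed (proj_tensor_alg (cDer m) C0) u)) C"
  unfolding vfunc_def using vfuncD[OF c(2)[unfolded proj_tensor_def]] PT.vembed_closed PT.vembed_simps by metis
 have t: "tsum bhs : carr PC" unfolding proj_tensor_def using TP.tensor_sum_closed[OF vl(3)] by (intro PT.vembed_closed) simp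
 have "Phi (vzero (Lp m q), tsum bhs) = (\<Sum>(b, h)\<leftarrow>bhs. Phi (vzero (Lp m q), tens b h))"
  unfolding tens_def by (rule TP.functional_tensor_sum[OF emb vl(3)])
 also have "map (%(b, h). Phi (vzero (Lp m q), tens b h)) bhs
   = map (%b. sint (L b) (%x. 1)) (map (%(b, h). der_mult m h b) bhs)" unfolding map_map
 proof (intro map_cong refl, clarsimp)
  fix b h assume "(b, h) : set bhs"
  hence bh: "b : DD m" "h : LIPb" "h : carr C0" using b(1) vl(3) by auto
  obtain e where e: "e : divergence m (der_mult m h b)" using der_mult_DerDiv[OF bh(1,2)] by (auto simp: DerDiv_def)
  have "Phi (vzero (Lp m q), tens b h) = sint (L b) h" using pr bh by (simp add: pairing_def)
  thus "Phi (vzero (Lp m q), tens b h) = sint (L (der_mult m h b)) (%x. 1)"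
   using bvD(8)[OF L bh(1,2) e] bv_one[OF L der_mult_DerDiv[OF bh(1,2)] e] by simp
 qed
 also have "sum_list ... = sint (L (div_sum bhs)) (%x. 1)" unfolding vlist_sum_DerDiv
 proof (rule D.vlist_sum_additive[OF _ _ vl(1), symmetric])
  have ops: "sint (L (vadd (Der m) b b')) (%x. 1) = sint (L b) (%x. 1) + sint (L b') (%x. 1)"
   "sint (L (vscale (Der m) 0 b)) (%x. 1) = 0" if "b : DD m" "b' : DD m" for b b'
   using bvD(5)[OF L that] bvD(6)[OF L that(1), of 0]
    Meas_add(3)[OF bvD(4)[OF L that(1)] bvD(4)[OF L that(2)] bdd_borel_const[of 1]]
    Meas_scale(3)[OF bvD(4)[OF L that(1)] bdd_borel_const[of 1]] by simp_all
  show "sint (L (vzero (DerDiv m))) (%x. 1) = 0"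
   using ops(2)[OF D.zero_closed D.zero_closed] D.scale_zero_left[OF D.zero_closed] by simp
 qed (simp add: bvD(5)[OF L] Meas_add(3)[OF bvD(4)[OF L] bvD(4)[OF L] bdd_borel_const[of 1]])
 also have "... = - (LINT x|m. f x * d x)" by (rule bv_one[OF L vl(2) b(2)])
 finally have 2: "Phi (vzero (Lp m q), tsum bhs) = - (LINT x|m. f x * d x)" .
 have "Phi (ae_class m d, vzero PC) = (LINT x|m. f x * d x)" using pr dL unfolding pairing_def by blast
 thus ?thesis unfolding weq using 2 c(3)[OF _ t, of "ae_class m d"] imageI[OF dL, of "ae_class m"] unfolding Lp_simps(1)[OF q] by simp
qed

end

section \<open>The isomorphism between BV and the dual of the quotient\<close>

context bounded_PI
begin

abbreviation V_closure where "V_closure \<equiv> vclosure (W_space m s) (V_set m)"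

abbreviation predual where "predual \<equiv> vquotient (W_space m s) V_closure"

abbreviation "lift Psi \<equiv> %w. Psi (vcoset (W_space m s) V_closure w)"

lemma s1: "1 <= s" using s by simp

interpretation W: seminormed "W_space m s" by (rule seminormed_W[OF s1])
interpretation Ls: seminormed "Lp m s" by (rule normed_imp_seminormed[OF normed_Lp[OF s1]])
interpretation PC: seminormed "proj_tensor (cDer m) (C0 :: ('a => real) nvs)" by (rule seminormed_PC)

lemma W_carrier: "carr (W_space m s) = carr (Lp m s) \<times> carr PC" by (simp add: W_space_def vprod_max_simps(1))

lemma V_closure: "vsubspace (W_space m s) V_closure" by (rule W.vsubspace_vclosure[OF vsubspace_V_set[OF s1]])

lemma seminormed_predual: "seminormed predual" by (rule W.seminormed_vquotient[OF V_closure])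

lemma banach_predual: "banach_space_on predual"
proof (rule banach_space_onI)
 show "normed_space_on predual" by (rule W.normed_vquotient[OF V_closure W.vclosure_idem[OF W.subspaceD(1)[OF vsubspace_V_set[OF s1]]]])
 show "vcomplete predual" by (rule W.vcomplete_vquotient[OF V_closure vcomplete_W[OF s]])
qed

lemma lift_functional:
 assumes Psi: "vfunc predual Psi C" and C: "0 <= C" shows "vfunc (W_space m s) (lift Psi) C" unfolding vfunc_def
proof (intro conjI ballI allI)
 note q = W.vquotient_simps[OF V_closure] and D = vfuncD[OF Psi]
 fix x y c assume x: "x : carr (W_space m s)"
 have X: "vcoset (W_space m s) V_closure x : carr predual" using x by (simp add: q(1))
 show "lift Psi (vscale (W_space m s) c x) = c * lift Psi x" using D(2)[OF X, of c] q(4)[OF x, of c] by simp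
 have "abs (lift Psi x) <= C * vnorm predual (vcoset (W_space m s) V_closure x)" by (rule D(3)[OF X])
 also have "... <= C * vnorm (W_space m s) x"
  by (intro mult_left_mono W.vquotient_norm_le[OF V_closure x W.self_mem_vcoset[OF V_closure x]] C)
 finally show "abs (lift Psi x) <= C * vnorm (W_space m s) x" .
 assume y: "y : carr (W_space m s)"
 have Y: "vcoset (W_space m s) V_closure y : carr predual" using y by (simp add: q(1))
 show "lift Psi (vadd (W_space m s) x y) = lift Psi x + lift Psi y" using D(1)[OF X Y] q(3)[OF x y] by simp
qed

text \<open>The sum of the Hoelder functional of \<open>f\<close> and the tensor functional of
  \<open>L\<close> vanishes on \<open>V_set m\<close>, by continuity also on its closure, and so
  descends to the quotient with the same bound.\<close>

lemma functional_of_bv: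
 assumes L: "bv f L C" and f: "f : Lp_funs m p"
 obtains Psi where "Psi : carr (vdual predual)" "vnorm (vdual predual) Psi <= Lp_norm m p f + C"
  "pairing s f L (lift Psi)"
proof -
 have int: "integrable m (%x. f x * g x)" if "g : Lp_funs m s" for g by (rule holder(1)[OF p(1) s p(2) f that])
 have fn: "vfunc (Lp_pre m s) (%g. LINT x|m. f x * g x) (Lp_norm m p f)"
  using int holder(2)[OF p(1) s p(2) f] by (simp add: vfunc_def distrib_left mult.left_commute)
 have 0: "(LINT x|m. f x * g x) = 0" if "g : null_funs m" for g using that by (intro integral_eq_zero_AE) (auto simp: null_funs_iff)
 obtain phi where "vfunc (vquotient (Lp_pre m s) (null_funs m)) phi (Lp_norm m p f)"
  "!!g. g : carr (Lp_pre m s) ==> phi (vcoset (Lp_pre m s) (null_funs m) g) = (LINT x|m. f x * g x)"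
  by (rule seminormed.quotient_functional[OF seminormed_Lp_pre[OF s1] vsubspace_null_funs_Lp(1)[OF s1] fn Lp_norm_nonneg 0]) (assumption, rule that)
 note phi = this(1)[folded Lp_eq] this(2)[unfolded vcoset_Lp Lp_pre_simps(1)]
 obtain psi where psi: "vfunc PC psi C"
  "!!b h. b : DD m ==> h : carr C0 ==> psi (tens b h) = sint (L b) h"
  by (rule bv_PC_functional[OF L]) (rule that)
 define Phi where "Phi = (%(x, y). phi x + psi y)"
 have N: "0 <= Lp_norm m p f + C" using Lp_norm_nonneg[of m p f] bvD(2)[OF L] by simp
 have Phi: "vfunc (W_space m s) Phi (Lp_norm m p f + C)" unfolding W_space_def Phi_def
  by (rule vfunc_prod[OF Ls.seminormed_axioms seminormed_PC phi(1) psi(1) Lp_norm_nonneg bvD(2)[OF L]])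
 have pr: "pairing s f L Phi" unfolding pairing_def Phi_def
  using Ls.vfunc_simps(1)[OF phi(1)] PC.vfunc_simps(1)[OF psi(1)] phi(2) psi(2) by simp
 have 0: "Phi w = 0" if w: "w : V_closure" for w
 proof (rule W.vfunc_eq_closure[OF Phi _ W.subspaceD(1)[OF vsubspace_V_set[OF s1]] _ w])
  show "vfunc (W_space m s) (%w. 0) 0" by (simp add: vfunc_def)
 qed (rule pairing_V_set[OF s1 Phi pr L])
 obtain Psi where Psi: "vfunc predual Psi (Lp_norm m p f + C)"
  "!!w. w : carr (W_space m s) ==> Psi (vcoset (W_space m s) V_closure w) = Phi w"
  by (rule W.quotient_functional[OF V_closure Phi N 0]) (assumption, rule that)
 let ?Psi = "restrict Psi (carr predual)"
 note r = vfunc_restrict[OF seminormed_predual Psi(1)]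
 have lift: "lift ?Psi w = Phi w" if "w : carr (W_space m s)" for w using that by (simp add: Psi(2) W.vquotient_simps(1)[OF V_closure])
 show thesis
 proof (rule that[of ?Psi])
  show "?Psi : carr (vdual predual)" unfolding vdual_carrier_iff[OF seminormed_predual] using r by auto
  show "vnorm (vdual predual) ?Psi <= Lp_norm m p f + C" by (rule vdual_norm_le[OF r N])
  have c1: "(ae_class m g, vzero PC) : carr (W_space m s)" if "g : Lp_funs m s" for g
   unfolding W_carrier Lp_simps(1)[OF s1] using that by (intro SigmaI imageI PC.zero_closed)
  have c2: "(vzero (Lp m s), tens b h) : carr (W_space m s)" if "b : DD m" "h : carr C0" for b h
   unfolding W_carrier using tens_bilinear(1)[OF DerDiv_DC[OF that(1)] that(2)] by (intro SigmaI Ls.zero_closed)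
  show "pairing s f L (lift ?Psi)" unfolding pairing_def
  proof (intro conjI ballI)
   show "lift ?Psi (ae_class m g, vzero PC) = (LINT x|m. f x * g x)" if "g : Lp_funs m s" for g
    by (rule trans[OF lift[OF c1] pairingD(1)[OF pr]]) (rule that)+
   show "lift ?Psi (vzero (Lp m s), tens b h) = sint (L b) h" if "b : DD m" "h : carr C0" for b h
    by (rule trans[OF lift[OF c2] pairingD(2)[OF pr]]) (rule that)+
  qed
 qed
qed

text \<open>The Riesz measures are chosen for each \<open>b\<close> separately; linearity of
  \<open>L\<close> is recovered because a measure is determined by its Lipschitz integrals. The
  factor 3 comes from \<open>riesz_representation\<close>.\<close>

lemma bv_of_functional:
 assumes Psi: "Psi : carr (vdual predual)"
 obtains f L where "bv f L (3 * vnorm (vdual predual) Psi)" "Lp_norm m p f <= vnorm (vdual predual) Psi" "f : Lp_funs m p"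
  "pairing s f L (lift Psi)"
proof -
 let ?N = "vnorm (vdual predual) Psi" and ?Phi = "lift Psi"
 note dn = vdual_norm[OF seminormed_predual Psi]
 note Phi = lift_functional[OF dn]
 note c = vfunc_components[OF Ls.seminormed_axioms seminormed_PC Phi[unfolded W_space_def], folded W_space_def]
 have "vfunc (Lp_pre m s) (%g. ?Phi (ae_class m g, vzero PC)) ?N" unfolding vfunc_def Lp_pre_simps
 proof (intro conjI ballI allI)
  fix g k r assume g: "g : Lp_funs m s"
  note gc = imageI[OF g, of "ae_class m", folded Lp_simps(1)[OF s1]]
  show "?Phi (ae_class m (%x. r * g x), vzero PC) = r * ?Phi (ae_class m g, vzero PC)"
   unfolding Lp_simps(4)[OF s1 g, symmetric] by (rule vfuncD(2)[OF c(1) gc])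
  show "abs (?Phi (ae_class m g, vzero PC)) <= ?N * Lp_norm m s g"
   unfolding Lp_simps(5)[OF s1 g, symmetric] by (rule vfuncD(3)[OF c(1) gc])
  assume k: "k : Lp_funs m s"
  note kc = imageI[OF k, of "ae_class m", folded Lp_simps(1)[OF s1]]
  show "?Phi (ae_class m (%x. g x + k x), vzero PC) = ?Phi (ae_class m g, vzero PC) + ?Phi (ae_class m k, vzero PC)"
   unfolding Lp_simps(3)[OF s1 g k, symmetric] by (rule vfuncD(1)[OF c(1) gc kc])
 qed
 then obtain f where f: "f : Lp_funs m p" "Lp_norm m p f <= ?N"
  "!!g. g : Lp_funs m s ==> ?Phi (ae_class m g, vzero PC) = (LINT x|m. f x * g x)" by (rule Lp_duality[OF p(1) s p(2) _ dn(2)]) (rule that)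
 have "EX mu. mu : carr Meas & vnorm Meas mu <= 3 * (?N * vnorm (Der m) b) &
   (ALL h:carr C0. sint mu h = ?Phi (vzero (Lp m s), tens b h))" if b: "b : DD m" for b
 proof -
  note tb = tens_bilinear[OF DerDiv_DC[OF b]] and psi = vfuncD[OF c(2)]
  have nb: "0 <= vnorm (Der m) b" using b seminormed.norm_nonneg[OF seminormed_DerDiv, of b] by simp
  obtain mu where mu: "mu : carr Meas" "vnorm Meas mu <= 3 * (?N * vnorm (Der m) b)"
   "!!h. continuous_on UNIV h ==> sint mu h = ?Phi (vzero (Lp m s), tens b h)"
  proof (rule riesz_representation[of "%h. ?Phi (vzero (Lp m s), tens b h)" "?N * vnorm (Der m) b"])
   fix h k :: "'a => real" and r B assume "continuous_on UNIV h"
   hence h: "h : carr C0" by (simp add: C0_carrier)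
   show "?Phi (vzero (Lp m s), tens b (%x. r * h x)) = r * ?Phi (vzero (Lp m s), tens b h)"
    unfolding tb(6)[OF h] by (rule psi(2)[OF tb(1)[OF h]])
   show "abs (?Phi (vzero (Lp m s), tens b h)) <= ?N * vnorm (Der m) b * B" if "!!x. abs (h x) <= B"
   proof -
    have "vnorm PC (tens b h) <= vnorm (Der m) b * B" by (rule order_trans[OF tb(2)[OF h] mult_left_mono[OF sup_norm_le nb]]) (rule that)
    from order_trans[OF psi(3)[OF tb(1)[OF h]] mult_left_mono[OF this dn(2)]] show ?thesis by (simp add: mult.assoc)
   qed
   assume "continuous_on UNIV k"
   hence k: "k : carr C0" by (simp add: C0_carrier)
   show "?Phi (vzero (Lp m s), tens b (%x. h x + k x)) = ?Phi (vzero (Lp m s), tens b h) + ?Phi (vzero (Lp m s), tens b k)"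
    unfolding tb(4)[OF h k] by (rule psi(1)[OF tb(1)[OF h] tb(1)[OF k]])
  qed (rule that)
  thus ?thesis by (auto simp: C0_carrier)
 qed
 hence "ALL b:DD m. EX mu. mu : carr Meas & vnorm Meas mu <= 3 * (?N * vnorm (Der m) b) &
   (ALL h:carr C0. sint mu h = ?Phi (vzero (Lp m s), tens b h))" by blast
 from bchoice[OF this] obtain L0 where L0: "ALL b:DD m. L0 b : carr Meas &
   vnorm Meas (L0 b) <= 3 * (?N * vnorm (Der m) b) & (ALL h:carr C0. sint (L0 b) h = ?Phi (vzero (Lp m s), tens b h))" ..
 define L where "L = restrict L0 (DD m)"
 have L: "L b : carr Meas" "vnorm Meas (L b) <= 3 * ?N * vnorm (Der m) b"
  "h : carr C0 ==> sint (L b) h = ?Phi (vzero (Lp m s), tens b h)" if "b : DD m" for b h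
  using L0 that by (simp_all add: L_def mult.assoc)
 have LC: "h : carr C0" if "h : LIPb" for h :: "'a => real" using LIPb_continuous[OF that] by (simp add: C0_carrier)
 note sub = seminormed.axioms(1)[OF seminormed_DerDiv]
 note cl = vspace_on.add_closed[OF sub, unfolded DerDiv_simps] vspace_on.scale_closed[OF sub, unfolded DerDiv_simps]
 have pr: "pairing s f L ?Phi" unfolding pairing_def using f(3) L(3) by simp
 have f1: "f : Lp_funs m 1"
 proof -
  have "integrable m (%x. f x * 1)" by (rule holder(1)[OF p(1) s p(2) f(1) bdd_borel_Lp[OF s1 bdd_borel_const]])
  thus ?thesis using f(1) by (auto simp: Lp_funs_def)
 qed
 have "bv f L (3 * ?N)" unfolding bv_def
 proof (intro conjI ballI allI f1)
  show "0 <= 3 * ?N" using dn(2) by simp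
  show "L : DD m \<rightarrow>\<^sub>E carr Meas" using L(1) by (auto simp: L_def)
  fix b b' h d r assume b: "b : DD m"
  note tb = tens_bilinear[OF DerDiv_DC[OF b]]
  show "vnorm Meas (L b) <= 3 * ?N * vnorm (Der m) b" by (rule L(2)[OF b])
  show "L (vscale (Der m) r b) = vscale Meas r (L b)"
  proof (rule Meas_eqI[OF L(1)[OF cl(2)[OF b]] Meas_scale(1)[OF L(1)[OF b]]])
   fix h :: "'a => real" assume h: "h : LIPb"
   show "sint (L (vscale (Der m) r b)) h = sint (vscale Meas r (L b)) h"
    unfolding L(3)[OF cl(2)[OF b] LC[OF h]] Meas_scale(3)[OF L(1)[OF b] LIPb_bdd_borel[OF h]] L(3)[OF b LC[OF h]]
     tb(5)[OF LC[OF h]] by (rule vfuncD(2)[OF c(2) tb(1)[OF LC[OF h]]])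
  qed
  show "L (vadd (Der m) b b') = vadd Meas (L b) (L b')" if b': "b' : DD m"
  proof (rule Meas_eqI[OF L(1)[OF cl(1)[OF b b']] Meas_add(1)[OF L(1)[OF b] L(1)[OF b']]])
   fix h :: "'a => real" assume h: "h : LIPb"
   show "sint (L (vadd (Der m) b b')) h = sint (vadd Meas (L b) (L b')) h"
    unfolding L(3)[OF cl(1)[OF b b'] LC[OF h]] Meas_add(3)[OF L(1)[OF b] L(1)[OF b'] LIPb_bdd_borel[OF h]]
     L(3)[OF b LC[OF h]] L(3)[OF b' LC[OF h]] tb(3)[OF LC[OF h] DerDiv_DC[OF b']]
    by (rule vfuncD(1)[OF c(2) tb(1)[OF LC[OF h]] tens_bilinear(1)[OF DerDiv_DC[OF b'] LC[OF h]]])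
  qed
  assume h: "h : LIPb" and d: "d : divergence m (der_mult m h b)"
  have dL: "d : Lp_funs m s" using d by (intro Linf_Lp[OF _ s1]) (simp add: divergence_def)
  have hb: "der_mult m h b : DD m" by (rule der_mult_DerDiv[OF b h])
  \<comment> \<open>The one-term list shows that the pair of the divergence of \<open>hb\<close> and
    \<open>b \<otimes> h\<close> is annihilated, which is precisely the identity required by
    \<open>bv\<close>.\<close>
  have "(ae_class m d, tens b h) : V_set m" unfolding V_set_iff
  proof (rule exI[of _ "[(b, h)]"], rule exI[of _ d], intro conjI)
   show "set [(b, h)] <= DD m \<times> LIPb" using b h by simp
   have "vadd (DerDiv m) (der_mult m h b) (vzero (DerDiv m)) = der_mult m h b" by (rule vspace_on.add_zero[OF sub hb])
   thus "d : divergence m (div_sum [(b, h)])" using d by (simp add: vlist_sum_def)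
   have "tensor (cDer m) C0 b h : carr (alg_tensor (cDer m) C0)" 
    "vspace_on (alg_tensor (cDer m) (C0 :: ('a => real) nvs))"
    using tensor_pair.tensor_closed[OF tensor_pair.intro[OF seminormed_DC seminormed_C0] DerDiv_DC[OF b] LC[OF h]]
     tensor_pair.seminormed_proj_tensor_alg[OF tensor_pair.intro[OF seminormed_DC seminormed_C0], THEN seminormed.axioms(1)]
    by (auto simp: proj_tensor_alg_def intro: vspace_on.vspace_cong)
   hence "tensor_sum (cDer m) C0 [(b, h)] = tensor (cDer m) C0 b h"
    by (simp add: tensor_sum_def vlist_sum_def vspace_on.add_zero)
   thus "(ae_class m d, tens b h) = (ae_class m d, vembed (proj_tensor_alg (cDer m) C0) (tensor_sum (cDer m) C0 [(b, h)]))"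
    by (simp only: tens_def)
  qed
  hence v: "(ae_class m d, tens b h) : V_closure" using W.subset_vclosure[OF W.subspaceD(1)[OF vsubspace_V_set[OF s1]]] by blast
  have "vcoset (W_space m s) V_closure (ae_class m d, tens b h) = vzero predual"
   using v W.subspaceD(2)[OF V_closure v] W.vcoset_eq_iff[OF V_closure W.subspaceD(2)[OF V_closure v] W.zero_closed]
   by (simp only: W.vquotient_simps(2)[OF V_closure] W.diff_zero)
  hence "?Phi (ae_class m d, tens b h) = 0"
   using vspace_on.vfunc_simps(1)[OF seminormed.axioms(1)[OF seminormed_predual] dn(1)] by simp
  thus "sint (L b) h = - (LINT x|m. f x * d x)"
   using c(3)[OF imageI[OF dL, of "ae_class m", folded Lp_simps(1)[OF s1]] tb(1)[OF LC[OF h]]]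
   unfolding L(3)[OF b LC[OF h]] f(3)[OF dL] by linarith
 qed
 thus thesis by (rule that[OF _ f(2,1) pr])
qed

text \<open>Stated as a relation because a class has many representatives \<open>f\<close> and no
  canonical formula for \<open>Psi\<close> is at hand; \<open>is_predual_BV\<close> selects a map
  from it.\<close>

definition represents where
 "represents A Psi \<longleftrightarrow> Psi : carr (vdual predual) &
   (EX f L C. A = ae_class m f & bv f L C & pairing s f L (lift Psi))"

lemma representsE:
 assumes "represents A Psi"
 obtains f C where "Psi : carr (vdual predual)" "A = ae_class m f" "bv f (BV_op m A) C" "pairing s f (BV_op m A) (lift Psi)"
 using assms bv_BV(2)[symmetric] unfolding represents_def by blast

lemma pairing_cong:
 assumes "f : borel_measurable m" "f' : borel_measurable m" "ae_class m f = ae_class m f'" "pairing s f L Phi" shows "pairing s f' L Phi"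
proof -
 have "AE x in m. f x = f' x" using assms(3) ae_class_eq_iff[OF assms(1,2)] by blast
 hence "(LINT x|m. f x * g x) = (LINT x|m. f' x * g x)" if "g : Lp_funs m s" for g
  using that assms(1,2) by (intro integral_cong_AE) (auto simp: Lp_funs_def)
 thus ?thesis using assms(4) unfolding pairing_def by simp
qed

lemma bv_measurable: "bv f L C ==> f : borel_measurable m" using bvD(1)[of f L C] by (simp add: Lp_funs_def)

lemma represents_unique:
 assumes A: "represents A Psi" and A': "represents A Theta" shows "Psi = Theta"
proof -
 obtain f C where Psi: "Psi : carr (vdual predual)" and f: "A = ae_class m f" "bv f (BV_op m A) C"
  "pairing s f (BV_op m A) (lift Psi)" by (rule representsE[OF A])
 obtain g D where Theta: "Theta : carr (vdual predual)" and g: "A = ae_class m g" "bv g (BV_op m A) D"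
  "pairing s g (BV_op m A) (lift Theta)" by (rule representsE[OF A'])
 note g' = pairing_cong[OF bv_measurable[OF g(2)] bv_measurable[OF f(2)] trans[OF g(1)[symmetric] f(1)] g(3)]
 note Psin = vdual_norm[OF seminormed_predual Psi] and Thetan = vdual_norm[OF seminormed_predual Theta]
 show ?thesis
 proof (rule extensionalityI[of _ "carr predual"])
  show "Psi : extensional (carr predual)" "Theta : extensional (carr predual)"
   using Psi Theta by (auto simp: vdual_carrier_iff[OF seminormed_predual])
  fix q assume "q : carr predual"
  then obtain w where "w : carr (W_space m s)" "q = vcoset (W_space m s) V_closure w"
   unfolding W.vquotient_simps(1)[OF V_closure] by blast
  thus "Psi q = Theta q" using pairing_unique[OF s1 lift_functional[OF Psin] lift_functional[OF Thetan] f(3) g'] by simp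
 qed
qed

text \<open>A class is determined by its function, so only the first component matters: testing the
  functionals on indicators compares the integrals over all Borel sets. With \<open>c = 1\<close>
  and \<open>t = 0\<close> this also says that \<open>Psi\<close> determines the class.\<close>

lemma represents_comb:
 assumes A: "represents A Psi" and B: "represents B Theta"
  and E: "represents E (vadd (vdual predual) (vscale (vdual predual) c Psi) (vscale (vdual predual) t Theta))"
 shows "E = vadd (BV m) (vscale (BV m) c A) (vscale (BV m) t B)"
proof -
 obtain f C where f: "A = ae_class m f" "bv f (BV_op m A) C" "pairing s f (BV_op m A) (lift Psi)" by (rule representsE[OF A])
 obtain g D where g: "B = ae_class m g" "bv g (BV_op m B) D" "pairing s g (BV_op m B) (lift Theta)" by (rule representsE[OF B])
 obtain k K where k: "E = ae_class m k" "bv k (BV_op m E) K" "pairing s k (BV_op m E)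
  (lift (vadd (vdual predual) (vscale (vdual predual) c Psi) (vscale (vdual predual) t Theta)))" by (rule representsE[OF E])
 have int: "integrable m u" if "bv u L C" for u L C using bvD(1)[OF that] by (auto simp: Lp_funs_def integrable_abs_iff)
 note i = int[OF f(2)] int[OF g(2)] int[OF k(2)]
 have "AE x in m. k x = c * f x + t * g x"
 proof (rule AE_eq_of_integrals)
  fix S :: "'a set" assume S: "S : sets borel"
  hence S': "indicator S : Lp_funs m s" by (intro bdd_borel_Lp[OF s1]) simp
  hence w: "vcoset (W_space m s) V_closure (ae_class m (indicator S), vzero PC) : carr predual"
   unfolding W.vquotient_simps(1)[OF V_closure] W_carrier Lp_simps(1)[OF s1] by (intro imageI SigmaI PC.zero_closed)
  have "(LINT x|m. k x * indicator S x) = c * (LINT x|m. f x * indicator S x) + t * (LINT x|m. g x * indicator S x)"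
   using pairingD(1)[OF k(3) S'] unfolding vdual_ops restrict_apply'[OF w] pairingD(1)[OF f(3) S'] pairingD(1)[OF g(3) S'] by simp
  thus "(LINT x|m. k x * indicator S x) = (LINT x|m. (c * f x + t * g x) * indicator S x)"
   using integrable_mult_bdd_borel[OF i(1) bdd_borel_indicator[OF S]] integrable_mult_bdd_borel[OF i(2) bdd_borel_indicator[OF S]]
   by (simp add: distrib_right mult.assoc)
 qed (use i in simp_all)
 hence "E = ae_class m (%x. c * f x + t * g x)" unfolding k(1) by (rule iffD2[OF ae_class_eq_iff, rotated 2])
   (use bv_measurable[OF f(2)] bv_measurable[OF g(2)] bv_measurable[OF k(2)] in \<open>simp_all add: borel_measurable_add borel_measurable_times\<close>)
 also have "... = vadd (BV m) (vscale (BV m) c A) (vscale (BV m) t B)"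
  unfolding f(1) g(1) BV_simps(4,5) using bvD(1)[OF f(2)] bvD(1)[OF g(2)]
  by (simp only: Lp_simps(3,4)[OF order_refl] Lp_funs_scale[OF order_refl])
 finally show ?thesis .
qed

theorem is_predual_BV: "is_predual predual (BV m)"
proof -
 obtain K where K: "0 <= K" "!!f L C. bv f L C ==> f : Lp_funs m p & Lp_norm m p f <= K * (Lp_norm m 1 f + C)" by (rule bv_Lp) (rule that)
 have ex: "EX Psi. represents A Psi & vnorm (vdual predual) Psi <= (K + 1) * vnorm (BV m) A" if A: "A : carr (BV m)" for A
 proof -
  obtain f where f: "A = ae_class m f" "bv f (BV_op m A) (BV_variation m A)" by (rule BV_E[OF A])
  have n: "vnorm (BV m) A = Lp_norm m 1 f + BV_variation m A" unfolding f(1) by (rule bv_BV(4)[OF f(2)])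
  obtain Psi where Psi: "Psi : carr (vdual predual)" "vnorm (vdual predual) Psi <= Lp_norm m p f + BV_variation m A"
   "pairing s f (BV_op m A) (lift Psi)" by (rule functional_of_bv[OF f(2) K(2)[OF f(2), THEN conjunct1]])
  have "vnorm (vdual predual) Psi <= K * (Lp_norm m 1 f + BV_variation m A) + (Lp_norm m 1 f + BV_variation m A)"
   using Psi(2) K(2)[OF f(2)] Lp_norm_nonneg[of m 1 f] by linarith
  hence "vnorm (vdual predual) Psi <= (K + 1) * vnorm (BV m) A" by (simp add: n algebra_simps)
  thus ?thesis using Psi(1,3) f unfolding represents_def by blast
 qed
 \<comment> \<open>The selected functional is unique by \<open>represents_unique\<close>, so the
   choice costs nothing.\<close>
 define T where "T = (\<lambda>A\<in>carr (BV m). SOME Psi. represents A Psi)"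
 have T: "represents A (T A)" if "A : carr (BV m)" for A using ex[OF that] someI_ex[of "represents A"] that by (auto simp: T_def)
 have T_eq: "T A = Psi" if "A : carr (BV m)" "represents A Psi" for A Psi by (rule represents_unique[OF T[OF that(1)] that(2)])
 have Td: "T A : carr (vdual predual)" if "A : carr (BV m)" for A using T[OF that] by (simp add: represents_def)
 interpret BV: seminormed "BV m" by (rule normed_imp_seminormed[OF normed_BV])
 \<comment> \<open>The norm of 1 in L^s comes from comparing the L^1 and L^p norms of
   \<open>f\<close> by Hoelder; 3 is the Riesz factor in the variation.\<close>
 let ?D = "Lp_norm m s (%x. 1) + 3"
 have surj: "EX A:carr (BV m). represents A Psi & vnorm (BV m) A <= ?D * vnorm (vdual predual) Psi"
  if Psi: "Psi : carr (vdual predual)" for Psi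
 proof -
  obtain f L where f: "bv f L (3 * vnorm (vdual predual) Psi)" "Lp_norm m p f <= vnorm (vdual predual) Psi" "f : Lp_funs m p"
   "pairing s f L (lift Psi)" by (rule bv_of_functional[OF Psi])
  have "(%x. abs (f x)) : Lp_funs m p" using f(3) by (auto simp: Lp_funs_def)
  from holder(2)[OF p(1) s p(2) this bdd_borel_Lp[OF s1 bdd_borel_const[of 1]]]
  have "Lp_norm m 1 f <= Lp_norm m p f * Lp_norm m s (%x. 1)" by (simp add: Lp_norm_def)
  also have "... <= vnorm (vdual predual) Psi * Lp_norm m s (%x. 1)" using f(2) by (intro mult_right_mono Lp_norm_nonneg)
  finally have "vnorm (BV m) (ae_class m f) <= ?D * vnorm (vdual predual) Psi"
   unfolding bv_BV(4)[OF f(1)] using bv_BV(3)[OF f(1)] by (simp add: algebra_simps)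
  thus ?thesis using Psi f(1,4) bv_BV(1)[OF f(1)] unfolding represents_def by blast
 qed
 interpret d: seminormed "vdual predual" by (rule normed_imp_seminormed[OF normed_vdual[OF seminormed_predual]])
 have comb: "T (vadd (BV m) (vscale (BV m) c A) (vscale (BV m) t B)) =
   vadd (vdual predual) (vscale (vdual predual) c (T A)) (vscale (vdual predual) t (T B))"
  if "A : carr (BV m)" "B : carr (BV m)" for A B c t
  using surj[OF d.add_closed[OF d.scale_closed[OF Td[OF that(1)]] d.scale_closed[OF Td[OF that(2)]]]]
   represents_comb[OF T[OF that(1)] T[OF that(2)]] T_eq by metis
 have lin: "vlinear (BV m) (vdual predual) T" unfolding vlinear_def
 proof (intro conjI ballI allI)
  show "T : carr (BV m) \<rightarrow>\<^sub>E carr (vdual predual)" using Td by (auto simp: T_def)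
  fix A B c assume A: "A : carr (BV m)"
  show "T (vscale (BV m) c A) = vscale (vdual predual) c (T A)" using comb[OF A A, of c 0] A Td[OF A] by simp
  assume B: "B : carr (BV m)"
  show "T (vadd (BV m) A B) = vadd (vdual predual) (T A) (T B)" using comb[OF A B, of 1 1] A B Td[OF A] Td[OF B] by simp
 qed
 have ub: "vnorm (vdual predual) (T A) <= (K + 1) * vnorm (BV m) A" if "A : carr (BV m)" for A using ex[OF that] T_eq[OF that] by blast
 have lb: "vnorm (BV m) A <= ?D * vnorm (vdual predual) (T A)" if A: "A : carr (BV m)" for A
  
 proof -
  \<comment> \<open>Surjectivity yields some class with the desired norm bound for
    \<open>T A\<close>; it must be \<open>A\<close>, since both are represented by the same
    functional.\<close>
  obtain B where B: "B : carr (BV m)" "represents B (T A)" "vnorm (BV m) B <= ?D * vnorm (vdual predual) (T A)"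
   using surj[OF Td[OF A]] by blast
  thus ?thesis using represents_comb[OF T[OF A] T[OF A], of B 1 0] A Td[OF A] by simp
 qed
 have onto: "EX A:carr (BV m). T A = Psi" if "Psi : carr (vdual predual)" for Psi using surj[OF that] T_eq by blast
 note iso = visomorphicI[OF normed_BV normed_imp_seminormed[OF normed_vdual[OF seminormed_predual]] lin ub lb onto]
 have "visomorphic (BV m) (vdual predual)" by (rule iso(1))
 moreover have "vcomplete (BV m)" by (rule iso(2)) (assumption | rule vcomplete_vdual[OF seminormed_predual])+
 ultimately show ?thesis unfolding is_predual_def using banach_predual banach_space_onI[OF normed_BV] by blast
qed

end

theorem theorem5p7:
  fixes m :: "'a::metric_space measure" and CD \<alpha> :: real
  assumes "PI_space m CD"
    and "bounded (UNIV :: 'a set)"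
    and "1 < \<alpha>"
    and "log 2 CD \<le> \<alpha>"
  shows "is_predual (vquotient (W_space m \<alpha>) (vclosure (W_space m \<alpha>) (V_set m))) (BV m)"
proof -
 have m: "finite_measure m" "sets m = sets borel" "complete (UNIV :: 'a set)" "doubling m CD" and "EX CP lam. poincare m CP lam"
  using assms(1) by (auto simp: PI_space_def metric_measure_space_def radon_measure_def)
 then obtain CP lam where P: "poincare m CP lam" by blast
 obtain R where R: "R > 0" "!!x :: 'a. ball x R = UNIV" by (rule bounded_radius[OF assms(2)]) (rule that)
 interpret finite_measure m by (rule m(1))
 interpret bounded_PI "TYPE('a)" m CD CP lam \<alpha> R
  using doubling_compact[OF m(1,2,4,3) assms(2)] m P R assms(3,4) by unfold_locales auto
 show ?thesis by (rule is_predual_BV)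
qed

end
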